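(* Let $\sigma\in\mathbb{R}$. There exists a constant $C=C_{\sigma,d}$ (independent of $\varepsilon>0$) such that for all $f\in\dot B_\varepsilon^{\sigma+2,\sigma}$ there exists a summable positive sequence $(c_j(f))_{j\in\mathbb{Z}}$ with sum $1$ such that, for all $t$ so small that $e^{2CV(t)}-1\le\frac12$ and for all $j\in\mathbb{Z}$, $$\|II_j'(f)\|_{L^2}\le C e^{CV(t)}\big(V(t)+e^{2CV(t)}-1\big)\,c_j(f)\,2^{-j\sigma}\Big\|\frac{\phi_\varepsilon*f-f}{\varepsilon^2}\Big\|_{\dot B_{2,1}^\sigma},$$ where $V(t)=\int_0^t\|\nabla v(\tau)\|_{L^\infty}d\tau$ and, with $f_j=\dot\Delta_jf$, $$II_j'(f)=\frac{\phi_\varepsilon*f_j-f_j}{\varepsilon^2}\circ\psi_{j,t}-\frac{\phi_\varepsilon*(f_j\circ\psi_{j,t})-f_j\circ\psi_{j,t}}{\varepsilon^2}.$$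
   Context: Littlewood-Paley: fix a smooth radial function $\chi$ on $\mathbb{R}^d$ supported in $B(0,\frac43)$, equal to $1$ near $B(0,\frac34)$ and radially nonincreasing; set $\varphi(\xi)=\chi(\xi/2)-\chi(\xi)$, supported in $\{\frac34\le|\xi|\le\frac83\}$, so that $\sum_{l\in\mathbb{Z}}\varphi(2^{-l}\xi)=1$ for $\xi\ne0$. Put $\dot\Delta_l=\varphi(2^{-l}D)$, $\dot S_l=\chi(2^{-l}D)$. Distributions are in $\mathcal S_h'$ (tempered with $\|\dot S_lu\|_{L^\infty}\to0$ as $l\to-\infty$). $\|u\|_{\dot B_{2,1}^s}=\sum_l2^{ls}\|\dot\Delta_lu\|_{L^2}$, and $\dot B_\varepsilon^{\sigma+2,\sigma}$ is the space with norm equivalent to $\sum_{l}\min(\frac1{\varepsilon^2},2^{2l})2^{l\sigma}\|\dot\Delta_lf\|_{L^2}$, equivalently to $\|\varepsilon^{-2}(\phi_\varepsilon*f-f)\|_{\dot B_{2,1}^\sigma}$. Kernel: $\phi_\varepsilon(x)=\varepsilon^{-d}\phi(x/\varepsilon)$ is the Gaussian with $\hat\phi_\varepsilon(\xi)=e^{-\varepsilon^2|\xi|^2}$, i.e. $\phi(x)=(4\pi)^{-d/2}e^{-|x|^2/4}$. Flow: $v\in L^1(I,\dot B_{2,1}^{\frac d2+1})\cap L^2(I,\dot B_{2,1}^{\frac d2})$ is a time-dependent vector field on $\mathbb{R}^d$ ($I=[0,T[$ or $[0,\infty[$, $t\in I$; no divergence-free assumption), and $\psi_{j,t}$ is the flow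 of $\dot S_{j-1}v$: $\psi_{j,t}(x)=x+\int_0^t\dot S_{j-1}v(\tau,\psi_{j,\tau}(x))\,d\tau$. *)

theory Defs
  imports "HOL-Analysis.Analysis" "HOL-Probability.Essential_Supremum"
begin

section \<open>Schwartz functions and tempered distributions on \<open>\<real>\<^sup>d\<close>, \<open>d = CARD('n)\<close>\<close>

definition partial_deriv :: "'n::finite \<Rightarrow> (real^'n \<Rightarrow> 'b::real_normed_vector) \<Rightarrow> real^'n \<Rightarrow> 'b" where
  "partial_deriv i f x = frechet_derivative f (at x) (axis i 1)"

text \<open>Multi-indices are lists of directions, so each multi-index has several representatives.\<close>

definition partial_derivs :: "'n::finite list \<Rightarrow> (real^'n \<Rightarrow> 'b::real_normed_vector) \<Rightarrow> real^'n \<Rightarrow> 'b" where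
  "partial_derivs ks f = foldr partial_deriv ks f"

definition smooth :: "(real^'n::finite \<Rightarrow> 'b::real_normed_vector) \<Rightarrow> bool" where
  "smooth f \<longleftrightarrow> (\<forall>ks x. partial_derivs ks f differentiable (at x))"

definition schwartz :: "(real^'n::finite \<Rightarrow> complex) \<Rightarrow> bool" where
  "schwartz \<theta> \<longleftrightarrow> smooth \<theta> \<and>
     (\<forall>ks N. bounded (range (\<lambda>x. (1 + norm x) ^ N *\<^sub>R partial_derivs ks \<theta> x)))"

definition schwartz_seminorm :: "nat \<Rightarrow> (real^'n::finite \<Rightarrow> complex) \<Rightarrow> real" where
  "schwartz_seminorm N \<theta> =
     (SUP (ks, x) \<in> {ks. length ks \<le> N} \<times> UNIV. (1 + norm x) ^ N * norm (partial_derivs ks \<theta> x))"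

text \<open>A distribution is a functional on all functions of which only the values on Schwartz
  functions matter. The pairing is bilinear (no complex conjugation).\<close>

type_synonym 'n dist = "(real^'n \<Rightarrow> complex) \<Rightarrow> complex"

definition tempered :: "'n::finite dist \<Rightarrow> bool" where
  "tempered u \<longleftrightarrow>
     (\<forall>\<theta> \<eta> a b. schwartz \<theta> \<longrightarrow> schwartz \<eta> \<longrightarrow>
        u (\<lambda>x. a * \<theta> x + b * \<eta> x) = a * u \<theta> + b * u \<eta>) \<and>
     (\<exists>M N. \<forall>\<theta>. schwartz \<theta> \<longrightarrow> norm (u \<theta>) \<le> M * schwartz_seminorm N \<theta>)"

definition real_dist :: "'n::finite dist \<Rightarrow> bool" where
  "real_dist u \<longleftrightarrow> (\<forall>\<theta>. schwartz \<theta> \<longrightarrow> u (\<lambda>x. cnj (\<theta> x)) = cnj (u \<theta>))"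

definition represents :: "(real^'n::finite \<Rightarrow> complex) \<Rightarrow> 'n dist \<Rightarrow> bool" where
  "represents g u \<longleftrightarrow> g \<in> borel_measurable lborel \<and>
     (\<forall>\<theta>. schwartz \<theta> \<longrightarrow> integrable lborel (\<lambda>x. g x * \<theta> x) \<and> u \<theta> = (\<integral>x. g x * \<theta> x \<partial>lborel))"

definition dist_partial :: "'n::finite \<Rightarrow> 'n dist \<Rightarrow> 'n dist" where
  "dist_partial i u \<theta> = - u (partial_deriv i \<theta>)"

definition dist_conv :: "(real^'n::finite \<Rightarrow> real) \<Rightarrow> 'n dist \<Rightarrow> 'n dist" where
  "dist_conv g u \<theta> = u (\<lambda>y. \<integral>x. complex_of_real (g (x - y)) * \<theta> x \<partial>lborel)"

section \<open>Norms\<close>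

definition L2_norm :: "(real^'n::finite \<Rightarrow> complex) \<Rightarrow> ennreal" where
  "L2_norm g = (let S = (\<integral>\<^sup>+x. ennreal ((norm (g x))\<^sup>2) \<partial>lborel)
                in if S = \<infinity> then \<infinity> else ennreal (sqrt (enn2real S)))"

definition Linf_norm :: "(real^'n::finite \<Rightarrow> 'b::real_normed_vector) \<Rightarrow> ennreal" where
  "Linf_norm g = esssup lborel (\<lambda>x. ennreal (norm (g x)))"

text \<open>The \<open>L\<^sup>\<infinity>\<close> norm of the distributional Jacobian: the representing function \<open>G\<close> is unique up to
  null sets, and the norm is \<open>\<infinity>\<close> (infimum of the empty set) if there is none.\<close>

definition grad_Linf_norm :: "('n::finite dist)^'n \<Rightarrow> ennreal" where
  "grad_Linf_norm w =
     (INF G \<in> {G :: real^'n \<Rightarrow> real^'n^'n.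
                 \<forall>k i. represents (\<lambda>x. complex_of_real (G x $ k $ i)) (dist_partial i (w $ k))}.
        Linf_norm G)"

section \<open>Littlewood-Paley decomposition\<close>

definition lp_cutoff :: "(real^'n::finite \<Rightarrow> real) \<Rightarrow> bool" where
  "lp_cutoff chi \<longleftrightarrow> smooth chi \<and>
     closure {\<xi>. chi \<xi> \<noteq> 0} \<subseteq> cball 0 (4/3) \<and>
     (\<exists>U. open U \<and> cball 0 (3/4) \<subseteq> U \<and> (\<forall>\<xi>\<in>U. chi \<xi> = 1)) \<and>
     (\<forall>\<xi> \<eta>. norm \<xi> = norm \<eta> \<longrightarrow> chi \<xi> = chi \<eta>) \<and>
     (\<forall>\<xi> \<eta>. norm \<xi> \<le> norm \<eta> \<longrightarrow> chi \<eta> \<le> chi \<xi>)"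

definition lp_phi :: "(real^'n::finite \<Rightarrow> real) \<Rightarrow> real^'n \<Rightarrow> real" where
  "lp_phi chi \<xi> = chi ((1/2) *\<^sub>R \<xi>) - chi \<xi>"

text \<open>Fourier convention: \<open>\<integral> exp(- i x \<bullet> \<xi>) g(x) dx\<close> for the direct transform.\<close>

definition inv_fourier :: "(real^'n::finite \<Rightarrow> real) \<Rightarrow> real^'n \<Rightarrow> complex" where
  "inv_fourier m x =
     complex_of_real (1 / (2 * pi) ^ CARD('n)) * (\<integral>\<xi>. cis (x \<bullet> \<xi>) * complex_of_real (m \<xi>) \<partial>lborel)"

text \<open>For \<open>m\<close> smooth with compact support and \<open>u\<close> tempered, \<open>m(D) u\<close> is the smooth function given by
  the convolution of \<open>u\<close> with the Schwartz function \<open>inv_fourier m\<close>.\<close>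

definition fourier_mult :: "(real^'n::finite \<Rightarrow> real) \<Rightarrow> 'n dist \<Rightarrow> real^'n \<Rightarrow> complex" where
  "fourier_mult m u x = u (\<lambda>y. inv_fourier m (x - y))"

definition lp_block :: "(real^'n::finite \<Rightarrow> real) \<Rightarrow> int \<Rightarrow> 'n dist \<Rightarrow> real^'n \<Rightarrow> complex" where
  "lp_block chi l u = fourier_mult (\<lambda>\<xi>. lp_phi chi ((2 powi (- l)) *\<^sub>R \<xi>)) u"

definition lp_low :: "(real^'n::finite \<Rightarrow> real) \<Rightarrow> int \<Rightarrow> 'n dist \<Rightarrow> real^'n \<Rightarrow> complex" where
  "lp_low chi l u = fourier_mult (\<lambda>\<xi>. chi ((2 powi (- l)) *\<^sub>R \<xi>)) u"

definition Sh' :: "(real^'n::finite \<Rightarrow> real) \<Rightarrow> 'n dist set" where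
  "Sh' chi = {u. tempered u \<and> ((\<lambda>l. Linf_norm (lp_low chi l u)) \<longlongrightarrow> 0) at_bot}"

definition besov_norm :: "(real^'n::finite \<Rightarrow> real) \<Rightarrow> real \<Rightarrow> 'n dist \<Rightarrow> ennreal" where
  "besov_norm chi s u =
     (\<Sum>\<^sub>\<infinity>l\<in>UNIV. ennreal (2 powr (real_of_int l * s)) * L2_norm (lp_block chi l u))"

definition besov_eps :: "(real^'n::finite \<Rightarrow> real) \<Rightarrow> real \<Rightarrow> real \<Rightarrow> 'n dist set" where
  "besov_eps chi \<epsilon> \<sigma> = {f \<in> Sh' chi.
     (\<Sum>\<^sub>\<infinity>l\<in>UNIV. ennreal (min (1 / \<epsilon>\<^sup>2) (2 powr (2 * real_of_int l)) * 2 powr (real_of_int l * \<sigma>))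
                 * L2_norm (lp_block chi l f)) < \<infinity>}"

section \<open>Time-dependent vector fields and their flows\<close>

definition vbesov_norm :: "(real^'n::finite \<Rightarrow> real) \<Rightarrow> real \<Rightarrow> ('n dist)^'n \<Rightarrow> ennreal" where
  "vbesov_norm chi s w = (\<Sum>k\<in>UNIV. besov_norm chi s (w $ k))"

definition vbesov :: "(real^'n::finite \<Rightarrow> real) \<Rightarrow> real \<Rightarrow> (('n dist)^'n) set" where
  "vbesov chi s = {w. (\<forall>k. w $ k \<in> Sh' chi \<and> real_dist (w $ k)) \<and> vbesov_norm chi s w < \<infinity>}"

text \<open>The Bochner space \<open>L\<^sup>p(I; B\<^sup>s\<^sub>2\<^sub>,\<^sub>1)\<close>: strong measurability (almost everywhere limit, in the
  Besov norm, of simple functions) and \<open>p\<close>-integrability of the norm.\<close>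

definition Lp_besov ::
  "(real^'n::finite \<Rightarrow> real) \<Rightarrow> nat \<Rightarrow> real set \<Rightarrow> real \<Rightarrow> (real \<Rightarrow> ('n dist)^'n) set" where
  "Lp_besov chi p I s = {v.
     (AE \<tau> in lebesgue_on I. v \<tau> \<in> vbesov chi s) \<and>
     (\<exists>S :: nat \<Rightarrow> real \<Rightarrow> ('n dist)^'n.
        (\<forall>n. simple_function (lebesgue_on I) (S n) \<and> (\<forall>\<tau>\<in>I. S n \<tau> \<in> vbesov chi s)) \<and>
        (AE \<tau> in lebesgue_on I. (\<lambda>n. vbesov_norm chi s (v \<tau> - S n \<tau>)) \<longlonglongrightarrow> 0)) \<and>
     (\<integral>\<^sup>+\<tau>. (vbesov_norm chi s (v \<tau>)) ^ p \<partial>lebesgue_on I) < \<infinity>}"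

text \<open>The real part is harmless: \<open>lp_low chi l u\<close> is real-valued for a real distribution \<open>u\<close> since
  \<open>chi\<close> is even.\<close>

definition vlow :: "(real^'n::finite \<Rightarrow> real) \<Rightarrow> int \<Rightarrow> ('n dist)^'n \<Rightarrow> real^'n \<Rightarrow> real^'n" where
  "vlow chi l w x = (\<chi> k. Re (lp_low chi l (w $ k) x))"

definition is_flow ::
  "real set \<Rightarrow> (real \<Rightarrow> real^'n::finite \<Rightarrow> real^'n) \<Rightarrow> (real \<Rightarrow> real^'n \<Rightarrow> real^'n) \<Rightarrow> bool" where
  "is_flow I w \<psi> \<longleftrightarrow> (\<forall>t\<in>I. \<forall>x.
     set_integrable lebesgue {0..t} (\<lambda>\<tau>. w \<tau> (\<psi> \<tau> x)) \<and>
     \<psi> t x = x + (LINT \<tau>:{0..t}|lebesgue. w \<tau> (\<psi> \<tau> x)))"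

definition time_interval :: "real set \<Rightarrow> bool" where
  "time_interval I \<longleftrightarrow> (\<exists>T>0. I = {0..<T}) \<or> I = {0..}"

definition V_int :: "(real \<Rightarrow> ('n::finite dist)^'n) \<Rightarrow> real \<Rightarrow> ennreal" where
  "V_int v t = (\<integral>\<^sup>+\<tau>\<in>{0..t}. grad_Linf_norm (v \<tau>) \<partial>lebesgue)"

definition eexp :: "ennreal \<Rightarrow> ennreal" where
  "eexp a = (if a = \<infinity> then \<infinity> else ennreal (exp (enn2real a)))"

section \<open>The nonlocal operator\<close>

definition gauss :: "real^'n::finite \<Rightarrow> real" where
  "gauss x = (4 * pi) powr (- real CARD('n) / 2) * exp (- (norm x)\<^sup>2 / 4)"

definition gauss_eps :: "real \<Rightarrow> real^'n::finite \<Rightarrow> real" where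
  "gauss_eps \<epsilon> x = gauss ((1 / \<epsilon>) *\<^sub>R x) / \<epsilon> ^ CARD('n)"

definition nonlocal_dist :: "real \<Rightarrow> 'n::finite dist \<Rightarrow> 'n dist" where
  "nonlocal_dist \<epsilon> u \<theta> = (dist_conv (gauss_eps \<epsilon>) u \<theta> - u \<theta>) / complex_of_real (\<epsilon>\<^sup>2)"

definition nonlocal_fun :: "real \<Rightarrow> (real^'n::finite \<Rightarrow> complex) \<Rightarrow> real^'n \<Rightarrow> complex" where
  "nonlocal_fun \<epsilon> g x =
     ((\<integral>y. complex_of_real (gauss_eps \<epsilon> (x - y)) * g y \<partial>lborel) - g x) / complex_of_real (\<epsilon>\<^sup>2)"

definition II' :: "real \<Rightarrow> (real^'n::finite \<Rightarrow> complex) \<Rightarrow> (real^'n \<Rightarrow> real^'n) \<Rightarrow> real^'n \<Rightarrow> complex" where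
  "II' \<epsilon> g \<psi> x = nonlocal_fun \<epsilon> g (\<psi> x) - nonlocal_fun \<epsilon> (g \<circ> \<psi>) x"

end

theory Submission
  imports Defs "HOL-Probability.Sinc_Integral" "HOL-Probability.Characteristic_Functions"
begin

text \<open>Write \<open>K\<^sub>\<delta>\<close> for convolution with the Gaussian of width \<open>\<delta>\<close>, \<open>U g = g \<circ> \<psi>\<close> for composition with the flow and
  \<open>g\<close> for the \<open>j\<close>-th block of \<open>f\<close>, so that \<open>II'(f) = (U K\<^sub>\<epsilon> - K\<^sub>\<epsilon> U) g / \<epsilon>\<^sup>2\<close>. The block satisfies \<open>g = k * g\<close> for a
  Schwartz kernel \<open>k\<close> at scale \<open>r = 2\<^sup>j\<close> with mean zero. Three estimates suffice.

  (1) The flow of the truncated field satisfies \<open>\<bar>\<psi> x - \<psi> y - (x - y)\<bar> \<le> \<rho> \<bar>x - y\<bar>\<close> and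
  \<open>\<bar>\<psi> (x + z) + \<psi> (x - z) - 2 \<psi> x\<bar> \<le> \<rho> r \<bar>z\<bar>\<^sup>2\<close> with \<open>\<rho>\<close> of order \<open>V\<close>. Working with differences avoids the
  linearised equation, so neither differentiability of the flow nor measurability of \<open>\<tau> \<mapsto> \<parallel>\<nabla>v(\<tau>)\<parallel>\<close> matters.

  (2) Symmetrising the Gaussian integral in \<open>z \<mapsto> - z\<close> and expanding \<open>k\<close> to second order gives
  \<open>\<parallel>(U K\<^sub>\<delta> - K\<^sub>\<delta> U) g\<parallel> \<le> C \<rho> (r \<delta>)\<^sup>2 \<parallel>g\<parallel>\<close> when \<open>r \<delta>\<close> is bounded, by Schur's test.

  (3) As \<open>k\<close> has mean zero, \<open>\<parallel>K\<^sub>\<delta> g\<parallel> \<le> \<parallel>g\<parallel> / 2\<close> once \<open>r \<delta>\<close> exceeds an absolute constant.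

  By the semigroup property of Gaussians, telescoping (2) along (3) bounds the commutator at all scales by
  \<open>C \<rho> min(1, (r \<epsilon>)\<^sup>2) \<parallel>g\<parallel>\<close>, and telescoping (3) alone bounds \<open>\<parallel>g\<parallel>\<close> by \<open>C (\<epsilon>\<^sup>2 + r\<^sup>-\<^sup>2)\<close> times the norm of
  \<open>(K\<^sub>\<epsilon> g - g) / \<epsilon>\<^sup>2\<close>, which is the \<open>j\<close>-th block of the right-hand side.\<close>

section \<open>Calculus on Euclidean space\<close>

text \<open>The obstacle is uniformity in two unrelated scales, \<epsilon> and the block length 1/r,
  against the prefactor 1/\<epsilon>^2. Second differences are essential in (2): a first-order
  expansion would give only a factor r \<delta>, which cannot compensate 1/\<epsilon>^2 when r
  \<epsilon> is small. When r \<epsilon> is large the quadratic factor is a loss, and (3) repairs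
  it: steps of length about 1/r halve the block each time, so the step errors form a geometric
  series instead of growing with their number. All L2 bounds come from Schur's test and Minkowski's
  inequality; Fourier analysis enters through pointwise kernel identities. Composition with the flow
  is never estimated in L2: the column bound in Schur's test follows from the distortion of
  distances by \<psi>, so no Jacobian appears. The hypothesis on e^(2CV) is used as smallness of CV.
  The bound obtained is linear in V, and the stated right-hand side dominates it by e^(CV) \<ge> 1
  and e^(2CV) - 1 \<ge> 0. Strict positivity of the sequence c comes from mixing normalised block
  norms with a fixed geometric sequence.\<close>

lemma has_derivative_quadratic:
  fixes f :: "'a::real_normed_vector \<Rightarrow> 'b::real_normed_vector"
  assumes "bounded_linear L"
    and "\<And>v. norm v \<le> 1 \<Longrightarrow> norm (f (x + v) - f x - L v) \<le> K * (norm v)\<^sup>2"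
  shows "(f has_derivative L) (at x)"
  unfolding has_derivative_at
proof
  show "(\<lambda>h. norm (f (x + h) - f x - L h) / norm h) \<midarrow>0\<rightarrow> 0"
  proof (rule tendsto_sandwich[of "\<lambda>_. 0" _ _ "\<lambda>h. K * norm h"])
    show "\<forall>\<^sub>F h in at 0. norm (f (x + h) - f x - L h) / norm h \<le> K * norm h"
      unfolding eventually_at
      by (rule exI[of _ 1], auto simp: divide_le_eq)
         (metis assms(2) less_imp_le mult.assoc power2_eq_square)
  qed (auto intro!: tendsto_eq_intros)
qed (fact assms)

lemma partial_deriv_eqI:
  "(f has_derivative L) (at x) \<Longrightarrow> partial_deriv i f x = L (axis i 1)"
  unfolding partial_deriv_def by (metis frechet_derivative_at)

lemma has_derivative_partial:
  fixes f :: "real^'n::finite \<Rightarrow> 'b::real_normed_vector"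
  assumes "f differentiable (at x)"
  shows "(f has_derivative (\<lambda>v. \<Sum>i\<in>UNIV. (v $ i) *\<^sub>R partial_deriv i f x)) (at x)"
proof -
  have D: "(f has_derivative frechet_derivative f (at x)) (at x)"
    using assms by (simp add: frechet_derivative_works)
  then have L: "linear (frechet_derivative f (at x))"
    by (rule has_derivative_linear)
  have "frechet_derivative f (at x) v = (\<Sum>i\<in>UNIV. (v $ i) *\<^sub>R partial_deriv i f x)" for v
  proof -
    have "frechet_derivative f (at x) (\<Sum>i\<in>UNIV. (v $ i) *\<^sub>R axis i 1) =
        (\<Sum>i\<in>UNIV. (v $ i) *\<^sub>R partial_deriv i f x)"
      using L by (simp add: linear_sum linear_scale partial_deriv_def)
    then show ?thesis
      using basis_expansion[of v] by (simp add: scalar_mult_eq_scaleR)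
  qed
  then have "frechet_derivative f (at x) = (\<lambda>v. \<Sum>i\<in>UNIV. (v $ i) *\<^sub>R partial_deriv i f x)"
    by blast
  with D show ?thesis by simp
qed

lemma norm_sum_components_le:
  fixes p :: "'n::finite \<Rightarrow> 'b::real_normed_vector"
  assumes "\<And>i. norm (p i) \<le> B"
  shows "norm (\<Sum>i\<in>UNIV. (v $ i) *\<^sub>R p i) \<le> (real CARD('n) * B) * norm v"
proof -
  have "norm (\<Sum>i\<in>UNIV. (v $ i) *\<^sub>R p i) \<le> (\<Sum>i\<in>(UNIV::'n set). norm v * B)"
    by (rule sum_norm_le) (use assms in \<open>auto intro!: mult_mono component_le_norm_cart\<close>)
  then show ?thesis by (simp add: mult_ac)
qed

text \<open>Bounding the operator norm of the derivative by the largest partial derivative costs a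
  factor \<open>CARD('n)\<close>; the powers of the dimension in later constants originate
  here.\<close>

lemma partial_mean_value:
  fixes f :: "real^'n::finite \<Rightarrow> 'b::real_normed_vector"
  assumes "convex S" "x \<in> S" "y \<in> S"
    and "\<And>z. z \<in> S \<Longrightarrow> f differentiable (at z)"
    and "\<And>i z. z \<in> S \<Longrightarrow> norm (partial_deriv i f z) \<le> B"
  shows "norm (f x - f y) \<le> real CARD('n) * B * norm (x - y)"
proof (rule differentiable_bound[OF assms(1) _ _ assms(2,3)])
  fix z assume z: "z \<in> S"
  show "(f has_derivative (\<lambda>v. \<Sum>i\<in>UNIV. (v $ i) *\<^sub>R partial_deriv i f z)) (at z within S)"
    using has_derivative_at_withinI[OF has_derivative_partial[OF assms(4)[OF z]]] .
  show "onorm (\<lambda>v. \<Sum>i\<in>UNIV. (v $ i) *\<^sub>R partial_deriv i f z) \<le> real CARD('n) * B"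
    by (rule onorm_le) (rule norm_sum_components_le, fact assms(5)[OF z])
qed

lemma norm_le_sum_abs: "norm (x :: real^'n::finite) \<le> (\<Sum>i\<in>UNIV. \<bar>x $ i\<bar>)"
  by (rule norm_le_l1_cart)

lemma one_plus_norm_add: "1 + norm (x + y) \<le> (1 + norm x) * (1 + norm y)"
  using norm_triangle_ineq[of x y] by (simp add: algebra_simps) (smt (verit) norm_ge_zero mult_nonneg_nonneg)

section \<open>Affine substitutions\<close>

lemma nn_integral_lborel_affine:
  fixes f :: "'a::euclidean_space \<Rightarrow> ennreal"
  assumes [measurable]: "f \<in> borel_measurable borel" and "c \<noteq> 0"
  shows "(\<integral>\<^sup>+x. f x \<partial>lborel) = ennreal (\<bar>c\<bar> ^ DIM('a)) * (\<integral>\<^sup>+x. f (t + c *\<^sub>R x) \<partial>lborel)"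
  by (subst lborel_affine[OF assms(2), of t])
     (simp add: nn_integral_density nn_integral_distr nn_integral_cmult)

lemma integrable_lborel_affine:
  fixes f :: "'a::euclidean_space \<Rightarrow> 'b::{banach, second_countable_topology}"
  assumes f: "integrable lborel f" and c: "c \<noteq> 0"
  shows "integrable lborel (\<lambda>x. f (t + c *\<^sub>R x))"
  using f f[THEN borel_measurable_integrable] c unfolding integrable_iff_bounded
  by (subst (asm) nn_integral_lborel_affine[where c=c and t=t]) (auto simp: ennreal_mult_less_top)

lemma integrable_lborel_affine_iff:
  fixes f :: "'a::euclidean_space \<Rightarrow> 'b::{banach, second_countable_topology}"
  assumes c: "c \<noteq> 0"
  shows "integrable lborel (\<lambda>x. f (t + c *\<^sub>R x)) \<longleftrightarrow> integrable lborel f"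
  using integrable_lborel_affine[of f c t]
    integrable_lborel_affine[of "\<lambda>x. f (t + c *\<^sub>R x)" "1/c" "- (1/c) *\<^sub>R t"] c
  by (auto simp: algebra_simps)

lemma integral_lborel_affine:
  fixes f :: "'a::euclidean_space \<Rightarrow> 'b::{banach, second_countable_topology}"
  assumes c: "c \<noteq> 0"
  shows "(\<integral>x. f x \<partial>lborel) = \<bar>c\<bar> ^ DIM('a) *\<^sub>R (\<integral>x. f (t + c *\<^sub>R x) \<partial>lborel)"
proof cases
  assume f: "integrable lborel f"
  note [measurable] = f[THEN borel_measurable_integrable]
  show ?thesis
    using c f f[THEN integrable_lborel_affine, of c t]
    by (subst lborel_affine[OF c, of t]) (simp add: integral_density integral_distr)
next
  assume "\<not> integrable lborel f" with c show ?thesis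
    by (simp add: integrable_lborel_affine_iff not_integrable_integral_eq)
qed

lemma nn_integral_lborel_reflect:
  fixes f :: "'a::euclidean_space \<Rightarrow> ennreal"
  assumes [measurable]: "f \<in> borel_measurable borel"
  shows "(\<integral>\<^sup>+x. f (a - x) \<partial>lborel) = (\<integral>\<^sup>+x. f x \<partial>lborel)"
  using nn_integral_lborel_affine[of f "-1" a] by simp

lemma nn_integral_lborel_shift:
  fixes f :: "'a::euclidean_space \<Rightarrow> ennreal"
  assumes [measurable]: "f \<in> borel_measurable borel"
  shows "(\<integral>\<^sup>+x. f (x + a) \<partial>lborel) = (\<integral>\<^sup>+x. f x \<partial>lborel)"
    and "(\<integral>\<^sup>+x. f (x - a) \<partial>lborel) = (\<integral>\<^sup>+x. f x \<partial>lborel)"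
  using nn_integral_lborel_affine[of f 1 a] nn_integral_lborel_affine[of f 1 "-a"]
  by (simp_all add: add.commute)

lemma integral_lborel_reflect:
  fixes f :: "'a::euclidean_space \<Rightarrow> 'b::{banach, second_countable_topology}"
  shows "(\<integral>x. f (a - x) \<partial>lborel) = (\<integral>x. f x \<partial>lborel)"
  using integral_lborel_affine[of "-1" f a] by simp

lemma integral_lborel_shift:
  fixes f :: "'a::euclidean_space \<Rightarrow> 'b::{banach, second_countable_topology}"
  shows "(\<integral>x. f (x + a) \<partial>lborel) = (\<integral>x. f x \<partial>lborel)"
    and "(\<integral>x. f (x - a) \<partial>lborel) = (\<integral>x. f x \<partial>lborel)"
  using integral_lborel_affine[of 1 f a] integral_lborel_affine[of 1 f "-a"]
  by (simp_all add: add.commute)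

lemma integrable_lborel_reflect_iff:
  fixes f :: "'a::euclidean_space \<Rightarrow> 'b::{banach, second_countable_topology}"
  shows "integrable lborel (\<lambda>x. f (a - x)) \<longleftrightarrow> integrable lborel f"
  using integrable_lborel_affine_iff[of "-1" f a] by simp

lemma integrable_lborel_shift_iff:
  fixes f :: "'a::euclidean_space \<Rightarrow> 'b::{banach, second_countable_topology}"
  shows "integrable lborel (\<lambda>x. f (x + a)) \<longleftrightarrow> integrable lborel f"
    and "integrable lborel (\<lambda>x. f (x - a)) \<longleftrightarrow> integrable lborel f"
  using integrable_lborel_affine_iff[of 1 f a] integrable_lborel_affine_iff[of 1 f "-a"]
  by (simp_all add: add.commute)

section \<open>An integrable weight and rapidly decreasing functions\<close>

text \<open>The exponent puts \<open>wt\<close> below the product over coordinates of 1/(1 + t^2),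
  so integrability becomes a one-dimensional fact. It is the common decay profile of kernels, of
  their derivatives and of the Schur kernel of the commutator.\<close>

definition wt :: "real^'n::finite \<Rightarrow> real" where
  "wt x = 1 / (1 + norm x) ^ (2 * CARD('n))"

lemma wt_pos [simp]: "wt x > 0"
  unfolding wt_def by (simp add: add_pos_nonneg)

lemma wt_nonneg [simp]: "wt x \<ge> 0"
  using wt_pos[of x] by linarith

lemma wt_measurable [measurable]: "wt \<in> borel_measurable borel"
  unfolding wt_def by measurable

lemma wt_le_scaled:
  fixes x y :: "real^'n::finite"
  assumes "1 + norm x \<le> a * (1 + norm y)" "a \<ge> 0"
  shows "wt y \<le> a ^ (2 * CARD('n)) * wt x"
proof -
  have "(1 + norm x) ^ (2 * CARD('n)) \<le> (a * (1 + norm y)) ^ (2 * CARD('n))"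
    using assms by (intro power_mono) auto
  then show ?thesis
    unfolding wt_def power_mult_distrib
    by (simp add: divide_simps add_pos_nonneg mult_ac)
qed

text \<open>By submultiplicativity of \<open>1 + norm\<close>, the weight changes within distance
  \<open>r\<close> by at most a power of 1 + r. This lets derivative bounds over a ball be frozen at
  its centre.\<close>

lemma wt_shift:
  fixes x y :: "real^'n::finite"
  assumes "norm (x - y) \<le> r"
  shows "wt y \<le> (1 + r) ^ (2 * CARD('n)) * wt x"
proof (rule wt_le_scaled)
  show r: "0 \<le> 1 + r" using assms norm_ge_zero[of "x - y"] by linarith
  have "1 + norm x \<le> (1 + norm (x - y)) * (1 + norm y)"
    using one_plus_norm_add[of "x - y" y] by simp
  also have "\<dots> \<le> (1 + r) * (1 + norm y)"
    by (rule mult_right_mono) (use assms in auto)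
  finally show "1 + norm x \<le> (1 + r) * (1 + norm y)" .
qed

lemma wt_le_prod:
  fixes x :: "real^'n::finite"
  shows "wt x \<le> (\<Prod>b\<in>Basis. inverse (1 + (x \<bullet> b)\<^sup>2))"
proof -
  have "(\<Prod>b\<in>(Basis::(real^'n) set). 1 + (x \<bullet> b)\<^sup>2) \<le> (\<Prod>b\<in>(Basis::(real^'n) set). (1 + norm x)\<^sup>2)"
  proof (rule prod_mono)
    fix b :: "real^'n" assume "b \<in> Basis"
    then have "\<bar>x \<bullet> b\<bar> \<le> norm x" by (rule Basis_le_norm)
    then have "(x \<bullet> b)\<^sup>2 \<le> (norm x)\<^sup>2" by (simp add: abs_le_square_iff[symmetric])
    then have "(x \<bullet> b)\<^sup>2 \<le> (norm x)\<^sup>2 + 2 * norm x"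
      using norm_ge_zero[of x] by linarith
    then show "0 \<le> 1 + (x \<bullet> b)\<^sup>2 \<and> 1 + (x \<bullet> b)\<^sup>2 \<le> (1 + norm x)\<^sup>2"
      by (simp add: power2_sum)
  qed
  also have "\<dots> = (1 + norm x) ^ (2 * CARD('n))"
    by (simp add: power_mult)
  finally have *: "(\<Prod>b\<in>(Basis::(real^'n) set). 1 + (x \<bullet> b)\<^sup>2) \<le> (1 + norm x) ^ (2 * CARD('n))" .
  have "0 < (\<Prod>b\<in>(Basis::(real^'n) set). 1 + (x \<bullet> b)\<^sup>2)"
    by (rule prod_pos) (simp add: add_pos_nonneg)
  with * show ?thesis
    unfolding wt_def prod_inversef[unfolded o_def, symmetric]
    by (simp add: inverse_eq_divide prod_dividef frac_le)
qed

lemma wt_nn_integral_finite: "(\<integral>\<^sup>+x. ennreal (wt (x::real^'n::finite)) \<partial>lborel) < \<infinity>"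
proof -
  have "(\<integral>\<^sup>+x. ennreal (inverse (1 + x\<^sup>2)) \<partial>(lborel :: real measure)) < \<infinity>"
    using integrable_inverse_1_plus_square
    by (auto simp: set_integrable_def real_integrable_def less_top)
  then have fin: "(\<Prod>b\<in>(Basis::(real^'n) set). (\<integral>\<^sup>+x. ennreal (inverse (1 + x\<^sup>2)) \<partial>(lborel :: real measure))) < \<infinity>"
    by (simp add: power_less_top_ennreal)
  have "(\<integral>\<^sup>+x. ennreal (wt (x::real^'n)) \<partial>lborel) \<le>
      (\<integral>\<^sup>+x. (\<Prod>b\<in>Basis. ennreal (inverse (1 + ((x::real^'n) \<bullet> b)\<^sup>2))) \<partial>lborel)"
    by (rule nn_integral_mono) (auto simp: prod_ennreal intro!: ennreal_leI wt_le_prod)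
  also have "\<dots> = (\<Prod>b\<in>(Basis::(real^'n) set). (\<integral>\<^sup>+x. ennreal (inverse (1 + x\<^sup>2)) \<partial>(lborel :: real measure)))"
    by (rule nn_integral_lborel_prod) auto
  finally show ?thesis using fin by simp
qed

lemma wt_integrable: "integrable lborel (wt :: real^'n::finite \<Rightarrow> real)"
  using wt_nn_integral_finite by (auto simp: integrable_iff_bounded)

text \<open>Decay without regularity. It is what convolution asks of its kernel, so Gaussians can
  stand beside Schwartz functions without estimates of their derivatives of all orders.\<close>

definition rapid :: "(real^'n::finite \<Rightarrow> complex) \<Rightarrow> bool" where
  "rapid f \<longleftrightarrow> f \<in> borel_measurable borel \<and> (\<forall>N. \<exists>C. \<forall>x. (1 + norm x) ^ N * norm (f x) \<le> C)"

lemma rapid_measurable: "rapid f \<Longrightarrow> f \<in> borel_measurable borel"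
  by (simp add: rapid_def)

lemma rapidD:
  fixes f :: "real^'n::finite \<Rightarrow> complex"
  assumes "rapid f"
  obtains C where "C \<ge> 0" "\<And>x. (1 + norm x) ^ N * norm (f x) \<le> C"
proof -
  from assms obtain C where C: "\<And>x. (1 + norm x) ^ N * norm (f x) \<le> C"
    unfolding rapid_def by blast
  have "0 \<le> (1 + norm (0::real^'n)) ^ N * norm (f 0)" by simp
  also have "\<dots> \<le> C" by (rule C)
  finally show ?thesis using that C by blast
qed

lemma rapid_wt:
  fixes f :: "real^'n::finite \<Rightarrow> complex"
  assumes "rapid f" obtains C where "C \<ge> 0" "\<And>x. (1 + norm x) ^ N * norm (f x) \<le> C * wt x"
proof -
  obtain C where C: "C \<ge> 0" "\<And>x. (1 + norm x) ^ (N + 2 * CARD('n)) * norm (f x) \<le> C"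
    using rapidD[OF assms] by blast
  have "(1 + norm x) ^ N * norm (f x) \<le> C * wt x" for x
    using C(2)[of x] by (simp add: wt_def power_add field_simps add_pos_nonneg)
  with C(1) that show ?thesis by blast
qed

lemma rapid_integrable_weighted:
  fixes f :: "real^'n::finite \<Rightarrow> complex"
  assumes "rapid f" shows "integrable lborel (\<lambda>x. (1 + norm x) ^ N * norm (f x))"
proof -
  have [measurable]: "f \<in> borel_measurable borel" using assms by (rule rapid_measurable)
  obtain C where C: "C \<ge> 0" "\<And>x. (1 + norm x) ^ N * norm (f x) \<le> C * wt x"
    using rapid_wt[OF assms] by blast
  show ?thesis
    by (rule Bochner_Integration.integrable_bound[OF integrable_mult_right[OF wt_integrable, of C]])
       (use C in \<open>auto intro!: AE_I2\<close>)
qed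

lemma rapid_integrable:
  assumes "rapid f" shows "integrable lborel f"
  using rapid_integrable_weighted[OF assms, of 0] rapid_measurable[OF assms]
  by (simp add: integrable_norm_iff)

lemma rapid_bounded: assumes "rapid f" obtains C where "C \<ge> 0" "\<And>x. norm (f x) \<le> C"
  using rapidD[OF assms, of 0] by auto

section \<open>Smooth functions\<close>

lemma partial_derivs_Nil [simp]: "partial_derivs [] f = f"
  by (simp add: partial_derivs_def)

lemma partial_derivs_Cons: "partial_derivs (k # ks) f = partial_deriv k (partial_derivs ks f)"
  by (simp add: partial_derivs_def)

lemma partial_derivs_append: "partial_derivs (ks @ ls) f = partial_derivs ks (partial_derivs ls f)"
  by (simp add: partial_derivs_def)

lemma partial_derivs_partial: "partial_derivs ks (partial_deriv i f) = partial_derivs (ks @ [i]) f"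
  by (simp add: partial_derivs_append partial_derivs_Cons)

text \<open>\<open>smooth\<close> is the largest class of differentiable functions closed under
  partial derivatives. Exhibiting a closed class \<open>P\<close> avoids formulas for iterated
  derivatives.\<close>

lemma smooth_coinduct:
  assumes "P f"
    and "\<And>g x. P g \<Longrightarrow> g differentiable (at x)"
    and "\<And>g i. P g \<Longrightarrow> P (partial_deriv i g)"
  shows "smooth f"
proof -
  have "P (partial_derivs ks f)" for ks
    by (induction ks) (auto simp: partial_derivs_Cons assms)
  then show ?thesis unfolding smooth_def using assms(2) by blast
qed

lemma smooth_differentiable: "smooth f \<Longrightarrow> f differentiable (at x)"
  unfolding smooth_def by (metis partial_derivs_Nil)

lemma smooth_partial: "smooth f \<Longrightarrow> smooth (partial_deriv i f)"
  unfolding smooth_def by (simp add: partial_derivs_partial)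

lemma smooth_partials: "smooth f \<Longrightarrow> smooth (partial_derivs ks f)"
  by (induction ks) (auto simp: partial_derivs_Cons smooth_partial)

lemma smooth_continuous: "smooth f \<Longrightarrow> continuous_on S f"
  by (meson continuous_at_imp_continuous_on differentiable_imp_continuous_within smooth_differentiable)

lemma smooth_measurable: "smooth f \<Longrightarrow> f \<in> borel_measurable borel"
  by (rule borel_measurable_continuous_onI) (rule smooth_continuous)

lemma partial_deriv_add:
  assumes "f differentiable (at x)" "g differentiable (at x)"
  shows "partial_deriv i (\<lambda>x. f x + g x) x = partial_deriv i f x + partial_deriv i g x"
  using partial_deriv_eqI[OF has_derivative_add[OF has_derivative_partial[OF assms(1)]
      has_derivative_partial[OF assms(2)]], of i]
    partial_deriv_eqI[OF has_derivative_partial[OF assms(1)], of i]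
    partial_deriv_eqI[OF has_derivative_partial[OF assms(2)], of i] by simp

lemma partial_deriv_bounded_linear:
  assumes "f differentiable (at x)" "bounded_linear L"
  shows "partial_deriv i (\<lambda>x. L (f x)) x = L (partial_deriv i f x)"
  using partial_deriv_eqI[OF bounded_linear.has_derivative[OF assms(2) has_derivative_partial[OF assms(1)]], of i]
    partial_deriv_eqI[OF has_derivative_partial[OF assms(1)], of i] by simp

lemma has_derivative_comp_affine:
  fixes f :: "real^'n::finite \<Rightarrow> 'b::real_normed_vector"
  assumes "f differentiable (at (a + c *\<^sub>R x))"
  shows "((\<lambda>x. f (a + c *\<^sub>R x)) has_derivative
     (\<lambda>v. \<Sum>i\<in>UNIV. ((c *\<^sub>R v) $ i) *\<^sub>R partial_deriv i f (a + c *\<^sub>R x))) (at x)"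
proof -
  have "((\<lambda>x. a + c *\<^sub>R x) has_derivative (\<lambda>v. c *\<^sub>R v)) (at x)"
    by (auto intro!: derivative_eq_intros)
  from has_derivative_compose[OF this has_derivative_partial[OF assms]]
  show ?thesis by simp
qed

lemma sum_axis_scaleR:
  fixes p :: "'n::finite \<Rightarrow> 'b::real_normed_vector"
  shows "(\<Sum>j\<in>UNIV. (axis i c :: real^'n::finite) $ j *\<^sub>R p j) = c *\<^sub>R p i"
proof -
  have "(\<Sum>j\<in>UNIV. (axis i c :: real^'n) $ j *\<^sub>R p j) = (\<Sum>j\<in>UNIV. if j = i then c *\<^sub>R p i else 0)"
    by (rule sum.cong[OF refl]) (auto simp: axis_def)
  then show ?thesis by simp
qed

lemma partial_deriv_affine:
  fixes f :: "real^'n::finite \<Rightarrow> 'b::real_normed_vector"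
  assumes "f differentiable (at (a + c *\<^sub>R x))"
  shows "partial_deriv i (\<lambda>x. f (a + c *\<^sub>R x)) x = c *\<^sub>R partial_deriv i f (a + c *\<^sub>R x)"
  using partial_deriv_eqI[OF has_derivative_comp_affine[OF assms], of i]
  by (simp add: sum_axis_scaleR flip: scaleR_scaleR scaleR_sum_right)

lemma differentiable_affine:
  fixes f :: "real^'n::finite \<Rightarrow> 'b::real_normed_vector"
  assumes "f differentiable (at (a + c *\<^sub>R x))"
  shows "(\<lambda>x. f (a + c *\<^sub>R x)) differentiable (at x)"
  using has_derivative_comp_affine[OF assms] unfolding differentiable_def by blast

lemma smooth_bounded_linear:
  fixes f :: "real^'n::finite \<Rightarrow> 'b::real_normed_vector"
  assumes "smooth f" "bounded_linear L"
  shows "smooth (\<lambda>x. L (f x))"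
proof -
  let ?P = "\<lambda>q :: real^'n \<Rightarrow> _. \<exists>f0. smooth f0 \<and> q = (\<lambda>x. L (f0 x))"
  have "?P (\<lambda>x. L (f x))" using assms by blast
  then show ?thesis
  proof (rule smooth_coinduct[of ?P])
    fix g x assume "?P g" 
    then obtain f0 where f0: "smooth f0" "g = (\<lambda>x. L (f0 x))" by blast
    show "g differentiable (at x)"
      unfolding f0(2) differentiable_def
      using bounded_linear.has_derivative[OF assms(2) has_derivative_partial[OF smooth_differentiable[OF f0(1)]]]
      by blast
  next
    fix g i assume "?P g"
    then obtain f0 where f0: "smooth f0" "g = (\<lambda>x. L (f0 x))" by blast
    then have "partial_deriv i g = (\<lambda>x. L (partial_deriv i f0 x))"
      by (auto simp: partial_deriv_bounded_linear[OF smooth_differentiable assms(2)])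
    with f0(1) show "?P (partial_deriv i g)" using smooth_partial by blast
  qed
qed

lemma smooth_affine:
  fixes f :: "real^'n::finite \<Rightarrow> 'b::real_normed_vector"
  assumes "smooth f"
  shows "smooth (\<lambda>x. f (a + c *\<^sub>R x))"
proof -
  let ?P = "\<lambda>q :: real^'n \<Rightarrow> _. \<exists>f0. smooth f0 \<and> q = (\<lambda>x. f0 (a + c *\<^sub>R x))"
  have "?P (\<lambda>x. f (a + c *\<^sub>R x))" using assms by blast
  then show ?thesis
  proof (rule smooth_coinduct[of ?P])
    fix g x assume "?P g" then show "g differentiable (at x)"
      using differentiable_affine smooth_differentiable by blast
  next
    fix g i assume "?P g"
    then obtain f0 where f0: "smooth f0" "g = (\<lambda>x. f0 (a + c *\<^sub>R x))" by blast
    then have "partial_deriv i g = (\<lambda>x. c *\<^sub>R partial_deriv i f0 (a + c *\<^sub>R x))"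
      by (auto simp: partial_deriv_affine[OF smooth_differentiable])
    moreover have "smooth (\<lambda>x. c *\<^sub>R partial_deriv i f0 x)"
      by (rule smooth_bounded_linear[OF smooth_partial[OF f0(1)] bounded_linear_scaleR_right])
    ultimately show "?P (partial_deriv i g)"
      by (intro exI[where x = "\<lambda>x. c *\<^sub>R partial_deriv i f0 x"] conjI)
  qed
qed

lemma smooth_add:
  assumes "smooth f" "smooth g"
  shows "smooth (\<lambda>x. f x + g x)"
proof -
  let ?P = "\<lambda>q. \<exists>f0 g0. smooth f0 \<and> smooth g0 \<and> q = (\<lambda>x. f0 x + g0 x)"
  have "?P (\<lambda>x. f x + g x)" using assms by blast
  then show ?thesis
  proof (rule smooth_coinduct[of ?P])
    fix h x assume "?P h" then show "h differentiable (at x)"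
      using differentiable_add smooth_differentiable by blast
  next
    fix h i assume "?P h"
    then obtain f0 g0 where f0: "smooth f0" "smooth g0" "h = (\<lambda>x. f0 x + g0 x)" by blast
    then have "partial_deriv i h = (\<lambda>x. partial_deriv i f0 x + partial_deriv i g0 x)"
      by (auto simp: partial_deriv_add[OF smooth_differentiable smooth_differentiable])
    with f0 show "?P (partial_deriv i h)" using smooth_partial by blast
  qed
qed

lemma has_derivative_coord_mult:
  fixes f :: "real^'n::finite \<Rightarrow> 'b::real_normed_vector"
  assumes "f differentiable (at x)"
  shows "((\<lambda>x. (x $ k) *\<^sub>R f x) has_derivative
     (\<lambda>v. (x $ k) *\<^sub>R (\<Sum>i\<in>UNIV. (v $ i) *\<^sub>R partial_deriv i f x) + (v $ k) *\<^sub>R f x)) (at x)"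
  by (rule has_derivative_scaleR[OF
        bounded_linear_imp_has_derivative[OF bounded_linear_vec_nth] has_derivative_partial[OF assms]])

lemma partial_deriv_coord_mult:
  fixes f :: "real^'n::finite \<Rightarrow> 'b::real_normed_vector"
  assumes "f differentiable (at x)"
  shows "partial_deriv i (\<lambda>x. (x $ k) *\<^sub>R f x) x =
      (x $ k) *\<^sub>R partial_deriv i f x + (if i = k then f x else 0)"
  using partial_deriv_eqI[OF has_derivative_coord_mult[OF assms], of i]
  by (simp only: sum_axis_scaleR) (simp add: axis_def)

lemma smooth_coord_mult:
  assumes "smooth f"
  shows "smooth (\<lambda>x. (x $ k) *\<^sub>R f x)"
proof -
  have z: "smooth (\<lambda>x. 0 *\<^sub>R f x)"
    by (rule smooth_bounded_linear[OF assms bounded_linear_scaleR_right])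
  \<comment> \<open>The summand \<open>g0\<close> absorbs the lower-order term created by the
    product rule, which is what closes the class under derivatives.\<close>
  let ?P = "\<lambda>q. \<exists>f0 g0. smooth f0 \<and> smooth g0 \<and> q = (\<lambda>x. (x $ k) *\<^sub>R f0 x + g0 x)"
  have "?P (\<lambda>x. (x $ k) *\<^sub>R f x)"
    using assms by (intro exI[of _ f] exI[of _ "\<lambda>x. 0 *\<^sub>R f x"]) (use z in auto)
  then show ?thesis
  proof (rule smooth_coinduct[of ?P])
    fix h x assume "?P h"
    then obtain f0 g0 where f0: "smooth f0" "smooth g0" "h = (\<lambda>x. (x $ k) *\<^sub>R f0 x + g0 x)" by blast
    have d: "(\<lambda>x. (x $ k) *\<^sub>R f0 x) differentiable (at x)"
      using has_derivative_coord_mult[OF smooth_differentiable[OF f0(1)], of k x]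
      by (auto simp: differentiable_def)
    show "h differentiable (at x)"
      unfolding f0(3) by (intro differentiable_add d smooth_differentiable f0(2))
  next
    fix h i assume "?P h"
    then obtain f0 g0 where f0: "smooth f0" "smooth g0" "h = (\<lambda>x. (x $ k) *\<^sub>R f0 x + g0 x)" by blast
    have d: "(\<lambda>x. (x $ k) *\<^sub>R f0 x) differentiable (at x)" for x
      using has_derivative_coord_mult[OF smooth_differentiable[OF f0(1)], of k x]
      by (auto simp: differentiable_def)
    have "partial_deriv i h = (\<lambda>x. (x $ k) *\<^sub>R partial_deriv i f0 x +
         ((if i = k then f0 x else 0 *\<^sub>R f0 x) + partial_deriv i g0 x))"
      using f0 by (auto simp: partial_deriv_add[OF d smooth_differentiable]
           partial_deriv_coord_mult[OF smooth_differentiable])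
    moreover have "smooth (\<lambda>x. if i = k then f0 x else 0 *\<^sub>R f0 x)"
      using f0(1) smooth_bounded_linear[OF f0(1) bounded_linear_scaleR_right[of 0]] by (cases "i = k") auto
    ultimately show "?P (partial_deriv i h)"
      using smooth_partial[OF f0(1)] smooth_partial[OF f0(2)] smooth_add by blast
  qed
qed

text \<open>The partial derivatives of \<open>f\<close> minus its linear part are increments of
  those of \<open>f\<close>. Two uses of the mean value bound, one for these increments and one for
  the difference itself, produce the square of the dimension.\<close>

lemma taylor_second_order:
  fixes f :: "real^'n::finite \<Rightarrow> 'b::real_normed_vector"
  assumes f: "smooth f" and B: "\<And>i j y. norm (y - x) \<le> norm v \<Longrightarrow> norm (partial_deriv j (partial_deriv i f) y) \<le> B"
  shows "norm (f (x + v) - f x - (\<Sum>i\<in>UNIV. (v $ i) *\<^sub>R partial_deriv i f x))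
     \<le> (real CARD('n))\<^sup>2 * B * (norm v)\<^sup>2"
proof -
  define S where "S = cball x (norm v)"
  have S: "convex S" "x \<in> S" "x + v \<in> S" by (auto simp: S_def dist_norm)
  define D where "D = (\<lambda>y. \<Sum>i\<in>UNIV. ((y - x) $ i) *\<^sub>R partial_deriv i f x)"
  have Dd: "(D has_derivative (\<lambda>w. \<Sum>i\<in>UNIV. (w $ i) *\<^sub>R partial_deriv i f x)) (at y)" for y
    unfolding D_def
  proof (intro has_derivative_sum has_derivative_scaleR_left bounded_linear.has_derivative[OF bounded_linear_vec_nth])
    show "((\<lambda>y. y - x) has_derivative (\<lambda>w. w)) (at y)"
      by (auto intro!: derivative_eq_intros)
  qed
  have B0: "0 \<le> B" using order_trans[OF norm_ge_zero B[of x undefined undefined]] by simp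
  have "norm ((f (x + v) - D (x + v)) - (f x - D x)) \<le>
      real CARD('n) * (real CARD('n) * B * norm v) * norm (x + v - x)"
  proof (rule partial_mean_value[OF S(1,3,2)])
    fix z assume z: "z \<in> S"
    have d: "((\<lambda>y. f y - D y) has_derivative (\<lambda>w. (\<Sum>i\<in>UNIV. (w $ i) *\<^sub>R partial_deriv i f z)
          - (\<Sum>i\<in>UNIV. (w $ i) *\<^sub>R partial_deriv i f x))) (at z)"
      by (intro has_derivative_diff Dd has_derivative_partial smooth_differentiable f)
    then show "(\<lambda>y. f y - D y) differentiable (at z)" unfolding differentiable_def by blast
    fix i
    have "norm (partial_deriv i f z - partial_deriv i f x) \<le> real CARD('n) * B * norm (z - x)"
      by (rule partial_mean_value[OF S(1) z S(2) smooth_differentiable[OF smooth_partial[OF f]]])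
        (use B in \<open>auto simp: S_def dist_norm norm_minus_commute\<close>)
    also have "\<dots> \<le> real CARD('n) * B * norm v"
      by (rule mult_left_mono) (use z B0 in \<open>auto simp: S_def dist_norm norm_minus_commute\<close>)
    finally show "norm (partial_deriv i (\<lambda>y. f y - D y) z) \<le> real CARD('n) * B * norm v"
      using partial_deriv_eqI[OF d, of i] by (simp add: sum_axis_scaleR)
  qed
  then show ?thesis
    by (simp add: D_def power2_eq_square algebra_simps)
qed

section \<open>Schwartz functions\<close>

lemma schwartz_smooth: "schwartz \<theta> \<Longrightarrow> smooth \<theta>"
  by (simp add: schwartz_def)

lemma schwartz_partial: "schwartz \<theta> \<Longrightarrow> schwartz (partial_deriv i \<theta>)"
  unfolding schwartz_def by (auto simp: smooth_partial partial_derivs_partial)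

lemma schwartz_partials: "schwartz \<theta> \<Longrightarrow> schwartz (partial_derivs ks \<theta>)"
  by (induction ks) (auto simp: partial_derivs_Cons schwartz_partial)

lemma schwartz_rapid: "schwartz \<theta> \<Longrightarrow> rapid \<theta>"
  unfolding rapid_def
proof (intro conjI allI)
  assume s: "schwartz \<theta>"
  then show "\<theta> \<in> borel_measurable borel" by (intro smooth_measurable schwartz_smooth)
  fix N
  from s have "bounded (range (\<lambda>x. (1 + norm x) ^ N *\<^sub>R partial_derivs [] \<theta> x))"
    unfolding schwartz_def by blast
  then obtain C where "\<And>x. norm ((1 + norm x) ^ N *\<^sub>R \<theta> x) \<le> C"
    unfolding bounded_iff by auto
  then show "\<exists>C. \<forall>x. (1 + norm x) ^ N * norm (\<theta> x) \<le> C" by auto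
qed

text \<open>Decay is asked only of the members of the class, since their derivatives of any order
  are members again.\<close>

lemma schwartz_coinduct:
  assumes "P \<theta>"
    and d: "\<And>g x. P g \<Longrightarrow> g differentiable (at x)"
    and p: "\<And>g i. P g \<Longrightarrow> P (partial_deriv i g)"
    and r: "\<And>g N. P g \<Longrightarrow> \<exists>C. \<forall>x. (1 + norm x) ^ N * norm (g x) \<le> C"
  shows "schwartz \<theta>"
  unfolding schwartz_def
proof (intro conjI allI)
  show "smooth \<theta>" using assms(1) by (rule smooth_coinduct) (use d p in auto)
  fix ks N
  have "P (partial_derivs ks \<theta>)"
    by (induction ks) (auto simp: partial_derivs_Cons assms)
  from r[OF this, of N] obtain C where "\<And>x. (1 + norm x) ^ N * norm (partial_derivs ks \<theta> x) \<le> C"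
    by blast
  then show "bounded (range (\<lambda>x. (1 + norm x) ^ N *\<^sub>R partial_derivs ks \<theta> x))"
    unfolding bounded_iff by (intro exI[of _ C]) auto
qed

lemma schwartz_cmult:
  assumes "schwartz \<theta>" shows "schwartz (\<lambda>x. a * \<theta> x)"
proof -
  let ?P = "\<lambda>q. \<exists>\<eta>. schwartz \<eta> \<and> q = (\<lambda>x. a * \<eta> x)"
  have "?P (\<lambda>x. a * \<theta> x)" using assms by blast
  then show ?thesis
  proof (rule schwartz_coinduct[of ?P])
    fix g x assume "?P g"
    then show "g differentiable (at x)" using schwartz_smooth smooth_differentiable by (auto intro!: derivative_intros)
  next
    fix g i assume "?P g"
    then obtain \<eta> where \<eta>: "schwartz \<eta>" "g = (\<lambda>x. a * \<eta> x)" by blast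
    then have "partial_deriv i g = (\<lambda>x. a * partial_deriv i \<eta> x)"
      by (auto simp: partial_deriv_bounded_linear[OF smooth_differentiable[OF schwartz_smooth] bounded_linear_mult_right])
    with \<eta>(1) show "?P (partial_deriv i g)" using schwartz_partial by blast
  next
    fix g and N :: nat assume "?P g"
    then obtain \<eta> where \<eta>: "schwartz \<eta>" "g = (\<lambda>x. a * \<eta> x)" by blast
    obtain C where "\<And>x. (1 + norm x) ^ N * norm (\<eta> x) \<le> C"
      using rapidD[OF schwartz_rapid[OF \<eta>(1)]] by blast
    then have "(1 + norm x) ^ N * norm (g x) \<le> norm a * C" for x
      unfolding \<eta>(2) norm_mult
      using mult_left_mono[of "(1 + norm x) ^ N * norm (\<eta> x)" C "norm a"] by (simp add: mult_ac)
    then show "\<exists>C. \<forall>x. (1 + norm x) ^ N * norm (g x) \<le> C" by blast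
  qed
qed

lemma schwartz_add:
  assumes "schwartz \<theta>1" "schwartz \<theta>2" shows "schwartz (\<lambda>x. \<theta>1 x + \<theta>2 x)"
proof -
  let ?P = "\<lambda>q. \<exists>f0 g0. schwartz f0 \<and> schwartz g0 \<and> q = (\<lambda>x. f0 x + g0 x)"
  have "?P (\<lambda>x. \<theta>1 x + \<theta>2 x)" using assms by blast
  then show ?thesis
  proof (rule schwartz_coinduct[of ?P])
    fix h x assume "?P h" then show "h differentiable (at x)"
      using differentiable_add smooth_differentiable schwartz_smooth by blast
  next
    fix h i assume "?P h"
    then obtain f0 g0 where f0: "schwartz f0" "schwartz g0" "h = (\<lambda>x. f0 x + g0 x)" by blast
    then have "partial_deriv i h = (\<lambda>x. partial_deriv i f0 x + partial_deriv i g0 x)"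
      by (auto simp: partial_deriv_add[OF smooth_differentiable smooth_differentiable, OF schwartz_smooth schwartz_smooth])
    with f0 show "?P (partial_deriv i h)" using schwartz_partial by blast
  next
    fix h and N :: nat assume "?P h"
    then obtain f0 g0 where f0: "schwartz f0" "schwartz g0" "h = (\<lambda>x. f0 x + g0 x)" by blast
    obtain C where C: "\<And>x. (1 + norm x) ^ N * norm (f0 x) \<le> C"
      using rapidD[OF schwartz_rapid[OF f0(1)]] by blast
    obtain D where D: "\<And>x. (1 + norm x) ^ N * norm (g0 x) \<le> D"
      using rapidD[OF schwartz_rapid[OF f0(2)]] by blast
    have "(1 + norm x) ^ N * norm (h x) \<le> C + D" for x
    proof -
      have "(1 + norm x) ^ N * norm (h x) \<le> (1 + norm x) ^ N * (norm (f0 x) + norm (g0 x))"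
        unfolding f0(3) by (intro mult_left_mono norm_triangle_ineq) auto
      with C[of x] D[of x] show ?thesis by (simp add: algebra_simps)
    qed
    then show "\<exists>C. \<forall>x. (1 + norm x) ^ N * norm (h x) \<le> C" by blast
  qed
qed

lemma schwartz_diff:
  assumes "schwartz \<theta>1" "schwartz \<theta>2" shows "schwartz (\<lambda>x. \<theta>1 x - \<theta>2 x)"
  using schwartz_add[OF assms(1) schwartz_cmult[OF assms(2), of "-1"]] by simp

lemma reflect_differentiable:
  fixes f :: "real^'n::finite \<Rightarrow> 'b::real_normed_vector"
  assumes "smooth f"
  shows "(\<lambda>y. f (x - y)) differentiable (at y)"
  using differentiable_affine[OF smooth_differentiable[OF assms], of x "-1" y] by simp

lemma partial_deriv_reflect:
  fixes f :: "real^'n::finite \<Rightarrow> 'b::real_normed_vector"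
  assumes "smooth f"
  shows "partial_deriv i (\<lambda>y. f (x - y)) y = - partial_deriv i f (x - y)"
  using partial_deriv_affine[OF smooth_differentiable[OF assms], of i x "-1" y] by simp

lemma partial_derivs_reflect:
  fixes f :: "real^'n::finite \<Rightarrow> 'b::real_normed_vector"
  assumes "smooth f"
  shows "partial_derivs ks (\<lambda>y. f (x - y)) y = (-1) ^ length ks *\<^sub>R partial_derivs ks f (x - y)"
proof (induction ks arbitrary: y)
  case (Cons k ks)
  have "partial_derivs (k # ks) (\<lambda>y. f (x - y)) y
      = partial_deriv k (\<lambda>y. (-1) ^ length ks *\<^sub>R partial_derivs ks f (x - y)) y"
    unfolding partial_derivs_Cons Cons.IH[abs_def] ..
  also have "\<dots> = (-1) ^ length ks *\<^sub>R partial_deriv k (\<lambda>y. partial_derivs ks f (x - y)) y"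
    by (rule partial_deriv_bounded_linear[OF reflect_differentiable[OF smooth_partials[OF assms]]
         bounded_linear_scaleR_right])
  finally show ?case
    by (simp add: partial_deriv_reflect[OF smooth_partials[OF assms]] partial_derivs_Cons)
qed simp

lemma schwartz_reflect:
  assumes "schwartz \<theta>" shows "schwartz (\<lambda>y. \<theta> (x - y))"
proof -
  let ?P = "\<lambda>q. \<exists>\<eta>. schwartz \<eta> \<and> q = (\<lambda>y. \<eta> (x - y))"
  have "?P (\<lambda>y. \<theta> (x - y))" using assms by blast
  then show ?thesis
  proof (rule schwartz_coinduct[of ?P])
    fix g y assume "?P g"
    then show "g differentiable (at y)" using reflect_differentiable schwartz_smooth by blast
  next
    fix g i assume "?P g"
    then obtain \<eta> where \<eta>: "schwartz \<eta>" "g = (\<lambda>y. \<eta> (x - y))" by blast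
    then have "partial_deriv i g = (\<lambda>y. (-1) * partial_deriv i \<eta> (x - y))"
      by (auto simp: partial_deriv_reflect[OF schwartz_smooth])
    moreover have "schwartz (\<lambda>y. (-1) * partial_deriv i \<eta> y)"
      by (intro schwartz_cmult schwartz_partial \<eta>)
    ultimately show "?P (partial_deriv i g)" by (intro exI[of _ "\<lambda>y. (-1) * partial_deriv i \<eta> y"]) auto
  next
    fix g and N :: nat assume "?P g"
    then obtain \<eta> where \<eta>: "schwartz \<eta>" "g = (\<lambda>y. \<eta> (x - y))" by blast
    obtain C where C: "C \<ge> 0" "\<And>x. (1 + norm x) ^ N * norm (\<eta> x) \<le> C"
      using rapidD[OF schwartz_rapid[OF \<eta>(1)]] by blast
    have "(1 + norm y) ^ N * norm (g y) \<le> (1 + norm x) ^ N * C" for y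
    proof -
      have "1 + norm y \<le> (1 + norm x) * (1 + norm (x - y))"
        using one_plus_norm_add[of x "y - x"] by (simp add: norm_minus_commute)
      then have "(1 + norm y) ^ N * norm (g y) \<le> ((1 + norm x) * (1 + norm (x - y))) ^ N * norm (g y)"
        by (intro mult_right_mono power_mono) auto
      also have "\<dots> = (1 + norm x) ^ N * ((1 + norm (x - y)) ^ N * norm (\<eta> (x - y)))"
        by (simp add: \<eta>(2) power_mult_distrib mult_ac)
      also have "\<dots> \<le> (1 + norm x) ^ N * C"
        by (intro mult_left_mono C) auto
      finally show ?thesis .
    qed
    then show "\<exists>C. \<forall>x. (1 + norm x) ^ N * norm (g x) \<le> C" by blast
  qed
qed

text \<open>A sum of finitely many constants serves all derivatives up to order two, the orders that
  enter a second difference of a kernel.\<close>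

lemma schwartz_wt:
  assumes "schwartz \<theta>"
  obtains C where "C \<ge> 0" "\<And>x. norm (\<theta> x) \<le> C * wt x"
    "\<And>i x. norm (partial_deriv i \<theta> x) \<le> C * wt x"
    "\<And>i j x. norm (partial_deriv j (partial_deriv i \<theta>) x) \<le> C * wt x"
proof -
  have ex: "\<exists>C\<ge>0. \<forall>x. norm (f x) \<le> C * wt x" if "schwartz f" for f :: "real^'a::finite \<Rightarrow> complex"
    using rapid_wt[OF schwartz_rapid[OF that], of 0] by (metis mult_1 power_0)
  obtain C0 where C0: "C0 \<ge> 0" "\<And>x. norm (\<theta> x) \<le> C0 * wt x" using ex[OF assms] by blast
  obtain C1 where C1: "\<And>i. C1 i \<ge> 0" "\<And>i x. norm (partial_deriv i \<theta> x) \<le> C1 i * wt x"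
    using ex[OF schwartz_partial[OF assms]] by metis
  have "\<forall>i j. \<exists>C\<ge>0. \<forall>x. norm (partial_deriv j (partial_deriv i \<theta>) x) \<le> C * wt x"
    by (intro allI ex schwartz_partial assms)
  then obtain C2 where C2: "\<And>i j. C2 i j \<ge> 0"
      "\<And>i j x. norm (partial_deriv j (partial_deriv i \<theta>) x) \<le> C2 i j * wt x"
    by metis
  define C where "C = C0 + (\<Sum>i\<in>UNIV. C1 i) + (\<Sum>i\<in>UNIV. \<Sum>j\<in>UNIV. C2 i j)"
  have s1: "0 \<le> (\<Sum>i\<in>UNIV. C1 i)" "0 \<le> (\<Sum>i\<in>UNIV. \<Sum>j\<in>UNIV. C2 i j)"
    by (auto intro!: sum_nonneg C1 C2)
  have s2: "C1 i \<le> (\<Sum>i\<in>UNIV. C1 i)" for i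
    by (rule member_le_sum) (auto intro: C1)
  have s3: "C2 i j \<le> (\<Sum>i\<in>UNIV. \<Sum>j\<in>UNIV. C2 i j)" for i j
  proof -
    have "C2 i j \<le> (\<Sum>j\<in>UNIV. C2 i j)"
      by (rule member_le_sum) (auto intro: C2)
    also have "\<dots> \<le> (\<Sum>i\<in>UNIV. \<Sum>j\<in>UNIV. C2 i j)"
      by (rule member_le_sum) (auto intro!: sum_nonneg C2)
    finally show ?thesis .
  qed
  show ?thesis
  proof (rule that[of C])
    show "C \<ge> 0" using C0 s1 by (simp add: C_def)
    fix x i j
    show "norm (\<theta> x) \<le> C * wt x"
      using s1 by (intro order_trans[OF C0(2)] mult_right_mono) (auto simp: C_def)
    show "norm (partial_deriv i \<theta> x) \<le> C * wt x"
      using s1 s2[of i] C0 by (intro order_trans[OF C1(2)] mult_right_mono) (auto simp: C_def)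
    show "norm (partial_deriv j (partial_deriv i \<theta>) x) \<le> C * wt x"
      using s1 s3[of i j] C0 by (intro order_trans[OF C2(2)] mult_right_mono) (auto simp: C_def)
  qed
qed

text \<open>Every iterated derivative equals \<open>x $ k\<close> times an iterated derivative of
  \<open>m\<close> plus a Schwartz function; one extra power of the weight pays for the factor
  \<open>x $ k\<close>.\<close>

lemma schwartz_coord_mult:
  fixes m :: "real^'n::finite \<Rightarrow> complex"
  assumes "schwartz m" shows "schwartz (\<lambda>x. (x $ k) *\<^sub>R m x)"
  unfolding schwartz_def
proof (intro conjI allI)
  show "smooth (\<lambda>x. (x $ k) *\<^sub>R m x)"
    by (intro smooth_coord_mult schwartz_smooth assms)
  fix ks :: "'n list" and N :: nat
  have "\<exists>f0. schwartz f0 \<and> partial_derivs ks (\<lambda>x. (x $ k) *\<^sub>R m x) =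
      (\<lambda>x. (x $ k) *\<^sub>R partial_derivs ks m x + f0 x)"
  proof (induction ks)
    case Nil
    have "schwartz (\<lambda>x. 0 * m x)" by (rule schwartz_cmult[OF assms])
    moreover have "partial_derivs [] (\<lambda>x. (x $ k) *\<^sub>R m x) =
      (\<lambda>x. (x $ k) *\<^sub>R partial_derivs [] m x + 0 * m x)" by simp
    ultimately show ?case by fast
  next
    case (Cons i ks)
    then obtain f0 where f0: "schwartz f0" and eq: "partial_derivs ks (\<lambda>x. (x $ k) *\<^sub>R m x) =
      (\<lambda>x. (x $ k) *\<^sub>R partial_derivs ks m x + f0 x)" by blast
    have s: "schwartz (partial_derivs ks m)" by (rule schwartz_partials[OF assms])
    note dm = smooth_differentiable[OF schwartz_smooth[OF s]]
    have d: "(\<lambda>x. (x $ k) *\<^sub>R partial_derivs ks m x) differentiable (at x)" for x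
      using has_derivative_coord_mult[OF dm, of k x] by (auto simp: differentiable_def)
    have "partial_derivs (i # ks) (\<lambda>x. (x $ k) *\<^sub>R m x) = (\<lambda>x. (x $ k) *\<^sub>R partial_derivs (i # ks) m x +
        ((if i = k then 1 else 0) * partial_derivs ks m x + partial_deriv i f0 x))"
      unfolding partial_derivs_Cons eq
      by (rule ext)
         (simp add: partial_deriv_add[OF d smooth_differentiable[OF schwartz_smooth[OF f0]]]
           partial_deriv_coord_mult[OF dm])
    moreover have "schwartz (\<lambda>x. (if i = k then 1 else 0) * partial_derivs ks m x + partial_deriv i f0 x)"
      by (intro schwartz_add schwartz_cmult s schwartz_partial f0)
    ultimately show ?case by fast
  qed
  then obtain f0 where f0: "schwartz f0" and eq: "partial_derivs ks (\<lambda>x. (x $ k) *\<^sub>R m x) =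
      (\<lambda>x. (x $ k) *\<^sub>R partial_derivs ks m x + f0 x)" by blast
  obtain C where C: "\<And>x. (1 + norm x) ^ Suc N * norm (partial_derivs ks m x) \<le> C"
    using rapidD[OF schwartz_rapid[OF schwartz_partials[OF assms]]] by blast
  obtain D where D: "\<And>x. (1 + norm x) ^ N * norm (f0 x) \<le> D"
    using rapidD[OF schwartz_rapid[OF f0]] by blast
  have "(1 + norm x) ^ N * norm (partial_derivs ks (\<lambda>x. (x $ k) *\<^sub>R m x) x) \<le> C + D" for x
  proof -
    have "norm ((x $ k) *\<^sub>R partial_derivs ks m x) \<le> (1 + norm x) * norm (partial_derivs ks m x)"
      using component_le_norm_cart[of x k] by (auto intro!: mult_right_mono)
    then have "(1 + norm x) ^ N * norm ((x $ k) *\<^sub>R partial_derivs ks m x)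
        \<le> (1 + norm x) ^ N * ((1 + norm x) * norm (partial_derivs ks m x))"
      by (intro mult_left_mono) auto
    also have "\<dots> \<le> C" using C[of x] by (simp add: mult_ac)
    finally have 1: "(1 + norm x) ^ N * norm ((x $ k) *\<^sub>R partial_derivs ks m x) \<le> C" .
    have "(1 + norm x) ^ N * norm (partial_derivs ks (\<lambda>x. (x $ k) *\<^sub>R m x) x) \<le>
       (1 + norm x) ^ N * (norm ((x $ k) *\<^sub>R partial_derivs ks m x) + norm (f0 x))"
      unfolding eq by (intro mult_left_mono norm_triangle_ineq) auto
    with 1 D[of x] show ?thesis unfolding distrib_left by linarith
  qed
  then show "bounded (range (\<lambda>x. (1 + norm x) ^ N *\<^sub>R partial_derivs ks (\<lambda>x. (x $ k) *\<^sub>R m x) x))"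
    unfolding bounded_iff by (intro exI[of _ "C + D"]) auto
qed

text \<open>On the unit ball around \<open>x\<close> the weight varies by at most a factor 2^N, so
  the decay of the second derivatives passes to the Taylor remainder.\<close>

lemma schwartz_taylor:
  fixes \<theta> :: "real^'n::finite \<Rightarrow> complex"
  assumes "schwartz \<theta>"
  obtains K where "K \<ge> 0" "\<And>x v. norm v \<le> 1 \<Longrightarrow>
    (1 + norm x) ^ N * norm (\<theta> (x + v) - \<theta> x - (\<Sum>i\<in>UNIV. (v $ i) *\<^sub>R partial_deriv i \<theta> x)) \<le> K * (norm v)\<^sup>2"
proof -
  have "\<exists>C\<ge>0. \<forall>x. (1 + norm x) ^ N * norm (partial_deriv j (partial_deriv i \<theta>) x) \<le> C" for i j
    using rapidD[OF schwartz_rapid[OF schwartz_partial[OF schwartz_partial[OF assms]]]] by metis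
  then have "\<forall>i j. \<exists>C\<ge>0. \<forall>x. (1 + norm x) ^ N * norm (partial_deriv j (partial_deriv i \<theta>) x) \<le> C"
    by blast
  then obtain C where C: "\<And>i j. C i j \<ge> 0"
    "\<And>i j x. (1 + norm x) ^ N * norm (partial_deriv j (partial_deriv i \<theta>) x) \<le> C i j" by metis
  define D where "D = (\<Sum>i\<in>UNIV. \<Sum>j\<in>UNIV. C i j)"
  have CD: "C i j \<le> D" for i j
  proof -
    have "C i j \<le> (\<Sum>j\<in>UNIV. C i j)" by (rule member_le_sum) (auto intro: C)
    also have "\<dots> \<le> D" unfolding D_def by (rule member_le_sum) (auto intro!: sum_nonneg C)
    finally show ?thesis .
  qed
  have D0: "0 \<le> D" unfolding D_def by (auto intro!: sum_nonneg C)
  show ?thesis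
  proof (rule that[of "(real CARD('n))\<^sup>2 * (2 ^ N * D)"])
    show "0 \<le> (real CARD('n))\<^sup>2 * (2 ^ N * D)" using D0 by simp
    fix x v :: "real^'n" assume v: "norm v \<le> 1"
    have p: "0 < (1 + norm x) ^ N" by (simp add: add_pos_nonneg)
    have "norm (\<theta> (x + v) - \<theta> x - (\<Sum>i\<in>UNIV. (v $ i) *\<^sub>R partial_deriv i \<theta> x))
        \<le> (real CARD('n))\<^sup>2 * (2 ^ N * D / (1 + norm x) ^ N) * (norm v)\<^sup>2"
    proof (rule taylor_second_order[OF schwartz_smooth[OF assms]])
      fix i j y assume y: "norm (y - x) \<le> norm v"
      have "1 + norm x \<le> 2 * (1 + norm y)"
        using norm_triangle_ineq2[of x y] y v norm_ge_zero[of y] unfolding norm_minus_commute[of y x] by argo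
      then have "(1 + norm x) ^ N \<le> 2 ^ N * (1 + norm y) ^ N"
        unfolding power_mult_distrib[symmetric] by (intro power_mono) auto
      then have "(1 + norm x) ^ N * norm (partial_deriv j (partial_deriv i \<theta>) y) \<le>
          2 ^ N * ((1 + norm y) ^ N * norm (partial_deriv j (partial_deriv i \<theta>) y))"
        using mult_right_mono[of "(1 + norm x) ^ N" "2 ^ N * (1 + norm y) ^ N"
            "norm (partial_deriv j (partial_deriv i \<theta>) y)"] by (simp add: mult_ac)
      also have "\<dots> \<le> 2 ^ N * D"
        by (intro mult_left_mono order_trans[OF C(2) CD]) auto
      finally show "norm (partial_deriv j (partial_deriv i \<theta>) y) \<le> 2 ^ N * D / (1 + norm x) ^ N"
        using p by (simp add: field_simps)
    qed
    with p show "(1 + norm x) ^ N * norm (\<theta> (x + v) - \<theta> x - (\<Sum>i\<in>UNIV. (v $ i) *\<^sub>R partial_deriv i \<theta> x))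
      \<le> (real CARD('n))\<^sup>2 * (2 ^ N * D) * (norm v)\<^sup>2"
      by (simp add: field_simps)
  qed
qed

text \<open>The exterior of the closed ball is open, so derivatives vanish there as well; on the
  ball, continuity and compactness give the bounds.\<close>

lemma schwartz_compact_support:
  fixes m :: "real^'n::finite \<Rightarrow> complex"
  assumes "smooth m" "\<And>\<xi>. norm \<xi> > R \<Longrightarrow> m \<xi> = 0"
  shows "schwartz m"
proof -
  let ?P = "\<lambda>q :: real^'n \<Rightarrow> complex. smooth q \<and> (\<forall>\<xi>. norm \<xi> > R \<longrightarrow> q \<xi> = 0)"
  have "?P m" using assms by blast
  then show ?thesis
  proof (rule schwartz_coinduct[of ?P])
    fix g :: "real^'n \<Rightarrow> complex" and x assume "?P g"
    then show "g differentiable (at x)" using smooth_differentiable by blast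
  next
    fix g :: "real^'n \<Rightarrow> complex" and i assume g: "?P g"
    have "partial_deriv i g \<xi> = 0" if \<xi>: "norm \<xi> > R" for \<xi>
    proof -
      have "open {\<xi> :: real^'n. R < norm \<xi>}" by (intro open_Collect_less continuous_intros)
      then have "(g has_derivative (\<lambda>_. 0)) (at \<xi>)"
        using g \<xi> by (intro has_derivative_transform_within_open[OF has_derivative_const[of 0]]) auto
      from partial_deriv_eqI[OF this] show ?thesis .
    qed
    with g show "?P (partial_deriv i g)" using smooth_partial by blast
  next
    fix g :: "real^'n \<Rightarrow> complex" and N :: nat assume g: "?P g"
    have "compact ((\<lambda>x. (1 + norm x) ^ N * norm (g x)) ` cball 0 R)"
      using g by (intro compact_continuous_image continuous_intros smooth_continuous) auto
    then have "bounded ((\<lambda>x. (1 + norm x) ^ N * norm (g x)) ` cball 0 R)"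
      by (rule compact_imp_bounded)
    then obtain C where "\<forall>y\<in>(\<lambda>x. (1 + norm x) ^ N * norm (g x)) ` cball 0 R. norm y \<le> C"
      unfolding bounded_iff by blast
    then have C: "norm ((1 + norm x) ^ N * norm (g x)) \<le> C" if "x \<in> cball 0 R" for x
      using that by blast
    have "(1 + norm x) ^ N * norm (g x) \<le> max C 0" for x
    proof (cases "norm x \<le> R")
      case True with C[of x] show ?thesis by simp
    next
      case False with g show ?thesis by simp
    qed
    then show "\<exists>C. \<forall>x. (1 + norm x) ^ N * norm (g x) \<le> C" by blast
  qed
qed

section \<open>Inverse Fourier transform of Schwartz symbols\<close>

text \<open>The complex-symbol form of \<open>inv_fourier\<close>: differentiating the transform
  multiplies the symbol by \<open>\<i> * (\<xi> $ i)\<close>, which leaves the real-valued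
  symbols.\<close>

definition ift :: "(real^'n::finite \<Rightarrow> complex) \<Rightarrow> real^'n \<Rightarrow> complex" where
  "ift m x = complex_of_real (1 / (2 * pi) ^ CARD('n)) * (\<integral>\<xi>. cis (x \<bullet> \<xi>) * m \<xi> \<partial>lborel)"

lemma inv_fourier_eq_ift: "inv_fourier m = ift (\<lambda>\<xi>. complex_of_real (m \<xi>))"
  by (simp add: fun_eq_iff inv_fourier_def ift_def)

lemma cis_measurable [measurable]: "cis \<in> borel_measurable borel"
  by (intro borel_measurable_continuous_onI continuous_on_cis continuous_on_id)

lemma integrable_cis_mult:
  fixes f :: "'a::euclidean_space \<Rightarrow> complex"
  assumes "integrable lborel f" "g \<in> borel_measurable borel"
  shows "integrable lborel (\<lambda>\<xi>. cis (g \<xi>) * f \<xi>)"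
proof -
  have [measurable]: "f \<in> borel_measurable borel" "g \<in> borel_measurable borel" using assms by auto
  show ?thesis
    by (rule Bochner_Integration.integrable_bound[OF assms(1)]) (auto simp: norm_mult)
qed

lemma integrable_ift:
  assumes "schwartz m"
  shows "integrable lborel (\<lambda>\<xi>. cis (x \<bullet> \<xi>) * m \<xi>)"
  by (intro integrable_cis_mult rapid_integrable schwartz_rapid assms) auto

lemma norm_ift_le:
  fixes m :: "real^'n::finite \<Rightarrow> complex"
  shows "norm (ift m x) \<le> (1 / (2 * pi) ^ CARD('n)) * (\<integral>\<xi>. norm (m \<xi>) \<partial>lborel)"
proof -
  have "norm (\<integral>\<xi>. cis (x \<bullet> \<xi>) * m \<xi> \<partial>lborel) \<le> (\<integral>\<xi>. norm (cis (x \<bullet> \<xi>) * m \<xi>) \<partial>lborel)"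
    by (rule integral_norm_bound)
  then show ?thesis unfolding ift_def norm_mult
    by (auto simp: norm_mult norm_divide norm_power intro!: divide_right_mono)
qed

lemma cis_remainder: "norm (cis b - 1 - \<i> * complex_of_real b) \<le> b\<^sup>2"
proof -
  have "norm (cis b - 1 - \<i> * complex_of_real b) \<le> \<bar>b\<bar>\<^sup>2 / 2"
    using iexp_approx1[of b 1] by (simp add: cis_conv_exp power2_eq_square algebra_simps)
  then show ?thesis using zero_le_power2[of b] unfolding power2_abs by linarith
qed

text \<open>Differentiation under the integral rests on the pointwise remainder
  \<open>b\<^sup>2\<close> of the phase, which the decay of \<open>m\<close> makes integrable; the
  remainder is therefore quadratic in \<open>v\<close>.\<close>

lemma ift_has_derivative:
  fixes m :: "real^'n::finite \<Rightarrow> complex"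
  assumes m: "schwartz m"
  shows "(ift m has_derivative (\<lambda>v. \<Sum>i\<in>UNIV. (v $ i) *\<^sub>R ift (\<lambda>\<xi>. \<i> * ((\<xi> $ i) *\<^sub>R m \<xi>)) x)) (at x)"
proof (rule has_derivative_quadratic)
  define c where "c = 1 / (2 * pi) ^ CARD('n)"
  have c0: "c > 0" by (simp add: c_def)
  have s: "schwartz (\<lambda>\<xi>. \<i> * ((\<xi> $ i) *\<^sub>R m \<xi>))" for i
    by (intro schwartz_cmult schwartz_coord_mult m)
  show "bounded_linear (\<lambda>v. \<Sum>i\<in>UNIV. (v $ i) *\<^sub>R ift (\<lambda>\<xi>. \<i> * ((\<xi> $ i) *\<^sub>R m \<xi>)) x)"
    by (intro bounded_linear_sum bounded_linear_compose[OF bounded_linear_scaleR_left bounded_linear_vec_nth])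
  fix v :: "real^'n"
  let ?r = "\<lambda>\<xi>. cis (x \<bullet> \<xi>) * ((cis (v \<bullet> \<xi>) - 1 - \<i> * complex_of_real (v \<bullet> \<xi>)) * m \<xi>)"
  have "has_bochner_integral lborel (\<lambda>\<xi>. cis ((x + v) \<bullet> \<xi>) * m \<xi> - cis (x \<bullet> \<xi>) * m \<xi> -
      (\<Sum>i\<in>UNIV. (v $ i) *\<^sub>R (cis (x \<bullet> \<xi>) * (\<i> * ((\<xi> $ i) *\<^sub>R m \<xi>)))))
     ((\<integral>\<xi>. cis ((x + v) \<bullet> \<xi>) * m \<xi> \<partial>lborel) - (\<integral>\<xi>. cis (x \<bullet> \<xi>) * m \<xi> \<partial>lborel) -
       (\<Sum>i\<in>UNIV. (v $ i) *\<^sub>R (\<integral>\<xi>. cis (x \<bullet> \<xi>) * (\<i> * ((\<xi> $ i) *\<^sub>R m \<xi>)) \<partial>lborel)))"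
    by (intro has_bochner_integral_diff has_bochner_integral_sum has_bochner_integral_scaleR_right
        has_bochner_integral_integrable integrable_ift m s)
  moreover have "(\<Sum>i\<in>UNIV. (v $ i) *\<^sub>R (cis (x \<bullet> \<xi>) * (\<i> * ((\<xi> $ i) *\<^sub>R m \<xi>))))
      = cis (x \<bullet> \<xi>) * (\<i> * complex_of_real (v \<bullet> \<xi>)) * m \<xi>" for \<xi>
    unfolding inner_vec_def of_real_sum sum_distrib_left sum_distrib_right
    by (intro sum.cong refl) (simp add: scaleR_conv_of_real mult_ac)
  moreover have "cis ((x + v) \<bullet> \<xi>) * m \<xi> - cis (x \<bullet> \<xi>) * m \<xi> -
      cis (x \<bullet> \<xi>) * (\<i> * complex_of_real (v \<bullet> \<xi>)) * m \<xi> = ?r \<xi>" for \<xi>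
    by (simp add: inner_add_left cis_mult[symmetric] algebra_simps)
  ultimately have B: "has_bochner_integral lborel ?r
     ((\<integral>\<xi>. cis ((x + v) \<bullet> \<xi>) * m \<xi> \<partial>lborel) - (\<integral>\<xi>. cis (x \<bullet> \<xi>) * m \<xi> \<partial>lborel) -
       (\<Sum>i\<in>UNIV. (v $ i) *\<^sub>R (\<integral>\<xi>. cis (x \<bullet> \<xi>) * (\<i> * ((\<xi> $ i) *\<^sub>R m \<xi>)) \<partial>lborel)))"
    by simp
  have "ift m (x + v) - ift m x - (\<Sum>i\<in>UNIV. (v $ i) *\<^sub>R ift (\<lambda>\<xi>. \<i> * ((\<xi> $ i) *\<^sub>R m \<xi>)) x)
      = complex_of_real c * (\<integral>\<xi>. ?r \<xi> \<partial>lborel)"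
    unfolding has_bochner_integral_integral_eq[OF B] ift_def c_def[symmetric] right_diff_distrib sum_distrib_left
    by (simp add: scaleR_conv_of_real mult_ac)
  moreover have "norm (\<integral>\<xi>. ?r \<xi> \<partial>lborel) \<le> (norm v)\<^sup>2 * (\<integral>\<xi>. (1 + norm \<xi>) ^ 2 * norm (m \<xi>) \<partial>lborel)"
    unfolding integral_mult_right_zero[symmetric]
  proof (rule Bochner_Integration.integral_norm_bound_integral)
    show "integrable lborel ?r" using B by (rule integrable.intros)
    show "integrable lborel (\<lambda>\<xi>. (norm v)\<^sup>2 * ((1 + norm \<xi>) ^ 2 * norm (m \<xi>)))"
      by (intro integrable_mult_right rapid_integrable_weighted schwartz_rapid m)
    fix \<xi> :: "real^'n"
    have "\<bar>v \<bullet> \<xi>\<bar> \<le> norm v * (1 + norm \<xi>)"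
      using Cauchy_Schwarz_ineq2[of v \<xi>] norm_ge_zero[of v] unfolding distrib_left by linarith
    then have "(v \<bullet> \<xi>)\<^sup>2 \<le> (norm v * (1 + norm \<xi>))\<^sup>2"
      by (metis abs_ge_zero power2_abs power_mono)
    with cis_remainder[of "v \<bullet> \<xi>"]
    have "norm (cis (v \<bullet> \<xi>) - 1 - \<i> * complex_of_real (v \<bullet> \<xi>)) \<le> (norm v * (1 + norm \<xi>))\<^sup>2"
      by linarith
    then have "norm (cis (v \<bullet> \<xi>) - 1 - \<i> * complex_of_real (v \<bullet> \<xi>)) * norm (m \<xi>)
        \<le> (norm v * (1 + norm \<xi>))\<^sup>2 * norm (m \<xi>)"
      by (rule mult_right_mono) simp
    then show "norm (?r \<xi>) \<le> (norm v)\<^sup>2 * ((1 + norm \<xi>) ^ 2 * norm (m \<xi>))"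
      by (simp add: norm_mult power_mult_distrib)
  qed
  ultimately show "norm (ift m (x + v) - ift m x - (\<Sum>i\<in>UNIV. (v $ i) *\<^sub>R ift (\<lambda>\<xi>. \<i> * ((\<xi> $ i) *\<^sub>R m \<xi>)) x))
     \<le> (c * (\<integral>\<xi>. (1 + norm \<xi>) ^ 2 * norm (m \<xi>) \<partial>lborel)) * (norm v)\<^sup>2"
    using mult_left_mono[of _ _ c] c0 by (simp add: norm_mult mult.commute mult.left_commute[of "(norm v)\<^sup>2"])
qed

text \<open>This is integration by parts, obtained without boundary terms from translation
  invariance of the integral by comparing first-order terms in the translation.\<close>

lemma ift_partial_symbol:
  fixes m :: "real^'n::finite \<Rightarrow> complex"
  assumes m: "schwartz m"
  shows "ift (\<lambda>\<xi>. \<i> * partial_deriv i m \<xi>) x = (x $ i) *\<^sub>R ift m x"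
proof -
  define A where "A = (\<integral>\<xi>. cis (x \<bullet> \<xi>) * partial_deriv i m \<xi> \<partial>lborel)"
  define B where "B = (\<integral>\<xi>. cis (x \<bullet> \<xi>) * m \<xi> \<partial>lborel)"
  obtain K where K: "K \<ge> 0" "\<And>x v. norm v \<le> 1 \<Longrightarrow> (1 + norm x) ^ (2 * CARD('n)) *
      norm (m (x + v) - m x - (\<Sum>i\<in>UNIV. (v $ i) *\<^sub>R partial_deriv i m x)) \<le> K * (norm v)\<^sup>2"
    using schwartz_taylor[OF m] by blast
  define W where "W = (\<integral>\<xi>. wt (\<xi>::real^'n) \<partial>lborel)"
  \<comment> \<open>A translation by \<open>t\<close> in direction \<open>i\<close> is read in two
    ways: on the symbol it gives \<open>t\<close> times the derivative up to O(t^2), on the phase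
    the factor \<open>cis (- (t * (x $ i)))\<close>. Comparing both and dividing by \<open>t\<close>
    leaves an error O(t).\<close>
  have est: "norm (A + \<i> * complex_of_real (x $ i) * B) \<le> t * (K * W + (x $ i)\<^sup>2 * norm B)"
    if t: "0 < t" "t \<le> 1" for t
  proof -
    let ?v = "axis i t :: real^'n"
    let ?r = "\<lambda>\<xi>. cis (x \<bullet> \<xi>) * (m (\<xi> + ?v) - m \<xi> - t *\<^sub>R partial_deriv i m \<xi>)"
    have mv: "integrable lborel (\<lambda>\<xi>. cis (x \<bullet> \<xi>) * m (\<xi> + ?v))"
      by (rule integrable_cis_mult)
        (auto simp: integrable_lborel_shift_iff intro!: rapid_integrable schwartz_rapid m)
    have sh: "(\<integral>\<xi>. cis (x \<bullet> \<xi>) * m (\<xi> + ?v) \<partial>lborel) = cis (- (t * (x $ i))) * B"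
    proof -
      have "(\<integral>\<xi>. cis (x \<bullet> \<xi>) * m (\<xi> + ?v) \<partial>lborel) = (\<integral>\<xi>. cis (x \<bullet> (\<xi> - ?v)) * m \<xi> \<partial>lborel)"
        using integral_lborel_shift(1)[of "\<lambda>\<xi>. cis (x \<bullet> (\<xi> - ?v)) * m \<xi>" ?v] by simp
      also have "\<dots> = (\<integral>\<xi>. cis (- (t * (x $ i))) * (cis (x \<bullet> \<xi>) * m \<xi>) \<partial>lborel)"
        by (intro Bochner_Integration.integral_cong refl)
          (simp add: inner_diff_right inner_axis cis_mult mult.commute[of t] flip: mult.assoc)
      finally show ?thesis by (simp add: B_def)
    qed
    have "has_bochner_integral lborel (\<lambda>\<xi>. cis (x \<bullet> \<xi>) * m (\<xi> + ?v) - cis (x \<bullet> \<xi>) * m \<xi>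
         - t *\<^sub>R (cis (x \<bullet> \<xi>) * partial_deriv i m \<xi>)) (cis (- (t * (x $ i))) * B - B - t *\<^sub>R A)"
      unfolding sh[symmetric] unfolding A_def B_def
      by (intro has_bochner_integral_diff has_bochner_integral_scaleR_right
        has_bochner_integral_integrable integrable_ift m schwartz_partial mv)
    then have H: "has_bochner_integral lborel ?r (cis (- (t * (x $ i))) * B - B - t *\<^sub>R A)"
      by (simp only: right_diff_distrib mult_scaleR_right)
    have "norm (\<integral>\<xi>. ?r \<xi> \<partial>lborel) \<le> (\<integral>\<xi>. (K * t\<^sup>2) * wt (\<xi>::real^'n) \<partial>lborel)"
    proof (rule Bochner_Integration.integral_norm_bound_integral)
      show "integrable lborel ?r" using H by (rule integrable.intros)
      show "integrable lborel (\<lambda>\<xi>::real^'n. (K * t\<^sup>2) * wt \<xi>)" by (intro integrable_mult_right wt_integrable)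
      fix \<xi> :: "real^'n"
      let ?d = "norm (m (\<xi> + ?v) - m \<xi> - t *\<^sub>R partial_deriv i m \<xi>)"
      have "norm ?v = t"
        using t by (simp add: norm_eq_sqrt_inner inner_axis_axis)
      then have "(1 + norm \<xi>) ^ (2 * CARD('n)) * ?d \<le> K * t\<^sup>2"
        using K(2)[of ?v \<xi>] t by (simp add: sum_axis_scaleR)
      moreover have "0 < (1 + norm \<xi>) ^ (2 * CARD('n))" by (simp add: add_pos_nonneg)
      ultimately have "?d \<le> K * t\<^sup>2 * wt \<xi>"
        by (simp add: wt_def pos_le_divide_eq mult.commute)
      then show "norm (?r \<xi>) \<le> (K * t\<^sup>2) * wt \<xi>"
        by (simp add: norm_mult)
    qed
    then have 1: "norm (cis (- (t * (x $ i))) * B - B - t *\<^sub>R A) \<le> K * t\<^sup>2 * W"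
      using has_bochner_integral_integral_eq[OF H] by (simp add: W_def)
    have "norm ((cis (- (t * (x $ i))) - 1 - \<i> * complex_of_real (- (t * (x $ i)))) * B)
        \<le> (- (t * (x $ i)))\<^sup>2 * norm B"
      unfolding norm_mult by (intro mult_right_mono cis_remainder) auto
    then have 2: "norm ((cis (- (t * (x $ i))) - 1 - \<i> * complex_of_real (- (t * (x $ i)))) * B)
        \<le> t\<^sup>2 * ((x $ i)\<^sup>2 * norm B)"
      by (simp add: power_mult_distrib)
    have "norm (t *\<^sub>R (A + \<i> * complex_of_real (x $ i) * B)) =
      norm (((cis (- (t * (x $ i))) - 1 - \<i> * complex_of_real (- (t * (x $ i)))) * B) -
      (cis (- (t * (x $ i))) * B - B - t *\<^sub>R A))"
      by (simp add: algebra_simps scaleR_conv_of_real)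
    also have "\<dots> \<le> t\<^sup>2 * ((x $ i)\<^sup>2 * norm B) + K * t\<^sup>2 * W"
      using norm_triangle_ineq4 add_mono[OF 2 1] by (rule order_trans)
    finally have "t * norm (A + \<i> * complex_of_real (x $ i) * B) \<le> t * (t * (K * W + (x $ i)\<^sup>2 * norm B))"
      unfolding norm_scaleR using t by (simp add: power2_eq_square distrib_left mult_ac)
    then show ?thesis using t by simp
  qed
  have "norm (A + \<i> * complex_of_real (x $ i) * B) \<le> 0"
  proof (rule tendsto_lowerbound)
    show "((\<lambda>t. t * (K * W + (x $ i)\<^sup>2 * norm B)) \<longlongrightarrow> 0) (at_right 0)"
      by (auto intro!: tendsto_eq_intros)
    show "\<forall>\<^sub>F t in at_right 0. norm (A + \<i> * complex_of_real (x $ i) * B) \<le> t * (K * W + (x $ i)\<^sup>2 * norm B)"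
      unfolding eventually_at_right_field using est by (intro exI[of _ 1]) auto
  qed simp
  then have "A = - (\<i> * complex_of_real (x $ i) * B)"
    by (simp add: add_eq_0_iff2)
  then have "\<i> * A = complex_of_real (x $ i) * B"
    by (simp add: mult.assoc[symmetric])
  moreover have "(\<integral>\<xi>. cis (x \<bullet> \<xi>) * (\<i> * partial_deriv i m \<xi>) \<partial>lborel) = \<i> * A"
    unfolding A_def by (subst integral_mult_right_zero[symmetric]) (simp add: mult_ac)
  ultimately show ?thesis
    by (simp add: ift_def B_def scaleR_conv_of_real)
qed

text \<open>Each coordinate factor turns into a derivative of the symbol, so one more power of the
  weight costs one derivative; hence the induction has to vary \<open>m\<close>.\<close>

lemma ift_weighted_bounded:
  fixes m :: "real^'n::finite \<Rightarrow> complex"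
  assumes "schwartz m"
  shows "\<exists>C. \<forall>x. (1 + norm x) ^ N * norm (ift m x) \<le> C"
  using assms
proof (induction N arbitrary: m)
  case 0 then show ?case using norm_ift_le[of m] by auto
next
  case (Suc N)
  have s: "schwartz (\<lambda>\<xi>. \<i> * partial_deriv i m \<xi>)" for i
    by (intro schwartz_cmult schwartz_partial Suc.prems)
  obtain C where C: "\<And>x. (1 + norm x) ^ N * norm (ift m x) \<le> C"
    using Suc.IH[OF Suc.prems] by blast
  have "\<forall>i. \<exists>C. \<forall>x. (1 + norm x) ^ N * norm (ift (\<lambda>\<xi>. \<i> * partial_deriv i m \<xi>) x) \<le> C"
    using Suc.IH[OF s] by blast
  then obtain D where D: "\<And>i x. (1 + norm x) ^ N * norm (ift (\<lambda>\<xi>. \<i> * partial_deriv i m \<xi>) x) \<le> D i"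
    by metis
  have "(1 + norm x) ^ Suc N * norm (ift m x) \<le> C + (\<Sum>i\<in>UNIV. D i)" for x
  proof -
    have "(1 + norm x) * norm (ift m x) \<le> (1 + (\<Sum>i\<in>UNIV. \<bar>x $ i\<bar>)) * norm (ift m x)"
      by (intro mult_right_mono add_left_mono norm_le_sum_abs) auto
    also have "\<dots> = norm (ift m x) + (\<Sum>i\<in>UNIV. norm (ift (\<lambda>\<xi>. \<i> * partial_deriv i m \<xi>) x))"
      by (simp add: ift_partial_symbol[OF Suc.prems] distrib_right sum_distrib_right)
    finally have "(1 + norm x) ^ N * ((1 + norm x) * norm (ift m x)) \<le> (1 + norm x) ^ N *
       (norm (ift m x) + (\<Sum>i\<in>UNIV. norm (ift (\<lambda>\<xi>. \<i> * partial_deriv i m \<xi>) x)))"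
      by (intro mult_left_mono) auto
    also have "\<dots> \<le> C + (\<Sum>i\<in>UNIV. D i)"
      unfolding distrib_left sum_distrib_left by (intro add_mono C sum_mono D)
    finally show ?thesis by (simp add: mult_ac)
  qed
  then show ?case by blast
qed

lemma schwartz_ift:
  fixes m :: "real^'n::finite \<Rightarrow> complex"
  assumes "schwartz m" shows "schwartz (ift m)"
proof -
  let ?P = "\<lambda>q :: real^'n \<Rightarrow> complex. \<exists>m. schwartz m \<and> q = ift m"
  have "?P (ift m)" using assms by blast
  then show ?thesis
  proof (rule schwartz_coinduct[of ?P])
    fix g :: "real^'n \<Rightarrow> complex" and x assume "?P g"
    then show "g differentiable (at x)" using ift_has_derivative unfolding differentiable_def by blast
  next
    fix g :: "real^'n \<Rightarrow> complex" and i assume "?P g"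
    then obtain m where m: "schwartz m" "g = ift m" by blast
    have "partial_deriv i g = ift (\<lambda>\<xi>. \<i> * ((\<xi> $ i) *\<^sub>R m \<xi>))"
      unfolding m(2) using partial_deriv_eqI[OF ift_has_derivative[OF m(1)]] by (auto simp: sum_axis_scaleR)
    moreover have "schwartz (\<lambda>\<xi>. \<i> * ((\<xi> $ i) *\<^sub>R m \<xi>))"
      by (intro schwartz_cmult schwartz_coord_mult m)
    ultimately show "?P (partial_deriv i g)" by blast
  next
    fix g :: "real^'n \<Rightarrow> complex" and N :: nat assume "?P g"
    then show "\<exists>C. \<forall>x. (1 + norm x) ^ N * norm (g x) \<le> C" using ift_weighted_bounded by blast
  qed
qed

lemma ift_scale:
  fixes m :: "real^'n::finite \<Rightarrow> complex"
  assumes "r > 0"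
  shows "ift (\<lambda>\<xi>. m ((1 / r) *\<^sub>R \<xi>)) x = complex_of_real (r ^ CARD('n)) * ift m (r *\<^sub>R x)"
  unfolding ift_def
  using integral_lborel_affine[of r "\<lambda>\<xi>. cis (x \<bullet> \<xi>) * m ((1 / r) *\<^sub>R \<xi>)" 0] assms
  by (simp add: scaleR_conv_of_real[of "r ^ CARD('n)"])

section \<open>Gaussians\<close>

lemma lborel_product:
  fixes f :: "'a::euclidean_space \<Rightarrow> real \<Rightarrow> complex"
  assumes f: "\<And>b. b \<in> Basis \<Longrightarrow> integrable lborel (f b)"
  shows integral_lborel_product:
      "(\<integral>x. (\<Prod>b\<in>Basis. f b (x \<bullet> b)) \<partial>lborel) = (\<Prod>b\<in>Basis. \<integral>x. f b x \<partial>lborel)" (is ?eq)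
    and integrable_lborel_product: "integrable lborel (\<lambda>x. \<Prod>b\<in>Basis. f b (x \<bullet> b))" (is ?int)
proof -
  interpret product_sigma_finite "\<lambda>_::'a. lborel :: real measure" ..
  have [measurable]: "\<And>b. b \<in> Basis \<Longrightarrow> f b \<in> borel_measurable borel" using f by auto
  let ?P = "\<Pi>\<^sub>M b\<in>(Basis::'a set). (lborel :: real measure)"
  let ?T = "\<lambda>g :: 'a \<Rightarrow> real. \<Sum>b\<in>Basis. g b *\<^sub>R b"
  have L: "(lborel :: 'a measure) = distr ?P borel ?T"
    unfolding lborel_eq_real by (rule lborel_def)
  have "(\<integral>x. (\<Prod>b\<in>Basis. f b (x \<bullet> b)) \<partial>(lborel::'a measure)) = (\<integral>g. (\<Prod>b\<in>Basis. f b (g b)) \<partial>?P)"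
    unfolding L by (subst integral_distr) (auto intro!: Bochner_Integration.integral_cong prod.cong)
  also have "\<dots> = (\<Prod>b\<in>Basis. \<integral>x. f b x \<partial>lborel)"
    by (rule product_integral_prod) (auto intro: f)
  finally show ?eq .
  have "integrable ?P (\<lambda>g. \<Prod>b\<in>Basis. f b (g b))"
    by (rule product_integrable_prod) (auto intro: f)
  then have "integrable ?P (\<lambda>g. \<Prod>b\<in>Basis. f b (?T g \<bullet> b))"
    by (simp cong: prod.cong)
  then show ?int
    unfolding L by (subst integrable_distr_eq) auto
qed

text \<open>Rescaling by \<open>s * sqrt 2\<close> reduces the integral to the characteristic
  function of the standard normal distribution.\<close>

lemma fourier_gaussian_real:
  assumes "s > 0"
  shows "has_bochner_integral lborel (\<lambda>z. cis (t * z) * complex_of_real (exp (- (s * z)\<^sup>2)))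
      (complex_of_real (sqrt pi / s * exp (- t\<^sup>2 / (4 * s\<^sup>2))))"
proof -
  let ?f = "\<lambda>x. cis (t / (s * sqrt 2) * x) * complex_of_real (exp (- x\<^sup>2 / 2))"
  have std: "integrable lborel std_normal_density" by simp
  have "integrable lborel (\<lambda>x. complex_of_real (sqrt (2 * pi) * std_normal_density x))"
    using std by (intro integrable_of_real integrable_mult_right)
  then have int: "integrable lborel (\<lambda>x. complex_of_real (exp (- x\<^sup>2 / 2)))"
    by (simp add: std_normal_density_def)
  then have intf: "integrable lborel ?f"
    by (intro integrable_cis_mult) auto
  have "complex_of_real (exp (- (t / (s * sqrt 2))\<^sup>2 / 2)) = char std_normal_distribution (t / (s * sqrt 2))"
    by (simp add: char_std_normal_distribution)
  also have "\<dots> = (\<integral>x. std_normal_density x *\<^sub>R cis (t / (s * sqrt 2) * x) \<partial>lborel)"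
    unfolding char_def by (subst integral_density) (auto simp: cis_conv_exp)
  also have "\<dots> = (\<integral>x. complex_of_real (1 / sqrt (2 * pi)) * ?f x \<partial>lborel)"
    by (intro Bochner_Integration.integral_cong refl) (simp add: std_normal_density_def scaleR_conv_of_real)
  finally have "complex_of_real (sqrt (2 * pi)) * complex_of_real (exp (- (t / (s * sqrt 2))\<^sup>2 / 2)) = (\<integral>x. ?f x \<partial>lborel)"
    by simp
  also have "\<dots> = (s * sqrt 2) *\<^sub>R (\<integral>x. ?f (0 + (s * sqrt 2) * x) \<partial>lborel)"
    using assms by (subst lborel_integral_real_affine[of "s * sqrt 2" _ 0]) auto
  also have "(\<lambda>x. ?f (0 + (s * sqrt 2) * x)) = (\<lambda>z. cis (t * z) * complex_of_real (exp (- (s * z)\<^sup>2)))"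
    using assms by (auto simp: fun_eq_iff power_mult_distrib)
  finally have "(\<integral>z. cis (t * z) * complex_of_real (exp (- (s * z)\<^sup>2)) \<partial>lborel) =
     complex_of_real (sqrt (2 * pi) / (s * sqrt 2)) * complex_of_real (exp (- (t / (s * sqrt 2))\<^sup>2 / 2))"
    using assms by (simp add: scaleR_conv_of_real field_simps)
  moreover have "sqrt (2 * pi) / (s * sqrt 2) = sqrt pi / s" using assms by (simp add: real_sqrt_mult)
  moreover have "- (t / (s * sqrt 2))\<^sup>2 / 2 = - t\<^sup>2 / (4 * s\<^sup>2)"
    using assms by (simp add: power_divide power_mult_distrib)
  moreover have "integrable lborel (\<lambda>z. cis (t * z) * complex_of_real (exp (- (s * z)\<^sup>2)))"
  proof -
    have "integrable lborel (\<lambda>x. ?f (0 + (s * sqrt 2) * x))"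
      by (rule lborel_integrable_real_affine[OF intf]) (use assms in auto)
    also have "(\<lambda>x. ?f (0 + (s * sqrt 2) * x)) = (\<lambda>z. cis (t * z) * complex_of_real (exp (- (s * z)\<^sup>2)))"
      using assms by (auto simp: fun_eq_iff power_mult_distrib)
    finally show ?thesis .
  qed
  ultimately show ?thesis by (simp add: has_bochner_integral_iff)
qed

text \<open>Phase and Gaussian both factor over the basis, so the integral is a product of
  one-dimensional ones.\<close>

lemma fourier_gaussian:
  fixes \<zeta> :: "real^'n::finite"
  assumes s: "s > 0"
  shows "has_bochner_integral lborel (\<lambda>z. cis (z \<bullet> \<zeta>) * complex_of_real (exp (- s\<^sup>2 * (norm z)\<^sup>2)))
     (complex_of_real ((sqrt pi / s) ^ CARD('n) * exp (- (norm \<zeta>)\<^sup>2 / (4 * s\<^sup>2))))"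
proof -
  let ?f = "\<lambda>b z. cis ((\<zeta> \<bullet> b) * z) * complex_of_real (exp (- (s * z)\<^sup>2))"
  have n2: "(norm z)\<^sup>2 = (\<Sum>b\<in>Basis. (z \<bullet> b)\<^sup>2)" for z :: "real^'n"
    unfolding power2_norm_eq_inner by (subst euclidean_inner) (simp add: power2_eq_square)
  have cis_sum: "cis (\<Sum>b\<in>A. g b) = (\<Prod>b\<in>A. cis (g b))" if "finite A" for A :: "(real^'n) set" and g
    using that by (induction rule: finite_induct) (auto simp: cis_mult[symmetric])
  have pr: "(\<Prod>b\<in>Basis. ?f b (z \<bullet> b)) = cis (z \<bullet> \<zeta>) * complex_of_real (exp (- s\<^sup>2 * (norm z)\<^sup>2))" for z :: "real^'n"
  proof -
    have "(\<Prod>b\<in>Basis. ?f b (z \<bullet> b)) = (\<Prod>b\<in>Basis. cis ((\<zeta> \<bullet> b) * (z \<bullet> b))) *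
        complex_of_real (\<Prod>b\<in>Basis. exp (- (s * (z \<bullet> b))\<^sup>2))"
      by (simp add: prod.distrib)
    also have "(\<Prod>b\<in>(Basis::(real^'n) set). cis ((\<zeta> \<bullet> b) * (z \<bullet> b))) = cis (z \<bullet> \<zeta>)"
      by (subst euclidean_inner, subst cis_sum[symmetric]) (auto simp: mult.commute)
    also have "(\<Prod>b\<in>(Basis::(real^'n) set). exp (- (s * (z \<bullet> b))\<^sup>2)) = exp (- s\<^sup>2 * (norm z)\<^sup>2)"
      unfolding n2 by (subst exp_sum[symmetric]) (auto simp: power_mult_distrib sum_distrib_left sum_negf)
    finally show ?thesis .
  qed
  have int: "integrable lborel (?f b)" for b
    using fourier_gaussian_real[OF s, of "\<zeta> \<bullet> b"] by (rule integrable.intros)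
  have "(\<Prod>b\<in>Basis. \<integral>x. ?f b x \<partial>lborel)
     = (\<Prod>b\<in>(Basis::(real^'n) set). complex_of_real (sqrt pi / s * exp (- (\<zeta> \<bullet> b)\<^sup>2 / (4 * s\<^sup>2))))"
    by (intro prod.cong refl has_bochner_integral_integral_eq fourier_gaussian_real s)
  also have "\<dots> = complex_of_real ((\<Prod>b\<in>(Basis::(real^'n) set). sqrt pi / s) * (\<Prod>b\<in>(Basis::(real^'n) set). exp (- (\<zeta> \<bullet> b)\<^sup>2 / (4 * s\<^sup>2))))"
    unfolding prod.distrib[symmetric] by simp
  also have "(\<Prod>b\<in>(Basis::(real^'n) set). exp (- (\<zeta> \<bullet> b)\<^sup>2 / (4 * s\<^sup>2))) = exp (- (norm \<zeta>)\<^sup>2 / (4 * s\<^sup>2))"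
    unfolding n2 by (subst exp_sum[symmetric]) (auto simp: sum_divide_distrib sum_negf)
  finally have "(\<Prod>b\<in>Basis. \<integral>x. ?f b x \<partial>lborel) =
      complex_of_real ((sqrt pi / s) ^ CARD('n) * exp (- (norm \<zeta>)\<^sup>2 / (4 * s\<^sup>2)))"
    by simp
  with integral_lborel_product[of ?f, OF int] integrable_lborel_product[of ?f, OF int]
  show ?thesis unfolding pr has_bochner_integral_iff by simp
qed

lemma gauss_const: "(4 * pi) powr (- real d / 2) = 1 / (2 * sqrt pi) ^ d"
proof -
  have "(4 * pi) powr (- real d / 2) = ((4 * pi) powr (1/2)) powr (- real d)"
    by (simp add: powr_powr)
  also have "(4 * pi) powr (1/2) = 2 * sqrt pi"
    by (simp add: powr_half_sqrt real_sqrt_mult)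
  finally show ?thesis by (simp add: powr_minus powr_realpow inverse_eq_divide)
qed

lemma gauss_eps_eq:
  fixes x :: "real^'n::finite"
  assumes "\<epsilon> > 0"
  shows "gauss_eps \<epsilon> x = exp (- (norm x)\<^sup>2 / (4 * \<epsilon>\<^sup>2)) / (2 * sqrt pi * \<epsilon>) ^ CARD('n)"
  unfolding gauss_eps_def gauss_def gauss_const
  using assms by (simp add: power_mult_distrib power_divide)

lemma gauss_eps_1: "gauss_eps 1 = (gauss :: real^'n::finite \<Rightarrow> real)"
  by (simp add: fun_eq_iff gauss_eps_def)

lemma gauss_eps_nonneg [simp]: "\<epsilon> > 0 \<Longrightarrow> gauss_eps \<epsilon> x \<ge> 0"
  by (simp add: gauss_eps_eq)

lemma gauss_eps_uminus [simp]: "gauss_eps \<epsilon> (- x) = gauss_eps \<epsilon> x"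
  by (simp add: gauss_eps_def gauss_def)

lemma gauss_eps_measurable [measurable]: "gauss_eps \<epsilon> \<in> borel_measurable borel"
  unfolding gauss_eps_def gauss_def by measurable

lemma gauss_eps_integral:
  assumes "\<epsilon> > 0"
  shows "has_bochner_integral lborel (gauss_eps \<epsilon> :: real^'n::finite \<Rightarrow> real) 1"
proof -
  have e: "- (1 / (2 * \<epsilon>))\<^sup>2 * (norm z)\<^sup>2 = - (norm z)\<^sup>2 / (4 * \<epsilon>\<^sup>2)" for z :: "real^'n"
    by (simp add: power_divide power_mult_distrib)
  have "has_bochner_integral lborel (\<lambda>z::real^'n. complex_of_real (exp (- (norm z)\<^sup>2 / (4 * \<epsilon>\<^sup>2))))
      (complex_of_real ((2 * sqrt pi * \<epsilon>) ^ CARD('n)))"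
    using fourier_gaussian[of "1 / (2 * \<epsilon>)" "0 :: real^'n"] assms unfolding e by (simp add: mult_ac)
  then have "has_bochner_integral lborel (\<lambda>z::real^'n. Re (complex_of_real (exp (- (norm z)\<^sup>2 / (4 * \<epsilon>\<^sup>2)))))
      (Re (complex_of_real ((2 * sqrt pi * \<epsilon>) ^ CARD('n))))"
    by (rule has_bochner_integral_bounded_linear[OF bounded_linear_Re])
  from has_bochner_integral_divide_zero[OF this, of "(2 * sqrt pi * \<epsilon>) ^ CARD('n)"]
  have "has_bochner_integral lborel (\<lambda>z::real^'n. exp (- (norm z)\<^sup>2 / (4 * \<epsilon>\<^sup>2)) / (2 * sqrt pi * \<epsilon>) ^ CARD('n)) 1"
    using assms by simp
  moreover have "gauss_eps \<epsilon> = (\<lambda>z::real^'n. exp (- (norm z)\<^sup>2 / (4 * \<epsilon>\<^sup>2)) / (2 * sqrt pi * \<epsilon>) ^ CARD('n))"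
    using assms by (simp only: fun_eq_iff gauss_eps_eq) simp
  ultimately show ?thesis by simp
qed

lemma gauss_eps_integrable: "\<epsilon> > 0 \<Longrightarrow> integrable lborel (gauss_eps \<epsilon> :: real^'n::finite \<Rightarrow> real)"
  using gauss_eps_integral by (rule integrable.intros)

lemma gauss_eps_nn_integral:
  assumes "\<epsilon> > 0"
  shows "(\<integral>\<^sup>+x. ennreal (gauss_eps \<epsilon> (x :: real^'n::finite)) \<partial>lborel) = 1"
  using gauss_eps_integral[OF assms, where 'n='n] gauss_eps_nonneg[OF assms]
  by (subst nn_integral_eq_integral) (auto simp: has_bochner_integral_iff)

text \<open>The polynomial weight is dominated by \<open>exp (real N * norm x)\<close>, and
  completing the square absorbs this into the Gaussian exponent.\<close>

lemma rapid_gauss_eps: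
  assumes e: "\<epsilon> > 0"
  shows "rapid (\<lambda>x :: real^'n::finite. complex_of_real (gauss_eps \<epsilon> x))"
  unfolding rapid_def
proof (intro conjI allI)
  fix N
  have "(1 + norm x) ^ N * norm (complex_of_real (gauss_eps \<epsilon> x)) \<le>
     exp ((real N * \<epsilon>)\<^sup>2) / (2 * sqrt pi * \<epsilon>) ^ CARD('n)" for x :: "real^'n"
  proof -
    have "(1 + norm x) ^ N \<le> exp (norm x) ^ N"
      by (intro power_mono exp_ge_add_one_self) auto
    then have "(1 + norm x) ^ N * exp (- (norm x)\<^sup>2 / (4 * \<epsilon>\<^sup>2)) \<le>
       exp (norm x) ^ N * exp (- (norm x)\<^sup>2 / (4 * \<epsilon>\<^sup>2))"
      by (rule mult_right_mono) simp
    also have "\<dots> = exp (real N * norm x - (norm x)\<^sup>2 / (4 * \<epsilon>\<^sup>2))"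
      by (simp add: exp_diff exp_minus exp_of_nat_mult field_simps)
    also have "\<dots> \<le> exp ((real N * \<epsilon>)\<^sup>2)"
    proof -
      have "0 \<le> (norm x / (2 * \<epsilon>) - real N * \<epsilon>)\<^sup>2" by simp
      also have "\<dots> = (norm x)\<^sup>2 / (4 * \<epsilon>\<^sup>2) - real N * norm x + (real N * \<epsilon>)\<^sup>2"
        using e by (simp add: power2_eq_square field_simps)
      finally show ?thesis by simp
    qed
    finally have "(1 + norm x) ^ N * exp (- (norm x)\<^sup>2 / (4 * \<epsilon>\<^sup>2)) / (2 * sqrt pi * \<epsilon>) ^ CARD('n) \<le>
        exp ((real N * \<epsilon>)\<^sup>2) / (2 * sqrt pi * \<epsilon>) ^ CARD('n)"
      using e by (intro divide_right_mono) auto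
    moreover have "norm (complex_of_real (gauss_eps \<epsilon> x)) = gauss_eps \<epsilon> x"
      using e by simp
    ultimately show ?thesis using e by (simp only: gauss_eps_eq times_divide_eq_right)
  qed
  then show "\<exists>C. \<forall>x::real^'n. (1 + norm x) ^ N * norm (complex_of_real (gauss_eps \<epsilon> x)) \<le> C" by blast
qed simp

text \<open>Completing the square: the product of two centred Gaussians at \<open>z\<close> and \<open>x - z\<close> is a Gaussian
  in \<open>x\<close> times a normalised Gaussian in \<open>z\<close>.\<close>

lemma gauss_eps_semigroup:
  fixes x :: "real^'n::finite"
  assumes "a > 0" "b > 0"
  shows "has_bochner_integral lborel (\<lambda>z. gauss_eps a z * gauss_eps b (x - z)) (gauss_eps (sqrt (a\<^sup>2 + b\<^sup>2)) x)"
proof -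
  define c where "c = sqrt (a\<^sup>2 + b\<^sup>2)"
  have c: "c > 0" "c\<^sup>2 = a\<^sup>2 + b\<^sup>2" using assms by (auto simp: c_def sum_power2_gt_zero_iff)
  define y where "y = (a\<^sup>2 / c\<^sup>2) *\<^sub>R x"
  have sq: "- (norm z)\<^sup>2 / (4 * a\<^sup>2) + - (norm (x - z))\<^sup>2 / (4 * b\<^sup>2) =
     - (norm x)\<^sup>2 / (4 * c\<^sup>2) + - (norm (z - y))\<^sup>2 / (4 * (a * b / c)\<^sup>2)" for z
  proof -
    define X Y Z where "X = x \<bullet> x" and "Y = x \<bullet> z" and "Z = z \<bullet> z"
    have n: "(norm (x - z))\<^sup>2 = X - 2 * Y + Z" "(norm z)\<^sup>2 = Z" "(norm x)\<^sup>2 = X"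
      by (auto simp: X_def Y_def Z_def power2_norm_eq_inner algebra_simps inner_commute)
    have m: "(norm (z - y))\<^sup>2 = Z - 2 * (a\<^sup>2 / c\<^sup>2) * Y + (a\<^sup>2 / c\<^sup>2)\<^sup>2 * X"
      unfolding power2_norm_eq_inner X_def Y_def Z_def y_def
      by (simp add: inner_diff inner_commute algebra_simps power2_eq_square)
    define A B where "A = a\<^sup>2" and "B = b\<^sup>2"
    have AB: "A > 0" "B > 0" "A + B > 0" using assms by (auto simp: A_def B_def add_pos_pos)
    have "- Z / (4 * A) + - (X - 2 * Y + Z) / (4 * B) = - X / (4 * (A + B))
        + - (Z - 2 * (A / (A + B)) * Y + (A / (A + B))\<^sup>2 * X) / (4 * (A * B / (A + B)))"
      using AB by (simp add: divide_simps power2_eq_square) (simp add: algebra_simps)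
    then show ?thesis unfolding n m power_mult_distrib power_divide c(2) A_def B_def .
  qed
  have "gauss_eps a z * gauss_eps b (x - z) = gauss_eps c x * gauss_eps (a * b / c) (z - y)" for z
  proof -
    have "(2 * sqrt pi * a) ^ CARD('n) * (2 * sqrt pi * b) ^ CARD('n) =
        (2 * sqrt pi * c) ^ CARD('n) * (2 * sqrt pi * (a * b / c)) ^ CARD('n)"
      using c(1) by (simp add: power_mult_distrib[symmetric] mult_ac)
    moreover have "gauss_eps a z * gauss_eps b (x - z) =
      exp (- (norm z)\<^sup>2 / (4 * a\<^sup>2) + - (norm (x - z))\<^sup>2 / (4 * b\<^sup>2)) /
       ((2 * sqrt pi * a) ^ CARD('n) * (2 * sqrt pi * b) ^ CARD('n))"
      using assms unfolding exp_add by (simp add: gauss_eps_eq)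
    moreover have "gauss_eps c x * gauss_eps (a * b / c) (z - y) =
      exp (- (norm x)\<^sup>2 / (4 * c\<^sup>2) + - (norm (z - y))\<^sup>2 / (4 * (a * b / c)\<^sup>2)) /
       ((2 * sqrt pi * c) ^ CARD('n) * (2 * sqrt pi * (a * b / c)) ^ CARD('n))"
      using assms c(1) unfolding exp_add by (simp add: gauss_eps_eq)
    ultimately show ?thesis by (simp only: sq)
  qed
  moreover have "has_bochner_integral lborel (\<lambda>z. gauss_eps c x * gauss_eps (a * b / c) (z - y)) (gauss_eps c x * 1)"
    using gauss_eps_integral[of "a * b / c", where 'n='n] assms c(1)
    by (intro has_bochner_integral_mult_right)
      (auto simp: has_bochner_integral_iff integrable_lborel_shift_iff integral_lborel_shift)
  ultimately show ?thesis by (simp add: c_def)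
qed

section \<open>Fourier inversion and the convolution theorem\<close>

text \<open>The Fubini hypothesis shared by inversion, the convolution theorem and commutation of
  convolutions: an integrable tensor product times a bounded factor \<open>h\<close>, either a phase
  or a bounded function.\<close>

lemma integrable_pair_mult:
  fixes f g :: "real^'n::finite \<Rightarrow> complex"
  assumes f: "integrable lborel f" and g: "integrable lborel g"
    and [measurable]: "h \<in> borel_measurable (borel \<Otimes>\<^sub>M borel)"
    and h: "\<And>x y. norm (h (x, y)) \<le> B"
  shows "integrable (lborel \<Otimes>\<^sub>M lborel) (\<lambda>(x, y). f x * g y * h (x, y))"
proof -
  have [measurable]: "f \<in> borel_measurable borel" "g \<in> borel_measurable borel" using f g by auto
  have B0: "0 \<le> B" using order_trans[OF norm_ge_zero h] .
  have "integrable (lborel \<Otimes>\<^sub>M lborel) (\<lambda>(x, y). f x * g y)"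
  proof (rule lborel_pair.Fubini_integrable)
    show "integrable lborel (\<lambda>x. \<integral>y. norm (case (x, y) of (x, y) \<Rightarrow> f x * g y) \<partial>lborel)"
      using f by (simp add: norm_mult)
    show "AE x in lborel. integrable lborel (\<lambda>y. case (x, y) of (x, y) \<Rightarrow> f x * g y)"
      using g by simp
  qed measurable
  then have "integrable (lborel \<Otimes>\<^sub>M lborel) (\<lambda>z. B * norm (case z of (x, y) \<Rightarrow> f x * g y))"
    by (intro integrable_mult_right integrable_norm)
  then show ?thesis
  proof (rule Bochner_Integration.integrable_bound)
    show "AE z in lborel \<Otimes>\<^sub>M lborel. norm (case z of (x, y) \<Rightarrow> f x * g y * h (x, y)) \<le>
        norm (B * norm (case z of (x, y) \<Rightarrow> f x * g y))"
      using B0 h by (auto intro!: AE_I2 simp: norm_mult mult.commute[of B] intro!: mult_left_mono split: prod.splits)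
  qed measurable
qed

text \<open>Damping the integrand by a wide Gaussian makes Fubini available and turns the integral
  into an average of \<open>m\<close> around \<eta>. As the damping is removed, one sequence tends
  to both sides of the identity.\<close>

lemma fourier_inversion:
  fixes m :: "real^'n::finite \<Rightarrow> complex"
  assumes m: "schwartz m"
  shows "(\<integral>z. ift m z * cis (- (z \<bullet> \<eta>)) \<partial>lborel) = m \<eta>"
proof (rule LIMSEQ_unique)
  define s where "s = (\<lambda>n::nat. 1 / (real n + 1))"
  have s0: "s n > 0" for n by (simp add: s_def)
  have slim: "s \<longlonglongrightarrow> 0"
    unfolding s_def using LIMSEQ_inverse_real_of_nat by (simp add: inverse_eq_divide add.commute)
  have mint: "integrable lborel m" and hint: "integrable lborel (ift m)"
    using m schwartz_ift by (auto intro: rapid_integrable schwartz_rapid)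
  have [measurable]: "m \<in> borel_measurable borel" "ift m \<in> borel_measurable borel"
    using mint hint by auto
  have mcont: "continuous_on UNIV m" by (intro smooth_continuous schwartz_smooth m)
  let ?A = "\<lambda>n. \<integral>z. ift m z * cis (- (z \<bullet> \<eta>)) * complex_of_real (exp (- (s n)\<^sup>2 * (norm z)\<^sup>2)) \<partial>lborel"
  show "?A \<longlonglongrightarrow> (\<integral>z. ift m z * cis (- (z \<bullet> \<eta>)) \<partial>lborel)"
  proof (rule integral_dominated_convergence[where w = "\<lambda>z. norm (ift m z)"])
    show "AE z in lborel. (\<lambda>n. ift m z * cis (- (z \<bullet> \<eta>)) * complex_of_real (exp (- (s n)\<^sup>2 * (norm z)\<^sup>2)))
        \<longlonglongrightarrow> ift m z * cis (- (z \<bullet> \<eta>))"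
      by (intro AE_I2) (auto intro!: tendsto_eq_intros slim)
    show "AE z in lborel. norm (ift m z * cis (- (z \<bullet> \<eta>)) * complex_of_real (exp (- (s n)\<^sup>2 * (norm z)\<^sup>2)))
        \<le> norm (ift m z)" for n
      by (intro AE_I2) (simp add: norm_mult mult_left_le)
  qed (use hint in auto)
  have "?A n = (\<integral>\<zeta>. m (\<eta> + s n *\<^sub>R \<zeta>) * complex_of_real (gauss \<zeta>) \<partial>lborel)" for n
  proof -
    let ?c = "complex_of_real (1 / (2 * pi) ^ CARD('n))"
    let ?e = "\<lambda>z :: real^'n. complex_of_real (exp (- (s n)\<^sup>2 * (norm z)\<^sup>2))"
    have eint: "integrable lborel ?e"
      using fourier_gaussian[OF s0[of n], of "0 :: real^'n"] by (auto simp: has_bochner_integral_iff)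
    have I: "integrable (lborel \<Otimes>\<^sub>M lborel) (\<lambda>(z, \<xi>). ?e z * m \<xi> * (\<lambda>(z, \<xi>). cis (z \<bullet> (\<xi> - \<eta>))) (z, \<xi>))"
      by (rule integrable_pair_mult[OF eint mint]) auto
    have "?A n = (\<integral>z. ?c * (\<integral>\<xi>. ?e z * m \<xi> * cis (z \<bullet> (\<xi> - \<eta>)) \<partial>lborel) \<partial>lborel)"
      unfolding ift_def
      by (intro Bochner_Integration.integral_cong refl)
        (simp add: inner_diff_right mult.assoc flip: cis_mult integral_mult_left_zero integral_mult_right_zero,
          intro Bochner_Integration.integral_cong refl, simp add: cis_mult cis_divide mult_ac)
    also have "\<dots> = ?c * (\<integral>z. (\<integral>\<xi>. ?e z * m \<xi> * cis (z \<bullet> (\<xi> - \<eta>)) \<partial>lborel) \<partial>lborel)"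
      by (rule integral_mult_right_zero)
    also have "(\<integral>z. (\<integral>\<xi>. ?e z * m \<xi> * cis (z \<bullet> (\<xi> - \<eta>)) \<partial>lborel) \<partial>lborel) =
      (\<integral>\<xi>. (\<integral>z. ?e z * m \<xi> * cis (z \<bullet> (\<xi> - \<eta>)) \<partial>lborel) \<partial>lborel)"
      using lborel_pair.Fubini_integral[of "\<lambda>z \<xi>. ?e z * m \<xi> * cis (z \<bullet> (\<xi> - \<eta>))"] I by simp
    also have "\<dots> = (\<integral>\<xi>. m \<xi> * complex_of_real ((sqrt pi / s n) ^ CARD('n) * exp (- (norm (\<xi> - \<eta>))\<^sup>2 / (4 * (s n)\<^sup>2))) \<partial>lborel)"
    proof (intro Bochner_Integration.integral_cong refl)
      fix \<xi> :: "real^'n"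
      have "(\<integral>z. ?e z * m \<xi> * cis (z \<bullet> (\<xi> - \<eta>)) \<partial>lborel) = (\<integral>z. m \<xi> * (cis (z \<bullet> (\<xi> - \<eta>)) * ?e z) \<partial>lborel)"
        by (simp add: mult_ac)
      also have "\<dots> = m \<xi> * (\<integral>z. cis (z \<bullet> (\<xi> - \<eta>)) * ?e z \<partial>lborel)"
        by (rule integral_mult_right_zero)
      finally show "(\<integral>z. ?e z * m \<xi> * cis (z \<bullet> (\<xi> - \<eta>)) \<partial>lborel) =
         m \<xi> * complex_of_real ((sqrt pi / s n) ^ CARD('n) * exp (- (norm (\<xi> - \<eta>))\<^sup>2 / (4 * (s n)\<^sup>2)))"
        using has_bochner_integral_integral_eq[OF fourier_gaussian[OF s0[of n], of "\<xi> - \<eta>"]] by simp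
    qed
    \<comment> \<open>The substitution \<xi> = \<eta> + s \<zeta> turns the concentrating Gaussian
      into the fixed density \<open>gauss\<close> and moves the parameter into the argument of
      \<open>m\<close>, where continuity at \<eta> applies.\<close>
    also have "\<dots> = \<bar>s n\<bar> ^ DIM(real^'n) *\<^sub>R (\<integral>\<zeta>. m (\<eta> + s n *\<^sub>R \<zeta>) * complex_of_real ((sqrt pi / s n) ^ CARD('n) *
         exp (- (norm ((\<eta> + s n *\<^sub>R \<zeta>) - \<eta>))\<^sup>2 / (4 * (s n)\<^sup>2))) \<partial>lborel)"
      using s0[of n] by (intro integral_lborel_affine) simp
    also have "?c * \<dots> = (\<integral>\<zeta>. (?c * complex_of_real (s n ^ CARD('n))) * (m (\<eta> + s n *\<^sub>R \<zeta>) * complex_of_real ((sqrt pi / s n) ^ CARD('n) *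
         exp (- (norm ((\<eta> + s n *\<^sub>R \<zeta>) - \<eta>))\<^sup>2 / (4 * (s n)\<^sup>2)))) \<partial>lborel)"
      using s0[of n] by (subst integral_mult_right_zero) (simp add: scaleR_conv_of_real)
    also have "\<dots> = (\<integral>\<zeta>. m (\<eta> + s n *\<^sub>R \<zeta>) * complex_of_real (gauss \<zeta>) \<partial>lborel)"
    proof (intro Bochner_Integration.integral_cong refl)
      fix \<zeta> :: "real^'n"
      have re: "(complex_of_real a * complex_of_real b) * (M * complex_of_real (c * e)) =
          M * complex_of_real (a * b * c * e)" for a b c e M
        by simp
      have "- (norm ((\<eta> + s n *\<^sub>R \<zeta>) - \<eta>))\<^sup>2 / (4 * (s n)\<^sup>2) = - (norm \<zeta>)\<^sup>2 / 4"
        using s0[of n] by (simp add: power_mult_distrib)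
      moreover have "1 / (2 * pi) ^ CARD('n) * s n ^ CARD('n) * (sqrt pi / s n) ^ CARD('n) = 1 / (2 * sqrt pi) ^ CARD('n)"
      proof -
        have "1 / (2 * pi) * s n * (sqrt pi / s n) = 1 / (2 * sqrt pi)"
          using s0[of n] by (simp add: field_simps)
        then show ?thesis by (metis power_mult_distrib power_one_over)
      qed
      ultimately show "(?c * complex_of_real (s n ^ CARD('n))) * (m (\<eta> + s n *\<^sub>R \<zeta>) * complex_of_real ((sqrt pi / s n) ^ CARD('n) *
         exp (- (norm ((\<eta> + s n *\<^sub>R \<zeta>) - \<eta>))\<^sup>2 / (4 * (s n)\<^sup>2)))) = m (\<eta> + s n *\<^sub>R \<zeta>) * complex_of_real (gauss \<zeta>)"
        unfolding gauss_def gauss_const re by (simp only: times_divide_eq_left mult_1_left)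
    qed
    finally show ?thesis .
  qed
  moreover have "(\<lambda>n. \<integral>\<zeta>. m (\<eta> + s n *\<^sub>R \<zeta>) * complex_of_real (gauss \<zeta>) \<partial>lborel) \<longlonglongrightarrow>
     (\<integral>\<zeta>. m \<eta> * complex_of_real (gauss (\<zeta> :: real^'n)) \<partial>lborel)"
  proof -
    obtain C where C: "C \<ge> 0" "\<And>x. norm (m x) \<le> C" using rapid_bounded[OF schwartz_rapid[OF m]] by blast
    have g: "integrable lborel (gauss :: real^'n \<Rightarrow> real)" "\<And>x::real^'n. gauss x \<ge> 0"
      and [measurable]: "gauss \<in> borel_measurable (borel :: (real^'n) measure)"
      using gauss_eps_integrable[of 1, where 'n='n] gauss_eps_nonneg[of 1] gauss_eps_measurable[of 1]
      by (auto simp: gauss_eps_1)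
    show ?thesis
    proof (rule integral_dominated_convergence[where w = "\<lambda>\<zeta>. C * gauss \<zeta>"])
      show "integrable lborel (\<lambda>\<zeta>::real^'n. C * gauss \<zeta>)" using g by simp
      show "AE \<zeta> in lborel. norm (m (\<eta> + s n *\<^sub>R \<zeta>) * complex_of_real (gauss \<zeta>)) \<le> C * gauss \<zeta>" for n
        using C(2) g(2) by (intro AE_I2) (simp add: norm_mult mult_right_mono)
      show "AE \<zeta> in lborel. (\<lambda>n. m (\<eta> + s n *\<^sub>R \<zeta>) * complex_of_real (gauss \<zeta>)) \<longlonglongrightarrow> m \<eta> * complex_of_real (gauss \<zeta>)"
      proof (intro AE_I2 tendsto_mult tendsto_const)
        fix \<zeta> :: "real^'n"
        have "(\<lambda>n. \<eta> + s n *\<^sub>R \<zeta>) \<longlonglongrightarrow> \<eta>" by (auto intro!: tendsto_eq_intros slim)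
        then show "(\<lambda>n. m (\<eta> + s n *\<^sub>R \<zeta>)) \<longlonglongrightarrow> m \<eta>"
          by (rule continuous_on_tendsto_compose[OF mcont]) auto
      qed
    qed measurable
  qed
  moreover have "(\<integral>\<zeta>. m \<eta> * complex_of_real (gauss (\<zeta> :: real^'n)) \<partial>lborel) = m \<eta>"
  proof -
    have "(\<integral>\<zeta>. gauss (\<zeta> :: real^'n) \<partial>lborel) = 1"
      using has_bochner_integral_integral_eq[OF gauss_eps_integral[of 1, where 'n='n]]
      unfolding gauss_eps_1 by simp
    then show ?thesis
      unfolding integral_mult_right_zero integral_complex_of_real by simp
  qed
  ultimately show "?A \<longlonglongrightarrow> m \<eta>" by (simp only:)
qed

definition conv :: "(real^'n::finite \<Rightarrow> complex) \<Rightarrow> (real^'n \<Rightarrow> complex) \<Rightarrow> real^'n \<Rightarrow> complex" where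
  "conv k g x = (\<integral>z. k z * g (x - z) \<partial>lborel)"

text \<open>Writing out the transform of \<open>m2\<close> and exchanging integrals leaves the
  Fourier integral of \<open>ift m1\<close>, which inversion evaluates to
  \<open>m1 \<xi>\<close>.\<close>

lemma conv_ift:
  fixes m1 m2 :: "real^'n::finite \<Rightarrow> complex"
  assumes m1: "schwartz m1" and m2: "schwartz m2"
  shows "conv (ift m1) (ift m2) x = ift (\<lambda>\<xi>. m1 \<xi> * m2 \<xi>) x"
proof -
  let ?c = "complex_of_real (1 / (2 * pi) ^ CARD('n))"
  have int: "integrable lborel (ift m1)" "integrable lborel m2"
    using m1 m2 by (auto intro!: rapid_integrable schwartz_rapid schwartz_ift)
  then have [measurable]: "ift m1 \<in> borel_measurable borel" "m2 \<in> borel_measurable borel" by auto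
  have I: "integrable (lborel \<Otimes>\<^sub>M lborel) (\<lambda>(z, \<xi>). ift m1 z * m2 \<xi> * (\<lambda>(z, \<xi>). cis ((x - z) \<bullet> \<xi>)) (z, \<xi>))"
    by (rule integrable_pair_mult[OF int]) auto
  have "conv (ift m1) (ift m2) x = (\<integral>z. ?c * (\<integral>\<xi>. ift m1 z * m2 \<xi> * cis ((x - z) \<bullet> \<xi>) \<partial>lborel) \<partial>lborel)"
    unfolding conv_def ift_def[of m2]
    by (intro Bochner_Integration.integral_cong refl)
      (simp add: mult_ac flip: integral_mult_right_zero)
  also have "\<dots> = ?c * (\<integral>z. (\<integral>\<xi>. ift m1 z * m2 \<xi> * cis ((x - z) \<bullet> \<xi>) \<partial>lborel) \<partial>lborel)"
    by (rule integral_mult_right_zero)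
  also have "(\<integral>z. (\<integral>\<xi>. ift m1 z * m2 \<xi> * cis ((x - z) \<bullet> \<xi>) \<partial>lborel) \<partial>lborel) =
     (\<integral>\<xi>. (\<integral>z. ift m1 z * m2 \<xi> * cis ((x - z) \<bullet> \<xi>) \<partial>lborel) \<partial>lborel)"
    using lborel_pair.Fubini_integral[of "\<lambda>z \<xi>. ift m1 z * m2 \<xi> * cis ((x - z) \<bullet> \<xi>)"] I by simp
  also have "\<dots> = (\<integral>\<xi>. cis (x \<bullet> \<xi>) * (m1 \<xi> * m2 \<xi>) \<partial>lborel)"
  proof (intro Bochner_Integration.integral_cong refl)
    fix \<xi> :: "real^'n"
    have "(\<integral>z. ift m1 z * m2 \<xi> * cis ((x - z) \<bullet> \<xi>) \<partial>lborel) =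
        (\<integral>z. (cis (x \<bullet> \<xi>) * m2 \<xi>) * (ift m1 z * cis (- (z \<bullet> \<xi>))) \<partial>lborel)"
      by (intro Bochner_Integration.integral_cong refl)
        (simp add: inner_diff_left cis_divide[symmetric] cis_inverse[symmetric] divide_inverse mult_ac del: cis_inverse)
    also have "\<dots> = (cis (x \<bullet> \<xi>) * m2 \<xi>) * m1 \<xi>"
      by (subst integral_mult_right_zero) (simp add: fourier_inversion[OF m1])
    finally show "(\<integral>z. ift m1 z * m2 \<xi> * cis ((x - z) \<bullet> \<xi>) \<partial>lborel) = cis (x \<bullet> \<xi>) * (m1 \<xi> * m2 \<xi>)"
      by (simp add: mult_ac)
  qed
  finally show ?thesis by (simp only: ift_def[of "\<lambda>\<xi>. m1 \<xi> * m2 \<xi>"])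
qed

section \<open>Convolution operators on \<open>L\<^sup>2\<close>\<close>

text \<open>The Bochner integral of a non-integrable function is 0, so the bound is unconditional;
  kernel estimates can then be run in \<open>ennreal\<close> without integrability side
  conditions.\<close>

lemma norm_integral_le_nn_integral:
  fixes f :: "'a \<Rightarrow> 'b::{banach, second_countable_topology}"
  shows "ennreal (norm (\<integral>x. f x \<partial>M)) \<le> (\<integral>\<^sup>+x. ennreal (norm (f x)) \<partial>M)"
  by (cases "integrable M f") (auto simp: integral_norm_bound_ennreal not_integrable_integral_eq)

text \<open>A real upper bound for the L2 norm in squared form, packaged with measurability. Sums,
  multiples and Schur's test then act on real constants instead of on \<open>L2_norm\<close> with
  its infinite value.\<close>

definition L2_le :: "(real^'n::finite \<Rightarrow> complex) \<Rightarrow> real \<Rightarrow> bool" where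
  "L2_le g a \<longleftrightarrow> g \<in> borel_measurable borel \<and> 0 \<le> a \<and>
     (\<integral>\<^sup>+x. ennreal ((norm (g x))\<^sup>2) \<partial>lborel) \<le> ennreal (a\<^sup>2)"

lemma L2_le_nonneg: "L2_le g a \<Longrightarrow> 0 \<le> a"
  and L2_le_measurable: "L2_le g a \<Longrightarrow> g \<in> borel_measurable borel"
  by (simp_all add: L2_le_def)

lemma L2_le_mono: "L2_le g a \<Longrightarrow> a \<le> b \<Longrightarrow> L2_le g b"
  unfolding L2_le_def by (auto intro: order_trans ennreal_leI power_mono)

lemma L2_norm_le: 
  assumes "L2_le g a" shows "L2_norm g \<le> ennreal a"
proof -
  let ?S = "\<integral>\<^sup>+x. ennreal ((norm (g x))\<^sup>2) \<partial>lborel"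
  have S: "?S \<le> ennreal (a\<^sup>2)" and a: "0 \<le> a" using assms by (auto simp: L2_le_def)
  then have "?S \<noteq> \<infinity>" using ennreal_less_top leD by fastforce
  moreover have "sqrt (enn2real ?S) \<le> a"
    using enn2real_mono[OF S] a by (intro real_le_lsqrt) auto
  ultimately show ?thesis by (simp add: L2_norm_def Let_def ennreal_leI)
qed

lemma L2_le_of_L2_norm:
  assumes "g \<in> borel_measurable borel" "L2_norm g = ennreal a" "0 \<le> a"
  shows "L2_le g a"
proof -
  let ?S = "\<integral>\<^sup>+x. ennreal ((norm (g x))\<^sup>2) \<partial>lborel"
  have fin: "?S \<noteq> \<infinity>" using assms(2) by (auto simp: L2_norm_def Let_def)
  then have "ennreal (sqrt (enn2real ?S)) = ennreal a"
    using assms(2) by (simp add: L2_norm_def Let_def)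
  then have "sqrt (enn2real ?S) = a" using assms(3) by (subst (asm) ennreal_inj) auto
  then have "enn2real ?S = a\<^sup>2" by (metis enn2real_nonneg real_sqrt_pow2)
  then have "?S = ennreal (a\<^sup>2)" using fin by (metis ennreal_enn2real infinity_ennreal_def less_top)
  with assms show ?thesis by (simp add: L2_le_def)
qed

lemma ennreal_le_of_power2_le:
  fixes I :: ennreal
  assumes "I\<^sup>2 \<le> ennreal (c\<^sup>2)" "0 \<le> c"
  shows "I \<le> ennreal c"
proof (cases I)
  case (real r)
  with assms have "r\<^sup>2 \<le> c\<^sup>2" by (simp add: ennreal_power)
  then have "r \<le> c" using assms(2) by (rule power2_le_imp_le)
  with real show ?thesis by (simp add: ennreal_leI)
next
  case top
  with assms show ?thesis by (simp add: power2_eq_square top_unique)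
qed

text \<open>Minkowski's inequality: expand the square and bound the mixed term by
  Cauchy-Schwarz.\<close>

lemma L2_le_add:
  fixes f g :: "real^'n::finite \<Rightarrow> complex"
  assumes f: "L2_le f a" and g: "L2_le g b"
  shows "L2_le (\<lambda>x. f x + g x) (a + b)"
  unfolding L2_le_def
proof (intro conjI)
  have [measurable]: "f \<in> borel_measurable borel" "g \<in> borel_measurable borel"
    and ab: "0 \<le> a" "0 \<le> b" using f g by (auto simp: L2_le_def)
  let ?F = "\<lambda>x. ennreal (norm (f x))" and ?G = "\<lambda>x. ennreal (norm (g x))"
  show "(\<lambda>x. f x + g x) \<in> borel_measurable borel" "0 \<le> a + b" using ab by auto
  have F: "(\<integral>\<^sup>+x. (?F x)\<^sup>2 \<partial>lborel) \<le> ennreal (a\<^sup>2)" and G: "(\<integral>\<^sup>+x. (?G x)\<^sup>2 \<partial>lborel) \<le> ennreal (b\<^sup>2)"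
    using f g by (auto simp: L2_le_def ennreal_power)
  have "(\<integral>\<^sup>+x. ?F x * ?G x \<partial>lborel)\<^sup>2 \<le> (\<integral>\<^sup>+x. (?F x)\<^sup>2 \<partial>lborel) * (\<integral>\<^sup>+x. (?G x)\<^sup>2 \<partial>lborel)"
    by (rule Cauchy_Schwarz_nn_integral) measurable
  also have "\<dots> \<le> ennreal (a\<^sup>2) * ennreal (b\<^sup>2)"
    by (rule mult_mono[OF F G]) auto
  also have "\<dots> = ennreal ((a * b)\<^sup>2)"
    by (simp add: ennreal_mult[symmetric] power_mult_distrib)
  finally have FG: "(\<integral>\<^sup>+x. ?F x * ?G x \<partial>lborel) \<le> ennreal (a * b)"
    by (rule ennreal_le_of_power2_le) (use ab in simp)
  have "(\<integral>\<^sup>+x. ennreal ((norm (f x + g x))\<^sup>2) \<partial>lborel) \<le>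
      (\<integral>\<^sup>+x. (?F x)\<^sup>2 + 2 * (?F x * ?G x) + (?G x)\<^sup>2 \<partial>lborel)"
  proof (rule nn_integral_mono)
    fix x
    have "(norm (f x + g x))\<^sup>2 \<le> (norm (f x) + norm (g x))\<^sup>2"
      by (intro power_mono norm_triangle_ineq) auto
    also have "\<dots> = (norm (f x))\<^sup>2 + 2 * (norm (f x) * norm (g x)) + (norm (g x))\<^sup>2"
      by (simp add: power2_sum)
    finally have "ennreal ((norm (f x + g x))\<^sup>2) \<le> ennreal ((norm (f x))\<^sup>2 + 2 * (norm (f x) * norm (g x)) + (norm (g x))\<^sup>2)"
      by (rule ennreal_leI)
    also have "\<dots> = (?F x)\<^sup>2 + 2 * (?F x * ?G x) + (?G x)\<^sup>2"
      by (simp add: ennreal_plus ennreal_mult ennreal_power)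
    finally show "ennreal ((norm (f x + g x))\<^sup>2) \<le> (?F x)\<^sup>2 + 2 * (?F x * ?G x) + (?G x)\<^sup>2" .
  qed
  also have "\<dots> = (\<integral>\<^sup>+x. (?F x)\<^sup>2 \<partial>lborel) + 2 * (\<integral>\<^sup>+x. ?F x * ?G x \<partial>lborel) + (\<integral>\<^sup>+x. (?G x)\<^sup>2 \<partial>lborel)"
    by (simp add: nn_integral_add nn_integral_cmult)
  also have "\<dots> \<le> ennreal (a\<^sup>2) + 2 * ennreal (a * b) + ennreal (b\<^sup>2)"
    by (intro add_mono mult_left_mono F G FG) auto
  also have "\<dots> = ennreal ((a + b)\<^sup>2)"
    using ab by (simp add: power2_sum ennreal_mult mult.assoc)
  finally show "(\<integral>\<^sup>+x. ennreal ((norm (f x + g x))\<^sup>2) \<partial>lborel) \<le> ennreal ((a + b)\<^sup>2)" .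
qed

lemma L2_le_cmult:
  assumes "L2_le f a" shows "L2_le (\<lambda>x. c * f x) (norm c * a)"
proof -
  have [measurable]: "f \<in> borel_measurable borel" using assms by (simp add: L2_le_def)
  have "(\<integral>\<^sup>+x. ennreal ((norm (c * f x))\<^sup>2) \<partial>lborel) = ennreal ((norm c)\<^sup>2) * (\<integral>\<^sup>+x. ennreal ((norm (f x))\<^sup>2) \<partial>lborel)"
    by (simp add: norm_mult power_mult_distrib ennreal_mult nn_integral_cmult)
  also have "\<dots> \<le> ennreal ((norm c)\<^sup>2) * ennreal (a\<^sup>2)"
    using assms by (intro mult_left_mono) (auto simp: L2_le_def)
  finally show ?thesis using assms by (simp add: L2_le_def ennreal_mult power_mult_distrib)
qed

lemma L2_le_diff: "L2_le f a \<Longrightarrow> L2_le g b \<Longrightarrow> L2_le (\<lambda>x. f x - g x) (a + b)"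
  using L2_le_add[of f a "\<lambda>x. (-1) * g x" b] L2_le_cmult[of g b "-1"] by simp

text \<open>Schur's test. Cauchy-Schwarz with respect to the measure of density
  \<open>\<kappa> x\<close> uses the row bound; Tonelli then exposes the column bound.
  \<open>T\<close> has only to be dominated pointwise, so the kernel may absorb all signs and
  phases.\<close>

lemma L2_le_schur:
  fixes T g :: "real^'n::finite \<Rightarrow> complex" and \<kappa> :: "real^'n \<Rightarrow> real^'n \<Rightarrow> ennreal"
  assumes T[measurable]: "T \<in> borel_measurable borel"
    and K[measurable]: "case_prod \<kappa> \<in> borel_measurable (borel \<Otimes>\<^sub>M borel)"
    and TK: "\<And>x. ennreal (norm (T x)) \<le> (\<integral>\<^sup>+y. \<kappa> x y * ennreal (norm (g y)) \<partial>lborel)"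
    and row: "\<And>x. (\<integral>\<^sup>+y. \<kappa> x y \<partial>lborel) \<le> ennreal A"
    and col: "\<And>y. (\<integral>\<^sup>+x. \<kappa> x y \<partial>lborel) \<le> ennreal A"
    and A: "0 \<le> A" and g: "L2_le g a"
  shows "L2_le T (A * a)"
  unfolding L2_le_def
proof (intro conjI)
  have [measurable]: "g \<in> borel_measurable borel" and a: "0 \<le> a"
    and ga: "(\<integral>\<^sup>+x. ennreal ((norm (g x))\<^sup>2) \<partial>lborel) \<le> ennreal (a\<^sup>2)" using g by (auto simp: L2_le_def)
  have "(\<lambda>y. case_prod \<kappa> (x, y)) \<in> borel_measurable borel" for x by measurable
  then have [measurable]: "\<kappa> x \<in> borel_measurable borel" for x by simp
  have "(\<lambda>x. case_prod \<kappa> (x, y)) \<in> borel_measurable borel" for y by measurable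
  then have [measurable]: "(\<lambda>x. \<kappa> x y) \<in> borel_measurable borel" for y by simp
  show "T \<in> borel_measurable borel" by fact
  show "0 \<le> A * a" using A a by simp
  have "(ennreal (norm (T x)))\<^sup>2 \<le> ennreal A * (\<integral>\<^sup>+y. \<kappa> x y * ennreal ((norm (g y))\<^sup>2) \<partial>lborel)" for x
  proof -
    have "(ennreal (norm (T x)))\<^sup>2 \<le> (\<integral>\<^sup>+y. \<kappa> x y * ennreal (norm (g y)) \<partial>lborel)\<^sup>2"
      by (intro power_mono TK) auto
    also have "\<dots> = (\<integral>\<^sup>+y. 1 * ennreal (norm (g y)) \<partial>density lborel (\<kappa> x))\<^sup>2"
      by (simp add: nn_integral_density)
    also have "\<dots> \<le> (\<integral>\<^sup>+y. 1\<^sup>2 \<partial>density lborel (\<kappa> x)) * (\<integral>\<^sup>+y. (ennreal (norm (g y)))\<^sup>2 \<partial>density lborel (\<kappa> x))"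
      by (rule Cauchy_Schwarz_nn_integral) auto
    also have "\<dots> = (\<integral>\<^sup>+y. \<kappa> x y \<partial>lborel) * (\<integral>\<^sup>+y. \<kappa> x y * ennreal ((norm (g y))\<^sup>2) \<partial>lborel)"
      by (simp add: nn_integral_density ennreal_power emeasure_density)
    also have "\<dots> \<le> ennreal A * (\<integral>\<^sup>+y. \<kappa> x y * ennreal ((norm (g y))\<^sup>2) \<partial>lborel)"
      by (intro mult_right_mono row) auto
    finally show ?thesis .
  qed
  then have "(\<integral>\<^sup>+x. ennreal ((norm (T x))\<^sup>2) \<partial>lborel) \<le>
     (\<integral>\<^sup>+x. ennreal A * (\<integral>\<^sup>+y. \<kappa> x y * ennreal ((norm (g y))\<^sup>2) \<partial>lborel) \<partial>lborel)"
    by (intro nn_integral_mono) (auto simp: ennreal_power)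
  also have "\<dots> = ennreal A * (\<integral>\<^sup>+x. (\<integral>\<^sup>+y. \<kappa> x y * ennreal ((norm (g y))\<^sup>2) \<partial>lborel) \<partial>lborel)"
    by (rule nn_integral_cmult) measurable
  also have "(\<integral>\<^sup>+x. (\<integral>\<^sup>+y. \<kappa> x y * ennreal ((norm (g y))\<^sup>2) \<partial>lborel) \<partial>lborel)
     = (\<integral>\<^sup>+y. (\<integral>\<^sup>+x. \<kappa> x y * ennreal ((norm (g y))\<^sup>2) \<partial>lborel) \<partial>lborel)"
    by (rule lborel_pair.Fubini'[symmetric]) measurable
  also have "\<dots> = (\<integral>\<^sup>+y. (\<integral>\<^sup>+x. \<kappa> x y \<partial>lborel) * ennreal ((norm (g y))\<^sup>2) \<partial>lborel)"
    by (intro nn_integral_cong nn_integral_multc) measurable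
  also have "\<dots> \<le> (\<integral>\<^sup>+y. ennreal A * ennreal ((norm (g y))\<^sup>2) \<partial>lborel)"
    by (intro nn_integral_mono mult_right_mono col) auto
  also have "\<dots> = ennreal A * (\<integral>\<^sup>+y. ennreal ((norm (g y))\<^sup>2) \<partial>lborel)"
    by (rule nn_integral_cmult) measurable
  also have "\<dots> \<le> ennreal A * ennreal (a\<^sup>2)"
    by (intro mult_left_mono ga) auto
  finally have "(\<integral>\<^sup>+x. ennreal ((norm (T x))\<^sup>2) \<partial>lborel) \<le> ennreal A * (ennreal A * ennreal (a\<^sup>2))"
    by (simp add: mult_left_mono)
  then show "(\<integral>\<^sup>+x. ennreal ((norm (T x))\<^sup>2) \<partial>lborel) \<le> ennreal ((A * a)\<^sup>2)"
    using A by (simp add: ennreal_mult[symmetric] power2_eq_square mult_ac)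
qed

text \<open>Boundedness survives composition with a measurable map without any change of variables,
  unlike square integrability. Identities between convolutions, including those of
  \<open>g \<circ> \<psi>\<close>, are therefore proved in this class, while L2 bounds are carried
  separately by \<open>L2_le\<close>.\<close>

definition bdd_meas :: "(real^'n::finite \<Rightarrow> complex) \<Rightarrow> bool" where
  "bdd_meas g \<longleftrightarrow> g \<in> borel_measurable borel \<and> (\<exists>B. \<forall>x. norm (g x) \<le> B)"

lemma bdd_meas_measurable: "bdd_meas g \<Longrightarrow> g \<in> borel_measurable borel"
  by (simp add: bdd_meas_def)

lemma bdd_measD: "bdd_meas g \<Longrightarrow> \<exists>B. \<forall>x. norm (g x) \<le> B"
  by (simp add: bdd_meas_def)

lemma conv_reflect: "conv k g x = (\<integral>y. k (x - y) * g y \<partial>lborel)"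
  unfolding conv_def using integral_lborel_reflect[of "\<lambda>z. k z * g (x - z)" x] by simp

lemma conv_measurable [measurable]:
  assumes [measurable]: "k \<in> borel_measurable borel" "g \<in> borel_measurable borel"
  shows "conv k g \<in> borel_measurable borel"
  unfolding conv_def[abs_def] by measurable

lemma integrable_mult_bdd_meas:
  fixes k :: "real^'n::finite \<Rightarrow> complex"
  assumes k: "integrable lborel k" and g: "bdd_meas g"
  shows "integrable lborel (\<lambda>z. k z * g (x - z))" "integrable lborel (\<lambda>z. k z * g z)"
    "integrable lborel (\<lambda>y. k (x - y) * g y)"
proof -
  have [measurable]: "k \<in> borel_measurable borel" "g \<in> borel_measurable borel"
    using k bdd_meas_measurable[OF g] by auto
  obtain B where B: "\<And>x. norm (g x) \<le> B" using bdd_measD[OF g] by blast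
  have *: "integrable lborel (\<lambda>z. k z * g (p z))" if [measurable]: "p \<in> borel_measurable borel" for p
  proof (rule Bochner_Integration.integrable_bound)
    show "integrable lborel (\<lambda>z. B * norm (k z))" using k by auto
    show "AE z in lborel. norm (k z * g (p z)) \<le> norm (B * norm (k z))"
    proof (intro AE_I2)
      fix z
      have "norm (k z * g (p z)) \<le> norm (k z) * B"
        unfolding norm_mult by (intro mult_left_mono B) auto
      also have "\<dots> \<le> norm (B * norm (k z))" by (simp add: mult.commute)
      finally show "norm (k z * g (p z)) \<le> norm (B * norm (k z))" .
    qed
  qed measurable
  show 1: "integrable lborel (\<lambda>z. k z * g (x - z))" "integrable lborel (\<lambda>z. k z * g z)"
    by (rule *; measurable)+
  then show "integrable lborel (\<lambda>y. k (x - y) * g y)"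
    using integrable_lborel_reflect_iff[of "\<lambda>z. k z * g (x - z)" x] by simp
qed

lemma bdd_meas_conv:
  assumes k: "integrable lborel k" and g: "bdd_meas g"
  shows "bdd_meas (conv k g)"
proof -
  have [measurable]: "k \<in> borel_measurable borel" "g \<in> borel_measurable borel"
    using k bdd_meas_measurable[OF g] by auto
  obtain B where B: "\<And>x. norm (g x) \<le> B" using bdd_measD[OF g] by blast
  have "norm (conv k g x) \<le> (\<integral>z. B * norm (k z) \<partial>lborel)" for x
    unfolding conv_def
  proof (rule Bochner_Integration.integral_norm_bound_integral)
    show "integrable lborel (\<lambda>z. k z * g (x - z))" by (rule integrable_mult_bdd_meas[OF k g])
    show "integrable lborel (\<lambda>z. B * norm (k z))" using k by auto
    show "norm (k z * g (x - z)) \<le> B * norm (k z)" for z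
      unfolding norm_mult mult.commute[of B] by (intro mult_left_mono B) auto
  qed
  then show ?thesis unfolding bdd_meas_def by (auto intro!: exI)
qed

lemma conv_comm:
  assumes k: "integrable lborel k1" "integrable lborel k2" and g: "bdd_meas g"
  shows "conv k1 (conv k2 g) x = conv k2 (conv k1 g) x"
proof -
  have [measurable]: "g \<in> borel_measurable borel" using g by (rule bdd_meas_measurable)
  obtain B where B: "\<And>x. norm (g x) \<le> B" using bdd_measD[OF g] by blast
  have I: "integrable (lborel \<Otimes>\<^sub>M lborel) (\<lambda>(z, w). k1 z * k2 w * (\<lambda>(z, w). g (x - z - w)) (z, w))"
    by (rule integrable_pair_mult[OF k, where B = B]) (use B in auto)
  have "conv k1 (conv k2 g) x = (\<integral>z. (\<integral>w. k1 z * k2 w * g (x - z - w) \<partial>lborel) \<partial>lborel)"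
    by (simp add: conv_def mult.assoc)
  also have "\<dots> = (\<integral>w. (\<integral>z. k1 z * k2 w * g (x - z - w) \<partial>lborel) \<partial>lborel)"
    using lborel_pair.Fubini_integral[of "\<lambda>z w. k1 z * k2 w * g (x - z - w)"] I by simp
  also have "\<dots> = (\<integral>w. (\<integral>z. k2 w * (k1 z * g (x - w - z)) \<partial>lborel) \<partial>lborel)"
    by (intro Bochner_Integration.integral_cong refl) (simp add: algebra_simps)
  also have "\<dots> = conv k2 (conv k1 g) x"
    by (simp add: conv_def)
  finally show ?thesis .
qed

lemma conv_diff:
  assumes k: "integrable lborel k" and f: "bdd_meas f" and g: "bdd_meas g"
  shows "conv k (\<lambda>x. f x - g x) x = conv k f x - conv k g x"
  unfolding conv_def right_diff_distrib
  by (intro Bochner_Integration.integral_diff integrable_mult_bdd_meas k f g)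

lemma bdd_meas_comp:
  "bdd_meas f \<Longrightarrow> p \<in> borel_measurable borel \<Longrightarrow> bdd_meas (f \<circ> p)"
  unfolding bdd_meas_def by (auto intro: measurable_comp)

text \<open>Young's inequality for L1 and L2: row and column integrals of \<open>k (x - y)\<close>
  both equal the L1 norm of \<open>k\<close>.\<close>

lemma L2_le_conv:
  fixes k g :: "real^'n::finite \<Rightarrow> complex"
  assumes [measurable]: "k \<in> borel_measurable borel"
    and k: "(\<integral>\<^sup>+z. ennreal (norm (k z)) \<partial>lborel) \<le> ennreal A" and A: "0 \<le> A" and g: "L2_le g a"
  shows "L2_le (conv k g) (A * a)"
proof (rule L2_le_schur[where \<kappa> = "\<lambda>x y. ennreal (norm (k (x - y)))", OF _ _ _ _ _ A g])
  have [measurable]: "g \<in> borel_measurable borel" using g by (rule L2_le_measurable)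
  show "conv k g \<in> borel_measurable borel" by measurable
  show "(\<lambda>(x, y). ennreal (norm (k (x - y)))) \<in> borel_measurable (borel \<Otimes>\<^sub>M borel)" by measurable
  show "ennreal (norm (conv k g x)) \<le> (\<integral>\<^sup>+y. ennreal (norm (k (x - y))) * ennreal (norm (g y)) \<partial>lborel)" for x
    unfolding conv_reflect
    by (rule order_trans[OF norm_integral_le_nn_integral]) (simp add: norm_mult ennreal_mult)
  show "(\<integral>\<^sup>+y. ennreal (norm (k (x - y))) \<partial>lborel) \<le> ennreal A" for x
    using k by (subst nn_integral_lborel_reflect[of "\<lambda>z. ennreal (norm (k z))"]) auto
  show "(\<integral>\<^sup>+x. ennreal (norm (k (x - y))) \<partial>lborel) \<le> ennreal A" for y
    using k by (subst nn_integral_lborel_shift[of "\<lambda>z. ennreal (norm (k z))"]) auto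
qed

abbreviation heat :: "real \<Rightarrow> real^'n::finite \<Rightarrow> complex" where
  "heat \<epsilon> \<equiv> \<lambda>x. complex_of_real (gauss_eps \<epsilon> x)"

lemma integrable_heat: "\<epsilon> > 0 \<Longrightarrow> integrable lborel (heat \<epsilon>)"
  by (intro integrable_of_real gauss_eps_integrable)

lemma L2_le_conv_heat:
  fixes g :: "real^'n::finite \<Rightarrow> complex"
  shows "\<epsilon> > 0 \<Longrightarrow> L2_le g a \<Longrightarrow> L2_le (conv (heat \<epsilon>) g) a"
  using L2_le_conv[of "heat \<epsilon>" 1 g a] gauss_eps_nn_integral[of \<epsilon>, where 'n='n] by simp

lemma conv_heat_semigroup:
  fixes g :: "real^'n::finite \<Rightarrow> complex"
  assumes ab: "a > 0" "b > 0" and g: "bdd_meas g"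
  shows "conv (heat a) (conv (heat b) g) x = conv (heat (sqrt (a\<^sup>2 + b\<^sup>2))) g x"
proof -
  have [measurable]: "g \<in> borel_measurable borel" using g by (rule bdd_meas_measurable)
  obtain B where B: "\<And>x. norm (g x) \<le> B" using bdd_measD[OF g] by blast
  have I0: "integrable (lborel \<Otimes>\<^sub>M lborel) (\<lambda>(z :: real^'n, u). heat a z * heat b (u - z))"
  proof (rule lborel_pair.Fubini_integrable)
    show "integrable lborel (\<lambda>z::real^'n. \<integral>u. norm (case (z, u) of (z, u) \<Rightarrow> heat a z * heat b (u - z)) \<partial>lborel)"
      using ab by (simp add: norm_mult integral_lborel_shift(2)[of "gauss_eps b"] gauss_eps_integrable)
    have "integrable lborel (\<lambda>u. heat b (u - z))" for z :: "real^'n"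
      by (rule iffD2[OF integrable_lborel_shift_iff(2)[of "heat b" z] integrable_heat[OF ab(2)]])
    then have I1: "integrable lborel (\<lambda>u. heat a z * heat b (u - z))" for z :: "real^'n"
      by (rule integrable_mult_right)
    show "AE z::real^'n in lborel. integrable lborel (\<lambda>u. case (z, u) of (z, u) \<Rightarrow> heat a z * heat b (u - z))"
      unfolding prod.case by (rule AE_I2) (rule I1)
  qed measurable
  have I: "integrable (lborel \<Otimes>\<^sub>M lborel) (\<lambda>(z, u). (heat a z * heat b (u - z)) * g (x - u))"
  proof (rule Bochner_Integration.integrable_bound[OF integrable_mult_right[OF integrable_norm[OF I0], of B]])
    show "AE p in lborel \<Otimes>\<^sub>M lborel. norm (case p of (z, u) \<Rightarrow> (heat a z * heat b (u - z)) * g (x - u))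
       \<le> norm (B * norm (case p of (z, u) \<Rightarrow> heat a z * heat b (u - z)))"
    proof (intro AE_I2)
      fix p :: "(real^'n) \<times> (real^'n)"
      obtain z u where p: "p = (z, u)" by fastforce
      have "norm ((heat a z * heat b (u - z)) * g (x - u)) \<le> norm (heat a z * heat b (u - z)) * B"
        unfolding norm_mult[of _ "g (x - u)"] by (intro mult_left_mono B) auto
      also have "\<dots> \<le> norm (B * norm (heat a z * heat b (u - z)))" by (simp add: mult.commute)
      finally show "norm (case p of (z, u) \<Rightarrow> (heat a z * heat b (u - z)) * g (x - u))
       \<le> norm (B * norm (case p of (z, u) \<Rightarrow> heat a z * heat b (u - z)))" by (simp add: p)
    qed
  qed measurable
  have "conv (heat a) (conv (heat b) g) x = (\<integral>z. (\<integral>u. (heat a z * heat b (u - z)) * g (x - u) \<partial>lborel) \<partial>lborel)"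
  proof -
    \<comment> \<open>Shifting the inner variable by \<open>z\<close> makes \<open>g\<close> depend
      on \<open>u\<close> alone, so after Fubini the \<open>z\<close>-integral is exactly the
      Gaussian product identity.\<close>
    have "conv (heat b) g (x - z) = (\<integral>u. heat b (u - z) * g (x - u) \<partial>lborel)" for z
      unfolding conv_def
      using integral_lborel_shift(2)[of "\<lambda>w. heat b w * g (x - z - w)" z] by simp
    then show ?thesis unfolding conv_def[of "heat a"] by (simp add: mult.assoc)
  qed
  also have "\<dots> = (\<integral>u. (\<integral>z. (heat a z * heat b (u - z)) * g (x - u) \<partial>lborel) \<partial>lborel)"
    using lborel_pair.Fubini_integral[of "\<lambda>z u. (heat a z * heat b (u - z)) * g (x - u)"] I by simp
  also have "\<dots> = (\<integral>u. heat (sqrt (a\<^sup>2 + b\<^sup>2)) u * g (x - u) \<partial>lborel)"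
  proof (intro Bochner_Integration.integral_cong refl)
    fix u :: "real^'n"
    have "(\<integral>z. heat a z * heat b (u - z) \<partial>lborel) = heat (sqrt (a\<^sup>2 + b\<^sup>2)) u"
      using has_bochner_integral_integral_eq[OF gauss_eps_semigroup[OF ab, of u]]
      unfolding of_real_mult[symmetric] integral_complex_of_real by simp
    then show "(\<integral>z. (heat a z * heat b (u - z)) * g (x - u) \<partial>lborel) = heat (sqrt (a\<^sup>2 + b\<^sup>2)) u * g (x - u)"
      by simp
  qed
  finally show ?thesis by (simp add: conv_def)
qed

section \<open>Translation estimates and decay of the heat flow on mean-zero kernels\<close>

text \<open>The mean value bound on the ball of radius \<open>r\<close> around \<open>p\<close>,
  where the weight is comparable to \<open>wt p\<close>; the Lipschitz constant keeps the decay in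
  \<open>p\<close>.\<close>

lemma wt_lipschitz:
  fixes f :: "real^'n::finite \<Rightarrow> complex"
  assumes "\<And>z. f differentiable (at z)" "\<And>i z. norm (partial_deriv i f z) \<le> C * wt z" "0 \<le> C"
    and "norm (x - p) \<le> r" "norm (y - p) \<le> r"
  shows "norm (f x - f y) \<le> real CARD('n) * (C * ((1 + r) ^ (2 * CARD('n)) * wt p)) * norm (x - y)"
proof (rule partial_mean_value[of "cball p r"])
  show "convex (cball p r)" by simp
  show "x \<in> cball p r" "y \<in> cball p r" using assms(4,5) by (auto simp: dist_norm norm_minus_commute)
  fix z assume "z \<in> cball p r"
  then have "wt z \<le> (1 + r) ^ (2 * CARD('n)) * wt p"
    by (intro wt_shift) (simp add: dist_norm)
  then show "norm (partial_deriv i f z) \<le> C * ((1 + r) ^ (2 * CARD('n)) * wt p)" for i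
    using assms(2)[of i z] assms(3) by (meson mult_left_mono order_trans)
qed (use assms(1) in auto)

text \<open>For \<open>norm a \<le> 1\<close> the weighted Lipschitz bound is integrated; for larger
  \<open>a\<close> the triangle inequality gives a constant, which \<open>norm a > 1\<close> turns
  into a linear bound.\<close>

lemma L1_translate:
  fixes f :: "real^'n::finite \<Rightarrow> complex"
  assumes d: "\<And>z. f differentiable (at z)" and p: "\<And>i z. norm (partial_deriv i f z) \<le> C * wt z"
    and f: "\<And>z. norm (f z) \<le> C * wt z" and C: "0 \<le> C"
  obtains K where "0 \<le> K" "\<And>a. (\<integral>\<^sup>+z. ennreal (norm (f (z + a) - f z)) \<partial>lborel) \<le> ennreal (K * norm a)"
proof -
  define W where "W = (\<integral>x. wt (x::real^'n) \<partial>lborel)"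
  have W: "(\<integral>\<^sup>+x. ennreal (wt (x::real^'n)) \<partial>lborel) = ennreal W"
    unfolding W_def by (intro nn_integral_eq_integral wt_integrable) auto
  have W0: "0 \<le> W" unfolding W_def by (rule integral_nonneg_AE) auto
  have "continuous_on UNIV f"
    using d by (simp add: continuous_at_imp_continuous_on differentiable_imp_continuous_within)
  then have [measurable]: "f \<in> borel_measurable borel" by (rule borel_measurable_continuous_onI)
  define E where "E = real CARD('n) * (C * 2 ^ (2 * CARD('n)))"
  have E: "0 \<le> E" using C by (simp add: E_def)
  define K where "K = (E + 2 * C) * W"
  have "(\<integral>\<^sup>+z. ennreal (norm (f (z + a) - f z)) \<partial>lborel) \<le> ennreal (K * norm a)" for a
  proof (cases "norm a \<le> 1")
    case True
    have "norm (f (z + a) - f z) \<le> E * norm a * wt z" for z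
      using wt_lipschitz[OF d p C, of "z + a" z 1 z] True by (simp add: E_def mult_ac)
    then have "(\<integral>\<^sup>+z. ennreal (norm (f (z + a) - f z)) \<partial>lborel) \<le> (\<integral>\<^sup>+z. ennreal (E * norm a) * ennreal (wt (z::real^'n)) \<partial>lborel)"
      using E by (intro nn_integral_mono) (auto simp: ennreal_mult[symmetric] intro: ennreal_leI)
    also have "\<dots> = ennreal (E * norm a * W)"
      using E W0 by (simp add: nn_integral_cmult W ennreal_mult)
    also have "\<dots> \<le> ennreal (K * norm a)"
      unfolding K_def using W0 C by (intro ennreal_leI) (simp add: algebra_simps)
    finally show ?thesis .
  next
    case False
    have fi: "(\<integral>\<^sup>+z. ennreal (norm (f z)) \<partial>lborel) \<le> ennreal (C * W)"
    proof -
      have "(\<integral>\<^sup>+z. ennreal (norm (f z)) \<partial>lborel) \<le> (\<integral>\<^sup>+z. ennreal C * ennreal (wt (z::real^'n)) \<partial>lborel)"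
        using C f by (intro nn_integral_mono) (auto simp: ennreal_mult[symmetric] intro: ennreal_leI)
      also have "\<dots> = ennreal (C * W)" using C W0 by (simp add: nn_integral_cmult W ennreal_mult)
      finally show ?thesis .
    qed
    have "(\<integral>\<^sup>+z. ennreal (norm (f (z + a) - f z)) \<partial>lborel) \<le>
       (\<integral>\<^sup>+z. ennreal (norm (f (z + a))) + ennreal (norm (f z)) \<partial>lborel)"
      by (intro nn_integral_mono) (auto simp: ennreal_plus[symmetric] norm_triangle_ineq4 intro!: ennreal_leI simp del: ennreal_plus)
    also have "\<dots> = (\<integral>\<^sup>+z. ennreal (norm (f (z + a))) \<partial>lborel) + (\<integral>\<^sup>+z. ennreal (norm (f z)) \<partial>lborel)"
      by (rule nn_integral_add) measurable
    also have "(\<integral>\<^sup>+z. ennreal (norm (f (z + a))) \<partial>lborel) = (\<integral>\<^sup>+z. ennreal (norm (f z)) \<partial>lborel)"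
      by (rule nn_integral_lborel_shift(1)[of "\<lambda>z. ennreal (norm (f z))"]) measurable
    also have "(\<integral>\<^sup>+z. ennreal (norm (f z)) \<partial>lborel) + (\<integral>\<^sup>+z. ennreal (norm (f z)) \<partial>lborel) \<le> ennreal (C * W) + ennreal (C * W)"
      by (intro add_mono fi)
    also have "\<dots> = ennreal (2 * C * W)" using C W0 by (simp add: ennreal_plus[symmetric] del: ennreal_plus)
    also have "\<dots> \<le> ennreal (K * norm a)"
    proof (rule ennreal_leI)
      have "2 * C * W \<le> K" unfolding K_def using E W0 by (simp add: distrib_right)
      also have "\<dots> \<le> K * norm a"
        using mult_left_mono[of 1 "norm a" K] False C E W0 by (simp add: K_def)
      finally show "2 * C * W \<le> K * norm a" .
    qed
    finally show ?thesis .
  qed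
  moreover have "0 \<le> K" using E C W0 by (simp add: K_def)
  ultimately show ?thesis using that by blast
qed

text \<open>The case \<epsilon> = 1 follows from decay of the Gaussian and its gradient. Dilation
  preserves the L1 normalisation and divides the translation by \<epsilon>, which produces the
  denominator.\<close>

lemma gauss_translate:
  obtains K where "0 \<le> K" "\<And>\<epsilon> a :: real^'n::finite. \<epsilon> > 0 \<Longrightarrow>
    (\<integral>\<^sup>+z. ennreal (norm (heat \<epsilon> (z + a) - heat \<epsilon> z)) \<partial>lborel) \<le> ennreal (K * norm a / \<epsilon>)"
proof -
  \<comment> \<open>The additional weight factor leaves room for the coordinate that differentiation
    of the Gaussian brings down.\<close>
  obtain C where C: "0 \<le> C" "\<And>x :: real^'n. (1 + norm x) ^ 1 * norm (heat 1 x) \<le> C * wt x"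
    using rapid_wt[OF rapid_gauss_eps[of 1]] by (metis zero_less_one)
  have D: "(heat 1 has_derivative (\<lambda>v. heat 1 x * complex_of_real (- (x \<bullet> v) / 2))) (at x)" for x :: "real^'n"
  proof -
    have "((\<lambda>x::real^'n. exp (- (x \<bullet> x) / 4) / (2 * sqrt pi) ^ CARD('n)) has_derivative
        (\<lambda>v. exp (- (x \<bullet> x) / 4) / (2 * sqrt pi) ^ CARD('n) * (- (x \<bullet> v) / 2))) (at x)"
      by (auto intro!: derivative_eq_intros simp: inner_commute field_simps)
    moreover have e1: "gauss_eps 1 x = exp (- (x \<bullet> x) / 4) / (2 * sqrt pi) ^ CARD('n)" for x :: "real^'n"
      by (simp add: gauss_eps_eq power2_norm_eq_inner)
    then have "gauss_eps 1 = (\<lambda>x::real^'n. exp (- (x \<bullet> x) / 4) / (2 * sqrt pi) ^ CARD('n))" by (rule ext)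
    ultimately have "(gauss_eps 1 has_derivative (\<lambda>v. gauss_eps 1 x * (- (x \<bullet> v) / 2))) (at x)"
      by simp
    then have "((\<lambda>x. complex_of_real (gauss_eps 1 x)) has_derivative
        (\<lambda>v. complex_of_real (gauss_eps 1 x * (- (x \<bullet> v) / 2)))) (at x)"
      by (rule bounded_linear.has_derivative[OF bounded_linear_of_real])
    then show ?thesis by simp
  qed
  have dG: "heat 1 differentiable (at z)" for z :: "real^'n"
    using D unfolding differentiable_def by blast
  have G1: "norm (heat 1 z) \<le> C * wt z" for z :: "real^'n"
  proof -
    have "1 * norm (heat 1 z) \<le> (1 + norm z) ^ 1 * norm (heat 1 z)"
      by (rule mult_right_mono) (simp_all only: power_one_right le_add_same_cancel1 norm_ge_zero)
    with C(2)[of z] show ?thesis by (simp only: mult_1_left)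
  qed
  have pG: "norm (partial_deriv i (heat 1) z) \<le> C * wt z" for i and z :: "real^'n"
  proof -
    have "norm (partial_deriv i (heat 1) z) = norm (heat 1 z) * (\<bar>z $ i\<bar> / 2)"
      using partial_deriv_eqI[OF D, of i z] by (simp add: norm_mult inner_axis)
    also have "\<dots> \<le> norm (heat 1 z) * (1 + norm z)"
      using component_le_norm_cart[of z i] norm_ge_zero[of z] by (intro mult_left_mono[OF _ norm_ge_zero]) linarith
    finally show ?thesis using C(2)[of z] by (simp add: mult.commute)
  qed
  obtain K where K: "0 \<le> K" "\<And>a :: real^'n. (\<integral>\<^sup>+z. ennreal (norm (heat 1 (z + a) - heat 1 z)) \<partial>lborel) \<le> ennreal (K * norm a)"
    using L1_translate[OF dG pG G1 C(1)] by blast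
  have "(\<integral>\<^sup>+z. ennreal (norm (heat \<epsilon> (z + a) - heat \<epsilon> z)) \<partial>lborel) \<le> ennreal (K * norm a / \<epsilon>)"
    if e: "\<epsilon> > 0" for \<epsilon> and a :: "real^'n"
  proof -
    have sc: "heat \<epsilon> (\<epsilon> *\<^sub>R w) = complex_of_real (1 / \<epsilon> ^ CARD('n)) * heat 1 w" for w :: "real^'n"
      using e by (simp add: gauss_eps_def)
    have "(\<integral>\<^sup>+z. ennreal (norm (heat \<epsilon> (z + a) - heat \<epsilon> z)) \<partial>lborel) =
       ennreal (\<epsilon> ^ CARD('n)) * (\<integral>\<^sup>+w. ennreal (norm (heat \<epsilon> (\<epsilon> *\<^sub>R w + a) - heat \<epsilon> (\<epsilon> *\<^sub>R w))) \<partial>lborel)"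
      using e by (subst nn_integral_lborel_affine[of _ \<epsilon> 0]) auto
    also have "(\<integral>\<^sup>+w. ennreal (norm (heat \<epsilon> (\<epsilon> *\<^sub>R w + a) - heat \<epsilon> (\<epsilon> *\<^sub>R w))) \<partial>lborel) =
       (\<integral>\<^sup>+w. ennreal (1 / \<epsilon> ^ CARD('n)) * ennreal (norm (heat 1 (w + (1 / \<epsilon>) *\<^sub>R a) - heat 1 w)) \<partial>lborel)"
    proof (intro nn_integral_cong)
      fix w :: "real^'n"
      have "\<epsilon> *\<^sub>R w + a = \<epsilon> *\<^sub>R (w + (1 / \<epsilon>) *\<^sub>R a)" using e by (simp add: scaleR_add_right)
      then have "norm (heat \<epsilon> (\<epsilon> *\<^sub>R w + a) - heat \<epsilon> (\<epsilon> *\<^sub>R w)) =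
          1 / \<epsilon> ^ CARD('n) * norm (heat 1 (w + (1 / \<epsilon>) *\<^sub>R a) - heat 1 w)"
        using e unfolding sc right_diff_distrib[symmetric] norm_mult
        by (simp only: sc right_diff_distrib[symmetric] norm_mult) (simp add: norm_divide norm_power)
      then show "ennreal (norm (heat \<epsilon> (\<epsilon> *\<^sub>R w + a) - heat \<epsilon> (\<epsilon> *\<^sub>R w))) =
          ennreal (1 / \<epsilon> ^ CARD('n)) * ennreal (norm (heat 1 (w + (1 / \<epsilon>) *\<^sub>R a) - heat 1 w))"
        using e by (simp only: ennreal_mult[symmetric] norm_ge_zero) (simp add: ennreal_mult[symmetric])
    qed
    also have "\<dots> = ennreal (1 / \<epsilon> ^ CARD('n)) * (\<integral>\<^sup>+w. ennreal (norm (heat 1 (w + (1 / \<epsilon>) *\<^sub>R a) - heat 1 w)) \<partial>lborel)"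
      by (rule nn_integral_cmult) measurable
    also have "ennreal (\<epsilon> ^ CARD('n)) * \<dots> = (\<integral>\<^sup>+w. ennreal (norm (heat 1 (w + (1 / \<epsilon>) *\<^sub>R a) - heat 1 w)) \<partial>lborel)"
      using e by (simp add: mult.assoc[symmetric] ennreal_mult[symmetric])
    also have "\<dots> \<le> ennreal (K * norm a / \<epsilon>)"
      using K(2)[of "(1 / \<epsilon>) *\<^sub>R a"] e by simp
    finally show ?thesis .
  qed
  with K(1) that show ?thesis by blast
qed

text \<open>If \<open>g = h * g\<close> with \<open>\<integral> h = 0\<close>, then \<open>heat * g = h * (heat * g)\<close> only sees the differences
  of \<open>heat\<close> under translations.\<close>

lemma L2_le_heat_mean_zero:
  obtains K where "0 \<le> K" "\<And>\<epsilon> (h :: real^'n::finite \<Rightarrow> complex) g a M. \<epsilon> > 0 \<Longrightarrow> integrable lborel h \<Longrightarrow>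
     (\<integral>z. h z \<partial>lborel) = 0 \<Longrightarrow> 0 \<le> M \<Longrightarrow> (\<integral>\<^sup>+z. ennreal (norm z * norm (h z)) \<partial>lborel) \<le> ennreal M \<Longrightarrow>
     bdd_meas g \<Longrightarrow> (\<And>x. conv h g x = g x) \<Longrightarrow> L2_le g a \<Longrightarrow> L2_le (conv (heat \<epsilon>) g) (K * M / \<epsilon> * a)"
proof -
  obtain K where K: "0 \<le> K" "\<And>\<epsilon> a :: real^'n. \<epsilon> > 0 \<Longrightarrow>
    (\<integral>\<^sup>+z. ennreal (norm (heat \<epsilon> (z + a) - heat \<epsilon> z)) \<partial>lborel) \<le> ennreal (K * norm a / \<epsilon>)"
    using gauss_translate by blast
  have "L2_le (conv (heat \<epsilon>) g) (K * M / \<epsilon> * a)"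
    if e: "\<epsilon> > 0" and h: "integrable lborel h" and h0: "(\<integral>z. h z \<partial>lborel) = 0" and M: "0 \<le> M"
      and hM: "(\<integral>\<^sup>+z. ennreal (norm z * norm (h z)) \<partial>lborel) \<le> ennreal M"
      and g: "bdd_meas g" and hg: "\<And>x. conv h g x = g x" and ga: "L2_le g a"
    for \<epsilon> and h g :: "real^'n \<Rightarrow> complex" and a M
  proof -
    have [measurable]: "h \<in> borel_measurable borel" "g \<in> borel_measurable borel"
      using h bdd_meas_measurable[OF g] by auto
    define u where "u = conv (heat \<epsilon>) g"
    have u: "bdd_meas u" unfolding u_def by (intro bdd_meas_conv integrable_heat e g)
    \<comment> \<open>The Schur kernel averages translation differences of the Gaussian against the
      modulus of \<open>h\<close>. By translation invariance its row and column integrals have the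
      same value, which \<open>S\<close> bounds by \<open>K / \<epsilon>\<close> times the first
      moment of \<open>h\<close>.\<close>
    define \<kappa> where "\<kappa> = (\<lambda>x w :: real^'n. \<integral>\<^sup>+y. ennreal (norm (h y)) * ennreal (norm (heat \<epsilon> (x - w - y) - heat \<epsilon> (x - w))) \<partial>lborel)"
    have km: "case_prod \<kappa> \<in> borel_measurable (borel \<Otimes>\<^sub>M borel)"
      unfolding \<kappa>_def by measurable
    have uh: "conv h u x = u x" for x
    proof -
      have "conv h u x = conv (heat \<epsilon>) (conv h g) x" unfolding u_def by (rule conv_comm[OF h integrable_heat[OF e] g])
      also have "conv h g = g" using hg by blast
      finally show ?thesis by (simp add: u_def)
    qed
    have diff: "u (x - y) - u x = (\<integral>w. (heat \<epsilon> (x - w - y) - heat \<epsilon> (x - w)) * g w \<partial>lborel)" for x y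
      unfolding u_def conv_reflect left_diff_distrib
      using integrable_mult_bdd_meas(3)[OF integrable_heat[OF e] g, of "x - y"]
        integrable_mult_bdd_meas(3)[OF integrable_heat[OF e] g, of x]
      by (subst Bochner_Integration.integral_diff) (auto simp: algebra_simps)
    have S: "(\<integral>\<^sup>+w. ennreal (norm (heat \<epsilon> (w - y) - heat \<epsilon> w)) \<partial>lborel) \<le> ennreal (K / \<epsilon> * norm y)" for y :: "real^'n"
      using K(2)[OF e, of "- y"] by simp
    have row': "(\<integral>\<^sup>+y. ennreal (norm (h y)) * (\<integral>\<^sup>+w. ennreal (norm (heat \<epsilon> (w - y) - heat \<epsilon> w)) \<partial>lborel) \<partial>lborel) \<le> ennreal (K * M / \<epsilon>)"
    proof -
      have "(\<integral>\<^sup>+y. ennreal (norm (h y)) * (\<integral>\<^sup>+w. ennreal (norm (heat \<epsilon> (w - y) - heat \<epsilon> w)) \<partial>lborel) \<partial>lborel)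
        \<le> (\<integral>\<^sup>+y. ennreal (norm (h y)) * ennreal (K / \<epsilon> * norm y) \<partial>lborel)"
        by (intro nn_integral_mono mult_left_mono S) auto
      also have "\<dots> = (\<integral>\<^sup>+y. ennreal (K / \<epsilon>) * ennreal (norm y * norm (h y)) \<partial>lborel)"
        using e K(1) by (intro nn_integral_cong) (simp add: ennreal_mult[symmetric] mult_ac)
      also have "\<dots> = ennreal (K / \<epsilon>) * (\<integral>\<^sup>+y. ennreal (norm y * norm (h y)) \<partial>lborel)"
        by (rule nn_integral_cmult) measurable
      also have "\<dots> \<le> ennreal (K / \<epsilon>) * ennreal M" by (intro mult_left_mono hM) auto
      also have "\<dots> = ennreal (K * M / \<epsilon>)" using e K(1) M by (simp add: ennreal_mult[symmetric])
      finally show ?thesis .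
    qed
    show ?thesis unfolding u_def[symmetric]
    proof (rule L2_le_schur[OF _ km _ _ _ _ ga])
      show "u \<in> borel_measurable borel" by (rule bdd_meas_measurable[OF u])
      show "0 \<le> K * M / \<epsilon>" using K(1) M e by simp
      fix x
      have "u x = (\<integral>y. h y * (u (x - y) - u x) \<partial>lborel)"
      proof -
        have "(\<integral>y. h y * (u (x - y) - u x) \<partial>lborel) = (\<integral>y. h y * u (x - y) \<partial>lborel) - (\<integral>y. h y * u x \<partial>lborel)"
          unfolding right_diff_distrib
          by (intro Bochner_Integration.integral_diff integrable_mult_bdd_meas(1)[OF h u] integrable_mult_left h)
        also have "\<dots> = u x" using uh[of x] h0 by (simp add: conv_def)
        finally show ?thesis by simp
      qed
      then have "ennreal (norm (u x)) \<le> (\<integral>\<^sup>+y. ennreal (norm (h y * (u (x - y) - u x))) \<partial>lborel)"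
        using norm_integral_le_nn_integral[of lborel "\<lambda>y. h y * (u (x - y) - u x)"] by metis
      also have "\<dots> \<le> (\<integral>\<^sup>+y. (\<integral>\<^sup>+w. ennreal (norm (h y)) * ennreal (norm (heat \<epsilon> (x - w - y) - heat \<epsilon> (x - w))) * ennreal (norm (g w)) \<partial>lborel) \<partial>lborel)"
      proof (rule nn_integral_mono)
        fix y
        have "ennreal (norm (u (x - y) - u x)) \<le>
           (\<integral>\<^sup>+w. ennreal (norm (heat \<epsilon> (x - w - y) - heat \<epsilon> (x - w))) * ennreal (norm (g w)) \<partial>lborel)"
          unfolding diff by (rule order_trans[OF norm_integral_le_nn_integral]) (simp add: norm_mult ennreal_mult)
        then have "ennreal (norm (h y)) * ennreal (norm (u (x - y) - u x)) \<le> ennreal (norm (h y)) *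
           (\<integral>\<^sup>+w. ennreal (norm (heat \<epsilon> (x - w - y) - heat \<epsilon> (x - w))) * ennreal (norm (g w)) \<partial>lborel)"
          by (rule mult_left_mono) simp
        then show "ennreal (norm (h y * (u (x - y) - u x))) \<le> (\<integral>\<^sup>+w. ennreal (norm (h y)) *
            ennreal (norm (heat \<epsilon> (x - w - y) - heat \<epsilon> (x - w))) * ennreal (norm (g w)) \<partial>lborel)"
          by (simp add: norm_mult ennreal_mult nn_integral_cmult mult.assoc)
      qed
      also have "\<dots> = (\<integral>\<^sup>+w. (\<integral>\<^sup>+y. ennreal (norm (h y)) * ennreal (norm (heat \<epsilon> (x - w - y) - heat \<epsilon> (x - w))) * ennreal (norm (g w)) \<partial>lborel) \<partial>lborel)"
        by (rule lborel_pair.Fubini'[symmetric]) measurable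
      also have "\<dots> = (\<integral>\<^sup>+w. \<kappa> x w * ennreal (norm (g w)) \<partial>lborel)"
        unfolding \<kappa>_def by (intro nn_integral_cong nn_integral_multc) measurable
      finally show "ennreal (norm (u x)) \<le> (\<integral>\<^sup>+w. \<kappa> x w * ennreal (norm (g w)) \<partial>lborel)" .
      have "(\<integral>\<^sup>+w. \<kappa> x w \<partial>lborel) = (\<integral>\<^sup>+y. (\<integral>\<^sup>+w. ennreal (norm (h y)) * ennreal (norm (heat \<epsilon> (x - w - y) - heat \<epsilon> (x - w))) \<partial>lborel) \<partial>lborel)"
        unfolding \<kappa>_def by (rule lborel_pair.Fubini') measurable
      also have "\<dots> = (\<integral>\<^sup>+y. ennreal (norm (h y)) * (\<integral>\<^sup>+w. ennreal (norm (heat \<epsilon> (w - y) - heat \<epsilon> w)) \<partial>lborel) \<partial>lborel)"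
        using nn_integral_lborel_reflect[of "\<lambda>w. ennreal (norm (heat \<epsilon> (w - y) - heat \<epsilon> w))" x for y]
        by (simp add: nn_integral_cmult)
      finally show "(\<integral>\<^sup>+w. \<kappa> x w \<partial>lborel) \<le> ennreal (K * M / \<epsilon>)" using row' by simp
    next
      fix w
      have "(\<integral>\<^sup>+x. \<kappa> x w \<partial>lborel) = (\<integral>\<^sup>+y. (\<integral>\<^sup>+x. ennreal (norm (h y)) * ennreal (norm (heat \<epsilon> (x - w - y) - heat \<epsilon> (x - w))) \<partial>lborel) \<partial>lborel)"
        unfolding \<kappa>_def by (rule lborel_pair.Fubini') measurable
      also have "\<dots> = (\<integral>\<^sup>+y. ennreal (norm (h y)) * (\<integral>\<^sup>+w. ennreal (norm (heat \<epsilon> (w - y) - heat \<epsilon> w)) \<partial>lborel) \<partial>lborel)"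
        using nn_integral_lborel_shift(2)[of "\<lambda>w. ennreal (norm (heat \<epsilon> (w - y) - heat \<epsilon> w))" w for y]
        by (simp add: nn_integral_cmult)
      finally show "(\<integral>\<^sup>+x. \<kappa> x w \<partial>lborel) \<le> ennreal (K * M / \<epsilon>)" using row' by simp
    qed
  qed
  with K(1) that show ?thesis by blast
qed

section \<open>Tempered distributions and reflected test functions\<close>

lemma partial_derivs_add:
  fixes f g :: "real^'n::finite \<Rightarrow> 'b::real_normed_vector"
  assumes "smooth f" "smooth g"
  shows "partial_derivs ks (\<lambda>x. f x + g x) = (\<lambda>x. partial_derivs ks f x + partial_derivs ks g x)"
proof (induction ks)
  case (Cons k ks)
  show ?case unfolding partial_derivs_Cons Cons.IH
    using smooth_partials[OF assms(1), of ks] smooth_partials[OF assms(2), of ks]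
    by (intro ext partial_deriv_add smooth_differentiable)
qed simp

lemma partial_derivs_cmult:
  fixes f :: "real^'n::finite \<Rightarrow> complex"
  assumes "smooth f"
  shows "partial_derivs ks (\<lambda>x. c * f x) = (\<lambda>x. c * partial_derivs ks f x)"
proof (induction ks)
  case (Cons k ks)
  show ?case unfolding partial_derivs_Cons Cons.IH
    by (intro ext partial_deriv_bounded_linear smooth_differentiable smooth_partials assms bounded_linear_mult_right)
qed simp

lemma partial_derivs_diff:
  fixes f g :: "real^'n::finite \<Rightarrow> complex"
  assumes f: "smooth f" and g: "smooth g"
  shows "partial_derivs ks (\<lambda>x. f x - g x) = (\<lambda>x. partial_derivs ks f x - partial_derivs ks g x)"
proof -
  have "smooth (\<lambda>x. (-1) * g x)" by (rule smooth_bounded_linear[OF g bounded_linear_mult_right])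
  from partial_derivs_add[OF f this, of ks] partial_derivs_cmult[OF g, of ks "-1"]
  show ?thesis by simp
qed

lemma schwartz_zero: "schwartz (\<lambda>x :: real^'n::finite. 0)"
proof -
  have "partial_deriv i (\<lambda>_::real^'n. 0::complex) = (\<lambda>_. 0)" for i
    by (rule ext) (rule partial_deriv_eqI[OF has_derivative_const])
  then have "smooth (\<lambda>_::real^'n. 0::complex)"
    by (intro smooth_coinduct[of "\<lambda>g. g = (\<lambda>_::real^'n. 0::complex)"]) auto
  then show ?thesis by (rule schwartz_compact_support) simp
qed

lemma partial_derivs_zero: "partial_derivs ks (\<lambda>x :: real^'n::finite. 0 :: complex) = (\<lambda>x. 0)"
  using partial_derivs_cmult[OF schwartz_smooth[OF schwartz_zero], of ks 0] by simp

lemma schwartz_sum: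
  fixes f :: "'i \<Rightarrow> real^'n::finite \<Rightarrow> complex"
  assumes "\<And>i. i \<in> I \<Longrightarrow> schwartz (f i)"
  shows "schwartz (\<lambda>x. \<Sum>i\<in>I. f i x)"
  using assms
proof (induction I rule: infinite_finite_induct)
  case (insert i I)
  then show ?case using schwartz_add[of "f i" "\<lambda>x. \<Sum>i\<in>I. f i x"] by simp
qed (simp_all add: schwartz_zero)

lemma partial_derivs_sum:
  fixes f :: "'i \<Rightarrow> real^'n::finite \<Rightarrow> complex"
  assumes "\<And>i. i \<in> I \<Longrightarrow> schwartz (f i)"
  shows "partial_derivs ks (\<lambda>x. \<Sum>i\<in>I. f i x) = (\<lambda>x. \<Sum>i\<in>I. partial_derivs ks (f i) x)"
  using assms
proof (induction I rule: infinite_finite_induct)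
  case (insert i I)
  then have s: "schwartz (f i)" "schwartz (\<lambda>x. \<Sum>i\<in>I. f i x)" by (auto intro: schwartz_sum)
  have "partial_derivs ks (\<lambda>x. f i x + (\<Sum>i\<in>I. f i x)) =
      (\<lambda>x. partial_derivs ks (f i) x + partial_derivs ks (\<lambda>x. \<Sum>i\<in>I. f i x) x)"
    by (rule partial_derivs_add[OF schwartz_smooth[OF s(1)] schwartz_smooth[OF s(2)]])
  with insert show ?case by simp
qed (simp_all add: partial_derivs_zero)

lemma schwartz_shift:
  assumes "schwartz \<theta>" shows "schwartz (\<lambda>w. \<theta> (w + v))"
  using schwartz_reflect[OF schwartz_reflect[OF assms, of v], of 0] by (simp add: add.commute)

lemma partial_derivs_shift:
  fixes f :: "real^'n::finite \<Rightarrow> 'b::real_normed_vector"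
  assumes "smooth f"
  shows "partial_derivs ks (\<lambda>w. f (w + v)) = (\<lambda>w. partial_derivs ks f (w + v))"
proof (induction ks)
  case (Cons k ks)
  show ?case unfolding partial_derivs_Cons Cons.IH
    using partial_deriv_affine[OF smooth_differentiable[OF smooth_partials[OF assms, of ks]], of k v 1]
    by (simp add: fun_eq_iff add.commute)
qed simp

lemma partial_deriv_ift:
  "schwartz m \<Longrightarrow> partial_deriv i (ift m) = ift (\<lambda>\<xi>. \<i> * ((\<xi> $ i) *\<^sub>R m \<xi>))"
  using partial_deriv_eqI[OF ift_has_derivative] by (auto simp: sum_axis_scaleR)

text \<open>Mixed derivatives commute here because on the symbol side they are multiplications by
  coordinates. The derivative of a distributional pairing relies on this commutation.\<close>

lemma partial_derivs_ift:
  fixes m :: "real^'n::finite \<Rightarrow> complex"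
  assumes "schwartz m"
  shows "\<exists>m'. schwartz m' \<and> partial_derivs ks (ift m) = ift m' \<and>
     partial_derivs ks (partial_deriv i (ift m)) = partial_deriv i (ift m')"
proof (induction ks)
  case Nil then show ?case using assms by auto
next
  case (Cons k ks)
  then obtain m' where m': "schwartz m'" "partial_derivs ks (ift m) = ift m'"
     "partial_derivs ks (partial_deriv i (ift m)) = partial_deriv i (ift m')" by blast
  have s: "schwartz (\<lambda>\<xi>. \<i> * ((\<xi> $ k) *\<^sub>R m' \<xi>))" for k
    by (intro schwartz_cmult schwartz_coord_mult m')
  have "partial_deriv k (partial_deriv i (ift m')) = partial_deriv i (partial_deriv k (ift m'))"
    unfolding partial_deriv_ift[OF m'(1)] partial_deriv_ift[OF s] by (simp add: mult_ac)
  then show ?case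
    using s[of k] m' by (intro exI[of _ "\<lambda>\<xi>. \<i> * ((\<xi> $ k) *\<^sub>R m' \<xi>)"])
      (auto simp: partial_derivs_Cons partial_deriv_ift)
qed

lemma finite_multi_indices: "finite {ks :: 'n::finite list. length ks \<le> N}"
  using finite_lists_length_le[of "UNIV :: 'n set" N] by simp

text \<open>A seminorm of order \<open>N\<close> involves finitely many multi-indices, so summing
  their constants gives one bound. The parameter \<open>p\<close> bundles all points on which the
  estimate depends.\<close>

lemma uniform_multi_index_bound:
  assumes "\<And>ks :: 'n::finite list. \<exists>K::real. 0 \<le> K \<and> (\<forall>p. \<phi> ks p \<le> K * \<psi> p)" "\<And>p. 0 \<le> \<psi> p"
  obtains K :: real where "0 \<le> K" "\<And>ks p. length ks \<le> N \<Longrightarrow> \<phi> ks p \<le> K * \<psi> p"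
proof -
  from assms(1) obtain K where K: "\<And>ks. 0 \<le> K ks" "\<And>ks p. \<phi> ks p \<le> K ks * \<psi> p" by metis
  let ?K = "\<Sum>ks | length ks \<le> N. K ks"
  have "\<phi> ks p \<le> ?K * \<psi> p" if "length ks \<le> N" for ks p
  proof -
    have "K ks \<le> ?K"
      by (rule member_le_sum) (use that K(1) finite_multi_indices in auto)
    then show ?thesis using K(2)[of ks p] assms(2)[of p] by (meson mult_right_mono order_trans)
  qed
  moreover have "0 \<le> ?K" by (intro sum_nonneg K)
  ultimately show ?thesis using that by blast
qed

section \<open>Pairings of a tempered distribution with translated and averaged test
  functions\<close>

lemma tempered_lincomb:
  "tempered u \<Longrightarrow> schwartz \<theta> \<Longrightarrow> schwartz \<eta> \<Longrightarrow> u (\<lambda>x. a * \<theta> x + b * \<eta> x) = a * u \<theta> + b * u \<eta>"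
  unfolding tempered_def by blast

lemma tempered_diff:
  "tempered u \<Longrightarrow> schwartz \<theta> \<Longrightarrow> schwartz \<eta> \<Longrightarrow> u (\<lambda>x. \<theta> x - \<eta> x) = u \<theta> - u \<eta>"
  using tempered_lincomb[of u \<theta> \<eta> 1 "-1"] by simp

lemma tempered_sum:
  fixes f :: "'i \<Rightarrow> real^'n::finite \<Rightarrow> complex"
  assumes u: "tempered u" and "\<And>i. i \<in> I \<Longrightarrow> schwartz (f i)"
  shows "u (\<lambda>x. \<Sum>i\<in>I. c i * f i x) = (\<Sum>i\<in>I. c i * u (f i))"
  using assms(2)
proof (induction I rule: infinite_finite_induct)
  case (insert i I)
  have s: "schwartz (\<lambda>x. \<Sum>i\<in>I. c i * f i x)"
    using insert by (intro schwartz_sum schwartz_cmult) auto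
  have "u (\<lambda>x. c i * f i x + 1 * (\<Sum>i\<in>I. c i * f i x)) = c i * u (f i) + 1 * u (\<lambda>x. \<Sum>i\<in>I. c i * f i x)"
    by (rule tempered_lincomb[OF u _ s]) (use insert in auto)
  with insert show ?case by simp
qed (use tempered_lincomb[OF u schwartz_zero schwartz_zero, of 0 0] in simp_all)

text \<open>All test functions in use are reflections \<open>y \<mapsto> \<theta> (x - y)\<close>, as in the definition of a Fourier multiplier.\<close>

lemma tempered_bound:
  fixes u :: "'n::finite dist"
  assumes "tempered u"
  obtains M N where "0 \<le> M" "\<And>\<theta> x B. schwartz \<theta> \<Longrightarrow>
     (\<And>ks w. length ks \<le> N \<Longrightarrow> (1 + norm w) ^ N * norm (partial_derivs ks \<theta> w) \<le> B) \<Longrightarrow>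
     norm (u (\<lambda>y. \<theta> (x - y))) \<le> M * ((1 + norm x) ^ N * B)"
proof -
  from assms obtain M N where MN: "\<And>\<theta>. schwartz \<theta> \<Longrightarrow> norm (u \<theta>) \<le> M * schwartz_seminorm N \<theta>"
    unfolding tempered_def by blast
  \<comment> \<open>The constant of a tempered distribution carries no sign condition; its absolute
    value is admissible because the seminorm is nonnegative.\<close>
  have "norm (u (\<lambda>y. \<theta> (x - y))) \<le> \<bar>M\<bar> * ((1 + norm x) ^ N * B)"
    if s: "schwartz \<theta>" and B: "\<And>ks w. length ks \<le> N \<Longrightarrow> (1 + norm w) ^ N * norm (partial_derivs ks \<theta> w) \<le> B"
    for \<theta> x B
  proof -
    have B0: "0 \<le> B" using order_trans[OF norm_ge_zero B[of "[]" 0, simplified]] .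
    let ?\<theta> = "\<lambda>y. \<theta> (x - y)"
    have le: "(1 + norm y) ^ N * norm (partial_derivs ks ?\<theta> y) \<le> (1 + norm x) ^ N * B" if "length ks \<le> N" for ks y
    proof -
      have "1 + norm y \<le> (1 + norm x) * (1 + norm (x - y))"
        using one_plus_norm_add[of x "y - x"] by (simp add: norm_minus_commute)
      then have "(1 + norm y) ^ N \<le> (1 + norm x) ^ N * (1 + norm (x - y)) ^ N"
        unfolding power_mult_distrib[symmetric] by (intro power_mono) auto
      then have "(1 + norm y) ^ N * norm (partial_derivs ks ?\<theta> y) \<le>
          ((1 + norm x) ^ N * (1 + norm (x - y)) ^ N) * norm (partial_derivs ks ?\<theta> y)"
        by (rule mult_right_mono) simp
      also have "\<dots> = (1 + norm x) ^ N * ((1 + norm (x - y)) ^ N * norm (partial_derivs ks \<theta> (x - y)))"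
        by (simp add: partial_derivs_reflect[OF schwartz_smooth[OF s]] mult.assoc)
      also have "\<dots> \<le> (1 + norm x) ^ N * B"
        by (intro mult_left_mono B that) auto
      finally show ?thesis .
    qed
    have "schwartz_seminorm N ?\<theta> \<le> (1 + norm x) ^ N * B"
      unfolding schwartz_seminorm_def
      by (rule cSUP_least) (use le in \<open>auto intro: exI[of _ "[]"]\<close>)
    moreover have "0 \<le> (1 + norm x) ^ N * B" using B0 by simp
    ultimately have "M * schwartz_seminorm N ?\<theta> \<le> \<bar>M\<bar> * ((1 + norm x) ^ N * B)"
    proof -
      assume 1: "schwartz_seminorm N ?\<theta> \<le> (1 + norm x) ^ N * B"
      have "0 \<le> schwartz_seminorm N ?\<theta>"
      proof -
        have "0 \<le> (1 + norm (0::real^'n)) ^ N * norm (partial_derivs [] ?\<theta> 0)" by simp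
        also have "\<dots> \<le> schwartz_seminorm N ?\<theta>"
          unfolding schwartz_seminorm_def
          by (rule cSUP_upper2[where x = "([], 0)"]) (use le in \<open>auto simp: bdd_above_def\<close>)
        finally show ?thesis .
      qed
      then have "M * schwartz_seminorm N ?\<theta> \<le> \<bar>M\<bar> * schwartz_seminorm N ?\<theta>"
        by (intro mult_right_mono) auto
      also have "\<dots> \<le> \<bar>M\<bar> * ((1 + norm x) ^ N * B)" using 1 by (intro mult_left_mono) auto
      finally show ?thesis .
    qed
    with MN[OF schwartz_reflect[OF s, of x]] show ?thesis by linarith
  qed
  then show ?thesis using that[of "\<bar>M\<bar>" N] by simp
qed

text \<open>On the ball of radius \<open>norm z + norm a\<close> around \<open>w\<close>,
  submultiplicativity of the weight costs \<open>(1 + norm z + norm a) ^ N\<close>, so the mean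
  value bound keeps its decay in \<open>w\<close>. The triple is packed for the uniform bound over
  multi-indices.\<close>

lemma schwartz_lipschitz:
  fixes \<theta> :: "real^'n::finite \<Rightarrow> complex"
  assumes s: "schwartz \<theta>"
  shows "\<exists>K. 0 \<le> K \<and> (\<forall>p. (case p of (w, z, a) \<Rightarrow> (1 + norm w) ^ N * norm (\<theta> (w - z) - \<theta> (w - a)))
     \<le> K * (case p of (w, z, a) \<Rightarrow> norm (z - a) * (1 + norm z + norm a) ^ N))"
proof -
  have "\<exists>C\<ge>0. \<forall>x. (1 + norm x) ^ N * norm (partial_deriv i \<theta> x) \<le> C" for i
    using rapidD[OF schwartz_rapid[OF schwartz_partial[OF s]]] by metis
  then obtain C where C: "\<And>i. 0 \<le> C i" "\<And>i x. (1 + norm x) ^ N * norm (partial_deriv i \<theta> x) \<le> C i" by metis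
  define D where "D = (\<Sum>i\<in>UNIV. C i)"
  have CD: "C i \<le> D" for i unfolding D_def by (rule member_le_sum) (use C in auto)
  have D0: "0 \<le> D" unfolding D_def by (intro sum_nonneg C)
  have "(1 + norm w) ^ N * norm (\<theta> (w - z) - \<theta> (w - a)) \<le>
      (real CARD('n) * D) * (norm (z - a) * (1 + norm z + norm a) ^ N)" for w z a
  proof -
    have pw: "0 < (1 + norm w) ^ N" by (simp add: add_pos_nonneg)
    have "norm (\<theta> (w - z) - \<theta> (w - a)) \<le>
       real CARD('n) * (D * (1 + norm z + norm a) ^ N / (1 + norm w) ^ N) * norm ((w - z) - (w - a))"
    proof (rule partial_mean_value[of "cball w (norm z + norm a)"])
      show "w - z \<in> cball w (norm z + norm a)" "w - a \<in> cball w (norm z + norm a)"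
        by (auto simp: dist_norm)
      fix i c assume c: "c \<in> cball w (norm z + norm a)"
      show "\<theta> differentiable (at c)" by (intro smooth_differentiable schwartz_smooth s)
      have "1 + norm w \<le> (1 + norm (w - c)) * (1 + norm c)"
        using one_plus_norm_add[of "w - c" c] by simp
      also have "\<dots> \<le> (1 + norm z + norm a) * (1 + norm c)"
        using c by (intro mult_right_mono) (auto simp: dist_norm)
      finally have "(1 + norm w) ^ N \<le> (1 + norm z + norm a) ^ N * (1 + norm c) ^ N"
        unfolding power_mult_distrib[symmetric] by (intro power_mono) auto
      then have "(1 + norm w) ^ N * norm (partial_deriv i \<theta> c) \<le>
          ((1 + norm z + norm a) ^ N * (1 + norm c) ^ N) * norm (partial_deriv i \<theta> c)"
        by (rule mult_right_mono) simp
      also have "\<dots> = (1 + norm z + norm a) ^ N * ((1 + norm c) ^ N * norm (partial_deriv i \<theta> c))"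
        by (rule mult.assoc)
      also have "\<dots> \<le> (1 + norm z + norm a) ^ N * D"
        by (intro mult_left_mono order_trans[OF C(2) CD]) auto
      finally show "norm (partial_deriv i \<theta> c) \<le> D * (1 + norm z + norm a) ^ N / (1 + norm w) ^ N"
        using pw by (simp add: field_simps)
    qed simp
    then show ?thesis using pw by (simp add: field_simps norm_minus_commute)
  qed
  then show ?thesis using D0 by (intro exI[of _ "real CARD('n) * D"]) auto
qed


lemma schwartz_lipschitz_uniform:
  fixes \<theta> :: "real^'n::finite \<Rightarrow> complex"
  assumes s: "schwartz \<theta>"
  obtains K where "0 \<le> K" "\<And>ks w z a. length ks \<le> N \<Longrightarrow>
      (1 + norm w) ^ N * norm (partial_derivs ks \<theta> (w - z) - partial_derivs ks \<theta> (w - a))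
      \<le> K * (norm (z - a) * (1 + norm z + norm a) ^ N)"
proof -
  let ?\<psi> = "\<lambda>p :: (real^'n) \<times> (real^'n) \<times> (real^'n). case p of (w, z, a) \<Rightarrow> norm (z - a) * (1 + norm z + norm a) ^ N"
  have nn: "0 \<le> ?\<psi> p" for p by (auto split: prod.split)
  define \<phi> where "\<phi> = (\<lambda>ks (p :: (real^'n) \<times> (real^'n) \<times> (real^'n)).
     case p of (w, z, a) \<Rightarrow> (1 + norm w) ^ N * norm (partial_derivs ks \<theta> (w - z) - partial_derivs ks \<theta> (w - a)))"
  have ex: "\<exists>K. 0 \<le> K \<and> (\<forall>p. \<phi> ks p \<le> K * ?\<psi> p)" for ks
    unfolding \<phi>_def by (rule schwartz_lipschitz[OF schwartz_partials[OF s]])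
  obtain K where K: "0 \<le> K" and le: "\<And>ks p. length ks \<le> N \<Longrightarrow> \<phi> ks p \<le> K * ?\<psi> p"
    using uniform_multi_index_bound[of \<phi>, OF ex nn, of N] by blast
  show ?thesis
  proof (rule that[OF K])
    fix ks :: "'n list" and w z a :: "real^'n" assume "length ks \<le> N"
    from le[OF this, of "(w, z, a)"]
    show "(1 + norm w) ^ N * norm (partial_derivs ks \<theta> (w - z) - partial_derivs ks \<theta> (w - a))
      \<le> K * (norm (z - a) * (1 + norm z + norm a) ^ N)" by (simp add: \<phi>_def)
  qed
qed

text \<open>Only the Schwartz factor is differentiated: its Taylor remainder is uniform in the base
  point, so integrability of \<open>k\<close> suffices.\<close>

lemma conv_has_derivative:
  fixes \<theta> :: "real^'n::finite \<Rightarrow> complex"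
  assumes k: "integrable lborel k" and s: "schwartz \<theta>"
  shows "(conv k \<theta> has_derivative (\<lambda>v. \<Sum>i\<in>UNIV. (v $ i) *\<^sub>R conv k (partial_deriv i \<theta>) x)) (at x)"
proof -
  obtain K where K: "K \<ge> 0" "\<And>x v. norm v \<le> 1 \<Longrightarrow>
    (1 + norm x) ^ 0 * norm (\<theta> (x + v) - \<theta> x - (\<Sum>i\<in>UNIV. (v $ i) *\<^sub>R partial_deriv i \<theta> x)) \<le> K * (norm v)\<^sup>2"
    using schwartz_taylor[OF s] by blast
  have bm: "bdd_meas \<eta>" if "schwartz \<eta>" for \<eta> :: "real^'n \<Rightarrow> complex"
    using rapid_bounded[OF schwartz_rapid[OF that]] rapid_measurable[OF schwartz_rapid[OF that]]
    unfolding bdd_meas_def by metis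
  show ?thesis
  proof (rule has_derivative_quadratic)
    show "bounded_linear (\<lambda>v. \<Sum>i\<in>UNIV. (v $ i) *\<^sub>R conv k (partial_deriv i \<theta>) x)"
      by (intro bounded_linear_sum bounded_linear_compose[OF bounded_linear_scaleR_left bounded_linear_vec_nth])
    fix v :: "real^'n" assume v: "norm v \<le> 1"
    let ?r = "\<lambda>z. k z * (\<theta> (x - z + v) - \<theta> (x - z) - (\<Sum>i\<in>UNIV. (v $ i) *\<^sub>R partial_deriv i \<theta> (x - z)))"
    have "has_bochner_integral lborel (\<lambda>z. k z * \<theta> (x + v - z) - k z * \<theta> (x - z) -
        (\<Sum>i\<in>UNIV. (v $ i) *\<^sub>R (k z * partial_deriv i \<theta> (x - z))))
      (conv k \<theta> (x + v) - conv k \<theta> x - (\<Sum>i\<in>UNIV. (v $ i) *\<^sub>R conv k (partial_deriv i \<theta>) x))"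
      unfolding conv_def
      by (intro has_bochner_integral_diff has_bochner_integral_sum has_bochner_integral_scaleR_right
          has_bochner_integral_integrable integrable_mult_bdd_meas(1)[OF k] bm s schwartz_partial)
    moreover have "k z * \<theta> (x + v - z) - k z * \<theta> (x - z) -
        (\<Sum>i\<in>UNIV. (v $ i) *\<^sub>R (k z * partial_deriv i \<theta> (x - z))) = ?r z" for z
      by (simp add: right_diff_distrib sum_distrib_left add_diff_eq diff_add_eq)
    ultimately have B: "has_bochner_integral lborel ?r
      (conv k \<theta> (x + v) - conv k \<theta> x - (\<Sum>i\<in>UNIV. (v $ i) *\<^sub>R conv k (partial_deriv i \<theta>) x))"
      by simp
    have "norm (\<integral>z. ?r z \<partial>lborel) \<le> (\<integral>z. (K * (norm v)\<^sup>2) * norm (k z) \<partial>lborel)"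
    proof (rule Bochner_Integration.integral_norm_bound_integral)
      show "integrable lborel ?r" using B by (rule integrable.intros)
      show "integrable lborel (\<lambda>z. (K * (norm v)\<^sup>2) * norm (k z))" using k by auto
      fix z
      have "norm (\<theta> (x - z + v) - \<theta> (x - z) - (\<Sum>i\<in>UNIV. (v $ i) *\<^sub>R partial_deriv i \<theta> (x - z))) \<le> K * (norm v)\<^sup>2"
        using K(2)[OF v, of "x - z"] by simp
      then show "norm (?r z) \<le> (K * (norm v)\<^sup>2) * norm (k z)"
        unfolding norm_mult mult.commute[of "K * (norm v)\<^sup>2"] by (intro mult_left_mono) auto
    qed
    then show "norm (conv k \<theta> (x + v) - conv k \<theta> x - (\<Sum>i\<in>UNIV. (v $ i) *\<^sub>R conv k (partial_deriv i \<theta>) x))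
       \<le> (K * (\<integral>z. norm (k z) \<partial>lborel)) * (norm v)\<^sup>2"
      unfolding has_bochner_integral_integral_eq[OF B] by (simp add: mult_ac)
  qed
qed

lemma partial_deriv_conv:
  assumes "integrable lborel k" "schwartz \<theta>"
  shows "partial_deriv i (conv k \<theta>) = conv k (partial_deriv i \<theta>)"
  using partial_deriv_eqI[OF conv_has_derivative[OF assms], of i] by (auto simp: sum_axis_scaleR)

lemma partial_derivs_conv:
  assumes "integrable lborel k" "schwartz \<theta>"
  shows "partial_derivs ks (conv k \<theta>) = conv k (partial_derivs ks \<theta>)"
  by (induction ks) (auto simp: partial_derivs_Cons partial_deriv_conv assms schwartz_partials)

text \<open>All derivatives fall on \<theta>, and the weight at \<open>x\<close> splits into a
  weight at \<open>z\<close> and one at \<open>x - z\<close>, paid by the decay of \<open>k\<close>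
  and of \<theta>.\<close>

lemma schwartz_conv:
  fixes k \<theta> :: "real^'n::finite \<Rightarrow> complex"
  assumes k: "rapid k" and s: "schwartz \<theta>"
  shows "schwartz (conv k \<theta>)"
proof -
  have ki: "integrable lborel k" by (rule rapid_integrable[OF k])
  let ?P = "\<lambda>q :: real^'n \<Rightarrow> complex. \<exists>\<eta>. schwartz \<eta> \<and> q = conv k \<eta>"
  have "?P (conv k \<theta>)" using s by blast
  then show ?thesis
  proof (rule schwartz_coinduct[of ?P])
    fix g :: "real^'n \<Rightarrow> complex" and x assume "?P g"
    then show "g differentiable (at x)" using conv_has_derivative[OF ki] unfolding differentiable_def by blast
  next
    fix g :: "real^'n \<Rightarrow> complex" and i assume "?P g"
    then obtain \<eta> where \<eta>: "schwartz \<eta>" "g = conv k \<eta>" by blast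
    then show "?P (partial_deriv i g)"
      using partial_deriv_conv[OF ki \<eta>(1), of i] schwartz_partial[OF \<eta>(1), of i] by auto
  next
    fix g :: "real^'n \<Rightarrow> complex" and N :: nat assume "?P g"
    then obtain \<eta> where \<eta>: "schwartz \<eta>" "g = conv k \<eta>" by blast
    obtain C where C: "C \<ge> 0" "\<And>x. (1 + norm x) ^ N * norm (\<eta> x) \<le> C"
      using rapidD[OF schwartz_rapid[OF \<eta>(1)]] by blast
    have [measurable]: "k \<in> borel_measurable borel" "\<eta> \<in> borel_measurable borel"
      using rapid_measurable k schwartz_rapid[OF \<eta>(1)] by blast+
    have wk: "integrable lborel (\<lambda>z. (1 + norm z) ^ N * norm (k z))" by (rule rapid_integrable_weighted[OF k])
    have "(1 + norm x) ^ N * norm (g x) \<le> (\<integral>z. C * ((1 + norm z) ^ N * norm (k z)) \<partial>lborel)" for x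
    proof -
      have le: "norm (complex_of_real ((1 + norm x) ^ N) * (k z * \<eta> (x - z))) \<le> C * ((1 + norm z) ^ N * norm (k z))" for z
      proof -
        have "1 + norm x \<le> (1 + norm z) * (1 + norm (x - z))"
          using one_plus_norm_add[of z "x - z"] by simp
        then have "(1 + norm x) ^ N \<le> (1 + norm z) ^ N * (1 + norm (x - z)) ^ N"
          unfolding power_mult_distrib[symmetric] by (intro power_mono) auto
        then have "(1 + norm x) ^ N * norm (k z * \<eta> (x - z)) \<le>
           ((1 + norm z) ^ N * (1 + norm (x - z)) ^ N) * norm (k z * \<eta> (x - z))"
          by (rule mult_right_mono) simp
        also have "\<dots> = ((1 + norm z) ^ N * norm (k z)) * ((1 + norm (x - z)) ^ N * norm (\<eta> (x - z)))"
          by (simp add: norm_mult mult_ac)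
        also have "\<dots> \<le> ((1 + norm z) ^ N * norm (k z)) * C"
          by (intro mult_left_mono C) auto
        finally show ?thesis unfolding norm_mult[of "complex_of_real _"] norm_of_real by (simp add: mult_ac)
      qed
      have "(1 + norm x) ^ N * norm (g x) = norm (\<integral>z. complex_of_real ((1 + norm x) ^ N) * (k z * \<eta> (x - z)) \<partial>lborel)"
        unfolding \<eta>(2) conv_def unfolding integral_mult_right_zero norm_mult[of "complex_of_real _"] norm_of_real by simp
      also have "\<dots> \<le> (\<integral>z. C * ((1 + norm z) ^ N * norm (k z)) \<partial>lborel)"
      proof (rule Bochner_Integration.integral_norm_bound_integral)
        show i: "integrable lborel (\<lambda>z. C * ((1 + norm z) ^ N * norm (k z)))" using wk by (rule integrable_mult_right)
        show "integrable lborel (\<lambda>z. complex_of_real ((1 + norm x) ^ N) * (k z * \<eta> (x - z)))"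
        proof (rule Bochner_Integration.integrable_bound[OF i])
          show "AE z in lborel. norm (complex_of_real ((1 + norm x) ^ N) * (k z * \<eta> (x - z))) \<le>
             norm (C * ((1 + norm z) ^ N * norm (k z)))"
            by (rule AE_I2) (rule order_trans[OF le], simp)
        qed measurable
      qed (rule le)
      finally show ?thesis .
    qed
    then show "\<exists>C. \<forall>x. (1 + norm x) ^ N * norm (g x) \<le> C" by blast
  qed
qed

text \<open>Moving the centre of a reflected test function changes every relevant seminorm by a
  multiple of the distance. The polynomial growth in \<open>z\<close> and \<open>a\<close> is
  harmless when integrated against a rapidly decreasing kernel.\<close>

lemma tempered_lipschitz:
  fixes u :: "'n::finite dist"
  assumes u: "tempered u" and s: "schwartz \<theta>"
  obtains K N where "0 \<le> K" "\<And>x z a. norm (u (\<lambda>y. \<theta> (x - z - y)) - u (\<lambda>y. \<theta> (x - a - y)))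
    \<le> K * (1 + norm x) ^ N * (norm (z - a) * (1 + norm z + norm a) ^ N)"
proof -
  obtain M N where M: "0 \<le> M" "\<And>\<theta> x B. schwartz \<theta> \<Longrightarrow>
     (\<And>ks w. length ks \<le> N \<Longrightarrow> (1 + norm w) ^ N * norm (partial_derivs ks \<theta> w) \<le> B) \<Longrightarrow>
     norm (u (\<lambda>y. \<theta> (x - y))) \<le> M * ((1 + norm x) ^ N * B)"
    using tempered_bound[OF u] by blast
  obtain K where K: "0 \<le> K" "\<And>ks w z a. length ks \<le> N \<Longrightarrow>
      (1 + norm w) ^ N * norm (partial_derivs ks \<theta> (w - z) - partial_derivs ks \<theta> (w - a))
      \<le> K * (norm (z - a) * (1 + norm z + norm a) ^ N)"
    using schwartz_lipschitz_uniform[OF s] by blast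
  have "norm (u (\<lambda>y. \<theta> (x - z - y)) - u (\<lambda>y. \<theta> (x - a - y)))
    \<le> M * ((1 + norm x) ^ N * (K * (norm (z - a) * (1 + norm z + norm a) ^ N)))" for x z a
  proof -
    let ?t = "\<lambda>c w. \<theta> (w - c)"
    have sc: "schwartz (?t c)" for c using schwartz_shift[OF s, of "- c"] by simp
    have pc: "partial_derivs ks (?t c) = (\<lambda>w. partial_derivs ks \<theta> (w - c))" for ks c
      using partial_derivs_shift[OF schwartz_smooth[OF s], of ks "- c"] by simp
    have e: "x - z - y = x - y - z" "x - a - y = x - y - a" for y by (simp_all add: algebra_simps)
    have "u (\<lambda>y. \<theta> (x - z - y)) - u (\<lambda>y. \<theta> (x - a - y)) = u (\<lambda>y. (\<lambda>w. ?t z w - ?t a w) (x - y))"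
      using tempered_diff[OF u schwartz_reflect[OF sc[of z], of x] schwartz_reflect[OF sc[of a], of x]]
      by (simp only: e)
    also have "norm \<dots> \<le> M * ((1 + norm x) ^ N * (K * (norm (z - a) * (1 + norm z + norm a) ^ N)))"
    proof (rule M(2))
      show "schwartz (\<lambda>w. ?t z w - ?t a w)" by (intro schwartz_diff sc)
      fix ks :: "'n list" and w assume "length ks \<le> N"
      from K(2)[OF this, of w z a]
      show "(1 + norm w) ^ N * norm (partial_derivs ks (\<lambda>w. ?t z w - ?t a w) w) \<le>
          K * (norm (z - a) * (1 + norm z + norm a) ^ N)"
        unfolding partial_derivs_diff[OF schwartz_smooth[OF sc] schwartz_smooth[OF sc]] pc by simp
    qed
    finally show ?thesis .
  qed
  then show ?thesis using that[of "M * K" N] M(1) K(1) by (simp add: mult_ac)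
qed

text \<open>Continuity in the centre is the source of measurability for the blocks.\<close>

lemma tempered_continuous:
  fixes u :: "'n::finite dist"
  assumes u: "tempered u" and s: "schwartz \<theta>"
  shows "continuous_on UNIV (\<lambda>x. u (\<lambda>y. \<theta> (x - y)))"
proof -
  obtain K N where K: "0 \<le> K" "\<And>x z a. norm (u (\<lambda>y. \<theta> (x - z - y)) - u (\<lambda>y. \<theta> (x - a - y)))
    \<le> K * (1 + norm x) ^ N * (norm (z - a) * (1 + norm z + norm a) ^ N)"
    using tempered_lipschitz[OF u s] by blast
  have "((\<lambda>x. u (\<lambda>y. \<theta> (x - y))) \<longlongrightarrow> u (\<lambda>y. \<theta> (p - y))) (at p)" for p
  proof (rule Lim_null[THEN iffD2], rule Lim_null_comparison)
    show "\<forall>\<^sub>F x in at p. norm (u (\<lambda>y. \<theta> (x - y)) - u (\<lambda>y. \<theta> (p - y)))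
        \<le> K * (norm (p - x) * (1 + norm x + norm p) ^ N)"
      using K(2)[of 0 "- x" "- p" for x] by (intro always_eventually allI) simp
    show "((\<lambda>x. K * (norm (p - x) * (1 + norm x + norm p) ^ N)) \<longlongrightarrow> 0) (at p)"
      by (auto intro!: tendsto_eq_intros)
  qed
  then show ?thesis by (simp add: continuous_on_def)
qed

text \<open>Interchange of \<open>u\<close> with an integral: discretise the integration variable by simple functions
  \<open>r n\<close> converging to the identity, so that linearity applies, and pass to the limit.\<close>

lemma tempered_conv:
  fixes u :: "'n::finite dist"
  assumes u: "tempered u" and k: "rapid k" and s: "schwartz \<theta>"
  shows "u (\<lambda>y. conv k \<theta> (x - y)) = conv k (\<lambda>p. u (\<lambda>y. \<theta> (p - y))) x"
proof -
  let ?U = "\<lambda>p. u (\<lambda>y. \<theta> (p - y))"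
  have ki: "integrable lborel k" by (rule rapid_integrable[OF k])
  obtain M N where M: "0 \<le> M" "\<And>\<theta> x B. schwartz \<theta> \<Longrightarrow>
     (\<And>ks w. length ks \<le> N \<Longrightarrow> (1 + norm w) ^ N * norm (partial_derivs ks \<theta> w) \<le> B) \<Longrightarrow>
     norm (u (\<lambda>y. \<theta> (x - y))) \<le> M * ((1 + norm x) ^ N * B)"
    using tempered_bound[OF u] by blast
  obtain K where K: "0 \<le> K" "\<And>ks w z a. length ks \<le> N \<Longrightarrow>
      (1 + norm w) ^ N * norm (partial_derivs ks \<theta> (w - z) - partial_derivs ks \<theta> (w - a))
      \<le> K * (norm (z - a) * (1 + norm z + norm a) ^ N)"
    using schwartz_lipschitz_uniform[OF s] by blast
  obtain K' N' where K': "0 \<le> K'" "\<And>x z a. norm (?U (x - z) - ?U (x - a))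
    \<le> K' * (1 + norm x) ^ N' * (norm (z - a) * (1 + norm z + norm a) ^ N')"
    using tempered_lipschitz[OF u s] by blast
  have [measurable]: "?U \<in> borel_measurable borel"
    by (intro borel_measurable_continuous_onI tempered_continuous u s)
  have [measurable]: "k \<in> borel_measurable borel" by (rule rapid_measurable[OF k])
  have "(\<lambda>x::real^'n. x) \<in> borel_measurable borel" by measurable
  \<comment> \<open>Choosing 0 as base point yields \<open>norm (r n z) \<le> 2 * norm z\<close>, so
    discretised integrands have a dominating function that does not depend on
    \<open>n\<close>.\<close>
  from borel_measurable_implies_sequence_metric[OF this, of 0]
  obtain r :: "nat \<Rightarrow> real^'n \<Rightarrow> real^'n" where r: "\<And>n. simple_function borel (r n)" "\<And>z. (\<lambda>n. r n z) \<longlonglongrightarrow> z"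
      "\<And>n z. norm (r n z) \<le> 2 * norm z"
    by (auto simp: dist_norm)
  have [measurable]: "r n \<in> borel_measurable borel" for n using r(1) by (rule borel_measurable_simple_function)
  have fin: "finite (range (r n))" for n using simple_functionD(1)[OF r(1)[of n]] by simp
  have [measurable]: "{z. r n z = a} \<in> sets borel" for n a by measurable
  \<comment> \<open>The discretisation error of the identity, weighted by \<open>k\<close>. The
    exponent \<open>L\<close> stays free because the seminorm side and the value side come with
    different orders \<open>N\<close> and \<open>N'\<close>.\<close>
  define E where "E = (\<lambda>L n. \<integral>z. norm (k z) * (norm (z - r n z) * (1 + norm z + norm (r n z)) ^ L) \<partial>lborel)"
  have bnd: "norm (k z) * (norm (z - r n z) * (1 + norm z + norm (r n z)) ^ L) \<le>
      3 ^ Suc L * ((1 + norm z) ^ Suc L * norm (k z))" for L n z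
  proof -
    have "norm (z - r n z) \<le> 3 * (1 + norm z)"
      using norm_triangle_ineq4[of z "r n z"] r(3)[of n z] unfolding distrib_left by linarith
    moreover have "(1 + norm z + norm (r n z)) ^ L \<le> (3 * (1 + norm z)) ^ L"
      using r(3)[of n z] by (intro power_mono) auto
    ultimately have "norm (z - r n z) * (1 + norm z + norm (r n z)) ^ L \<le> (3 * (1 + norm z)) * (3 * (1 + norm z)) ^ L"
      by (intro mult_mono) auto
    then have "norm (k z) * (norm (z - r n z) * (1 + norm z + norm (r n z)) ^ L) \<le>
       norm (k z) * ((3 * (1 + norm z)) * (3 * (1 + norm z)) ^ L)"
      by (rule mult_left_mono) simp
    then show ?thesis unfolding power_mult_distrib power_Suc by (simp only: mult_ac)
  qed
  have dom: "integrable lborel (\<lambda>z. 3 ^ Suc L * ((1 + norm z) ^ Suc L * norm (k z)))" for L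
    by (intro integrable_mult_right rapid_integrable_weighted k)
  have Eint: "integrable lborel (\<lambda>z. norm (k z) * (norm (z - r n z) * (1 + norm z + norm (r n z)) ^ L))" for L n
  proof (rule Bochner_Integration.integrable_bound[OF dom[of L]])
    show "AE z in lborel. norm (norm (k z) * (norm (z - r n z) * (1 + norm z + norm (r n z)) ^ L)) \<le>
        norm (3 ^ Suc L * ((1 + norm z) ^ Suc L * norm (k z)))"
    proof (rule AE_I2)
      fix z
      show "norm (norm (k z) * (norm (z - r n z) * (1 + norm z + norm (r n z)) ^ L)) \<le>
        norm (3 ^ Suc L * ((1 + norm z) ^ Suc L * norm (k z)))"
        using bnd[of z n L] by (simp only: real_norm_def abs_of_nonneg[of "_ * _"] mult_nonneg_nonneg norm_ge_zero
            zero_le_power add_nonneg_nonneg zero_le_one zero_le_numeral)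
    qed
  qed measurable
  have Elim: "E L \<longlonglongrightarrow> 0" for L
  proof -
    have "E L \<longlonglongrightarrow> (\<integral>z. 0 \<partial>(lborel :: (real^'n) measure))" unfolding E_def
    proof (rule integral_dominated_convergence[OF _ _ dom[of L]])
      show "AE z in lborel. (\<lambda>n. norm (k z) * (norm (z - r n z) * (1 + norm z + norm (r n z)) ^ L)) \<longlonglongrightarrow> 0"
        by (intro AE_I2) (auto intro!: tendsto_eq_intros r(2))
      show "AE z in lborel. norm (norm (k z) * (norm (z - r n z) * (1 + norm z + norm (r n z)) ^ L)) \<le>
        3 ^ Suc L * ((1 + norm z) ^ Suc L * norm (k z))" for n
      proof (rule AE_I2)
        fix z
        show "norm (norm (k z) * (norm (z - r n z) * (1 + norm z + norm (r n z)) ^ L)) \<le>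
          3 ^ Suc L * ((1 + norm z) ^ Suc L * norm (k z))"
          using bnd[of z n L] by (simp only: real_norm_def abs_of_nonneg[of "_ * _"] mult_nonneg_nonneg norm_ge_zero
            zero_le_power add_nonneg_nonneg zero_le_one)
      qed
    qed measurable
    then show ?thesis by simp
  qed
  \<comment> \<open>The mass of \<open>k\<close> on each level set of \<open>r n\<close>: it is the
    coefficient of the translate by \<open>a\<close> in the discretised convolution.\<close>
  define c where "c = (\<lambda>n a. \<integral>z. k z * indicator {z. r n z = a} z \<partial>lborel)"
  have disc: "integrable lborel (\<lambda>z. k z * \<phi> (r n z))"
      "(\<integral>z. k z * \<phi> (r n z) \<partial>lborel) = (\<Sum>a\<in>range (r n). c n a * \<phi> a)" for \<phi> :: "real^'n \<Rightarrow> complex" and n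
  proof -
    have eq: "k z * \<phi> (r n z) = (\<Sum>a\<in>range (r n). \<phi> a * (k z * indicator {z. r n z = a} z))" for z
    proof -
      have "(\<Sum>a\<in>range (r n). \<phi> a * (k z * indicator {z. r n z = a} z)) =
          (\<Sum>a\<in>range (r n). if a = r n z then \<phi> a * k z else 0)"
        by (intro sum.cong refl) (auto simp: indicator_def)
      also have "\<dots> = k z * \<phi> (r n z)" using fin[of n] by simp
      finally show ?thesis by simp
    qed
    have i: "integrable lborel (\<lambda>z. k z * indicator {z. r n z = a} z)" for a
      by (rule Bochner_Integration.integrable_bound[OF ki]) (auto simp: norm_mult indicator_def)
    show "integrable lborel (\<lambda>z. k z * \<phi> (r n z))"
      unfolding eq by (intro Bochner_Integration.integrable_sum integrable_mult_right i)
    show "(\<integral>z. k z * \<phi> (r n z) \<partial>lborel) = (\<Sum>a\<in>range (r n). c n a * \<phi> a)"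
      unfolding eq c_def by (subst Bochner_Integration.integral_sum) (auto intro!: integrable_mult_right i simp: mult.commute)
  qed
  let ?t = "\<lambda>c w. \<theta> (w - c)"
  have sc: "schwartz (?t c)" for c using schwartz_shift[OF s, of "- c"] by simp
  have pc: "partial_derivs ks (?t c) = (\<lambda>w. partial_derivs ks \<theta> (w - c))" for ks c
    using partial_derivs_shift[OF schwartz_smooth[OF s], of ks "- c"] by simp
  define F where "F = (\<lambda>n w. \<Sum>a\<in>range (r n). c n a * ?t a w)"
  have sF: "schwartz (F n)" for n unfolding F_def by (intro schwartz_sum schwartz_cmult sc)
  have pF: "partial_derivs ks (F n) w = (\<integral>z. k z * partial_derivs ks \<theta> (w - r n z) \<partial>lborel)" for ks n w
  proof -
    have "partial_derivs ks (F n) = (\<lambda>w. \<Sum>a\<in>range (r n). partial_derivs ks (\<lambda>w. c n a * ?t a w) w)"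
      unfolding F_def by (intro partial_derivs_sum schwartz_cmult sc)
    then show ?thesis
      by (simp add: partial_derivs_cmult[OF schwartz_smooth[OF sc]] pc disc(2)[of "\<lambda>a. partial_derivs ks \<theta> (w - a)"])
  qed
  have uF: "u (\<lambda>y. F n (x - y)) = (\<integral>z. k z * ?U (x - r n z) \<partial>lborel)" for n
  proof -
    have "u (\<lambda>y. F n (x - y)) = (\<Sum>a\<in>range (r n). c n a * u (\<lambda>y. ?t a (x - y)))"
      unfolding F_def by (intro tempered_sum u schwartz_reflect sc)
    moreover have "(\<lambda>y. \<theta> (x - y - a)) = (\<lambda>y. \<theta> (x - a - y))" for a
      by (rule ext) (simp add: algebra_simps)
    ultimately show ?thesis by (simp only: disc(2)[of "\<lambda>a. ?U (x - a)"])
  qed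
  have sconv: "schwartz (conv k \<theta>)" by (rule schwartz_conv[OF k s])
  \<comment> \<open>Seminorm side: in the seminorms that control \<open>u\<close>, the convolution
    and its finite discretisation \<open>F n\<close> differ by at most a multiple of
    \<open>E N n\<close>.\<close>
  have est1: "norm (u (\<lambda>y. conv k \<theta> (x - y)) - u (\<lambda>y. F n (x - y))) \<le> M * ((1 + norm x) ^ N * (K * E N n))" for n
  proof -
    have "u (\<lambda>y. conv k \<theta> (x - y)) - u (\<lambda>y. F n (x - y)) = u (\<lambda>y. (\<lambda>w. conv k \<theta> w - F n w) (x - y))"
      by (rule tempered_diff[OF u schwartz_reflect[OF sconv] schwartz_reflect[OF sF], symmetric])
    also have "norm \<dots> \<le> M * ((1 + norm x) ^ N * (K * E N n))"
    proof (rule M(2))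
      show "schwartz (\<lambda>w. conv k \<theta> w - F n w)" by (intro schwartz_diff sconv sF)
      fix ks :: "'n list" and w assume ks: "length ks \<le> N"
      let ?\<Phi> = "partial_derivs ks \<theta>"
      have bm: "bdd_meas ?\<Phi>"
        using rapid_bounded[OF schwartz_rapid[OF schwartz_partials[OF s]]]
          rapid_measurable[OF schwartz_rapid[OF schwartz_partials[OF s]]]
        unfolding bdd_meas_def by metis
      have 1: "partial_derivs ks (\<lambda>w. conv k \<theta> w - F n w) w = (\<integral>z. k z * ?\<Phi> (w - z) - k z * ?\<Phi> (w - r n z) \<partial>lborel)"
        unfolding partial_derivs_diff[OF schwartz_smooth[OF sconv] schwartz_smooth[OF sF]]
          partial_derivs_conv[OF ki s] pF conv_def[of k ?\<Phi>]
        by (intro Bochner_Integration.integral_diff[symmetric] integrable_mult_bdd_meas(1)[OF ki bm] disc(1)[of "\<lambda>a. ?\<Phi> (w - a)"])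
      have "norm (complex_of_real ((1 + norm w) ^ N) * (\<integral>z. k z * ?\<Phi> (w - z) - k z * ?\<Phi> (w - r n z) \<partial>lborel))
         = norm (\<integral>z. complex_of_real ((1 + norm w) ^ N) * (k z * ?\<Phi> (w - z) - k z * ?\<Phi> (w - r n z)) \<partial>lborel)"
        by simp
      also have "\<dots> \<le> (\<integral>z. K * (norm (k z) * (norm (z - r n z) * (1 + norm z + norm (r n z)) ^ N)) \<partial>lborel)"
      proof (rule Bochner_Integration.integral_norm_bound_integral)
        show "integrable lborel (\<lambda>z. complex_of_real ((1 + norm w) ^ N) * (k z * ?\<Phi> (w - z) - k z * ?\<Phi> (w - r n z)))"
          by (intro integrable_mult_right Bochner_Integration.integrable_diff integrable_mult_bdd_meas(1)[OF ki bm] disc(1)[of "\<lambda>a. ?\<Phi> (w - a)"])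
        show "integrable lborel (\<lambda>z. K * (norm (k z) * (norm (z - r n z) * (1 + norm z + norm (r n z)) ^ N)))"
          by (intro integrable_mult_right Eint)
        fix z
        have "norm (k z) * ((1 + norm w) ^ N * norm (?\<Phi> (w - z) - ?\<Phi> (w - r n z))) \<le>
           norm (k z) * (K * (norm (z - r n z) * (1 + norm z + norm (r n z)) ^ N))"
          using K(2)[OF ks, of w z "r n z"] by (intro mult_left_mono) auto
        then show "norm (complex_of_real ((1 + norm w) ^ N) * (k z * ?\<Phi> (w - z) - k z * ?\<Phi> (w - r n z))) \<le>
           K * (norm (k z) * (norm (z - r n z) * (1 + norm z + norm (r n z)) ^ N))"
          unfolding right_diff_distrib[symmetric] norm_mult norm_of_real by (simp add: mult_ac)
      qed
      also have "\<dots> = K * E N n" by (simp add: E_def)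
      finally show "(1 + norm w) ^ N * norm (partial_derivs ks (\<lambda>w. conv k \<theta> w - F n w) w) \<le> K * E N n"
        unfolding 1 norm_mult norm_of_real by simp
    qed
    finally show ?thesis .
  qed
  \<comment> \<open>Value side: the Lipschitz bound compares the integral of the pairings with its
    discretisation. This also supplies integrability, since the discretised integrand is a finite
    sum of integrable pieces.\<close>
  have iU: "integrable lborel (\<lambda>z. k z * ?U (x - z))" and est2:
    "norm (conv k ?U x - u (\<lambda>y. F n (x - y))) \<le> K' * (1 + norm x) ^ N' * E N' n" for n
  proof -
    let ?d = "\<lambda>z. k z * (?U (x - z) - ?U (x - r n z))"
    have le: "norm (?d z) \<le> (K' * (1 + norm x) ^ N') * (norm (k z) * (norm (z - r n z) * (1 + norm z + norm (r n z)) ^ N'))" for z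
      unfolding norm_mult
      using mult_left_mono[OF K'(2)[of x z "r n z"], of "norm (k z)"] by (simp add: mult_ac)
    have i2: "integrable lborel (\<lambda>z. (K' * (1 + norm x) ^ N') * (norm (k z) * (norm (z - r n z) * (1 + norm z + norm (r n z)) ^ N')))"
      by (intro integrable_mult_right Eint)
    have id: "integrable lborel ?d"
    proof (rule Bochner_Integration.integrable_bound[OF i2])
      show "AE z in lborel. norm (?d z) \<le> norm ((K' * (1 + norm x) ^ N') * (norm (k z) * (norm (z - r n z) * (1 + norm z + norm (r n z)) ^ N')))"
        by (rule AE_I2, rule order_trans[OF le]) (simp only: real_norm_def abs_ge_self)
    qed measurable
    have ir: "integrable lborel (\<lambda>z. k z * ?U (x - r n z))" by (rule disc(1)[of "\<lambda>a. ?U (x - a)"])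
    from Bochner_Integration.integrable_add[OF id ir] show iU: "integrable lborel (\<lambda>z. k z * ?U (x - z))"
      by (simp add: algebra_simps)
    have "conv k ?U x - u (\<lambda>y. F n (x - y)) = (\<integral>z. ?d z \<partial>lborel)"
      unfolding conv_def uF right_diff_distrib by (rule Bochner_Integration.integral_diff[symmetric, OF iU ir])
    also have "norm \<dots> \<le> (\<integral>z. (K' * (1 + norm x) ^ N') * (norm (k z) * (norm (z - r n z) * (1 + norm z + norm (r n z)) ^ N')) \<partial>lborel)"
      by (rule Bochner_Integration.integral_norm_bound_integral[OF id i2 le])
    also have "\<dots> = K' * (1 + norm x) ^ N' * E N' n" by (simp add: E_def)
    finally show "norm (conv k ?U x - u (\<lambda>y. F n (x - y))) \<le> K' * (1 + norm x) ^ N' * E N' n" .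
  qed
  have "(\<lambda>n. u (\<lambda>y. F n (x - y))) \<longlonglongrightarrow> u (\<lambda>y. conv k \<theta> (x - y))"
  proof (rule Lim_null[THEN iffD2], rule Lim_null_comparison)
    show "\<forall>\<^sub>F n in sequentially. norm (u (\<lambda>y. F n (x - y)) - u (\<lambda>y. conv k \<theta> (x - y))) \<le> M * ((1 + norm x) ^ N * (K * E N n))"
      using est1 by (intro always_eventually allI) (simp add: norm_minus_commute)
    show "(\<lambda>n. M * ((1 + norm x) ^ N * (K * E N n))) \<longlonglongrightarrow> 0"
      by (auto intro!: tendsto_eq_intros Elim)
  qed
  moreover have "(\<lambda>n. u (\<lambda>y. F n (x - y))) \<longlonglongrightarrow> conv k ?U x"
  proof (rule Lim_null[THEN iffD2], rule Lim_null_comparison)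
    show "\<forall>\<^sub>F n in sequentially. norm (u (\<lambda>y. F n (x - y)) - conv k ?U x) \<le> K' * (1 + norm x) ^ N' * E N' n"
      using est2 by (intro always_eventually allI) (simp add: norm_minus_commute)
    show "(\<lambda>n. K' * (1 + norm x) ^ N' * E N' n) \<longlonglongrightarrow> 0"
      by (auto intro!: tendsto_eq_intros Elim)
  qed
  ultimately show ?thesis by (rule LIMSEQ_unique)
qed

text \<open>The Taylor remainder of the test function is quadratically small in every seminorm.
  Restricting to transforms \<open>ift m\<close> makes derivatives of the remainder remainders of
  derivatives, by commutation of partial derivatives.\<close>

lemma tempered_has_derivative:
  fixes u :: "'n::finite dist"
  assumes u: "tempered u" and m: "schwartz m"
  shows "((\<lambda>x. u (\<lambda>y. ift m (x - y))) has_derivative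
     (\<lambda>v. \<Sum>i\<in>UNIV. (v $ i) *\<^sub>R u (\<lambda>y. partial_deriv i (ift m) (x - y)))) (at x)"
proof -
  let ?h = "ift m"
  have s: "schwartz ?h" by (rule schwartz_ift[OF m])
  have comm: "partial_derivs ks (partial_deriv i ?h) = partial_deriv i (partial_derivs ks ?h)" for ks i
    using partial_derivs_ift[OF m, of ks i] by auto
  obtain M N where M: "0 \<le> M" "\<And>\<theta> x B. schwartz \<theta> \<Longrightarrow>
     (\<And>ks w. length ks \<le> N \<Longrightarrow> (1 + norm w) ^ N * norm (partial_derivs ks \<theta> w) \<le> B) \<Longrightarrow>
     norm (u (\<lambda>y. \<theta> (x - y))) \<le> M * ((1 + norm x) ^ N * B)"
    using tempered_bound[OF u] by blast
  define R where "R = (\<lambda>ks v w. partial_derivs ks ?h (w + v) - partial_derivs ks ?h w -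
       (\<Sum>i\<in>UNIV. (v $ i) *\<^sub>R partial_deriv i (partial_derivs ks ?h) w))"
  \<comment> \<open>Setting the quantity to 0 for large \<open>v\<close> makes the bound hold for
    every parameter, as the uniform bound over multi-indices demands.\<close>
  define \<phi> where "\<phi> = (\<lambda>ks (p :: (real^'n) \<times> (real^'n)). case p of (v, w) \<Rightarrow>
      if norm v \<le> 1 then (1 + norm w) ^ N * norm (R ks v w) else 0)"
  have ex: "\<exists>K. 0 \<le> K \<and> (\<forall>p. \<phi> ks p \<le> K * (case p of (v, w) \<Rightarrow> (norm v)\<^sup>2))" for ks
  proof -
    obtain K where "K \<ge> 0" "\<And>w v. norm v \<le> 1 \<Longrightarrow> (1 + norm w) ^ N * norm (R ks v w) \<le> K * (norm v)\<^sup>2"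
      unfolding R_def using schwartz_taylor[OF schwartz_partials[OF s]] by blast
    then show ?thesis by (intro exI[of _ K]) (auto simp: \<phi>_def)
  qed
  have nn: "0 \<le> (case p of (v, w :: real^'n) \<Rightarrow> (norm (v :: real^'n))\<^sup>2)" for p by (auto split: prod.split)
  obtain K where K0: "0 \<le> K" and le: "\<And>ks p. length ks \<le> N \<Longrightarrow> \<phi> ks p \<le> K * (case p of (v, w) \<Rightarrow> (norm v)\<^sup>2)"
    using uniform_multi_index_bound[of \<phi>, OF ex nn, of N] by blast
  have K: "(1 + norm w) ^ N * norm (R ks v w) \<le> K * (norm v)\<^sup>2" if "length ks \<le> N" "norm v \<le> 1" for ks v w
    using le[OF that(1), of "(v, w)"] that(2) by (simp add: \<phi>_def)
  show ?thesis
  proof (rule has_derivative_quadratic)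
    show "bounded_linear (\<lambda>v. \<Sum>i\<in>UNIV. (v $ i) *\<^sub>R u (\<lambda>y. partial_deriv i ?h (x - y)))"
      by (intro bounded_linear_sum bounded_linear_compose[OF bounded_linear_scaleR_left bounded_linear_vec_nth])
    fix v :: "real^'n" assume v: "norm v \<le> 1"
    let ?D = "\<lambda>w. \<Sum>i\<in>UNIV. complex_of_real (v $ i) * partial_deriv i ?h w"
    have sD: "schwartz ?D" by (intro schwartz_sum schwartz_cmult schwartz_partial s)
    have sv: "schwartz (\<lambda>w. ?h (w + v))" by (rule schwartz_shift[OF s])
    have s1: "schwartz (\<lambda>w. ?h (w + v) - ?h w)" by (intro schwartz_diff sv s)
    have "u (\<lambda>y. ?h (x + v - y)) - u (\<lambda>y. ?h (x - y)) - (\<Sum>i\<in>UNIV. (v $ i) *\<^sub>R u (\<lambda>y. partial_deriv i ?h (x - y)))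
        = u (\<lambda>y. (\<lambda>w. ?h (w + v) - ?h w - ?D w) (x - y))"
    proof -
      have "u (\<lambda>y. (\<lambda>w. ?h (w + v) - ?h w - ?D w) (x - y)) =
          u (\<lambda>y. ?h (x - y + v)) - u (\<lambda>y. ?h (x - y)) - u (\<lambda>y. ?D (x - y))"
        using tempered_diff[OF u schwartz_reflect[OF s1, of x] schwartz_reflect[OF sD, of x]]
          tempered_diff[OF u schwartz_reflect[OF sv, of x] schwartz_reflect[OF s, of x]] by simp
      also have "u (\<lambda>y. ?D (x - y)) = (\<Sum>i\<in>UNIV. complex_of_real (v $ i) * u (\<lambda>y. partial_deriv i ?h (x - y)))"
        by (intro tempered_sum u schwartz_reflect schwartz_partial s)
      finally show ?thesis by (simp add: scaleR_conv_of_real diff_add_eq)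
    qed
    also have "norm \<dots> \<le> M * ((1 + norm x) ^ N * (K * (norm v)\<^sup>2))"
    proof (rule M(2))
      show "schwartz (\<lambda>w. ?h (w + v) - ?h w - ?D w)" by (intro schwartz_diff s1 sD)
      fix ks :: "'n list" and w assume ks: "length ks \<le> N"
      have "partial_derivs ks (\<lambda>w. ?h (w + v) - ?h w - ?D w) w =
          partial_derivs ks ?h (w + v) - partial_derivs ks ?h w -
           (\<Sum>i\<in>UNIV. complex_of_real (v $ i) * partial_derivs ks (partial_deriv i ?h) w)"
        unfolding partial_derivs_diff[OF schwartz_smooth[OF s1] schwartz_smooth[OF sD]]
          partial_derivs_diff[OF schwartz_smooth[OF sv] schwartz_smooth[OF s]]
          partial_derivs_shift[OF schwartz_smooth[OF s]]
          partial_derivs_sum[OF schwartz_cmult[OF schwartz_partial[OF s]]]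
          partial_derivs_cmult[OF schwartz_smooth[OF schwartz_partial[OF s]]] ..
      then have "partial_derivs ks (\<lambda>w. ?h (w + v) - ?h w - ?D w) w = R ks v w"
        by (simp add: R_def comm scaleR_conv_of_real)
      then show "(1 + norm w) ^ N * norm (partial_derivs ks (\<lambda>w. ?h (w + v) - ?h w - ?D w) w) \<le> K * (norm v)\<^sup>2"
        using K[OF ks v] by simp
    qed
    finally show "norm (u (\<lambda>y. ?h (x + v - y)) - u (\<lambda>y. ?h (x - y)) -
       (\<Sum>i\<in>UNIV. (v $ i) *\<^sub>R u (\<lambda>y. partial_deriv i ?h (x - y)))) \<le> (M * (1 + norm x) ^ N * K) * (norm v)\<^sup>2"
      by (simp add: mult_ac)
  qed
qed

section \<open>Dilated kernels\<close>

text \<open>The L1-normalised dilation; on the Fourier side it stretches the symbol to frequency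
  \<open>r\<close>.\<close>

definition dil :: "real \<Rightarrow> (real^'n::finite \<Rightarrow> complex) \<Rightarrow> real^'n \<Rightarrow> complex" where
  "dil r h x = complex_of_real (r ^ CARD('n)) * h (r *\<^sub>R x)"

lemma ift_dil: "r > 0 \<Longrightarrow> ift (\<lambda>\<xi>. m ((1 / r) *\<^sub>R \<xi>)) = dil r (ift m)"
  by (simp add: fun_eq_iff ift_scale dil_def)

lemma nn_integral_dil:
  fixes F :: "real^'n::finite \<Rightarrow> ennreal"
  assumes [measurable]: "F \<in> borel_measurable borel" and r: "r > 0"
  shows "(\<integral>\<^sup>+x. ennreal (r ^ CARD('n)) * F (r *\<^sub>R x) \<partial>lborel) = (\<integral>\<^sup>+x. F x \<partial>lborel)"
  using nn_integral_lborel_affine[of F r 0] r by (simp add: nn_integral_cmult)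

lemma dil_translate:
  fixes h :: "real^'n::finite \<Rightarrow> complex"
  assumes [measurable]: "h \<in> borel_measurable borel" and r: "r > 0"
    and K: "\<And>a. (\<integral>\<^sup>+z. ennreal (norm (h (z + a) - h z)) \<partial>lborel) \<le> ennreal (K * norm a)"
  shows "(\<integral>\<^sup>+z. ennreal (norm (dil r h (z + a) - dil r h z)) \<partial>lborel) \<le> ennreal (K * r * norm a)"
proof -
  have "norm (dil r h (z + a) - dil r h z) = r ^ CARD('n) * norm (h (r *\<^sub>R z + r *\<^sub>R a) - h (r *\<^sub>R z))" for z
    unfolding dil_def right_diff_distrib[symmetric] norm_mult norm_of_real
    using r by (simp add: scaleR_add_right)
  then have "(\<integral>\<^sup>+z. ennreal (norm (dil r h (z + a) - dil r h z)) \<partial>lborel) =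
     (\<integral>\<^sup>+z. ennreal (r ^ CARD('n)) * (\<lambda>z. ennreal (norm (h (z + r *\<^sub>R a) - h z))) (r *\<^sub>R z) \<partial>lborel)"
    using r by (simp add: ennreal_mult)
  also have "\<dots> = (\<integral>\<^sup>+z. ennreal (norm (h (z + r *\<^sub>R a) - h z)) \<partial>lborel)"
    by (rule nn_integral_dil[OF _ r]) measurable
  also have "\<dots> \<le> ennreal (K * norm (r *\<^sub>R a))" by (rule K)
  finally show ?thesis using r by (simp add: mult_ac)
qed

lemma dil_L1:
  fixes h :: "real^'n::finite \<Rightarrow> complex"
  assumes [measurable]: "h \<in> borel_measurable borel" and r: "r > 0"
  shows "(\<integral>\<^sup>+z. ennreal (norm (dil r h z)) \<partial>lborel) = (\<integral>\<^sup>+z. ennreal (norm (h z)) \<partial>lborel)"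
  using nn_integral_dil[of "\<lambda>z. ennreal (norm (h z))" r] r
  by (simp add: dil_def norm_mult norm_power ennreal_mult)

section \<open>Regularity of the truncated velocity\<close>

text \<open>Young's inequality for L1 and L-infinity, with an almost everywhere bound so that
  representing functions determined up to null sets may enter.\<close>

lemma conv_Linf_bound:
  fixes h g :: "real^'n::finite \<Rightarrow> complex"
  assumes [measurable]: "h \<in> borel_measurable borel" "g \<in> borel_measurable borel"
    and h: "(\<integral>\<^sup>+z. ennreal (norm (h z)) \<partial>lborel) \<le> ennreal A" and A: "0 \<le> A"
    and g: "AE y in lborel. norm (g y) \<le> b" and b: "0 \<le> b"
  shows "norm (\<integral>y. h (x - y) * g y \<partial>lborel) \<le> A * b"
proof -
  have "ennreal (norm (\<integral>y. h (x - y) * g y \<partial>lborel)) \<le> (\<integral>\<^sup>+y. ennreal (norm (h (x - y) * g y)) \<partial>lborel)"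
    by (rule norm_integral_le_nn_integral)
  also have "\<dots> \<le> (\<integral>\<^sup>+y. ennreal (norm (h (x - y))) * ennreal b \<partial>lborel)"
    using g by (intro nn_integral_mono_AE) (auto simp: norm_mult ennreal_mult[symmetric] b intro!: ennreal_leI mult_left_mono)
  also have "\<dots> = (\<integral>\<^sup>+y. ennreal (norm (h (x - y))) \<partial>lborel) * ennreal b"
    by (rule nn_integral_multc) measurable
  also have "(\<integral>\<^sup>+y. ennreal (norm (h (x - y))) \<partial>lborel) = (\<integral>\<^sup>+z. ennreal (norm (h z)) \<partial>lborel)"
    by (rule nn_integral_lborel_reflect[of "\<lambda>z. ennreal (norm (h z))"]) measurable
  also have "\<dots> * ennreal b \<le> ennreal A * ennreal b" by (intro mult_right_mono h) auto
  finally show ?thesis using A b by (simp add: ennreal_mult[symmetric])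
qed

lemma smooth_lp_cutoff: "lp_cutoff chi \<Longrightarrow> smooth chi"
  by (simp add: lp_cutoff_def)

lemma lp_cutoff_zero:
  assumes "lp_cutoff chi" "norm \<xi> > 4/3" shows "chi \<xi> = 0"
proof (rule ccontr)
  assume "chi \<xi> \<noteq> 0"
  then have "\<xi> \<in> {\<xi>. chi \<xi> \<noteq> 0}" by simp
  then have "\<xi> \<in> closure {\<xi>. chi \<xi> \<noteq> 0}" by (rule set_mp[OF closure_subset])
  moreover have "closure {\<xi>. chi \<xi> \<noteq> 0} \<subseteq> cball 0 (4/3)"
    using assms(1) unfolding lp_cutoff_def by (elim conjE)
  ultimately have "\<xi> \<in> cball 0 (4/3)" by (rule set_rev_mp)
  with assms(2) show False by simp
qed

lemma lp_cutoff_one: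
  assumes "lp_cutoff chi" "norm \<xi> \<le> 3/4" shows "chi \<xi> = 1"
proof -
  obtain U where U: "cball 0 (3/4) \<subseteq> U" "\<forall>\<xi>\<in>U. chi \<xi> = 1"
    using assms(1) unfolding lp_cutoff_def by (elim conjE exE)
  have "\<xi> \<in> cball 0 (3/4)" using assms(2) by simp
  with U show ?thesis by blast
qed

lemma schwartz_lp_cutoff:
  fixes chi :: "real^'n::finite \<Rightarrow> real"
  assumes "lp_cutoff chi" "c > 0"
  shows "schwartz (\<lambda>\<xi>. complex_of_real (chi (c *\<^sub>R \<xi>)))"
proof (rule schwartz_compact_support)
  show "smooth (\<lambda>\<xi>. complex_of_real (chi (c *\<^sub>R \<xi>)))"
    using smooth_bounded_linear[OF smooth_affine[OF smooth_lp_cutoff[OF assms(1)], of 0 c] bounded_linear_of_real]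
    by simp
  fix \<xi> :: "real^'n" assume "norm \<xi> > (4/3) / c"
  then have "norm (c *\<^sub>R \<xi>) > 4/3" using assms(2) by (simp add: field_simps)
  then show "complex_of_real (chi (c *\<^sub>R \<xi>)) = 0" by (simp add: lp_cutoff_zero[OF assms(1)])
qed

lemma powi_minus_scaleR: "(2 powi (- l)) *\<^sub>R (\<xi> :: 'a::real_vector) = (1 / (2 powi l)) *\<^sub>R \<xi>"
  by (simp add: power_int_minus inverse_eq_divide)

lemma inv_fourier_dil:
  "inv_fourier (\<lambda>\<xi>. m ((2 powi (- l)) *\<^sub>R \<xi>)) = dil (2 powi l) (ift (\<lambda>\<xi>. complex_of_real (m \<xi>)))"
  unfolding inv_fourier_eq_ift powi_minus_scaleR
  by (rule ift_dil[of "2 powi l" "\<lambda>\<xi>. complex_of_real (m \<xi>)"]) simp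

text \<open>The norm is an infimum, so a strict upper bound \<open>r\<close> is what yields a
  representing Jacobian. This is why later bounds on the field are stated for every \<open>r\<close>
  above the norm.\<close>

lemma grad_Linf_normD:
  fixes w :: "('n::finite dist)^'n"
  assumes "grad_Linf_norm w < ennreal r"
  obtains G :: "real^'n \<Rightarrow> real^'n^'n" where
    "\<And>k i. represents (\<lambda>x. complex_of_real (G x $ k $ i)) (dist_partial i (w $ k))"
    "\<And>k i. AE x in lborel. norm (complex_of_real (G x $ k $ i)) \<le> r"
proof -
  from assms obtain G :: "real^'n \<Rightarrow> real^'n^'n" where
    G: "\<And>k i. represents (\<lambda>x. complex_of_real (G x $ k $ i)) (dist_partial i (w $ k))" "Linf_norm G < ennreal r"
    unfolding grad_Linf_norm_def INF_less_iff by blast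
  have "AE x in lborel. ennreal (norm (G x)) \<le> Linf_norm G"
    unfolding Linf_norm_def by (rule esssup_AE)
  then have "AE x in lborel. norm (complex_of_real (G x $ k $ i)) \<le> r" for k i
  proof (rule AE_mp, intro AE_I2 impI)
    fix x assume "ennreal (norm (G x)) \<le> Linf_norm G"
    then have "ennreal (norm (G x)) < ennreal r" using G(2) by (rule le_less_trans)
    then have "norm (G x) < r" by (simp add: ennreal_less_iff)
    moreover have "\<bar>G x $ k $ i\<bar> \<le> norm (G x $ k)" by (rule component_le_norm_cart)
    moreover have "norm (G x $ k) \<le> norm (G x)" by (rule Finite_Cartesian_Product.norm_nth_le)
    ultimately show "norm (complex_of_real (G x $ k $ i)) \<le> r" by simp
  qed
  with G(1) that show ?thesis by blast
qed

text \<open>The gradient of the truncated field is the convolution of its kernel with the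
  representing Jacobian \<open>G\<close>. The L1 norm of the kernel is scale invariant, giving the
  Lipschitz bound; translating the kernel costs one factor of the frequency, giving the second
  difference bound.\<close>

lemma velocity_regularity:
  fixes chi :: "real^'n::finite \<Rightarrow> real"
  assumes chi: "lp_cutoff chi"
  obtains C where "1 \<le> C"
    "\<And>l v r x y. (\<And>k. tempered (v $ k)) \<Longrightarrow> 0 \<le> r \<Longrightarrow> grad_Linf_norm v < ennreal r \<Longrightarrow>
       norm (vlow chi l v x - vlow chi l v y) \<le> C * r * norm (x - y)"
    "\<And>l v r p b. (\<And>k. tempered (v $ k)) \<Longrightarrow> 0 \<le> r \<Longrightarrow> grad_Linf_norm v < ennreal r \<Longrightarrow>
       norm (vlow chi l v (p + b) + vlow chi l v (p - b) - 2 *\<^sub>R vlow chi l v p) \<le> C * 2 powi l * r * (norm b)\<^sup>2"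
proof -
  let ?m = "\<lambda>\<xi>. complex_of_real (chi \<xi>)"
  define h where "h = ift ?m"
  have m: "schwartz ?m" using schwartz_lp_cutoff[OF chi, of 1] by simp
  have h: "schwartz h" unfolding h_def by (rule schwartz_ift[OF m])
  have [measurable]: "h \<in> borel_measurable borel" by (rule rapid_measurable[OF schwartz_rapid[OF h]])
  obtain A where A: "0 \<le> A" "(\<integral>\<^sup>+z. ennreal (norm (h z)) \<partial>lborel) = ennreal A"
  proof -
    have "(\<integral>\<^sup>+z. ennreal (norm (h z)) \<partial>lborel) = ennreal (\<integral>z. norm (h z) \<partial>lborel)"
      by (rule nn_integral_eq_integral) (auto intro: integrable_norm rapid_integrable schwartz_rapid h)
    then show ?thesis using that[of "\<integral>z. norm (h z) \<partial>lborel"] by (simp add: integral_nonneg_AE)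
  qed
  obtain c where c: "c \<ge> 0" "\<And>x. norm (h x) \<le> c * wt x"
    "\<And>i x. norm (partial_deriv i h x) \<le> c * wt x"
    using schwartz_wt[OF h] by metis
  obtain K where K: "0 \<le> K" "\<And>a. (\<integral>\<^sup>+z. ennreal (norm (h (z + a) - h z)) \<partial>lborel) \<le> ennreal (K * norm a)"
    using L1_translate[OF smooth_differentiable[OF schwartz_smooth[OF h]] c(3,2,1)] by blast
  let ?d = "real CARD('n)"
  \<comment> \<open>One factor \<open>?d\<close> comes from the mean value bound, the other from
    summing components; the summand 1 secures \<open>1 \<le> C\<close>.\<close>
  define C where "C = 1 + ?d * (?d * A) + ?d * (?d * K)"
  have main: "norm (vlow chi l v x - vlow chi l v y) \<le> C * r * norm (x - y) \<and>
     norm (vlow chi l v (p + b) + vlow chi l v (p - b) - 2 *\<^sub>R vlow chi l v p) \<le> C * 2 powi l * r * (norm b)\<^sup>2"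
    if t: "\<And>k. tempered (v $ k)" and r: "0 \<le> r" and g: "grad_Linf_norm v < ennreal r"
    for l and v :: "('n dist)^'n" and r x y p b
  proof -
    define R :: real where "R = 2 powi l"
    have R: "R > 0" by (simp add: R_def)
    define hl where "hl = dil R h"
    have hl_ift: "hl = ift (\<lambda>\<xi>. ?m ((1 / R) *\<^sub>R \<xi>))"
      unfolding hl_def h_def by (rule ift_dil[OF R, symmetric])
    have ml: "schwartz (\<lambda>\<xi>. ?m ((1 / R) *\<^sub>R \<xi>))" by (rule schwartz_lp_cutoff[OF chi]) (use R in simp)
    have shl: "schwartz hl" unfolding hl_ift by (rule schwartz_ift[OF ml])
    have [measurable]: "hl \<in> borel_measurable borel" by (rule rapid_measurable[OF schwartz_rapid[OF shl]])
    obtain G where G: "\<And>k i. represents (\<lambda>x. complex_of_real (G x $ k $ i)) (dist_partial i (v $ k))"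
      "\<And>k i. AE x in lborel. norm (complex_of_real (G x $ k $ i)) \<le> r"
      using grad_Linf_normD[OF g] by blast
    have [measurable]: "(\<lambda>x. complex_of_real (G x $ k $ i)) \<in> borel_measurable borel" for k i
      using G(1)[of k i] unfolding represents_def by simp
    define a where "a = (\<lambda>k i x. \<integral>y. hl (x - y) * complex_of_real (G y $ k $ i) \<partial>lborel)"
    define f where "f = (\<lambda>k x. Re ((v $ k) (\<lambda>y. hl (x - y))))"
    have vf: "vlow chi l v x = (\<chi> k. f k x)" for x
      unfolding vlow_def lp_low_def fourier_mult_def f_def hl_def R_def h_def inv_fourier_dil ..
    have fD: "(f k has_derivative (\<lambda>\<eta>. \<Sum>i\<in>UNIV. (\<eta> $ i) *\<^sub>R Re (a k i x))) (at x)" for k x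
    proof -
      \<comment> \<open>The sign in \<open>dist_partial\<close> and the sign from reflecting the
        test function cancel, so the derivative on the kernel becomes convolution with
        \<open>G\<close>.\<close>
      have "(v $ k) (\<lambda>y. partial_deriv i hl (x - y)) = a k i x" for i
      proof -
        have "dist_partial i (v $ k) (\<lambda>y. hl (x - y)) = - (v $ k) (\<lambda>y. - partial_deriv i hl (x - y))"
          unfolding dist_partial_def partial_deriv_reflect[OF schwartz_smooth[OF shl], abs_def] ..
        also have "(v $ k) (\<lambda>y. - partial_deriv i hl (x - y)) = - (v $ k) (\<lambda>y. partial_deriv i hl (x - y))"
          using tempered_lincomb[OF t[of k] schwartz_reflect[OF schwartz_partial[OF shl]] schwartz_reflect[OF schwartz_partial[OF shl]], of "-1" i x 0 i x]
          by simp
        finally have "(v $ k) (\<lambda>y. partial_deriv i hl (x - y)) = dist_partial i (v $ k) (\<lambda>y. hl (x - y))" by simp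
        also have "\<dots> = a k i x"
          using G(1)[of k i] schwartz_reflect[OF shl, of x] unfolding represents_def a_def by (simp add: mult.commute)
        finally show ?thesis .
      qed
      then have "((\<lambda>x. (v $ k) (\<lambda>y. hl (x - y))) has_derivative (\<lambda>\<eta>. \<Sum>i\<in>UNIV. (\<eta> $ i) *\<^sub>R a k i x)) (at x)"
        using tempered_has_derivative[OF t[of k] ml, of x] unfolding hl_ift[symmetric] by simp
      from bounded_linear.has_derivative[OF bounded_linear_Re this]
      show ?thesis unfolding f_def by simp
    qed
    have fdiff: "f k differentiable (at x)" for k x using fD unfolding differentiable_def by blast
    have fp: "partial_deriv i (f k) x = Re (a k i x)" for k i x
      using partial_deriv_eqI[OF fD, of i k x] by (simp only: sum_axis_scaleR scaleR_one)
    have hl1: "(\<integral>\<^sup>+z. ennreal (norm (hl z)) \<partial>lborel) \<le> ennreal A"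
      unfolding hl_def using dil_L1[of h R] R A(2) by simp
    have a1: "norm (a k i x) \<le> A * r" for k i x
      unfolding a_def by (rule conv_Linf_bound[OF _ _ hl1 A(1) G(2) r]) measurable
    have a2: "norm (a k i (x + c) - a k i x) \<le> (K * R * norm c) * r" for k i x c
    proof -
      have gi: "integrable lborel (\<lambda>y. hl (x - y) * complex_of_real (G y $ k $ i))" for x
        using G(1)[of k i] schwartz_reflect[OF shl, of x] unfolding represents_def by (simp add: mult.commute)
      have "a k i (x + c) - a k i x = (\<integral>y. hl (x + c - y) * complex_of_real (G y $ k $ i) - hl (x - y) * complex_of_real (G y $ k $ i) \<partial>lborel)"
        unfolding a_def by (rule Bochner_Integration.integral_diff[symmetric, OF gi gi])
      also have "\<dots> = (\<integral>y. (\<lambda>z. hl (z + c) - hl z) (x - y) * complex_of_real (G y $ k $ i) \<partial>lborel)"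
        by (intro Bochner_Integration.integral_cong refl) (simp add: algebra_simps)
      also have "norm \<dots> \<le> (K * R * norm c) * r"
      proof (rule conv_Linf_bound[OF _ _ _ _ G(2) r])
        show "(\<integral>\<^sup>+z. ennreal (norm (hl (z + c) - hl z)) \<partial>lborel) \<le> ennreal (K * R * norm c)"
          unfolding hl_def by (rule dil_translate[OF _ R K(2)]) measurable
        show "0 \<le> K * R * norm c" using K(1) R by simp
      qed measurable
      finally show ?thesis .
    qed
    have f1: "\<bar>f k x - f k y\<bar> \<le> ?d * (A * r) * norm (x - y)" for k
      using partial_mean_value[of UNIV x y "f k" "A * r"] fdiff abs_Re_le_cmod a1 by (simp add: fp) (meson order_trans)
    \<comment> \<open>The second difference is the increment of
      \<open>\<lambda>x. f k (x + b) - f k x\<close> between \<open>p - b\<close> and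
      \<open>p\<close>, and the gradient of that function is a translation difference controlled by
      \<open>a2\<close>.\<close>
    have f2: "\<bar>f k (p + b) + f k (p - b) - 2 * f k p\<bar> \<le> ?d * ((K * R * norm b) * r) * norm b" for k
    proof -
      have Fd: "((\<lambda>x. f k (x + b) - f k x) has_derivative
          (\<lambda>\<eta>. (\<Sum>i\<in>UNIV. (\<eta> $ i) *\<^sub>R Re (a k i (x + b))) - (\<Sum>i\<in>UNIV. (\<eta> $ i) *\<^sub>R Re (a k i x)))) (at x)" for x
      proof (intro has_derivative_diff fD)
        have "((\<lambda>x. x + b) has_derivative (\<lambda>x. x)) (at x)" by (auto intro!: derivative_eq_intros)
        from has_derivative_compose[OF this fD]
        show "((\<lambda>x. f k (x + b)) has_derivative (\<lambda>\<eta>. \<Sum>i\<in>UNIV. (\<eta> $ i) *\<^sub>R Re (a k i (x + b)))) (at x)" .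
      qed
      have "norm ((\<lambda>x. f k (x + b) - f k x) p - (\<lambda>x. f k (x + b) - f k x) (p - b)) \<le>
          ?d * ((K * R * norm b) * r) * norm (p - (p - b))"
      proof (rule partial_mean_value[of UNIV])
        fix i z
        show "(\<lambda>x. f k (x + b) - f k x) differentiable (at z)" using Fd unfolding differentiable_def by blast
        have "norm (partial_deriv i (\<lambda>x. f k (x + b) - f k x) z) = \<bar>Re (a k i (z + b) - a k i z)\<bar>"
          using partial_deriv_eqI[OF Fd, of i z] by (simp only: sum_axis_scaleR scaleR_one) simp
        also have "\<dots> \<le> (K * R * norm b) * r" by (rule order_trans[OF abs_Re_le_cmod a2])
        finally show "norm (partial_deriv i (\<lambda>x. f k (x + b) - f k x) z) \<le> (K * R * norm b) * r" .
      qed auto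
      then show ?thesis by (simp add: algebra_simps)
    qed
    have n1: "norm (vlow chi l v x - vlow chi l v y) \<le> ?d * (?d * (A * r) * norm (x - y))"
    proof -
      have "norm (vlow chi l v x - vlow chi l v y) \<le> (\<Sum>k\<in>UNIV. \<bar>f k x - f k y\<bar>)"
        using norm_le_sum_abs[of "vlow chi l v x - vlow chi l v y"] by (simp add: vf)
      also have "\<dots> \<le> (\<Sum>k\<in>(UNIV::'n set). ?d * (A * r) * norm (x - y))" by (intro sum_mono f1)
      finally show ?thesis by simp
    qed
    have n2: "norm (vlow chi l v (p + b) + vlow chi l v (p - b) - 2 *\<^sub>R vlow chi l v p) \<le> ?d * (?d * ((K * R * norm b) * r) * norm b)"
    proof -
      have "norm (vlow chi l v (p + b) + vlow chi l v (p - b) - 2 *\<^sub>R vlow chi l v p) \<le>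
          (\<Sum>k\<in>UNIV. \<bar>f k (p + b) + f k (p - b) - 2 * f k p\<bar>)"
        using norm_le_sum_abs[of "vlow chi l v (p + b) + vlow chi l v (p - b) - 2 *\<^sub>R vlow chi l v p"] by (simp add: vf)
      also have "\<dots> \<le> (\<Sum>k\<in>(UNIV::'n set). ?d * ((K * R * norm b) * r) * norm b)" by (intro sum_mono f2)
      finally show ?thesis by simp
    qed
    have C1: "?d * (?d * A) \<le> C" "?d * (?d * K) \<le> C" using A(1) K(1) by (simp_all add: C_def)
    have "?d * (?d * (A * r) * norm (x - y)) = (?d * (?d * A)) * (r * norm (x - y))" by simp
    also have "\<dots> \<le> C * (r * norm (x - y))" by (rule mult_right_mono[OF C1(1)]) (use r in simp)
    finally have m1: "norm (vlow chi l v x - vlow chi l v y) \<le> C * r * norm (x - y)" using n1 by simp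
    have "?d * (?d * ((K * R * norm b) * r) * norm b) = (?d * (?d * K)) * (R * r * (norm b)\<^sup>2)"
      by (simp add: power2_eq_square)
    also have "\<dots> \<le> C * (R * r * (norm b)\<^sup>2)" by (rule mult_right_mono[OF C1(2)]) (use r R in simp)
    finally have "norm (vlow chi l v (p + b) + vlow chi l v (p - b) - 2 *\<^sub>R vlow chi l v p) \<le> C * R * r * (norm b)\<^sup>2"
      using n2 by (simp add: mult_ac)
    with m1 show ?thesis by (simp add: R_def)
  qed
  have "1 \<le> C" using A(1) K(1) by (simp add: C_def)
  then show ?thesis by (rule that) (use main in blast)+
qed

section \<open>Differences of flow trajectories\<close>

lemma time_interval_le: "time_interval I \<Longrightarrow> t \<in> I \<Longrightarrow> 0 \<le> s \<Longrightarrow> s \<le> t \<Longrightarrow> s \<in> I"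
  and time_interval_nonneg: "time_interval I \<Longrightarrow> t \<in> I \<Longrightarrow> 0 \<le> t"
  and time_interval_sets: "time_interval I \<Longrightarrow> I \<in> sets lebesgue"
  unfolding time_interval_def by auto

text \<open>\<open>g\<close> need not be measurable, and its \<open>nn_integral\<close> is then a
  supremum over simple functions below it. Monotonicity still holds, so the constant
  \<open>c\<close> is pulled out on the side of the measurable integrand before comparing with
  \<open>g\<close>.\<close>

lemma norm_set_integral_le_lower_integral:
  fixes a :: "real \<Rightarrow> 'a::euclidean_space" and g :: "real \<Rightarrow> ennreal"
  assumes int: "set_integrable lebesgue {0..s} a" and s: "s \<le> t"
    and V: "(\<integral>\<^sup>+\<tau>\<in>{0..t}. g \<tau> \<partial>lebesgue) \<le> ennreal V" "0 \<le> V" and c: "0 < c"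
    and ae: "AE \<tau> in lebesgue. \<tau> \<in> {0..t} \<longrightarrow> (\<forall>r\<ge>0. g \<tau> < ennreal r \<longrightarrow> norm (a \<tau>) \<le> c * r)"
  shows "norm (LINT \<tau>:{0..s}|lebesgue. a \<tau>) \<le> c * V"
proof -
  have [measurable]: "(\<lambda>\<tau>. indicator {0..s} \<tau> *\<^sub>R a \<tau>) \<in> borel_measurable lebesgue"
    using int by (auto simp: set_integrable_def)
  have le: "ennreal (norm (a \<tau>)) \<le> ennreal c * g \<tau>"
    if "\<forall>r\<ge>0. g \<tau> < ennreal r \<longrightarrow> norm (a \<tau>) \<le> c * r" for \<tau>
  proof (cases "g \<tau>")
    case (real q)
    have "norm (a \<tau>) / c \<le> q"
    proof (rule dense_ge)
      fix r assume "q < r"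
      with real that have "norm (a \<tau>) \<le> c * r" by (simp add: ennreal_less_iff)
      then show "norm (a \<tau>) / c \<le> r" using c by (simp add: divide_le_eq mult.commute)
    qed
    then have "norm (a \<tau>) \<le> c * q" using c by (simp add: divide_le_eq mult.commute)
    then show ?thesis using real c by (simp add: ennreal_mult[symmetric] ennreal_leI)
  next
    case top then show ?thesis using c by (simp add: ennreal_mult_top)
  qed
  have "ennreal (norm (LINT \<tau>:{0..s}|lebesgue. a \<tau>)) \<le> (\<integral>\<^sup>+\<tau>. ennreal (norm (indicator {0..s} \<tau> *\<^sub>R a \<tau>)) \<partial>lebesgue)"
    unfolding set_lebesgue_integral_def by (rule norm_integral_le_nn_integral)
  also have "\<dots> = (\<integral>\<^sup>+\<tau>. ennreal c * (ennreal (1 / c) * ennreal (norm (indicator {0..s} \<tau> *\<^sub>R a \<tau>))) \<partial>lebesgue)"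
    using c by (intro nn_integral_cong) (simp add: ennreal_mult[symmetric] del: norm_scaleR)
  also have "\<dots> = ennreal c * (\<integral>\<^sup>+\<tau>. ennreal (1 / c) * ennreal (norm (indicator {0..s} \<tau> *\<^sub>R a \<tau>)) \<partial>lebesgue)"
    by (rule nn_integral_cmult) measurable
  also have "(\<integral>\<^sup>+\<tau>. ennreal (1 / c) * ennreal (norm (indicator {0..s} \<tau> *\<^sub>R a \<tau>)) \<partial>lebesgue) \<le>
      (\<integral>\<^sup>+\<tau>\<in>{0..t}. g \<tau> \<partial>lebesgue)"
  proof (rule nn_integral_mono_AE, rule AE_mp[OF ae], intro AE_I2 impI)
    fix \<tau> assume *: "\<tau> \<in> {0..t} \<longrightarrow> (\<forall>r\<ge>0. g \<tau> < ennreal r \<longrightarrow> norm (a \<tau>) \<le> c * r)"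
    show "ennreal (1 / c) * ennreal (norm (indicator {0..s} \<tau> *\<^sub>R a \<tau>)) \<le> g \<tau> * indicator {0..t} \<tau>"
    proof (cases "\<tau> \<in> {0..s}")
      case True
      with s * have "ennreal (1 / c) * ennreal (norm (a \<tau>)) \<le> ennreal (1 / c) * (ennreal c * g \<tau>)"
        by (intro mult_left_mono le) auto
      also have "\<dots> = g \<tau>" using c by (simp add: mult.assoc[symmetric] ennreal_mult[symmetric])
      finally show ?thesis using True s by simp
    qed simp
  qed
  also have "ennreal c * (\<integral>\<^sup>+\<tau>\<in>{0..t}. g \<tau> \<partial>lebesgue) \<le> ennreal c * ennreal V"
    by (intro mult_left_mono V) auto
  finally have "ennreal (norm (LINT \<tau>:{0..s}|lebesgue. a \<tau>)) \<le> ennreal c * ennreal V"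
    by (simp add: mult_left_mono)
  then show ?thesis using c V(2) by (simp add: ennreal_mult[symmetric])
qed

text \<open>Trajectories are bounded on compact time intervals, which makes the suprema used for
  absorption finite.\<close>

lemma flow_bounded:
  assumes flow: "is_flow I w \<psi>" and I: "time_interval I" and t: "t \<in> I"
  obtains B where "\<And>s. s \<in> {0..t} \<Longrightarrow> norm (\<psi> s x) \<le> B"
proof -
  let ?f = "\<lambda>\<tau>. w \<tau> (\<psi> \<tau> x)"
  have int: "set_integrable lebesgue {0..t} ?f" using flow t unfolding is_flow_def by blast
  have "norm (\<psi> s x) \<le> norm x + (LINT \<tau>:{0..t}|lebesgue. norm (?f \<tau>))" if s: "s \<in> {0..t}" for s
  proof -
    have sI: "s \<in> I" using time_interval_le[OF I t, of s] s by simp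
    have si: "set_integrable lebesgue {0..s} ?f" and eq: "\<psi> s x = x + (LINT \<tau>:{0..s}|lebesgue. ?f \<tau>)"
      using flow sI unfolding is_flow_def by blast+
    have "norm (LINT \<tau>:{0..s}|lebesgue. ?f \<tau>) \<le> (LINT \<tau>:{0..s}|lebesgue. norm (?f \<tau>))"
      by (rule set_integral_norm_bound[OF si])
    also have "\<dots> \<le> (LINT \<tau>:{0..t}|lebesgue. norm (?f \<tau>))"
      unfolding set_lebesgue_integral_def
      using set_integrable_norm[OF si] set_integrable_norm[OF int] s
      by (intro integral_mono) (auto simp: set_integrable_def indicator_def)
    finally show ?thesis using norm_triangle_ineq[of x "LINT \<tau>:{0..s}|lebesgue. ?f \<tau>"] unfolding eq by linarith
  qed
  then show ?thesis using that by blast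
qed

text \<open>Since \<open>V\<close> is small, no Gronwall argument is needed: the supremum over \<open>{0..t}\<close> of each difference
  is absorbed into the left-hand side.\<close>

lemma flow_differences:
  fixes w :: "real \<Rightarrow> real^'n::finite \<Rightarrow> real^'n" and g :: "real \<Rightarrow> ennreal"
  assumes flow: "is_flow I w \<psi>" and I: "time_interval I" and t: "t \<in> I"
    and V: "(\<integral>\<^sup>+\<tau>\<in>{0..t}. g \<tau> \<partial>lebesgue) \<le> ennreal V" "0 \<le> V" and C: "0 < C" "C * V \<le> 1/2" and R: "0 < R"
    and ae: "AE \<tau> in lebesgue. \<tau> \<in> {0..t} \<longrightarrow> (\<forall>r\<ge>0. g \<tau> < ennreal r \<longrightarrow>
       (\<forall>x y. norm (w \<tau> x - w \<tau> y) \<le> C * r * norm (x - y)) \<and>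
       (\<forall>p b. norm (w \<tau> (p + b) + w \<tau> (p - b) - 2 *\<^sub>R w \<tau> p) \<le> C * R * r * (norm b)\<^sup>2))"
  shows "norm (\<psi> t x - \<psi> t y - (x - y)) \<le> 2 * C * V * norm (x - y)"
    and "norm (\<psi> t (x + z) + \<psi> t (x - z) - 2 *\<^sub>R \<psi> t x) \<le> 8 * C * V * R * (norm z)\<^sup>2"
proof -
  have t0: "0 \<le> t" by (rule time_interval_nonneg[OF I t])
  have sI: "s \<in> I" if "s \<in> {0..t}" for s using time_interval_le[OF I t, of s] that by simp
  have si: "set_integrable lebesgue {0..s} (\<lambda>\<tau>. w \<tau> (\<psi> \<tau> x))" and eq: "\<psi> s x = x + (LINT \<tau>:{0..s}|lebesgue. w \<tau> (\<psi> \<tau> x))"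
    if "s \<in> {0..t}" for s x
    using flow sI[OF that] unfolding is_flow_def by blast+
  have lin: "norm (\<psi> s x - \<psi> s y) \<le> 2 * norm (x - y) \<and> norm (\<psi> s x - \<psi> s y - (x - y)) \<le> 2 * C * V * norm (x - y)"
    if s: "s \<in> {0..t}" for s x y
  proof (cases "x = y")
    case False
    let ?D = "\<lambda>s. norm (\<psi> s x - \<psi> s y)"
    obtain B1 B2 where B: "\<And>s. s \<in> {0..t} \<Longrightarrow> norm (\<psi> s x) \<le> B1" "\<And>s. s \<in> {0..t} \<Longrightarrow> norm (\<psi> s y) \<le> B2"
      using flow_bounded[OF flow I t] by metis
    have bdd: "bdd_above (?D ` {0..t})"
      unfolding bdd_above_def
    proof (intro exI[of _ "B1 + B2"] ballI, elim imageE, simp only:)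
      fix s assume s: "s \<in> {0..t}"
      show "?D s \<le> B1 + B2"
        using norm_triangle_ineq4[of "\<psi> s x" "\<psi> s y"] B(1)[OF s] B(2)[OF s] by linarith
    qed
    define S where "S = (SUP s\<in>{0..t}. ?D s)"
    have DS: "?D s \<le> S" if "s \<in> {0..t}" for s unfolding S_def by (rule cSUP_upper[OF that bdd])
    \<comment> \<open>At time zero both trajectories are at their starting points, so
      \<open>S\<close> is at least their distance. Strict positivity is what the integral estimate
      asks of its constant.\<close>
    have S0: "0 < S"
    proof -
      have "(LINT \<tau>:{0..0}|lebesgue. w \<tau> (\<psi> \<tau> x)) = 0" for x
        unfolding set_lebesgue_integral_def
        by (rule integral_eq_zero_AE, rule AE_mp[OF AE_completion[OF AE_lborel_singleton[of 0]]]) auto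
      then have "\<psi> 0 x = x" for x using eq[of 0 x] t0 by simp
      then have "norm (x - y) \<le> S" using DS[of 0] t0 by simp
      with False show ?thesis by (meson less_le_trans zero_less_norm_iff right_minus_eq)
    qed
    have inc: "norm (\<psi> s x - \<psi> s y - (x - y)) \<le> C * S * V" if s: "s \<in> {0..t}" for s
    proof -
      have "\<psi> s x - \<psi> s y - (x - y) = (LINT \<tau>:{0..s}|lebesgue. w \<tau> (\<psi> \<tau> x) - w \<tau> (\<psi> \<tau> y))"
        unfolding set_integral_diff(2)[OF si[OF s] si[OF s]] using eq[OF s, of x] eq[OF s, of y] by simp
      also have "norm \<dots> \<le> C * S * V"
      proof (rule norm_set_integral_le_lower_integral[OF set_integral_diff(1)[OF si[OF s] si[OF s]] _ V])
        show "AE \<tau> in lebesgue. \<tau> \<in> {0..t} \<longrightarrow> (\<forall>r\<ge>0. g \<tau> < ennreal r \<longrightarrow> norm (w \<tau> (\<psi> \<tau> x) - w \<tau> (\<psi> \<tau> y)) \<le> C * S * r)"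
        proof (rule AE_mp[OF ae], intro AE_I2 impI allI)
          fix \<tau> r assume *: "\<tau> \<in> {0..t}" "0 \<le> r" "g \<tau> < ennreal r" and "\<tau> \<in> {0..t} \<longrightarrow> (\<forall>r\<ge>0. g \<tau> < ennreal r \<longrightarrow>
            (\<forall>x y. norm (w \<tau> x - w \<tau> y) \<le> C * r * norm (x - y)) \<and>
            (\<forall>p b. norm (w \<tau> (p + b) + w \<tau> (p - b) - 2 *\<^sub>R w \<tau> p) \<le> C * R * r * (norm b)\<^sup>2))"
          then have "norm (w \<tau> (\<psi> \<tau> x) - w \<tau> (\<psi> \<tau> y)) \<le> C * r * ?D \<tau>" by blast
          also have "\<dots> \<le> C * r * S" by (intro mult_left_mono DS) (use * C in auto)
          finally show "norm (w \<tau> (\<psi> \<tau> x) - w \<tau> (\<psi> \<tau> y)) \<le> C * S * r" by (simp add: mult_ac)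
        qed
      qed (use s C S0 in auto)
      finally show ?thesis .
    qed
    have "S \<le> norm (x - y) + C * S * V"
      unfolding S_def
    proof (rule cSUP_least)
      show "{0..t} \<noteq> {}" using t0 by simp
      fix s assume s: "s \<in> {0..t}"
      show "?D s \<le> norm (x - y) + C * (SUP s\<in>{0..t}. ?D s) * V"
        using inc[OF s] norm_triangle_ineq[of "\<psi> s x - \<psi> s y - (x - y)" "x - y"] unfolding S_def by simp
    qed
    also have "C * S * V \<le> (1/2) * S"
      using mult_right_mono[OF C(2), of S] S0 by (simp add: mult_ac)
    finally have S2: "S \<le> 2 * norm (x - y)" by simp
    have "C * S * V \<le> 2 * C * V * norm (x - y)"
      using mult_left_mono[OF S2, of "C * V"] C(1) V(2) by (simp add: mult_ac)
    with inc[OF s] DS[OF s] S2 show ?thesis by linarith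
  qed simp
  from lin[of t x y] t0 show "norm (\<psi> t x - \<psi> t y - (x - y)) \<le> 2 * C * V * norm (x - y)" by simp
  show "norm (\<psi> t (x + z) + \<psi> t (x - z) - 2 *\<^sub>R \<psi> t x) \<le> 8 * C * V * R * (norm z)\<^sup>2"
  proof (cases "z = 0")
    case False
    let ?E = "\<lambda>s. \<psi> s (x + z) + \<psi> s (x - z) - 2 *\<^sub>R \<psi> s x"
    obtain B1 B2 B3 where B: "\<And>s. s \<in> {0..t} \<Longrightarrow> norm (\<psi> s (x + z)) \<le> B1"
      "\<And>s. s \<in> {0..t} \<Longrightarrow> norm (\<psi> s (x - z)) \<le> B2" "\<And>s. s \<in> {0..t} \<Longrightarrow> norm (\<psi> s x) \<le> B3"
      using flow_bounded[OF flow I t] by metis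
    have bdd: "bdd_above ((\<lambda>s. norm (?E s)) ` {0..t})"
      unfolding bdd_above_def
    proof (intro exI[of _ "B1 + B2 + 2 * B3"] ballI, elim imageE, simp only:)
      fix s assume s: "s \<in> {0..t}"
      show "norm (?E s) \<le> B1 + B2 + 2 * B3"
        using norm_triangle_ineq4[of "\<psi> s (x + z) + \<psi> s (x - z)" "2 *\<^sub>R \<psi> s x"]
          norm_triangle_ineq[of "\<psi> s (x + z)" "\<psi> s (x - z)"] B(1)[OF s] B(2)[OF s] B(3)[OF s]
        by simp
    qed
    define S where "S = (SUP s\<in>{0..t}. norm (?E s))"
    have ES: "norm (?E s) \<le> S" if "s \<in> {0..t}" for s unfolding S_def by (rule cSUP_upper[OF that bdd])
    have S0: "0 \<le> S" using order_trans[OF norm_ge_zero ES[of 0]] t0 by simp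
    \<comment> \<open>The first term is the curvature of the field along the pair of outer
      trajectories, with \<open>norm b \<le> 2 * norm z\<close>; the second is its Lipschitz
      response to the displacement of their midpoint from the inner trajectory.\<close>
    define c where "c = C * (4 * R * (norm z)\<^sup>2 + S)"
    have c0: "0 < c" unfolding c_def using C(1) R False S0 by (intro mult_pos_pos add_pos_nonneg) auto
    have inc: "norm (?E s) \<le> c * V" if s: "s \<in> {0..t}" for s
    proof -
      have si3: "set_integrable lebesgue {0..s} (\<lambda>\<tau>. w \<tau> (\<psi> \<tau> (x + z)) + w \<tau> (\<psi> \<tau> (x - z)) - 2 *\<^sub>R w \<tau> (\<psi> \<tau> x))"
        by (intro set_integral_diff set_integral_add set_integrable_scaleR_right si s)
      have "?E s = (LINT \<tau>:{0..s}|lebesgue. w \<tau> (\<psi> \<tau> (x + z)) + w \<tau> (\<psi> \<tau> (x - z)) - 2 *\<^sub>R w \<tau> (\<psi> \<tau> x))"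
        unfolding set_integral_diff(2)[OF set_integral_add(1)[OF si[OF s] si[OF s]] set_integrable_scaleR_right[OF si[OF s]]]
          set_integral_add(2)[OF si[OF s] si[OF s]] set_integral_scaleR_right
        using eq[OF s, of "x + z"] eq[OF s, of "x - z"] eq[OF s, of x] by (simp add: scaleR_add_right scaleR_2)
      also have "norm \<dots> \<le> c * V"
      proof (rule norm_set_integral_le_lower_integral[OF si3 _ V c0])
        show "AE \<tau> in lebesgue. \<tau> \<in> {0..t} \<longrightarrow> (\<forall>r\<ge>0. g \<tau> < ennreal r \<longrightarrow>
          norm (w \<tau> (\<psi> \<tau> (x + z)) + w \<tau> (\<psi> \<tau> (x - z)) - 2 *\<^sub>R w \<tau> (\<psi> \<tau> x)) \<le> c * r)"
        proof (rule AE_mp[OF ae], intro AE_I2 impI allI)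
          fix \<tau> r assume *: "\<tau> \<in> {0..t}" "0 \<le> r" "g \<tau> < ennreal r" and "\<tau> \<in> {0..t} \<longrightarrow> (\<forall>r\<ge>0. g \<tau> < ennreal r \<longrightarrow>
            (\<forall>x y. norm (w \<tau> x - w \<tau> y) \<le> C * r * norm (x - y)) \<and>
            (\<forall>p b. norm (w \<tau> (p + b) + w \<tau> (p - b) - 2 *\<^sub>R w \<tau> p) \<le> C * R * r * (norm b)\<^sup>2))"
          then have L1: "norm (w \<tau> x - w \<tau> y) \<le> C * r * norm (x - y)"
            and L2: "norm (w \<tau> (p + b) + w \<tau> (p - b) - 2 *\<^sub>R w \<tau> p) \<le> C * R * r * (norm b)\<^sup>2" for x y p b by blast+
          \<comment> \<open>Centring at the midpoint \<open>p\<close> separates a genuine second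
            difference of the field, with increment \<open>b\<close>, from twice the increment
            between \<open>p\<close> and the inner trajectory. The latter displacement is half of
            \<open>?E \<tau>\<close> and is absorbed.\<close>
          define p where "p = (1/2) *\<^sub>R (\<psi> \<tau> (x + z) + \<psi> \<tau> (x - z))"
          define b where "b = (1/2) *\<^sub>R (\<psi> \<tau> (x + z) - \<psi> \<tau> (x - z))"
          have pb: "p + b = \<psi> \<tau> (x + z)" "p - b = \<psi> \<tau> (x - z)"
            by (simp_all add: p_def b_def algebra_simps flip: scaleR_add_left)
          have pE: "p - \<psi> \<tau> x = (1/2) *\<^sub>R ?E \<tau>"
            by (simp add: p_def algebra_simps)
          have "norm b \<le> 2 * norm z"
          proof -
            have "norm (\<psi> \<tau> (x + z) - \<psi> \<tau> (x - z)) \<le> 2 * norm ((x + z) - (x - z))" using lin[OF *(1)] by blast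
            also have "(x + z) - (x - z) = 2 *\<^sub>R z" by (simp add: scaleR_2)
            finally show ?thesis by (simp add: b_def)
          qed
          then have b2: "(norm b)\<^sup>2 \<le> 4 * (norm z)\<^sup>2"
            using power_mono[of "norm b" "2 * norm z" 2] by (simp add: power_mult_distrib)
          have e1: "norm (w \<tau> (p + b) + w \<tau> (p - b) - 2 *\<^sub>R w \<tau> p) \<le> C * R * r * (4 * (norm z)\<^sup>2)"
            by (rule order_trans[OF L2]) (intro mult_left_mono b2, use C R * in simp)
          have "norm (w \<tau> p - w \<tau> (\<psi> \<tau> x)) \<le> C * r * ((1/2) * norm (?E \<tau>))"
            using L1[of p "\<psi> \<tau> x"] unfolding pE by simp
          also have "\<dots> \<le> C * r * ((1/2) * S)"
            by (intro mult_left_mono ES *) (use C * in auto)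
          finally have e2: "norm (2 *\<^sub>R (w \<tau> p - w \<tau> (\<psi> \<tau> x))) \<le> C * r * S" by simp
          have "w \<tau> (\<psi> \<tau> (x + z)) + w \<tau> (\<psi> \<tau> (x - z)) - 2 *\<^sub>R w \<tau> (\<psi> \<tau> x) =
            (w \<tau> (p + b) + w \<tau> (p - b) - 2 *\<^sub>R w \<tau> p) + 2 *\<^sub>R (w \<tau> p - w \<tau> (\<psi> \<tau> x))"
            unfolding pb by (simp add: algebra_simps)
          also have "norm \<dots> \<le> C * R * r * (4 * (norm z)\<^sup>2) + C * r * S"
            by (rule order_trans[OF norm_triangle_ineq add_mono[OF e1 e2]])
          also have "\<dots> = c * r" by (simp add: c_def algebra_simps)
          finally show "norm (w \<tau> (\<psi> \<tau> (x + z)) + w \<tau> (\<psi> \<tau> (x - z)) - 2 *\<^sub>R w \<tau> (\<psi> \<tau> x)) \<le> c * r" .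
        qed
      qed (use s in auto)
      finally show ?thesis .
    qed
    have "S \<le> c * V"
      unfolding S_def by (rule cSUP_least) (use t0 inc in auto)
    also have "\<dots> = 4 * C * V * R * (norm z)\<^sup>2 + (C * V) * S" by (simp add: c_def algebra_simps)
    also have "(C * V) * S \<le> (1/2) * S" by (rule mult_right_mono[OF C(2) S0])
    finally have "S \<le> 8 * C * V * R * (norm z)\<^sup>2" by simp
    with ES[of t] t0 show ?thesis by simp
  next
    case True
    then show ?thesis by (simp add: scaleR_2)
  qed
qed

section \<open>The commutator of the heat kernel with a near-isometric change of variables\<close>

text \<open>Replacing \<open>b\<close> by \<open>- a\<close> costs \<open>norm (a + b)\<close>,
  which is already quadratic in \<open>z\<close>. What remains compares the increment by
  \<open>a\<close> at \<open>p + z\<close> and at \<open>p - z - a\<close>: a second derivative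
  times \<open>norm a\<close> times a distance of order \<open>norm z\<close>.\<close>

lemma kernel_difference:
  fixes h :: "real^'n::finite \<Rightarrow> complex"
  assumes h: "schwartz h"
  obtains C where "0 \<le> C" "\<And>p z a b \<rho>. 0 \<le> \<rho> \<Longrightarrow> \<rho> \<le> 1/2 \<Longrightarrow> norm a \<le> \<rho> * norm z \<Longrightarrow> norm b \<le> \<rho> * norm z \<Longrightarrow>
     norm (a + b) \<le> \<rho> * (norm z)\<^sup>2 \<Longrightarrow>
     norm (h (p + z + a) + h (p - z + b) - h (p + z) - h (p - z)) \<le> C * \<rho> * (norm z)\<^sup>2 * (1 + 4 * norm z) ^ (2 * CARD('n)) * wt p"
proof -
  obtain c where c: "c \<ge> 0" "\<And>x. norm (h x) \<le> c * wt x" "\<And>i x. norm (partial_deriv i h x) \<le> c * wt x"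
    "\<And>i j x. norm (partial_deriv j (partial_deriv i h) x) \<le> c * wt x"
    using schwartz_wt[OF h] by metis
  let ?d = "real CARD('n)"
  have dh: "h differentiable (at x)" "partial_deriv i h differentiable (at x)" for x i
    by (intro smooth_differentiable schwartz_smooth schwartz_partial h)+
  have "norm (h (p + z + a) + h (p - z + b) - h (p + z) - h (p - z)) \<le>
      (?d * c + 3 * ?d\<^sup>2 * c) * \<rho> * (norm z)\<^sup>2 * (1 + 4 * norm z) ^ (2 * CARD('n)) * wt p"
    if \<rho>: "0 \<le> \<rho>" "\<rho> \<le> 1/2" and a: "norm a \<le> \<rho> * norm z" and b: "norm b \<le> \<rho> * norm z"
      and ab: "norm (a + b) \<le> \<rho> * (norm z)\<^sup>2" for p z a b \<rho>
  proof -
    \<comment> \<open>All points that occur lie in the ball of radius \<open>4 * norm z\<close>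
      around \<open>p\<close>, so this one weight loss covers both terms.\<close>
    define Q where "Q = c * ((1 + 4 * norm z) ^ (2 * CARD('n)) * wt p)"
    have Q: "0 \<le> Q" unfolding Q_def using c(1) by simp
    have a': "norm a \<le> norm z / 2" and b': "norm b \<le> norm z / 2"
      using a b mult_right_mono[OF \<rho>(2), of "norm z"] by auto
    have "norm (h (p - z + b) - h (p - z - a)) \<le> ?d * Q * norm ((p - z + b) - (p - z - a))"
      unfolding Q_def
    proof (rule wt_lipschitz[OF dh(1) c(3,1)])
      have e: "(p - z + b) - p = b - z" "(p - z - a) - p = - (z + a)" by simp_all
      show "norm ((p - z + b) - p) \<le> 4 * norm z"
        unfolding e using norm_triangle_ineq4[of b z] b' norm_ge_zero[of z] by linarith
      show "norm ((p - z - a) - p) \<le> 4 * norm z"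
        unfolding e norm_minus_cancel using norm_triangle_ineq[of z a] a' norm_ge_zero[of z] by linarith
    qed
    also have "(p - z + b) - (p - z - a) = a + b" by simp
    also have "?d * Q * norm (a + b) \<le> ?d * Q * (\<rho> * (norm z)\<^sup>2)"
      by (intro mult_left_mono ab) (use Q in simp)
    finally have T1: "norm (h (p - z + b) - h (p - z - a)) \<le> ?d * Q * (\<rho> * (norm z)\<^sup>2)" .
    let ?H = "\<lambda>x. h (x + a) - h x"
    have HD: "(?H has_derivative (\<lambda>v. (\<Sum>i\<in>UNIV. (v $ i) *\<^sub>R partial_deriv i h (x + a)) - (\<Sum>i\<in>UNIV. (v $ i) *\<^sub>R partial_deriv i h x))) (at x)" for x
    proof (intro has_derivative_diff has_derivative_partial[OF dh(1)])
      have "((\<lambda>x. x + a) has_derivative (\<lambda>x. x)) (at x)" by (auto intro!: derivative_eq_intros)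
      from has_derivative_compose[OF this has_derivative_partial[OF dh(1)]]
      show "((\<lambda>x. h (x + a)) has_derivative (\<lambda>v. \<Sum>i\<in>UNIV. (v $ i) *\<^sub>R partial_deriv i h (x + a))) (at x)" .
    qed
    have "norm (?H (p + z) - ?H (p - z - a)) \<le> ?d * (?d * Q * norm a) * norm ((p + z) - (p - z - a))"
    proof (rule partial_mean_value[of "cball p (2 * norm z)"])
      show "p + z \<in> cball p (2 * norm z)" by (simp add: dist_norm)
      show "p - z - a \<in> cball p (2 * norm z)"
        using norm_triangle_ineq[of z a] a' norm_ge_zero[of z] by (simp add: dist_norm del: norm_ge_zero)
      fix i x assume x: "x \<in> cball p (2 * norm z)"
      show "?H differentiable (at x)" using HD unfolding differentiable_def by blast
      have "norm (partial_deriv i h (x + a) - partial_deriv i h x) \<le> ?d * Q * norm ((x + a) - x)"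
        unfolding Q_def
      proof (rule wt_lipschitz[OF dh(2) c(4,1)])
        have xp: "norm (x - p) \<le> 2 * norm z" using x by (simp add: dist_norm norm_minus_commute)
        have e: "x + a - p = (x - p) + a" by simp
        show "norm (x + a - p) \<le> 4 * norm z"
          unfolding e using xp norm_triangle_ineq[of "x - p" a] a' norm_ge_zero[of z] by linarith
        show "norm (x - p) \<le> 4 * norm z"
          using xp norm_ge_zero[of z] by linarith
      qed
      then show "norm (partial_deriv i ?H x) \<le> ?d * Q * norm a"
        using partial_deriv_eqI[OF HD, of i x] by (simp add: sum_axis_scaleR)
    qed simp
    also have "\<dots> \<le> ?d * (?d * Q * (\<rho> * norm z)) * (3 * norm z)"
    proof (intro mult_mono)
      have "(p + z) - (p - z - a) = 2 *\<^sub>R z + a" by (simp add: scaleR_2)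
      then show "norm ((p + z) - (p - z - a)) \<le> 3 * norm z"
        using norm_triangle_ineq[of "2 *\<^sub>R z" a] a' norm_ge_zero[of z] by (simp del: norm_ge_zero)
    qed (use a Q \<rho> in auto)
    finally have T2: "norm (?H (p + z) - ?H (p - z - a)) \<le> ?d * (?d * Q * (\<rho> * norm z)) * (3 * norm z)" .
    have "h (p + z + a) + h (p - z + b) - h (p + z) - h (p - z) =
        (h (p - z + b) - h (p - z - a)) + (?H (p + z) - ?H (p - z - a))" by simp
    also have "norm \<dots> \<le> ?d * Q * (\<rho> * (norm z)\<^sup>2) + ?d * (?d * Q * (\<rho> * norm z)) * (3 * norm z)"
      by (rule order_trans[OF norm_triangle_ineq add_mono[OF T1 T2]])
    also have "\<dots> = (?d * c + 3 * ?d\<^sup>2 * c) * \<rho> * (norm z)\<^sup>2 * (1 + 4 * norm z) ^ (2 * CARD('n)) * wt p"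
      unfolding Q_def power2_eq_square distrib_right by (simp only: mult_ac)
    finally show ?thesis .
  qed
  moreover have "0 \<le> ?d * c + 3 * ?d\<^sup>2 * c" using c(1) by simp
  ultimately show ?thesis using that by blast
qed

text \<open>Multiplying all displacements by \<open>r\<close> turns the bound on
  \<open>a + b\<close> into the scale-free one. The two length factors give
  \<open>r\<^sup>2\<close>, and the remaining \<open>r ^ CARD('n)\<close> normalises the dilated
  weight in L1.\<close>

lemma dil_kernel_difference:
  fixes h :: "real^'n::finite \<Rightarrow> complex"
  assumes h: "schwartz h"
  obtains C where "0 \<le> C" "\<And>r p z a b \<rho>. 0 < r \<Longrightarrow> 0 \<le> \<rho> \<Longrightarrow> \<rho> \<le> 1/2 \<Longrightarrow> norm a \<le> \<rho> * norm z \<Longrightarrow> norm b \<le> \<rho> * norm z \<Longrightarrow>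
     norm (a + b) \<le> \<rho> * r * (norm z)\<^sup>2 \<Longrightarrow>
     norm (dil r h (p + z + a) + dil r h (p - z + b) - dil r h (p + z) - dil r h (p - z))
       \<le> (C * \<rho> * r\<^sup>2) * ((norm z)\<^sup>2 * (1 + 4 * r * norm z) ^ (2 * CARD('n))) * (r ^ CARD('n) * wt (r *\<^sub>R p))"
proof -
  obtain C where C: "0 \<le> C" "\<And>p z a b \<rho>. 0 \<le> \<rho> \<Longrightarrow> \<rho> \<le> 1/2 \<Longrightarrow> norm a \<le> \<rho> * norm z \<Longrightarrow> norm b \<le> \<rho> * norm z \<Longrightarrow>
     norm (a + b) \<le> \<rho> * (norm z)\<^sup>2 \<Longrightarrow>
     norm (h (p + z + a) + h (p - z + b) - h (p + z) - h (p - z)) \<le> C * \<rho> * (norm z)\<^sup>2 * (1 + 4 * norm z) ^ (2 * CARD('n)) * wt p"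
    using kernel_difference[OF h] by blast
  have "norm (dil r h (p + z + a) + dil r h (p - z + b) - dil r h (p + z) - dil r h (p - z))
       \<le> (C * \<rho> * r\<^sup>2) * ((norm z)\<^sup>2 * (1 + 4 * r * norm z) ^ (2 * CARD('n))) * (r ^ CARD('n) * wt (r *\<^sub>R p))"
    if r: "0 < r" and \<rho>: "0 \<le> \<rho>" "\<rho> \<le> 1/2" and a: "norm a \<le> \<rho> * norm z" and b: "norm b \<le> \<rho> * norm z"
      and ab: "norm (a + b) \<le> \<rho> * r * (norm z)\<^sup>2" for r p z a b \<rho>
  proof -
    have s: "norm (r *\<^sub>R a) \<le> \<rho> * norm (r *\<^sub>R z)" "norm (r *\<^sub>R b) \<le> \<rho> * norm (r *\<^sub>R z)"
      using mult_left_mono[OF a, of r] mult_left_mono[OF b, of r] r by (simp_all add: mult_ac)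
    have s2: "norm (r *\<^sub>R a + r *\<^sub>R b) \<le> \<rho> * (norm (r *\<^sub>R z))\<^sup>2"
      using mult_left_mono[OF ab, of r] r by (simp add: power2_eq_square mult_ac flip: scaleR_add_right)
    let ?h = "h (r *\<^sub>R p + r *\<^sub>R z + r *\<^sub>R a) + h (r *\<^sub>R p - r *\<^sub>R z + r *\<^sub>R b) - h (r *\<^sub>R p + r *\<^sub>R z) - h (r *\<^sub>R p - r *\<^sub>R z)"
    have "dil r h (p + z + a) + dil r h (p - z + b) - dil r h (p + z) - dil r h (p - z) = complex_of_real (r ^ CARD('n)) * ?h"
      unfolding dil_def scaleR_add_right scaleR_diff_right by (simp add: distrib_left right_diff_distrib)
    then have "norm (dil r h (p + z + a) + dil r h (p - z + b) - dil r h (p + z) - dil r h (p - z)) = r ^ CARD('n) * norm ?h"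
      using r by (simp only: norm_mult norm_of_real) simp
    also have "\<dots> \<le> r ^ CARD('n) * (C * \<rho> * (norm (r *\<^sub>R z))\<^sup>2 * (1 + 4 * norm (r *\<^sub>R z)) ^ (2 * CARD('n)) * wt (r *\<^sub>R p))"
      by (intro mult_left_mono C(2) \<rho> s s2) (use r in simp)
    also have "\<dots> = (C * \<rho> * r\<^sup>2) * ((norm z)\<^sup>2 * (1 + 4 * r * norm z) ^ (2 * CARD('n))) * (r ^ CARD('n) * wt (r *\<^sub>R p))"
      using r by (simp add: power_mult_distrib mult_ac)
    finally show ?thesis .
  qed
  with C(1) show ?thesis by (rule that)
qed

text \<open>After rescaling by \<delta>, the bound on \<open>r * \<delta>\<close> is what keeps the
  weight loss of the kernel difference within a fixed polynomial, which the unit Gaussian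
  integrates.\<close>

lemma gauss_eps_moment:
  assumes "0 < A"
  obtains C where "0 \<le> C" "\<And>r \<delta>. 0 < r \<Longrightarrow> 0 < \<delta> \<Longrightarrow> r * \<delta> \<le> A \<Longrightarrow>
    (\<integral>\<^sup>+z. ennreal (gauss_eps \<delta> (z :: real^'n::finite) * ((norm z)\<^sup>2 * (1 + 4 * r * norm z) ^ (2 * CARD('n)))) \<partial>lborel) \<le> ennreal (C * \<delta>\<^sup>2)"
proof -
  let ?N = "2 * CARD('n) + 2"
  define I where "I = (\<integral>w. (1 + norm w) ^ ?N * norm (heat 1 (w :: real^'n)) \<partial>lborel)"
  have Iint: "integrable lborel (\<lambda>w :: real^'n. (1 + norm w) ^ ?N * norm (heat 1 w))"
    by (rule rapid_integrable_weighted[OF rapid_gauss_eps]) simp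
  have I0: "0 \<le> I" unfolding I_def by (rule integral_nonneg_AE) auto
  have I: "(\<integral>\<^sup>+w. ennreal ((1 + norm w) ^ ?N * norm (heat 1 (w :: real^'n))) \<partial>lborel) = ennreal I"
    unfolding I_def by (rule nn_integral_eq_integral[OF Iint]) auto
  define C where "C = (1 + 4 * A) ^ (2 * CARD('n)) * I"
  have "(\<integral>\<^sup>+z. ennreal (gauss_eps \<delta> (z :: real^'n) * ((norm z)\<^sup>2 * (1 + 4 * r * norm z) ^ (2 * CARD('n)))) \<partial>lborel) \<le> ennreal (C * \<delta>\<^sup>2)"
    if r: "0 < r" and d: "0 < \<delta>" and A: "r * \<delta> \<le> A" for r \<delta>
  proof -
    have "(\<integral>\<^sup>+z. ennreal (gauss_eps \<delta> (z :: real^'n) * ((norm z)\<^sup>2 * (1 + 4 * r * norm z) ^ (2 * CARD('n)))) \<partial>lborel) =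
       (\<integral>\<^sup>+w. ennreal (\<delta> ^ CARD('n)) * ennreal (gauss_eps \<delta> (\<delta> *\<^sub>R (w :: real^'n)) *
         ((norm (\<delta> *\<^sub>R w))\<^sup>2 * (1 + 4 * r * norm (\<delta> *\<^sub>R w)) ^ (2 * CARD('n)))) \<partial>lborel)"
      using d by (intro nn_integral_dil[symmetric]) auto
    also have "\<dots> \<le> (\<integral>\<^sup>+w. ennreal (\<delta>\<^sup>2 * (1 + 4 * A) ^ (2 * CARD('n))) * ennreal ((1 + norm w) ^ ?N * norm (heat 1 (w :: real^'n))) \<partial>lborel)"
    proof (rule nn_integral_mono)
      fix w :: "real^'n"
      have g: "\<delta> ^ CARD('n) * gauss_eps \<delta> (\<delta> *\<^sub>R w) = gauss_eps 1 w"
        using d by (simp add: gauss_eps_def)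
      have "r * \<delta> * norm w \<le> A * norm w" by (rule mult_right_mono[OF A]) simp
      also have "\<dots> \<le> A * (1 + norm w)" by (rule mult_left_mono) (use assms in auto)
      finally have "4 * (r * \<delta> * norm w) \<le> 4 * (A * (1 + norm w))" by simp
      moreover have "1 + 4 * (A * (1 + norm w)) \<le> (1 + 4 * A) * (1 + norm w)"
        by (simp add: algebra_simps)
      ultimately have "1 + 4 * (r * \<delta> * norm w) \<le> (1 + 4 * A) * (1 + norm w)" by linarith
      then have p: "(1 + 4 * r * norm (\<delta> *\<^sub>R w)) ^ (2 * CARD('n)) \<le> (1 + 4 * A) ^ (2 * CARD('n)) * (1 + norm w) ^ (2 * CARD('n))"
        unfolding power_mult_distrib[symmetric] using r d by (intro power_mono) (auto simp: mult_ac)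
      have q: "(norm (\<delta> *\<^sub>R w))\<^sup>2 \<le> \<delta>\<^sup>2 * (1 + norm w)\<^sup>2"
        using d power_mono[of "norm w" "1 + norm w" 2] by (simp add: power_mult_distrib)
      have "\<delta> ^ CARD('n) * (gauss_eps \<delta> (\<delta> *\<^sub>R w) * ((norm (\<delta> *\<^sub>R w))\<^sup>2 * (1 + 4 * r * norm (\<delta> *\<^sub>R w)) ^ (2 * CARD('n))))
        = gauss_eps 1 w * ((norm (\<delta> *\<^sub>R w))\<^sup>2 * (1 + 4 * r * norm (\<delta> *\<^sub>R w)) ^ (2 * CARD('n)))"
        unfolding g[symmetric] by (simp only: mult.assoc)
      also have "\<dots> \<le> gauss_eps 1 w * ((\<delta>\<^sup>2 * (1 + norm w)\<^sup>2) * ((1 + 4 * A) ^ (2 * CARD('n)) * (1 + norm w) ^ (2 * CARD('n))))"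
        by (intro mult_left_mono mult_mono p q) (use r d in auto)
      also have "\<dots> = (\<delta>\<^sup>2 * (1 + 4 * A) ^ (2 * CARD('n))) * ((1 + norm w) ^ ?N * norm (heat 1 w))"
        by (simp add: power_add power2_eq_square mult_ac)
      finally show "ennreal (\<delta> ^ CARD('n)) * ennreal (gauss_eps \<delta> (\<delta> *\<^sub>R w) * ((norm (\<delta> *\<^sub>R w))\<^sup>2 * (1 + 4 * r * norm (\<delta> *\<^sub>R w)) ^ (2 * CARD('n))))
        \<le> ennreal (\<delta>\<^sup>2 * (1 + 4 * A) ^ (2 * CARD('n))) * ennreal ((1 + norm w) ^ ?N * norm (heat 1 w))"
        using d assms by (subst (1 2) ennreal_mult''[symmetric]) (auto intro!: ennreal_leI mult_nonneg_nonneg)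
    qed
    also have "\<dots> = ennreal (\<delta>\<^sup>2 * (1 + 4 * A) ^ (2 * CARD('n))) * ennreal I"
      unfolding I[symmetric] by (rule nn_integral_cmult) measurable
    also have "\<dots> = ennreal (C * \<delta>\<^sup>2)"
      using I0 assms by (simp add: C_def ennreal_mult[symmetric] mult_ac)
    finally show ?thesis .
  qed
  moreover have "0 \<le> C" using I0 assms by (simp add: C_def)
  ultimately show ?thesis using that by blast
qed

text \<open>The commutator before division by \<epsilon>^2; in this form it obeys a product rule
  under the heat semigroup.\<close>

definition heat_comm :: "real \<Rightarrow> (real^'n::finite \<Rightarrow> complex) \<Rightarrow> (real^'n \<Rightarrow> real^'n) \<Rightarrow> real^'n \<Rightarrow> complex" where
  "heat_comm \<delta> g \<psi> x = conv (heat \<delta>) g (\<psi> x) - conv (heat \<delta>) (g \<circ> \<psi>) x"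

text \<open>Evenness of the Gaussian allows averaging the integrand with its reflection. The
  deviations of \<psi> from a translation then appear in pairs whose sum is quadratic in
  \<open>z\<close>.\<close>

lemma heat_comm_symmetrized:
  fixes g :: "real^'n::finite \<Rightarrow> complex"
  assumes d: "0 < \<delta>" and g: "bdd_meas g" and \<psi>: "\<psi> \<in> borel_measurable borel"
  shows "2 * heat_comm \<delta> g \<psi> x = (\<integral>z. heat \<delta> z * (g (\<psi> x - z) + g (\<psi> x + z) - g (\<psi> (x - z)) - g (\<psi> (x + z))) \<partial>lborel)"
proof -
  have gp: "bdd_meas (g \<circ> \<psi>)" by (rule bdd_meas_comp[OF g \<psi>])
  have i1: "integrable lborel (\<lambda>z. heat \<delta> z * g (\<psi> x - z))" and i2: "integrable lborel (\<lambda>z. heat \<delta> z * g (\<psi> (x - z)))"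
    using integrable_mult_bdd_meas(1)[OF integrable_heat[OF d] g, of "\<psi> x"]
      integrable_mult_bdd_meas(1)[OF integrable_heat[OF d] gp, of x] by simp_all
  define f where "f = (\<lambda>z. heat \<delta> z * (g (\<psi> x - z) - g (\<psi> (x - z))))"
  have fi: "integrable lborel f"
    unfolding f_def right_diff_distrib by (rule Bochner_Integration.integrable_diff[OF i1 i2])
  have "heat_comm \<delta> g \<psi> x = (\<integral>z. f z \<partial>lborel)"
    unfolding heat_comm_def conv_def f_def right_diff_distrib
    by (subst Bochner_Integration.integral_diff[OF i1 i2]) simp
  moreover have "(\<integral>z. f (0 - z) \<partial>lborel) = (\<integral>z. f z \<partial>lborel)" by (rule integral_lborel_reflect)
  moreover have fi': "integrable lborel (\<lambda>z. f (0 - z))" using fi integrable_lborel_reflect_iff[of f 0] by blast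
  ultimately have "2 * heat_comm \<delta> g \<psi> x = (\<integral>z. f z + f (0 - z) \<partial>lborel)"
    using Bochner_Integration.integral_add[OF fi fi'] by simp
  also have "\<dots> = (\<integral>z. heat \<delta> z * (g (\<psi> x - z) + g (\<psi> x + z) - g (\<psi> (x - z)) - g (\<psi> (x + z))) \<partial>lborel)"
    by (intro Bochner_Integration.integral_cong refl) (simp add: f_def algebra_simps)
  finally show ?thesis .
qed

text \<open>Such a map is 2-Lipschitz; continuity gives measurability of the compositions.\<close>

lemma near_identity_continuous:
  fixes \<psi> :: "real^'n::finite \<Rightarrow> real^'n"
  assumes \<rho>: "\<rho> \<le> 1/2" and \<psi>: "\<And>x y. norm (\<psi> x - \<psi> y - (x - y)) \<le> \<rho> * norm (x - y)"
  shows "continuous_on UNIV \<psi>"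
proof -
  have "dist (\<psi> x) (\<psi> y) \<le> 2 * dist x y" for x y
  proof -
    have "norm (\<psi> x - \<psi> y) \<le> norm (\<psi> x - \<psi> y - (x - y)) + norm (x - y)"
      using norm_triangle_ineq[of "\<psi> x - \<psi> y - (x - y)" "x - y"] by simp
    also have "\<dots> \<le> (1/2) * norm (x - y) + norm (x - y)"
      using order_trans[OF \<psi> mult_right_mono[OF \<rho>]] by simp
    finally show ?thesis using norm_ge_zero[of "x - y"] unfolding dist_norm by linarith
  qed
  then have "2-lipschitz_on UNIV \<psi>" by (intro lipschitz_onI) auto
  then show ?thesis by (rule lipschitz_on_continuous_on)
qed

text \<open>The column bound of Schur's test, with no change of variables. A point \<open>x0\<close>
  minimises the distance of \<open>\<psi> x\<close> to \<open>y\<close> up to 1/r; since \<psi>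
  shrinks distances by at most a factor 2, \<open>norm (x - x0)\<close> is at most four times that
  distance plus 2/r, and the weight moves to \<open>x - x0\<close>.\<close>

lemma wt_near_identity_integral:
  fixes \<psi> :: "real^'n::finite \<Rightarrow> real^'n"
  assumes r: "0 < r" and \<rho>: "\<rho> \<le> 1/2" and \<psi>: "\<And>x y. norm (\<psi> x - \<psi> y - (x - y)) \<le> \<rho> * norm (x - y)"
  shows "(\<integral>\<^sup>+x. ennreal (r ^ CARD('n) * wt (r *\<^sub>R (\<psi> x - y))) \<partial>lborel) \<le> ennreal (4 ^ (2 * CARD('n)) * (\<integral>x. wt (x :: real^'n) \<partial>lborel))"
proof -
  define W where "W = (\<integral>x. wt (x :: real^'n) \<partial>lborel)"
  have W: "(\<integral>\<^sup>+x. ennreal (wt (x::real^'n)) \<partial>lborel) = ennreal W"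
    unfolding W_def by (intro nn_integral_eq_integral wt_integrable) auto
  have W0: "0 \<le> W" unfolding W_def by (rule integral_nonneg_AE) auto
  have inf: "bdd_below (range (\<lambda>x. norm (\<psi> x - y)))" by (auto simp: bdd_below_def intro!: exI[of _ 0])
  have "(INF x. norm (\<psi> x - y)) < (INF x. norm (\<psi> x - y)) + 1 / r" using r by simp
  then obtain x0 where x0: "norm (\<psi> x0 - y) < (INF x. norm (\<psi> x - y)) + 1 / r"
    using iffD1[OF cINF_less_iff[OF UNIV_not_empty inf]] by blast
  have "wt (r *\<^sub>R (\<psi> x - y)) \<le> 4 ^ (2 * CARD('n)) * wt (r *\<^sub>R (x - x0))" for x
  proof (rule wt_le_scaled)
    have "norm (\<psi> x0 - y) \<le> norm (\<psi> x - y) + 1 / r"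
      using x0 cINF_lower[OF inf, of x] by simp
    moreover have "norm (\<psi> x - \<psi> x0) \<le> norm (\<psi> x - y) + norm (\<psi> x0 - y)"
      using norm_triangle_ineq4[of "\<psi> x - y" "\<psi> x0 - y"] by simp
    moreover have "norm (x - x0) \<le> norm (\<psi> x - \<psi> x0) + (1/2) * norm (x - x0)"
      using norm_triangle_ineq4[of "\<psi> x - \<psi> x0" "\<psi> x - \<psi> x0 - (x - x0)"]
        order_trans[OF \<psi>[of x x0] mult_right_mono[OF \<rho>, of "norm (x - x0)"]] by simp
    ultimately have "norm (x - x0) \<le> 4 * norm (\<psi> x - y) + 2 * (1 / r)" by linarith
    then have "r * norm (x - x0) \<le> r * (4 * norm (\<psi> x - y) + 2 * (1 / r))"
      by (rule mult_left_mono) (use r in simp)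
    also have "\<dots> = 4 * (r * norm (\<psi> x - y)) + 2" using r by (simp add: field_simps)
    finally show "1 + norm (r *\<^sub>R (x - x0)) \<le> 4 * (1 + norm (r *\<^sub>R (\<psi> x - y)))"
      using r by (simp add: distrib_left)
  qed simp
  then have "(\<integral>\<^sup>+x. ennreal (r ^ CARD('n) * wt (r *\<^sub>R (\<psi> x - y))) \<partial>lborel) \<le>
     (\<integral>\<^sup>+x. ennreal (4 ^ (2 * CARD('n))) * (ennreal (r ^ CARD('n)) * ennreal (wt (r *\<^sub>R (x - x0)))) \<partial>lborel)"
    using r by (intro nn_integral_mono)
      (auto simp: ennreal_mult[symmetric] mult.left_commute intro!: ennreal_leI mult_left_mono)
  also have "\<dots> = ennreal (4 ^ (2 * CARD('n))) * (\<integral>\<^sup>+x. ennreal (r ^ CARD('n)) * ennreal (wt (r *\<^sub>R (x - x0))) \<partial>lborel)"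
    by (rule nn_integral_cmult) measurable
  also have "(\<integral>\<^sup>+x. ennreal (r ^ CARD('n)) * ennreal (wt (r *\<^sub>R (x - x0))) \<partial>lborel) =
      (\<integral>\<^sup>+x. ennreal (r ^ CARD('n)) * ennreal (wt (r *\<^sub>R (x :: real^'n))) \<partial>lborel)"
    by (rule nn_integral_lborel_shift(2)[of "\<lambda>x. ennreal (r ^ CARD('n)) * ennreal (wt (r *\<^sub>R x))"]) measurable
  also have "\<dots> = ennreal W" unfolding W[symmetric] by (rule nn_integral_dil[OF _ r]) measurable
  also have "ennreal (4 ^ (2 * CARD('n))) * ennreal W = ennreal (4 ^ (2 * CARD('n)) * W)"
    by (simp add: ennreal_mult W0)
  finally show ?thesis by (simp add: W_def)
qed

text \<open>Inserting \<open>g\<close> as a convolution with the dilated kernel moves the second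
  difference from \<open>g\<close> onto a Schwartz function. Its bound separates \<open>z\<close>
  from \<open>y\<close>: the Gaussian moment integrates the former and a weight centred at
  \<open>\<psi> x\<close> remains.\<close>

lemma heat_comm_pointwise:
  fixes h :: "real^'n::finite \<Rightarrow> complex"
  assumes h: "schwartz h" and A: "0 < A"
  obtains C where "0 \<le> C" "\<And>r \<delta> g \<psi> \<rho> x. 0 < r \<Longrightarrow> 0 < \<delta> \<Longrightarrow> r * \<delta> \<le> A \<Longrightarrow> bdd_meas g \<Longrightarrow>
     (\<And>x. conv (dil r h) g x = g x) \<Longrightarrow> 0 \<le> \<rho> \<Longrightarrow> \<rho> \<le> 1/2 \<Longrightarrow>
     (\<And>x y. norm (\<psi> x - \<psi> y - (x - y)) \<le> \<rho> * norm (x - y)) \<Longrightarrow>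
     (\<And>x z. norm (\<psi> (x + z) + \<psi> (x - z) - 2 *\<^sub>R \<psi> x) \<le> \<rho> * r * (norm z)\<^sup>2) \<Longrightarrow>
     ennreal (norm (heat_comm \<delta> g \<psi> x)) \<le> ennreal (C * \<rho> * (r * \<delta>)\<^sup>2) *
       (\<integral>\<^sup>+y. ennreal (r ^ CARD('n) * wt (r *\<^sub>R (\<psi> x - y))) * ennreal (norm (g y)) \<partial>lborel)"
proof -
  obtain C where C: "0 \<le> C" "\<And>r p z a b \<rho>. 0 < r \<Longrightarrow> 0 \<le> \<rho> \<Longrightarrow> \<rho> \<le> 1/2 \<Longrightarrow> norm a \<le> \<rho> * norm z \<Longrightarrow> norm b \<le> \<rho> * norm z \<Longrightarrow>
     norm (a + b) \<le> \<rho> * r * (norm z)\<^sup>2 \<Longrightarrow>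
     norm (dil r h (p + z + a) + dil r h (p - z + b) - dil r h (p + z) - dil r h (p - z))
       \<le> (C * \<rho> * r\<^sup>2) * ((norm z)\<^sup>2 * (1 + 4 * r * norm z) ^ (2 * CARD('n))) * (r ^ CARD('n) * wt (r *\<^sub>R p))"
    using dil_kernel_difference[OF h] by blast
  obtain D where D: "0 \<le> D" "\<And>r \<delta>. 0 < r \<Longrightarrow> 0 < \<delta> \<Longrightarrow> r * \<delta> \<le> A \<Longrightarrow>
    (\<integral>\<^sup>+z. ennreal (gauss_eps \<delta> (z :: real^'n) * ((norm z)\<^sup>2 * (1 + 4 * r * norm z) ^ (2 * CARD('n)))) \<partial>lborel) \<le> ennreal (D * \<delta>\<^sup>2)"
    using gauss_eps_moment[OF A, where 'n = 'n] by blast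
  have "ennreal (norm (heat_comm \<delta> g \<psi> x)) \<le> ennreal (C * D * \<rho> * (r * \<delta>)\<^sup>2) *
       (\<integral>\<^sup>+y. ennreal (r ^ CARD('n) * wt (r *\<^sub>R (\<psi> x - y))) * ennreal (norm (g y)) \<partial>lborel)"
    if r: "0 < r" and d: "0 < \<delta>" and rd: "r * \<delta> \<le> A" and g: "bdd_meas g" and hg: "\<And>x. conv (dil r h) g x = g x"
      and \<rho>: "0 \<le> \<rho>" "\<rho> \<le> 1/2" and \<psi>1: "\<And>x y. norm (\<psi> x - \<psi> y - (x - y)) \<le> \<rho> * norm (x - y)"
      and \<psi>2: "\<And>x z. norm (\<psi> (x + z) + \<psi> (x - z) - 2 *\<^sub>R \<psi> x) \<le> \<rho> * r * (norm z)\<^sup>2"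
    for r \<delta> and g :: "real^'n \<Rightarrow> complex" and \<psi> \<rho> x
  proof -
    have pm [measurable]: "\<psi> \<in> borel_measurable borel"
      by (rule borel_measurable_continuous_onI[OF near_identity_continuous[OF \<rho>(2) \<psi>1]])
    have [measurable]: "g \<in> borel_measurable borel" by (rule bdd_meas_measurable[OF g])
    let ?k = "dil r h"
    have ki: "integrable lborel ?k"
      unfolding dil_def using integrable_lborel_affine[OF rapid_integrable[OF schwartz_rapid[OF h]], of r 0] r by simp
    define T where "T = (\<integral>\<^sup>+y. ennreal (r ^ CARD('n) * wt (r *\<^sub>R (\<psi> x - y))) * ennreal (norm (g y)) \<partial>lborel)"
    define m where "m = (\<lambda>z :: real^'n. (norm z)\<^sup>2 * (1 + 4 * r * norm z) ^ (2 * CARD('n)))"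
    have m0: "0 \<le> m z" for z unfolding m_def using r by simp
    have [measurable]: "m \<in> borel_measurable borel" unfolding m_def by measurable
    let ?B = "\<lambda>z. g (\<psi> x - z) + g (\<psi> x + z) - g (\<psi> (x - z)) - g (\<psi> (x + z))"
    have B: "ennreal (norm (?B z)) \<le> ennreal (C * \<rho> * r\<^sup>2 * m z) * T" for z
    proof -
      have gi: "g p = (\<integral>y. ?k (p - y) * g y \<partial>lborel)" and gint: "integrable lborel (\<lambda>y. ?k (p - y) * g y)" for p
        using hg[of p] conv_reflect[of ?k g p] integrable_mult_bdd_meas(3)[OF ki g, of p] by auto
      \<comment> \<open>\<open>a\<close> and \<open>b\<close> are the deviations of \<psi> from
        rigid translation at \<open>x + z\<close> and \<open>x - z\<close>; their sum is the second
        difference of \<psi>.\<close>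
      define a where "a = \<psi> (x + z) - \<psi> x - z"
      define b where "b = \<psi> (x - z) - \<psi> x + z"
      have a: "norm a \<le> \<rho> * norm z" using \<psi>1[of "x + z" x] by (simp add: a_def)
      have b: "norm b \<le> \<rho> * norm z" using \<psi>1[of "x - z" x] by (simp add: b_def)
      have ab: "norm (a + b) \<le> \<rho> * r * (norm z)\<^sup>2"
        using \<psi>2[of x z] by (simp add: a_def b_def scaleR_2 algebra_simps)
      let ?K = "\<lambda>y. ?k (\<psi> x - y + z + a) + ?k (\<psi> x - y - z + b) - ?k (\<psi> x - y + z) - ?k (\<psi> x - y - z)"
      have "- ?B z = (\<integral>y. ?k (\<psi> (x + z) - y) * g y + ?k (\<psi> (x - z) - y) * g y - ?k (\<psi> x + z - y) * g y - ?k (\<psi> x - z - y) * g y \<partial>lborel)"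
      proof -
        have "(\<integral>y. ?k (\<psi> (x + z) - y) * g y + ?k (\<psi> (x - z) - y) * g y - ?k (\<psi> x + z - y) * g y - ?k (\<psi> x - z - y) * g y \<partial>lborel)
          = g (\<psi> (x + z)) + g (\<psi> (x - z)) - g (\<psi> x + z) - g (\<psi> x - z)"
          unfolding gi[of "\<psi> (x + z)"] gi[of "\<psi> (x - z)"] gi[of "\<psi> x + z"] gi[of "\<psi> x - z"]
          by (simp add: gint)
        then show ?thesis by simp
      qed
      also have "\<dots> = (\<integral>y. ?K y * g y \<partial>lborel)"
        by (intro Bochner_Integration.integral_cong refl) (simp add: a_def b_def algebra_simps)
      finally have eq: "- ?B z = (\<integral>y. ?K y * g y \<partial>lborel)" .
      have "norm (?B z) = norm (\<integral>y. ?K y * g y \<partial>lborel)"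
        unfolding eq[symmetric] by (rule norm_minus_cancel[symmetric])
      then have "ennreal (norm (?B z)) \<le> (\<integral>\<^sup>+y. ennreal (norm (?K y * g y)) \<partial>lborel)"
        using norm_integral_le_nn_integral[of lborel "\<lambda>y. ?K y * g y"] by (simp only:)
      also have "\<dots> \<le> (\<integral>\<^sup>+y. ennreal (C * \<rho> * r\<^sup>2 * m z) * (ennreal (r ^ CARD('n) * wt (r *\<^sub>R (\<psi> x - y))) * ennreal (norm (g y))) \<partial>lborel)"
      proof (rule nn_integral_mono)
        fix y
        have "norm (?K y) \<le> (C * \<rho> * r\<^sup>2 * m z) * (r ^ CARD('n) * wt (r *\<^sub>R (\<psi> x - y)))"
          unfolding m_def by (rule C(2)[OF r \<rho> a b ab])
        then have "norm (?K y * g y) \<le> (C * \<rho> * r\<^sup>2 * m z) * (r ^ CARD('n) * wt (r *\<^sub>R (\<psi> x - y))) * norm (g y)"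
          unfolding norm_mult by (rule mult_right_mono) simp
        then show "ennreal (norm (?K y * g y)) \<le> ennreal (C * \<rho> * r\<^sup>2 * m z) * (ennreal (r ^ CARD('n) * wt (r *\<^sub>R (\<psi> x - y))) * ennreal (norm (g y)))"
          using C(1) \<rho> r m0[of z] by (simp add: ennreal_mult[symmetric] mult.assoc ennreal_leI)
      qed
      also have "\<dots> = ennreal (C * \<rho> * r\<^sup>2 * m z) * T"
        unfolding T_def by (rule nn_integral_cmult) measurable
      finally show ?thesis .
    qed
    have "ennreal (norm (heat_comm \<delta> g \<psi> x)) \<le> ennreal (norm (2 * heat_comm \<delta> g \<psi> x))"
      by (intro ennreal_leI) (simp add: norm_mult)
    also have "\<dots> \<le> (\<integral>\<^sup>+z. ennreal (norm (heat \<delta> z * ?B z)) \<partial>lborel)"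
      unfolding heat_comm_symmetrized[OF d g pm] by (rule norm_integral_le_nn_integral)
    also have "\<dots> \<le> (\<integral>\<^sup>+z. ennreal (C * \<rho> * r\<^sup>2) * (ennreal (gauss_eps \<delta> z * m z) * T) \<partial>lborel)"
    proof (rule nn_integral_mono)
      fix z
      have "ennreal (norm (heat \<delta> z * ?B z)) = ennreal (gauss_eps \<delta> z) * ennreal (norm (?B z))"
        using d by (simp add: norm_mult ennreal_mult)
      also have "\<dots> \<le> ennreal (gauss_eps \<delta> z) * (ennreal (C * \<rho> * r\<^sup>2 * m z) * T)"
        by (intro mult_left_mono B) simp
      also have "\<dots> = ennreal (C * \<rho> * r\<^sup>2) * (ennreal (gauss_eps \<delta> z * m z) * T)"
        using C(1) \<rho> m0[of z] d by (simp add: ennreal_mult mult_ac)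
      finally show "ennreal (norm (heat \<delta> z * ?B z)) \<le> ennreal (C * \<rho> * r\<^sup>2) * (ennreal (gauss_eps \<delta> z * m z) * T)" .
    qed
    also have "\<dots> = ennreal (C * \<rho> * r\<^sup>2) * ((\<integral>\<^sup>+z. ennreal (gauss_eps \<delta> z * m z) \<partial>lborel) * T)"
      by (simp add: nn_integral_cmult nn_integral_multc)
    also have "\<dots> \<le> ennreal (C * \<rho> * r\<^sup>2) * (ennreal (D * \<delta>\<^sup>2) * T)"
      unfolding m_def by (intro mult_left_mono mult_right_mono D(2)[OF r d rd]) auto
    also have "\<dots> = ennreal (C * D * \<rho> * (r * \<delta>)\<^sup>2) * T"
    proof -
      have "ennreal (C * \<rho> * r\<^sup>2) * ennreal (D * \<delta>\<^sup>2) = ennreal ((C * \<rho> * r\<^sup>2) * (D * \<delta>\<^sup>2))"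
        using C(1) D(1) \<rho> by (intro ennreal_mult[symmetric]) auto
      also have "(C * \<rho> * r\<^sup>2) * (D * \<delta>\<^sup>2) = C * D * \<rho> * (r * \<delta>)\<^sup>2" by (simp add: power_mult_distrib)
      finally show ?thesis by (simp only: mult.assoc[symmetric])
    qed
    finally show ?thesis unfolding T_def .
  qed
  moreover have "0 \<le> C * D" using C D by simp
  ultimately show ?thesis using that by blast
qed

text \<open>Schur's test for the pointwise kernel: rows are plain reflections and give the mass of
  the weight, columns need the distortion bound. The larger constant \<open>E\<close> serves
  both.\<close>

lemma L2_le_heat_comm:
  fixes h :: "real^'n::finite \<Rightarrow> complex"
  assumes h: "schwartz h" and A: "0 < A"
  obtains C where "0 \<le> C" "\<And>r \<delta> g \<psi> \<rho> a. 0 < r \<Longrightarrow> 0 < \<delta> \<Longrightarrow> r * \<delta> \<le> A \<Longrightarrow> bdd_meas g \<Longrightarrow>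
     (\<And>x. conv (dil r h) g x = g x) \<Longrightarrow> L2_le g a \<Longrightarrow> 0 \<le> \<rho> \<Longrightarrow> \<rho> \<le> 1/2 \<Longrightarrow>
     (\<And>x y. norm (\<psi> x - \<psi> y - (x - y)) \<le> \<rho> * norm (x - y)) \<Longrightarrow>
     (\<And>x z. norm (\<psi> (x + z) + \<psi> (x - z) - 2 *\<^sub>R \<psi> x) \<le> \<rho> * r * (norm z)\<^sup>2) \<Longrightarrow>
     L2_le (heat_comm \<delta> g \<psi>) (C * \<rho> * (r * \<delta>)\<^sup>2 * a)"
proof -
  obtain C where C: "0 \<le> C" "\<And>r \<delta> g \<psi> \<rho> x. 0 < r \<Longrightarrow> 0 < \<delta> \<Longrightarrow> r * \<delta> \<le> A \<Longrightarrow> bdd_meas g \<Longrightarrow>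
     (\<And>x. conv (dil r h) g x = g x) \<Longrightarrow> 0 \<le> \<rho> \<Longrightarrow> \<rho> \<le> 1/2 \<Longrightarrow>
     (\<And>x y. norm (\<psi> x - \<psi> y - (x - y)) \<le> \<rho> * norm (x - y)) \<Longrightarrow>
     (\<And>x z. norm (\<psi> (x + z) + \<psi> (x - z) - 2 *\<^sub>R \<psi> x) \<le> \<rho> * r * (norm z)\<^sup>2) \<Longrightarrow>
     ennreal (norm (heat_comm \<delta> g \<psi> x)) \<le> ennreal (C * \<rho> * (r * \<delta>)\<^sup>2) *
       (\<integral>\<^sup>+y. ennreal (r ^ CARD('n) * wt (r *\<^sub>R (\<psi> x - y))) * ennreal (norm (g y)) \<partial>lborel)"
    using heat_comm_pointwise[OF h A] by blast
  define W where "W = (\<integral>x. wt (x :: real^'n) \<partial>lborel)"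
  have W0: "0 \<le> W" unfolding W_def by (rule integral_nonneg_AE) auto
  have W: "(\<integral>\<^sup>+x. ennreal (wt (x::real^'n)) \<partial>lborel) = ennreal W"
    unfolding W_def by (intro nn_integral_eq_integral wt_integrable) auto
  define E where "E = 4 ^ (2 * CARD('n)) * W"
  have E: "0 \<le> E" "W \<le> E" using W0 mult_right_mono[of 1 "4 ^ (2 * CARD('n))" W] by (auto simp: E_def)
  have "L2_le (heat_comm \<delta> g \<psi>) (C * E * \<rho> * (r * \<delta>)\<^sup>2 * a)"
    if r: "0 < r" and d: "0 < \<delta>" and rd: "r * \<delta> \<le> A" and g: "bdd_meas g" and hg: "\<And>x. conv (dil r h) g x = g x"
      and ga: "L2_le g a"
      and \<rho>: "0 \<le> \<rho>" "\<rho> \<le> 1/2" and \<psi>1: "\<And>x y. norm (\<psi> x - \<psi> y - (x - y)) \<le> \<rho> * norm (x - y)"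
      and \<psi>2: "\<And>x z. norm (\<psi> (x + z) + \<psi> (x - z) - 2 *\<^sub>R \<psi> x) \<le> \<rho> * r * (norm z)\<^sup>2"
    for r \<delta> and g :: "real^'n \<Rightarrow> complex" and \<psi> \<rho> a
  proof -
    have pm [measurable]: "\<psi> \<in> borel_measurable borel"
      by (rule borel_measurable_continuous_onI[OF near_identity_continuous[OF \<rho>(2) \<psi>1]])
    have [measurable]: "g \<in> borel_measurable borel" by (rule bdd_meas_measurable[OF g])
    define q where "q = C * \<rho> * (r * \<delta>)\<^sup>2"
    have q: "0 \<le> q" using C(1) \<rho> by (simp add: q_def)
    define \<kappa> where "\<kappa> = (\<lambda>x y. ennreal q * ennreal (r ^ CARD('n) * wt (r *\<^sub>R (\<psi> x - y))))"
    have "L2_le (heat_comm \<delta> g \<psi>) ((q * E) * a)"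
    proof (rule L2_le_schur[of _ \<kappa>])
      have [measurable]: "conv (heat \<delta>) g \<in> borel_measurable borel" "conv (heat \<delta>) (g \<circ> \<psi>) \<in> borel_measurable borel"
        by (intro conv_measurable; measurable)+
      show "heat_comm \<delta> g \<psi> \<in> borel_measurable borel" unfolding heat_comm_def[abs_def] by measurable
      show "case_prod \<kappa> \<in> borel_measurable (borel \<Otimes>\<^sub>M borel)" unfolding \<kappa>_def by measurable
      show "0 \<le> q * E" using q E by simp
      show "L2_le g a" by fact
      fix x
      have "ennreal (norm (heat_comm \<delta> g \<psi> x)) \<le> ennreal q *
         (\<integral>\<^sup>+y. ennreal (r ^ CARD('n) * wt (r *\<^sub>R (\<psi> x - y))) * ennreal (norm (g y)) \<partial>lborel)"
        unfolding q_def by (rule C(2)[OF r d rd g hg \<rho> \<psi>1 \<psi>2])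
      also have "\<dots> = (\<integral>\<^sup>+y. \<kappa> x y * ennreal (norm (g y)) \<partial>lborel)"
        unfolding \<kappa>_def mult.assoc by (rule nn_integral_cmult[symmetric]) measurable
      finally show "ennreal (norm (heat_comm \<delta> g \<psi> x)) \<le> (\<integral>\<^sup>+y. \<kappa> x y * ennreal (norm (g y)) \<partial>lborel)" .
      have "(\<integral>\<^sup>+y. ennreal (r ^ CARD('n) * wt (r *\<^sub>R (\<psi> x - y))) \<partial>lborel) = (\<integral>\<^sup>+y. ennreal (r ^ CARD('n) * wt (r *\<^sub>R (y :: real^'n))) \<partial>lborel)"
        by (rule nn_integral_lborel_reflect[of "\<lambda>y. ennreal (r ^ CARD('n) * wt (r *\<^sub>R y))"]) measurable
      also have "\<dots> = (\<integral>\<^sup>+y. ennreal (r ^ CARD('n)) * ennreal (wt (r *\<^sub>R (y :: real^'n))) \<partial>lborel)"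
        using r by (simp add: ennreal_mult)
      also have "\<dots> = ennreal W" unfolding W[symmetric] by (rule nn_integral_dil[OF _ r]) measurable
      finally have "(\<integral>\<^sup>+y. \<kappa> x y \<partial>lborel) = ennreal (q * W)"
        using q W0 by (simp add: \<kappa>_def nn_integral_cmult ennreal_mult)
      then show "(\<integral>\<^sup>+y. \<kappa> x y \<partial>lborel) \<le> ennreal (q * E)"
        using mult_left_mono[OF E(2) q] by (simp add: ennreal_leI)
    next
      fix y
      have "(\<integral>\<^sup>+x. \<kappa> x y \<partial>lborel) = ennreal q * (\<integral>\<^sup>+x. ennreal (r ^ CARD('n) * wt (r *\<^sub>R (\<psi> x - y))) \<partial>lborel)"
        unfolding \<kappa>_def by (rule nn_integral_cmult) measurable
      also have "\<dots> \<le> ennreal q * ennreal E"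
        unfolding E_def W_def by (intro mult_left_mono wt_near_identity_integral[OF r \<rho>(2) \<psi>1]) auto
      finally show "(\<integral>\<^sup>+x. \<kappa> x y \<partial>lborel) \<le> ennreal (q * E)" using q E by (simp add: ennreal_mult)
    qed
    then show ?thesis by (simp add: q_def mult_ac)
  qed
  moreover have "0 \<le> C * E" using C(1) E(1) by simp
  ultimately show ?thesis using that by blast
qed

section \<open>Absorption and telescoping along the heat semigroup\<close>

lemma L2_le_norm:
  assumes "L2_le g a"
  obtains b where "0 \<le> b" "L2_norm g = ennreal b" "L2_le g b" "\<And>c. L2_le g c \<Longrightarrow> b \<le> c"
proof -
  let ?S = "\<integral>\<^sup>+x. ennreal ((norm (g x))\<^sup>2) \<partial>lborel"
  have "?S \<le> ennreal (a\<^sup>2)" using assms by (simp add: L2_le_def)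
  also have "\<dots> < \<infinity>" by simp
  finally have fin: "?S < \<infinity>" .
  define b where "b = sqrt (enn2real ?S)"
  have b: "0 \<le> b" "L2_norm g = ennreal b"
    using fin by (auto simp: b_def L2_norm_def Let_def)
  have Lb: "L2_le g b" by (rule L2_le_of_L2_norm[OF L2_le_measurable[OF assms] b(2,1)])
  have "b \<le> c" if "L2_le g c" for c
    using L2_norm_le[OF that] L2_le_nonneg[OF that] unfolding b(2) by simp
  with b Lb that show ?thesis by blast
qed

text \<open>The hypothesis is applied to the smallest bound, the norm itself. The a priori bound
  \<open>a\<close> makes it finite, so half of it can be subtracted.\<close>

lemma L2_le_absorb:
  assumes g: "L2_le g a" and "\<And>a. L2_le g a \<Longrightarrow> L2_le g (a / 2 + c)"
  shows "L2_le g (2 * c)"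
proof -
  obtain b where b: "L2_le g b" "\<And>c. L2_le g c \<Longrightarrow> b \<le> c"
    using L2_le_norm[OF g] by metis
  have "b \<le> b / 2 + c" by (rule b(2)[OF assms(2)[OF b(1)]])
  with b(1) show ?thesis by (intro L2_le_mono[OF b(1)]) simp
qed

text \<open>A bounded integrable kernel is square integrable, so Cauchy-Schwarz in the reproducing
  formula bounds \<open>g\<close> everywhere.\<close>

lemma bdd_meas_reproducing:
  fixes k g :: "real^'n::finite \<Rightarrow> complex"
  assumes k: "rapid k" and g: "L2_le g a" and kg: "\<And>x. conv k g x = g x"
  shows "bdd_meas g"
proof -
  have [measurable]: "k \<in> borel_measurable borel" "g \<in> borel_measurable borel"
    using rapid_measurable[OF k] L2_le_measurable[OF g] .
  obtain C where C: "0 \<le> C" "\<And>x. norm (k x) \<le> C" using rapid_bounded[OF k] by blast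
  define I where "I = (\<integral>z. norm (k z) \<partial>lborel)"
  have I: "(\<integral>\<^sup>+z. ennreal (norm (k z)) \<partial>lborel) = ennreal I" "0 \<le> I"
    unfolding I_def using rapid_integrable[OF k] by (auto intro!: nn_integral_eq_integral integral_nonneg_AE)
  have k2: "(\<integral>\<^sup>+y. (ennreal (norm (k (x - y))))\<^sup>2 \<partial>lborel) \<le> ennreal (C * I)" for x
  proof -
    have "(\<integral>\<^sup>+y. (ennreal (norm (k (x - y))))\<^sup>2 \<partial>lborel) = (\<integral>\<^sup>+y. (ennreal (norm (k y)))\<^sup>2 \<partial>lborel)"
      by (rule nn_integral_lborel_reflect[of "\<lambda>y. (ennreal (norm (k y)))\<^sup>2"]) measurable
    also have "\<dots> \<le> (\<integral>\<^sup>+y. ennreal C * ennreal (norm (k y)) \<partial>lborel)"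
      using C by (intro nn_integral_mono) (auto simp: power2_eq_square intro!: mult_right_mono ennreal_leI)
    also have "\<dots> = ennreal C * ennreal I" unfolding I(1)[symmetric] by (rule nn_integral_cmult) measurable
    also have "\<dots> = ennreal (C * I)" using C(1) I(2) by (simp add: ennreal_mult)
    finally show ?thesis .
  qed
  have a: "0 \<le> a" "(\<integral>\<^sup>+y. (ennreal (norm (g y)))\<^sup>2 \<partial>lborel) \<le> ennreal (a\<^sup>2)"
    using g by (auto simp: L2_le_def ennreal_power)
  have "norm (g x) \<le> sqrt (C * I * a\<^sup>2)" for x
  proof -
    have "ennreal (norm (g x)) = ennreal (norm (\<integral>y. k (x - y) * g y \<partial>lborel))"
      using kg[of x] by (simp add: conv_reflect)
    also have "\<dots> \<le> (\<integral>\<^sup>+y. ennreal (norm (k (x - y) * g y)) \<partial>lborel)"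
      by (rule norm_integral_le_nn_integral)
    finally have "ennreal (norm (g x)) \<le> (\<integral>\<^sup>+y. ennreal (norm (k (x - y))) * ennreal (norm (g y)) \<partial>lborel)"
      by (simp add: norm_mult ennreal_mult)
    then have "(ennreal (norm (g x)))\<^sup>2 \<le> (\<integral>\<^sup>+y. ennreal (norm (k (x - y))) * ennreal (norm (g y)) \<partial>lborel)\<^sup>2"
      by (intro power_mono) auto
    also have "\<dots> \<le> (\<integral>\<^sup>+y. (ennreal (norm (k (x - y))))\<^sup>2 \<partial>lborel) * (\<integral>\<^sup>+y. (ennreal (norm (g y)))\<^sup>2 \<partial>lborel)"
      by (rule Cauchy_Schwarz_nn_integral) measurable
    also have "\<dots> \<le> ennreal (C * I) * ennreal (a\<^sup>2)"
      by (intro mult_mono k2 a(2)) auto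
    also have "\<dots> = ennreal (C * I * a\<^sup>2)" using C(1) I(2) by (simp add: ennreal_mult)
    finally have "(norm (g x))\<^sup>2 \<le> C * I * a\<^sup>2"
      using C(1) I(2) by (simp add: ennreal_power)
    then show ?thesis by (rule real_le_rsqrt)
  qed
  then show ?thesis unfolding bdd_meas_def by auto
qed

lemma nonlocal_fun_conv: "nonlocal_fun \<epsilon> g x = (conv (heat \<epsilon>) g x - g x) / complex_of_real (\<epsilon>\<^sup>2)"
  by (simp add: nonlocal_fun_def conv_reflect)

lemma II'_heat_comm: "II' \<epsilon> g \<psi> x = complex_of_real (1 / \<epsilon>\<^sup>2) * heat_comm \<epsilon> g \<psi> x"
  by (simp add: II'_def nonlocal_fun_conv heat_comm_def diff_divide_distrib)

text \<open>Widths add in squares: \<open>n\<close> steps of width \<delta> amount to one of width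
  \<open>sqrt (real n) * \<delta>\<close>.\<close>

lemma conv_heat_power:
  fixes g :: "real^'n::finite \<Rightarrow> complex"
  assumes d: "0 < \<delta>" and g: "bdd_meas g" and n: "0 < n"
  shows "conv (heat \<delta>) (conv (heat (sqrt (real n) * \<delta>)) g) = conv (heat (sqrt (real (Suc n)) * \<delta>)) g"
proof -
  have "sqrt (\<delta>\<^sup>2 + (sqrt (real n) * \<delta>)\<^sup>2) = sqrt ((sqrt (real (Suc n)) * \<delta>)\<^sup>2)"
    by (simp add: power_mult_distrib algebra_simps)
  also have "\<dots> = sqrt (real (Suc n)) * \<delta>" using d by (simp add: real_sqrt_mult)
  finally have "sqrt (\<delta>\<^sup>2 + (sqrt (real n) * \<delta>)\<^sup>2) = sqrt (real (Suc n)) * \<delta>" .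
  then show ?thesis using conv_heat_semigroup[OF d _ g, of "sqrt (real n) * \<delta>"] d n by (simp add: fun_eq_iff)
qed

text \<open>Both the estimate of the commutator for large \<open>r \<epsilon>\<close> and the bound of \<open>g\<close> by
  \<open>(K g - g) / \<epsilon>\<^sup>2\<close> for small \<open>r \<epsilon>\<close> telescope over heat steps: in the first case \<open>\<epsilon>\<close> is
  split into steps of size comparable to \<open>1 / r\<close>, each halving the norm of \<open>g\<close>; in the second,
  steps of size \<open>\<epsilon>\<close> are accumulated until the norm is halved.\<close>

lemma L2_le_II':
  fixes h :: "real^'n::finite \<Rightarrow> complex"
  assumes h: "schwartz h" and h0: "(\<integral>z. h z \<partial>lborel) = 0"
  obtains C where "0 \<le> C" "\<And>r \<epsilon> g \<psi> \<rho> a b. 0 < r \<Longrightarrow> 0 < \<epsilon> \<Longrightarrow> bdd_meas g \<Longrightarrow>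
     (\<And>x. conv (dil r h) g x = g x) \<Longrightarrow> L2_le g a \<Longrightarrow> L2_le (nonlocal_fun \<epsilon> g) b \<Longrightarrow> 0 \<le> \<rho> \<Longrightarrow> \<rho> \<le> 1/2 \<Longrightarrow>
     (\<And>x y. norm (\<psi> x - \<psi> y - (x - y)) \<le> \<rho> * norm (x - y)) \<Longrightarrow>
     (\<And>x z. norm (\<psi> (x + z) + \<psi> (x - z) - 2 *\<^sub>R \<psi> x) \<le> \<rho> * r * (norm z)\<^sup>2) \<Longrightarrow>
     L2_le (II' \<epsilon> g \<psi>) (C * \<rho> * b)"
proof -
  obtain K where K: "0 \<le> K" "\<And>\<epsilon> (h :: real^'n \<Rightarrow> complex) g a M. \<epsilon> > 0 \<Longrightarrow> integrable lborel h \<Longrightarrow>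
     (\<integral>z. h z \<partial>lborel) = 0 \<Longrightarrow> 0 \<le> M \<Longrightarrow> (\<integral>\<^sup>+z. ennreal (norm z * norm (h z)) \<partial>lborel) \<le> ennreal M \<Longrightarrow>
     bdd_meas g \<Longrightarrow> (\<And>x. conv h g x = g x) \<Longrightarrow> L2_le g a \<Longrightarrow> L2_le (conv (heat \<epsilon>) g) (K * M / \<epsilon> * a)"
    using L2_le_heat_mean_zero[where 'n = 'n] by blast
  have hi: "integrable lborel h" by (rule rapid_integrable[OF schwartz_rapid[OF h]])
  have [measurable]: "h \<in> borel_measurable borel" using hi by auto
  define M where "M = (\<integral>z. (1 + norm z) ^ 1 * norm (h z) \<partial>lborel)"
  have Mint: "integrable lborel (\<lambda>z. (1 + norm z) ^ 1 * norm (h z))"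
    by (rule rapid_integrable_weighted[OF schwartz_rapid[OF h]])
  have M0: "0 \<le> M" unfolding M_def by (rule integral_nonneg_AE) auto
  have M: "(\<integral>\<^sup>+z. ennreal (norm z * norm (h z)) \<partial>lborel) \<le> ennreal M"
  proof -
    have "(\<integral>\<^sup>+z. ennreal (norm z * norm (h z)) \<partial>lborel) \<le> (\<integral>\<^sup>+z. ennreal ((1 + norm z) ^ 1 * norm (h z)) \<partial>lborel)"
      by (intro nn_integral_mono ennreal_leI mult_right_mono) auto
    also have "\<dots> = ennreal M" unfolding M_def by (rule nn_integral_eq_integral[OF Mint]) auto
    finally show ?thesis .
  qed
  \<comment> \<open>The threshold for halving: once \<open>A \<le> r * s\<close>, the decay factor
    \<open>K * (M / r) / s\<close> is at most 1/2. The maximum with 1 keeps \<open>A\<close>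
    positive.\<close>
  define A where "A = max 1 (2 * K * M)"
  have A: "0 < A" "1 \<le> A" "2 * K * M \<le> A" by (auto simp: A_def)
  \<comment> \<open>The commutator estimate is taken with threshold \<open>2 * A\<close> because
    rounding the number of steps makes them slightly longer than the halving threshold.\<close>
  have A2: "0 < 2 * A" using A(1) by simp
  obtain C where C: "0 \<le> C" "\<And>r \<delta> g \<psi> \<rho> a. 0 < r \<Longrightarrow> 0 < \<delta> \<Longrightarrow> r * \<delta> \<le> 2 * A \<Longrightarrow> bdd_meas g \<Longrightarrow>
     (\<And>x. conv (dil r h) g x = g x) \<Longrightarrow> L2_le g a \<Longrightarrow> 0 \<le> \<rho> \<Longrightarrow> \<rho> \<le> 1/2 \<Longrightarrow>
     (\<And>x y. norm (\<psi> x - \<psi> y - (x - y)) \<le> \<rho> * norm (x - y)) \<Longrightarrow>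
     (\<And>x z. norm (\<psi> (x + z) + \<psi> (x - z) - 2 *\<^sub>R \<psi> x) \<le> \<rho> * r * (norm z)\<^sup>2) \<Longrightarrow>
     L2_le (heat_comm \<delta> g \<psi>) (C * \<rho> * (r * \<delta>)\<^sup>2 * a)"
    using L2_le_heat_comm[OF h A2] by blast
  have "L2_le (II' \<epsilon> g \<psi>) (8 * C * A\<^sup>2 * \<rho> * b)"
    if r: "0 < r" and e: "0 < \<epsilon>" and g: "bdd_meas g" and hg: "\<And>x. conv (dil r h) g x = g x"
      and ga: "L2_le g a" and gb: "L2_le (nonlocal_fun \<epsilon> g) b"
      and \<rho>: "0 \<le> \<rho>" "\<rho> \<le> 1/2" and \<psi>1: "\<And>x y. norm (\<psi> x - \<psi> y - (x - y)) \<le> \<rho> * norm (x - y)"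
      and \<psi>2: "\<And>x z. norm (\<psi> (x + z) + \<psi> (x - z) - 2 *\<^sub>R \<psi> x) \<le> \<rho> * r * (norm z)\<^sup>2"
    for r \<epsilon> and g :: "real^'n \<Rightarrow> complex" and \<psi> \<rho> a b
  proof -
    have pm: "\<psi> \<in> borel_measurable borel"
      by (rule borel_measurable_continuous_onI[OF near_identity_continuous[OF \<rho>(2) \<psi>1]])
    have gp: "bdd_meas (g \<circ> \<psi>)" by (rule bdd_meas_comp[OF g pm])
    have b0: "0 \<le> b" by (rule L2_le_nonneg[OF gb])
    let ?k = "dil r h"
    have ki: "integrable lborel ?k"
      unfolding dil_def using integrable_lborel_affine[OF hi, of r 0] r by simp
    have k0: "(\<integral>z. ?k z \<partial>lborel) = 0"
      using integral_lborel_affine[of r h 0] r h0 by (simp add: dil_def)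
    have kM: "(\<integral>\<^sup>+z. ennreal (norm z * norm (?k z)) \<partial>lborel) \<le> ennreal (M / r)"
    proof -
      have "(\<integral>\<^sup>+z. ennreal (norm z * norm (?k z)) \<partial>lborel) =
         (\<integral>\<^sup>+z. ennreal (r ^ CARD('n)) * (\<lambda>z. ennreal (1 / r) * ennreal (norm z * norm (h z))) (r *\<^sub>R z) \<partial>lborel)"
        using r by (intro nn_integral_cong) (simp add: dil_def norm_mult norm_power ennreal_mult[symmetric] mult_ac)
      also have "\<dots> = (\<integral>\<^sup>+z. ennreal (1 / r) * ennreal (norm z * norm (h z)) \<partial>lborel)"
        by (rule nn_integral_dil[OF _ r]) measurable
      also have "\<dots> = ennreal (1 / r) * (\<integral>\<^sup>+z. ennreal (norm z * norm (h z)) \<partial>lborel)"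
        by (rule nn_integral_cmult) measurable
      also have "\<dots> \<le> ennreal (1 / r) * ennreal M" by (intro mult_left_mono M) auto
      also have "\<dots> = ennreal (M / r)" using r M0 by (simp add: ennreal_mult[symmetric])
      finally show ?thesis .
    qed
    have half: "L2_le (conv (heat s) f) (q / 2)"
      if s: "A \<le> r * s" and f: "bdd_meas f" and hf: "\<And>x. conv ?k f x = f x" and fq: "L2_le f q" for s f q
    proof (rule L2_le_mono)
      have s0: "0 < s" using s A(1) r by (meson less_le_trans zero_less_mult_pos)
      show "L2_le (conv (heat s) f) (K * (M / r) / s * q)"
        by (rule K(2)[OF s0 ki k0 _ kM f hf fq]) (use M0 r in simp)
      have "K * (M / r) / s \<le> 1/2" using s A(3) r s0 by (simp add: field_simps)
      from mult_right_mono[OF this L2_le_nonneg[OF fq]] show "K * (M / r) / s * q \<le> q / 2" by simp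
    qed
    have repr: "conv ?k (conv (heat s) f) x = conv (heat s) f x"
      if "0 < s" "bdd_meas f" "\<And>x. conv ?k f x = f x" for s f x
    proof -
      have "conv ?k f = f" using that(3) by (rule ext)
      with conv_comm[OF ki integrable_heat[OF that(1)] that(2), of x] show ?thesis by simp
    qed
    have diff: "L2_le (\<lambda>x. g x - conv (heat \<epsilon>) g x) (\<epsilon>\<^sup>2 * b)"
    proof -
      have "(\<lambda>x. g x - conv (heat \<epsilon>) g x) = (\<lambda>x. (- complex_of_real (\<epsilon>\<^sup>2)) * nonlocal_fun \<epsilon> g x)"
        using e by (simp add: fun_eq_iff nonlocal_fun_conv)
      moreover have "norm (- complex_of_real (\<epsilon>\<^sup>2)) = \<epsilon>\<^sup>2"
        unfolding norm_minus_cancel norm_of_real by simp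
      ultimately show ?thesis using L2_le_cmult[OF gb, of "- complex_of_real (\<epsilon>\<^sup>2)"] by simp
    qed
    have "L2_le (heat_comm \<epsilon> g \<psi>) (8 * C * A\<^sup>2 * \<rho> * b * \<epsilon>\<^sup>2)"
    proof (cases "A \<le> r * \<epsilon>")
      case True
      \<comment> \<open>The block is its heat evolution, halved in norm, plus the difference that
        \<open>b\<close> controls.\<close>
      have "L2_le g (2 * (\<epsilon>\<^sup>2 * b))"
      proof (rule L2_le_absorb[OF ga])
        fix q assume "L2_le g q"
        from L2_le_add[OF half[OF True g hg this] diff] show "L2_le g (q / 2 + \<epsilon>\<^sup>2 * b)" by simp
      qed
      then have g2: "L2_le g (2 * \<epsilon>\<^sup>2 * b)" by (simp only: mult.assoc)
      \<comment> \<open>Rounding \<open>X\<close> down gives \<open>N\<close> steps of width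
        \<delta> whose \<open>(r * \<delta>)\<^sup>2\<close> lies between \<open>A\<^sup>2\<close>
        and \<open>2 * A\<^sup>2\<close>: long enough for halving, short enough for the commutator
        estimate.\<close>
      define X where "X = (r * \<epsilon> / A)\<^sup>2"
      have X1: "1 \<le> X" unfolding X_def using True A(1) by simp
      define N where "N = nat \<lfloor>X\<rfloor>"
      have f1: "1 \<le> \<lfloor>X\<rfloor>" using X1 by linarith
      then have "real N = of_int \<lfloor>X\<rfloor>" "1 \<le> real N" by (simp_all add: N_def)
      then have N: "0 < N" "real N \<le> X" "X \<le> 2 * real N"
        using floor_correct[of X] by linarith+
      define \<delta> where "\<delta> = \<epsilon> / sqrt (real N)"
      have d: "0 < \<delta>" using e N by (simp add: \<delta>_def)
      have eN: "\<epsilon> = sqrt (real N) * \<delta>" using N by (simp add: \<delta>_def)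
      have rd2: "(r * \<delta>)\<^sup>2 = A\<^sup>2 * (X / real N)"
        using A(1) N(1) by (simp add: X_def \<delta>_def power_mult_distrib power_divide)
      have rdA: "A \<le> r * \<delta>"
      proof (rule power2_le_imp_le)
        have "A\<^sup>2 * 1 \<le> A\<^sup>2 * (X / real N)" using N by (intro mult_left_mono) auto
        then show "A\<^sup>2 \<le> (r * \<delta>)\<^sup>2" unfolding rd2 by simp
      qed (use r d in simp)
      have rd2': "(r * \<delta>)\<^sup>2 \<le> 2 * A\<^sup>2"
      proof -
        have "A\<^sup>2 * (X / real N) \<le> A\<^sup>2 * 2" using N by (intro mult_left_mono) (auto simp: field_simps)
        then show ?thesis unfolding rd2 by simp
      qed
      have rdA': "r * \<delta> \<le> 2 * A"
      proof (rule power2_le_imp_le)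
        have "(2 * A)\<^sup>2 = 4 * A\<^sup>2" by (simp add: power_mult_distrib)
        with rd2' zero_le_power2[of A] show "(r * \<delta>)\<^sup>2 \<le> (2 * A)\<^sup>2" by linarith
      qed (use A in simp)
      define q where "q = 2 * \<epsilon>\<^sup>2 * b"
      have q: "0 \<le> q" using b0 by (simp add: q_def)
      define c where "c = C * \<rho> * (r * \<delta>)\<^sup>2"
      have c: "0 \<le> c" using C(1) \<rho> by (simp add: c_def)
      let ?g = "\<lambda>n. conv (heat (sqrt (real n) * \<delta>)) g"
      have s0: "0 < sqrt (real n) * \<delta>" if "0 < n" for n using that d by simp
      have gn: "bdd_meas (?g n)" "\<And>x. conv ?k (?g n) x = ?g n x" if "0 < n" for n
        using bdd_meas_conv[OF integrable_heat[OF s0[OF that]] g] repr[OF s0[OF that] g hg] by blast+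
      have decay: "L2_le (?g (Suc n)) (q / 2 ^ Suc n)" for n
      proof (induction n)
        case 0
        show ?case using half[OF rdA g hg, of q] g2 by (simp add: q_def)
      next
        case (Suc n)
        have "L2_le (conv (heat \<delta>) (?g (Suc n))) (q / 2 ^ Suc n / 2)"
          by (rule half[OF rdA gn(1) gn(2) Suc]) auto
        then show ?case unfolding conv_heat_power[OF d g zero_less_Suc] by (simp add: field_simps)
      qed
      \<comment> \<open>The factor \<open>2 - 2 / 2 ^ Suc n\<close> is the geometric sum 1 + 1/2 +
        ... + 1/2^n, so the accumulated bound stays below 2 whatever the number of steps.\<close>
      have "L2_le (heat_comm (sqrt (real (Suc n)) * \<delta>) g \<psi>) (c * q * (2 - 2 / 2 ^ Suc n))" for n
      proof (induction n)
        case 0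
        show ?case using C(2)[OF r d rdA' g hg g2 \<rho> \<psi>1 \<psi>2] by (simp add: c_def q_def)
      next
        case (Suc n)
        let ?s = "sqrt (real (Suc n)) * \<delta>"
        \<comment> \<open>The product rule for commutators: a new step acts on the evolved block,
          which is already small, and the old commutator is merely transported by the L2-contractive
          heat step.\<close>
        have eq: "heat_comm (sqrt (real (Suc (Suc n))) * \<delta>) g \<psi> =
            (\<lambda>x. heat_comm \<delta> (?g (Suc n)) \<psi> x + conv (heat \<delta>) (heat_comm ?s g \<psi>) x)"
        proof (rule ext)
          fix x
          have "conv (heat \<delta>) (heat_comm ?s g \<psi>) x = conv (heat \<delta>) (\<lambda>x. (?g (Suc n) \<circ> \<psi>) x - conv (heat ?s) (g \<circ> \<psi>) x) x"
            by (simp add: heat_comm_def[abs_def])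
          also have "\<dots> = conv (heat \<delta>) (?g (Suc n) \<circ> \<psi>) x - conv (heat \<delta>) (conv (heat ?s) (g \<circ> \<psi>)) x"
            by (intro conv_diff integrable_heat d bdd_meas_comp gn(1) pm bdd_meas_conv s0 gp zero_less_Suc)
          finally show "heat_comm (sqrt (real (Suc (Suc n))) * \<delta>) g \<psi> x =
             heat_comm \<delta> (?g (Suc n)) \<psi> x + conv (heat \<delta>) (heat_comm ?s g \<psi>) x"
            unfolding heat_comm_def conv_heat_power[OF d g zero_less_Suc] conv_heat_power[OF d gp zero_less_Suc] by simp
        qed
        have "L2_le (heat_comm \<delta> (?g (Suc n)) \<psi>) (C * \<rho> * (r * \<delta>)\<^sup>2 * (q / 2 ^ Suc n))"
          by (rule C(2)[OF r d rdA' gn(1) gn(2) decay \<rho> \<psi>1 \<psi>2]) auto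
        then have "L2_le (heat_comm (sqrt (real (Suc (Suc n))) * \<delta>) g \<psi>) (c * (q / 2 ^ Suc n) + c * q * (2 - 2 / 2 ^ Suc n))"
          unfolding eq c_def[symmetric] by (rule L2_le_add) (rule L2_le_conv_heat[OF d Suc])
        also have "c * (q / 2 ^ Suc n) + c * q * (2 - 2 / 2 ^ Suc n) = c * q * (2 - 2 / 2 ^ Suc (Suc n))"
          by (simp add: field_simps)
        finally show ?case .
      qed
      from this[of "N - 1"] have "L2_le (heat_comm \<epsilon> g \<psi>) (c * q * (2 - 2 / 2 ^ N))"
        using N(1) eN by simp
      then show ?thesis
      proof (rule L2_le_mono)
        have "c * q * (2 - 2 / 2 ^ N) \<le> c * q * 2" using c q by (intro mult_left_mono) auto
        also have "\<dots> = (C * \<rho> * (4 * \<epsilon>\<^sup>2 * b)) * (r * \<delta>)\<^sup>2" by (simp add: c_def q_def)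
        also have "\<dots> \<le> (C * \<rho> * (4 * \<epsilon>\<^sup>2 * b)) * (2 * A\<^sup>2)"
          by (rule mult_left_mono[OF rd2']) (use C(1) \<rho> b0 in simp)
        finally show "c * q * (2 - 2 / 2 ^ N) \<le> 8 * C * A\<^sup>2 * \<rho> * b * \<epsilon>\<^sup>2" by (simp add: mult_ac)
      qed
    next
      case False
      then have re: "r * \<epsilon> < A" by simp
      define X where "X = (A / (r * \<epsilon>))\<^sup>2"
      have X1: "1 \<le> X" unfolding X_def using re r e by simp
      \<comment> \<open>Rounding up, so that \<open>N\<close> steps of width \<epsilon> reach the
        halving threshold while \<open>N\<close> stays below \<open>2 * X\<close>.\<close>
      define N where "N = nat \<lceil>X\<rceil>"
      have f1: "1 \<le> \<lceil>X\<rceil>" using X1 by linarith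
      then have "real N = of_int \<lceil>X\<rceil>" by (simp add: N_def)
      then have N: "0 < N" "X \<le> real N" "real N \<le> 2 * X"
        using ceiling_correct[of X] X1 by linarith+
      have sN: "A \<le> r * (sqrt (real N) * \<epsilon>)"
      proof -
        have "A / (r * \<epsilon>) = sqrt X" unfolding X_def using A r e by simp
        also have "\<dots> \<le> sqrt (real N)" using N by simp
        finally show ?thesis using r e by (simp add: field_simps)
      qed
      \<comment> \<open>Each further step adds at most \<open>\<epsilon>\<^sup>2 * b\<close>, since
        the heat operator does not increase L2 bounds.\<close>
      have acc: "L2_le (\<lambda>x. g x - conv (heat (sqrt (real (Suc n)) * \<epsilon>)) g x) (real (Suc n) * (\<epsilon>\<^sup>2 * b))" for n
      proof (induction n)
        case 0 show ?case using diff by simp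
      next
        case (Suc n)
        let ?s = "sqrt (real (Suc n)) * \<epsilon>"
        have s0: "0 < ?s" using e by simp
        have "conv (heat \<epsilon>) (\<lambda>x. g x - conv (heat ?s) g x) x = conv (heat \<epsilon>) g x - conv (heat (sqrt (real (Suc (Suc n))) * \<epsilon>)) g x" for x
          unfolding conv_heat_power[OF e g zero_less_Suc, symmetric]
          by (intro conv_diff integrable_heat e g bdd_meas_conv s0)
        then have eq: "(\<lambda>x. g x - conv (heat (sqrt (real (Suc (Suc n))) * \<epsilon>)) g x) =
           (\<lambda>x. (g x - conv (heat \<epsilon>) g x) + conv (heat \<epsilon>) (\<lambda>x. g x - conv (heat ?s) g x) x)"
          by (simp add: fun_eq_iff)
        have "L2_le (\<lambda>x. g x - conv (heat (sqrt (real (Suc (Suc n))) * \<epsilon>)) g x) (\<epsilon>\<^sup>2 * b + real (Suc n) * (\<epsilon>\<^sup>2 * b))"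
          unfolding eq by (rule L2_le_add[OF diff L2_le_conv_heat[OF e Suc]])
        also have "\<epsilon>\<^sup>2 * b + real (Suc n) * (\<epsilon>\<^sup>2 * b) = real (Suc (Suc n)) * (\<epsilon>\<^sup>2 * b)"
          by (simp add: algebra_simps)
        finally show ?case .
      qed
      from acc[of "N - 1"] have accN: "L2_le (\<lambda>x. g x - conv (heat (sqrt (real N) * \<epsilon>)) g x) (real N * (\<epsilon>\<^sup>2 * b))"
        using N(1) by simp
      have "L2_le g (2 * (real N * (\<epsilon>\<^sup>2 * b)))"
      proof (rule L2_le_absorb[OF ga])
        fix q assume "L2_le g q"
        from L2_le_add[OF half[OF sN g hg this] accN] show "L2_le g (q / 2 + real N * (\<epsilon>\<^sup>2 * b))" by simp
      qed
      from C(2)[OF r e _ g hg this \<rho> \<psi>1 \<psi>2] re A(1)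
      have "L2_le (heat_comm \<epsilon> g \<psi>) (C * \<rho> * (r * \<epsilon>)\<^sup>2 * (2 * (real N * (\<epsilon>\<^sup>2 * b))))" by simp
      then show ?thesis
      proof (rule L2_le_mono)
        \<comment> \<open>The loss of a factor \<open>N\<close> in bounding \<open>g\<close> is
          compensated exactly by the quadratic gain of the commutator.\<close>
        have "(r * \<epsilon>)\<^sup>2 * real N \<le> (r * \<epsilon>)\<^sup>2 * (2 * X)" by (intro mult_left_mono N) auto
        also have "\<dots> = 2 * A\<^sup>2" using r e by (simp add: X_def power_divide)
        finally have 1: "(r * \<epsilon>)\<^sup>2 * real N \<le> 2 * A\<^sup>2" .
        have "C * \<rho> * (r * \<epsilon>)\<^sup>2 * (2 * (real N * (\<epsilon>\<^sup>2 * b))) = (C * \<rho> * (2 * \<epsilon>\<^sup>2 * b)) * ((r * \<epsilon>)\<^sup>2 * real N)"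
          by (simp add: mult_ac)
        also have "\<dots> \<le> (C * \<rho> * (2 * \<epsilon>\<^sup>2 * b)) * (2 * A\<^sup>2)"
          by (rule mult_left_mono[OF 1]) (use C(1) \<rho> b0 in simp)
        also have "\<dots> \<le> 8 * C * A\<^sup>2 * \<rho> * b * \<epsilon>\<^sup>2"
          using C(1) \<rho> b0 by (simp add: mult_ac mult_left_mono)
        finally show "C * \<rho> * (r * \<epsilon>)\<^sup>2 * (2 * (real N * (\<epsilon>\<^sup>2 * b))) \<le> 8 * C * A\<^sup>2 * \<rho> * b * \<epsilon>\<^sup>2" .
      qed
    qed
    from L2_le_cmult[OF this, of "complex_of_real (1 / \<epsilon>\<^sup>2)"]
    have "L2_le (II' \<epsilon> g \<psi>) (norm (complex_of_real (1 / \<epsilon>\<^sup>2)) * (8 * C * A\<^sup>2 * \<rho> * b * \<epsilon>\<^sup>2))"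
      unfolding II'_heat_comm[abs_def] .
    moreover have "norm (complex_of_real (1 / \<epsilon>\<^sup>2)) * (8 * C * A\<^sup>2 * \<rho> * b * \<epsilon>\<^sup>2) = 8 * C * A\<^sup>2 * \<rho> * b"
      unfolding norm_of_real using e by simp
    ultimately show ?thesis by (simp only:)
  qed
  moreover have "0 \<le> 8 * C * A\<^sup>2" using C(1) by simp
  ultimately show ?thesis using that by blast
qed

section \<open>Littlewood-Paley blocks\<close>

lemma infsum_ennreal_ge:
  fixes f :: "'a \<Rightarrow> ennreal"
  assumes "finite F"
  shows "sum f F \<le> infsum f UNIV"
  using assms by (subst nonneg_infsum_complete) (auto intro!: SUP_upper)

text \<open>The symbol \<open>\<phi>(2\<xi>) + \<phi>(\<xi>) + \<phi>(\<xi>/2)\<close> in telescoped form; it is \<open>1\<close> on the support of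
  \<open>\<phi>\<close> and vanishes at the origin.\<close>

definition lp_fat :: "(real^'n::finite \<Rightarrow> real) \<Rightarrow> real^'n \<Rightarrow> complex" where
  "lp_fat chi \<xi> = complex_of_real (chi ((1/4) *\<^sub>R \<xi>)) - complex_of_real (chi (2 *\<^sub>R \<xi>))"

lemma schwartz_lp_fat: "lp_cutoff chi \<Longrightarrow> schwartz (lp_fat chi)"
  unfolding lp_fat_def[abs_def] by (intro schwartz_diff schwartz_lp_cutoff) auto

lemma schwartz_lp_phi: "lp_cutoff chi \<Longrightarrow> schwartz (\<lambda>\<xi>. complex_of_real (lp_phi chi \<xi>))"
  unfolding lp_phi_def of_real_diff
  using schwartz_diff[OF schwartz_lp_cutoff[of chi "1/2"] schwartz_lp_cutoff[of chi 1]] by simp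

text \<open>For \<open>norm \<xi>\<close> between 3/4 and 8/3, \<open>(1/4) *\<^sub>R \<xi>\<close>
  has norm at most 2/3 and \<open>2 *\<^sub>R \<xi>\<close> has norm above 3/2 > 4/3; elsewhere
  \<open>lp_phi\<close> vanishes.\<close>

lemma lp_fat_mult_phi:
  assumes chi: "lp_cutoff chi"
  shows "lp_fat chi \<xi> * complex_of_real (lp_phi chi \<xi>) = complex_of_real (lp_phi chi \<xi>)"
proof -
  note one = lp_cutoff_one[OF chi] and zero = lp_cutoff_zero[OF chi]
  consider "norm \<xi> \<le> 3/4" | "norm \<xi> > 8/3" | "norm \<xi> > 3/4" "norm \<xi> \<le> 8/3" by linarith
  then show ?thesis
  proof cases
    case 1
    then have "lp_phi chi \<xi> = 0" using one[of \<xi>] one[of "(1/2) *\<^sub>R \<xi>"] by (simp add: lp_phi_def)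
    then show ?thesis by simp
  next
    case 2
    then have "lp_phi chi \<xi> = 0" using zero[of \<xi>] zero[of "(1/2) *\<^sub>R \<xi>"] by (simp add: lp_phi_def)
    then show ?thesis by simp
  next
    case 3
    then have "lp_fat chi \<xi> = 1" using one[of "(1/4) *\<^sub>R \<xi>"] zero[of "2 *\<^sub>R \<xi>"] by (simp add: lp_fat_def)
    then show ?thesis by simp
  qed
qed

text \<open>By inversion at the origin the mean of the kernel is its symbol at 0, a difference of
  two values 1.\<close>

lemma integral_ift_lp_fat:
  assumes chi: "lp_cutoff chi"
  shows "(\<integral>z. ift (lp_fat chi) z \<partial>lborel) = 0"
  using fourier_inversion[OF schwartz_lp_fat[OF chi], of 0] lp_cutoff_one[OF chi, of 0] by (simp add: lp_fat_def)

abbreviation lp_kernel :: "(real^'n::finite \<Rightarrow> real) \<Rightarrow> int \<Rightarrow> real^'n \<Rightarrow> complex" where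
  "lp_kernel chi j \<equiv> inv_fourier (\<lambda>\<xi>. lp_phi chi ((2 powi (- j)) *\<^sub>R \<xi>))"

lemma schwartz_dilate:
  fixes m :: "real^'n::finite \<Rightarrow> complex"
  assumes m: "schwartz m" and r: "0 < r"
  shows "schwartz (\<lambda>\<xi>. m (r *\<^sub>R \<xi>))"
proof -
  let ?P = "\<lambda>q :: real^'n \<Rightarrow> complex. \<exists>m. schwartz m \<and> q = (\<lambda>\<xi>. m (r *\<^sub>R \<xi>))"
  have "?P (\<lambda>\<xi>. m (r *\<^sub>R \<xi>))" using m by blast
  then show ?thesis
  proof (rule schwartz_coinduct[of ?P])
    fix g :: "real^'n \<Rightarrow> complex" and x assume "?P g"
    then obtain m where m: "schwartz m" "g = (\<lambda>\<xi>. m (r *\<^sub>R \<xi>))" by blast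
    show "g differentiable (at x)"
      unfolding m(2) using differentiable_affine[OF smooth_differentiable[OF schwartz_smooth[OF m(1)]], of 0 r x] by simp
  next
    fix g :: "real^'n \<Rightarrow> complex" and i assume "?P g"
    then obtain m where m: "schwartz m" "g = (\<lambda>\<xi>. m (r *\<^sub>R \<xi>))" by blast
    have "partial_deriv i g = (\<lambda>\<xi>. (\<lambda>\<xi>. complex_of_real r * partial_deriv i m \<xi>) (r *\<^sub>R \<xi>))"
      unfolding m(2)
      using partial_deriv_affine[OF smooth_differentiable[OF schwartz_smooth[OF m(1)]], of i 0 r]
      by (simp add: fun_eq_iff scaleR_conv_of_real)
    moreover have "schwartz (\<lambda>\<xi>. complex_of_real r * partial_deriv i m \<xi>)"
      by (intro schwartz_cmult schwartz_partial m)
    ultimately show "?P (partial_deriv i g)" by blast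
  next
    fix g :: "real^'n \<Rightarrow> complex" and N :: nat assume "?P g"
    then obtain m where m: "schwartz m" "g = (\<lambda>\<xi>. m (r *\<^sub>R \<xi>))" by blast
    obtain C where C: "0 \<le> C" "\<And>x. (1 + norm x) ^ N * norm (m x) \<le> C"
      using rapidD[OF schwartz_rapid[OF m(1)]] by blast
    define q where "q = 1 + 1 / r"
    have q: "0 \<le> q" using r by (simp add: q_def)
    have "(1 + norm x) ^ N * norm (g x) \<le> q ^ N * C" for x
    proof -
      have "1 + norm x \<le> q * (1 + norm (r *\<^sub>R x))"
      proof -
        have "q * (1 + norm (r *\<^sub>R x)) = 1 + norm x + (1 / r + r * norm x)"
          using r by (simp add: q_def field_simps)
        moreover have "0 \<le> 1 / r + r * norm x" using r by simp
        ultimately show ?thesis by linarith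
      qed
      then have "(1 + norm x) ^ N \<le> q ^ N * (1 + norm (r *\<^sub>R x)) ^ N"
        unfolding power_mult_distrib[symmetric] by (intro power_mono) auto
      then have "(1 + norm x) ^ N * norm (g x) \<le> (q ^ N * (1 + norm (r *\<^sub>R x)) ^ N) * norm (g x)"
        by (rule mult_right_mono) simp
      also have "\<dots> = q ^ N * ((1 + norm (r *\<^sub>R x)) ^ N * norm (m (r *\<^sub>R x)))" by (simp add: m(2))
      also have "\<dots> \<le> q ^ N * C" by (intro mult_left_mono C) (use q in simp)
      finally show ?thesis .
    qed
    then show "\<exists>C. \<forall>x. (1 + norm x) ^ N * norm (g x) \<le> C" by blast
  qed
qed

lemma lp_kernel_ift: "lp_kernel chi j = ift (\<lambda>\<xi>. complex_of_real (lp_phi chi ((1 / 2 powi j) *\<^sub>R \<xi>)))"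
  unfolding inv_fourier_eq_ift powi_minus_scaleR ..

lemma schwartz_lp_kernel:
  assumes "lp_cutoff chi" shows "schwartz (lp_kernel chi j)"
  unfolding lp_kernel_ift using schwartz_dilate[OF schwartz_lp_phi[OF assms], of "1 / 2 powi j"]
  by (intro schwartz_ift) simp

lemma schwartz_dil_lp_fat:
  assumes "lp_cutoff chi" "0 < r" shows "schwartz (dil r (ift (lp_fat chi)))"
  unfolding ift_dil[OF assms(2), symmetric] using schwartz_dilate[OF schwartz_lp_fat[OF assms(1)], of "1 / r"] assms(2)
  by (intro schwartz_ift) simp

text \<open>The convolution theorem transfers the symbol identity for the fattened cutoff to
  kernels.\<close>

lemma conv_lp_kernel:
  assumes chi: "lp_cutoff chi"
  shows "conv (dil (2 powi j) (ift (lp_fat chi))) (lp_kernel chi j) = lp_kernel chi j"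
proof (rule ext)
  fix x
  let ?r = "2 powi j :: real"
  have r: "0 < ?r" by simp
  have m1: "schwartz (\<lambda>\<xi>. lp_fat chi ((1 / ?r) *\<^sub>R \<xi>))" by (rule schwartz_dilate[OF schwartz_lp_fat[OF chi]]) simp
  have m2: "schwartz (\<lambda>\<xi>. complex_of_real (lp_phi chi ((1 / ?r) *\<^sub>R \<xi>)))"
    using schwartz_dilate[OF schwartz_lp_phi[OF chi], of "1 / ?r"] by simp
  show "conv (dil ?r (ift (lp_fat chi))) (lp_kernel chi j) x = lp_kernel chi j x"
    unfolding lp_kernel_ift ift_dil[OF r, symmetric] conv_ift[OF m1 m2] lp_fat_mult_phi[OF chi] ..
qed

lemma lp_block_eq: "lp_block chi j u x = u (\<lambda>y. lp_kernel chi j (x - y))"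
  by (simp add: lp_block_def fourier_mult_def)

text \<open>The kernel identity passes to the block by exchanging the distribution with the
  convolution integral.\<close>

lemma lp_block_reproducing:
  assumes chi: "lp_cutoff chi" and u: "tempered u"
  shows "conv (dil (2 powi j) (ift (lp_fat chi))) (lp_block chi j u) x = lp_block chi j u x"
proof -
  have "u (\<lambda>y. conv (dil (2 powi j) (ift (lp_fat chi))) (lp_kernel chi j) (x - y)) =
      conv (dil (2 powi j) (ift (lp_fat chi))) (\<lambda>p. u (\<lambda>y. lp_kernel chi j (p - y))) x"
    by (rule tempered_conv[OF u schwartz_rapid[OF schwartz_dil_lp_fat[OF chi]] schwartz_lp_kernel[OF chi]]) simp
  then show ?thesis
    unfolding conv_lp_kernel[OF chi] lp_block_eq[abs_def] by simp
qed

lemma lp_block_measurable: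
  assumes chi: "lp_cutoff chi" and u: "tempered u"
  shows "lp_block chi j u \<in> borel_measurable borel"
  unfolding lp_block_eq[abs_def]
  by (intro borel_measurable_continuous_onI tempered_continuous u schwartz_lp_kernel chi)

text \<open>Links the two versions of the operator: the Besov norm on the right applies it to the
  distribution, the commutator to the block as a function.\<close>

lemma lp_block_nonlocal:
  assumes chi: "lp_cutoff chi" and u: "tempered u" and e: "0 < \<epsilon>"
  shows "lp_block chi j (nonlocal_dist \<epsilon> u) x = nonlocal_fun \<epsilon> (lp_block chi j u) x"
proof -
  let ?k = "lp_kernel chi j"
  have "(\<integral>x'. heat \<epsilon> (x' - y) * ?k (x - x') \<partial>lborel) = conv (heat \<epsilon>) ?k (x - y)" for y
    using integral_lborel_shift(1)[of "\<lambda>x'. heat \<epsilon> (x' - y) * ?k (x - x')" y]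
    by (simp add: conv_def algebra_simps)
  then have "dist_conv (gauss_eps \<epsilon>) u (\<lambda>y. ?k (x - y)) = u (\<lambda>y. conv (heat \<epsilon>) ?k (x - y))"
    by (simp add: dist_conv_def)
  also have "\<dots> = conv (heat \<epsilon>) (\<lambda>p. u (\<lambda>y. ?k (p - y))) x"
    by (rule tempered_conv[OF u rapid_gauss_eps[OF e] schwartz_lp_kernel[OF chi]])
  finally show ?thesis
    by (simp add: lp_block_eq[of chi j "nonlocal_dist \<epsilon> u"] nonlocal_dist_def nonlocal_fun_conv lp_block_eq[abs_def])
qed

text \<open>One term of a finite series with positive weight. It provides the a priori finiteness on
  which absorption rests.\<close>

lemma lp_block_L2:
  assumes f: "f \<in> besov_eps chi \<epsilon> \<sigma>" and chi: "lp_cutoff chi" and e: "0 < \<epsilon>"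
  obtains a where "L2_le (lp_block chi j f) a"
proof -
  have u: "tempered f" using f by (simp add: besov_eps_def Sh'_def)
  let ?w = "\<lambda>l :: int. min (1 / \<epsilon>\<^sup>2) (2 powr (2 * real_of_int l)) * 2 powr (real_of_int l * \<sigma>)"
  have w: "0 < ?w j" using e by simp
  have "ennreal (?w j) * L2_norm (lp_block chi j f) \<le> (\<Sum>\<^sub>\<infinity>l\<in>UNIV. ennreal (?w l) * L2_norm (lp_block chi l f))"
    using infsum_ennreal_ge[of "{j}" "\<lambda>l. ennreal (?w l) * L2_norm (lp_block chi l f)"] by simp
  also have "\<dots> < \<infinity>" using f by (simp add: besov_eps_def)
  finally have "L2_norm (lp_block chi j f) < \<infinity>" using w by (auto simp: ennreal_mult_less_top)
  then have "L2_norm (lp_block chi j f) = ennreal (enn2real (L2_norm (lp_block chi j f)))" by simp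
  from L2_le_of_L2_norm[OF lp_block_measurable[OF chi u] this enn2real_nonneg] that show ?thesis by blast
qed

section \<open>Summable weights attached to the blocks\<close>

lemma positive_unit_weights:
  obtains e :: "int \<Rightarrow> real" where "\<And>j. 0 < e j" "(e has_sum 1) UNIV"
proof -
  have "((\<lambda>n::nat. (1/2::real) ^ Suc n) has_sum 1) UNIV"
    by (rule sums_nonneg_imp_has_sum[OF power_half_series]) simp
  then have "((\<lambda>j::int. (1/2::real) ^ Suc (int_encode j)) has_sum 1) UNIV"
    using has_sum_reindex_bij_betw[OF bij_int_encode, of "\<lambda>n. (1/2::real) ^ Suc n" 1] by simp
  then show ?thesis using that[of "\<lambda>j. (1/2::real) ^ Suc (int_encode j)"] by simp
qed

text \<open>The average of the normalised sequence and a fixed positive one has sum 1 and no zeros,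
  at the price of the factor 2.\<close>

lemma besov_weights:
  fixes a :: "int \<Rightarrow> real"
  assumes a: "\<And>j. 0 \<le> a j"
  obtains c :: "int \<Rightarrow> real" where "\<And>j. 0 < c j" "(c has_sum 1) UNIV"
    "\<And>j. ennreal (a j) \<le> 2 * ennreal (c j) * (\<Sum>\<^sub>\<infinity>l\<in>UNIV. ennreal (a l))"
proof -
  obtain e :: "int \<Rightarrow> real" where e: "\<And>j. 0 < e j" "(e has_sum 1) UNIV" using positive_unit_weights by blast
  let ?B = "\<Sum>\<^sub>\<infinity>l\<in>UNIV. ennreal (a l)"
  have fin: "(\<Sum>l\<in>F. ennreal (a l)) \<le> ?B" if "finite F" for F by (rule infsum_ennreal_ge[OF that])
  show ?thesis
  proof (cases "?B = \<infinity>")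
    \<comment> \<open>With an infinite total any positive weights will do, because the right-hand
      side is infinite for every \<open>j\<close>.\<close>
    case True
    have "2 * ennreal (e j) * ?B = \<infinity>" for j using e(1)[of j] unfolding True by (simp add: ennreal_mult_eq_top_iff)
    with e that show ?thesis by (metis top_greatest infinity_ennreal_def)
  next
    case False
    define b where "b = enn2real ?B"
    have b: "?B = ennreal b" "0 \<le> b" using False by (auto simp: b_def less_top)
    have le: "sum a F \<le> b" if "finite F" for F
      using fin[OF that] a b by (simp add: sum_ennreal)
    have sm: "a summable_on UNIV"
      by (rule nonneg_bdd_above_summable_on) (use a le in \<open>auto simp: bdd_above_def\<close>)
    define S where "S = infsum a UNIV"
    have S: "(a has_sum S) UNIV" unfolding S_def by (rule has_sum_infsum[OF sm])
    have Sb: "S \<le> b" by (rule has_sum_le_finite_sums[OF S]) (use le in auto)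
    have aS: "a j \<le> S" for j using finite_sum_le_has_sum[OF S, of "{j}"] a by simp
    show ?thesis
    proof (cases "S = 0")
      case True
      then have "a j = 0" for j using aS[of j] a[of j] by simp
      then show ?thesis by (intro that[of e] e) simp
    next
      case False
      then have S0: "0 < S" using aS[of 0] a[of 0] by linarith
      define c where "c = (\<lambda>j. (1 / (2 * S)) * a j + (1/2) * e j)"
      have "(c has_sum ((1 / (2 * S)) * S + (1/2) * 1)) UNIV"
        unfolding c_def by (intro has_sum_add has_sum_cmult_right S e)
      then have c1: "(c has_sum 1) UNIV" using S0 by simp
      have c0: "0 < c j" for j unfolding c_def using S0 a[of j] e(1)[of j] by (intro add_nonneg_pos) auto
      have "a j \<le> 2 * c j * b" for j
      proof -
        have "a j = 2 * ((1 / (2 * S)) * a j) * S" using S0 by simp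
        also have "\<dots> \<le> 2 * c j * b"
          by (intro mult_mono Sb) (use S0 a[of j] e(1)[of j] in \<open>auto simp: c_def\<close>)
        finally show ?thesis .
      qed
      then have "ennreal (a j) \<le> 2 * ennreal (c j) * ?B" for j
        unfolding b(1) using c0[of j] b(2) by (simp add: ennreal_mult[symmetric] ennreal_leI flip: ennreal_numeral)
      with c0 c1 that show ?thesis by blast
    qed
  qed
qed

lemma lp_block_commutator_bound:
  fixes chi :: "real^'n::finite \<Rightarrow> real"
  assumes chi: "lp_cutoff chi"
  obtains K where "1 \<le> K" "\<And>\<epsilon> \<sigma> f I v \<psi> t j V. 0 < \<epsilon> \<Longrightarrow> f \<in> besov_eps chi \<epsilon> \<sigma> \<Longrightarrow> time_interval I \<Longrightarrow>
    AE \<tau> in lebesgue_on I. \<forall>k. tempered (v \<tau> $ k) \<Longrightarrow>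
    is_flow I (\<lambda>\<tau>. vlow chi (j - 1) (v \<tau>)) \<psi> \<Longrightarrow> t \<in> I \<Longrightarrow> V_int v t = ennreal V \<Longrightarrow> 0 \<le> V \<Longrightarrow> K * V \<le> 1 / 2 \<Longrightarrow>
    L2_norm (II' \<epsilon> (lp_block chi j f) (\<psi> t)) \<le> ennreal (K * V) * L2_norm (lp_block chi j (nonlocal_dist \<epsilon> f))"
proof -
  obtain C1 where C1: "1 \<le> C1"
    "\<And>l v r x y. (\<And>k. tempered (v $ k)) \<Longrightarrow> 0 \<le> r \<Longrightarrow> grad_Linf_norm v < ennreal r \<Longrightarrow>
       norm (vlow chi l v x - vlow chi l v y) \<le> C1 * r * norm (x - y)"
    "\<And>l v r p b. (\<And>k. tempered (v $ k)) \<Longrightarrow> 0 \<le> r \<Longrightarrow> grad_Linf_norm v < ennreal r \<Longrightarrow>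
       norm (vlow chi l v (p + b) + vlow chi l v (p - b) - 2 *\<^sub>R vlow chi l v p) \<le> C1 * 2 powi l * r * (norm b)\<^sup>2"
    using velocity_regularity[OF chi] by blast
  let ?h = "ift (lp_fat chi)"
  have h: "schwartz ?h" by (intro schwartz_ift schwartz_lp_fat chi)
  obtain C2 where C2: "0 \<le> C2" "\<And>r \<epsilon> g \<psi> \<rho> a b. 0 < r \<Longrightarrow> 0 < \<epsilon> \<Longrightarrow> bdd_meas g \<Longrightarrow>
     (\<And>x. conv (dil r ?h) g x = g x) \<Longrightarrow> L2_le g a \<Longrightarrow> L2_le (nonlocal_fun \<epsilon> g) b \<Longrightarrow> 0 \<le> \<rho> \<Longrightarrow> \<rho> \<le> 1/2 \<Longrightarrow>
     (\<And>x y. norm (\<psi> x - \<psi> y - (x - y)) \<le> \<rho> * norm (x - y)) \<Longrightarrow>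
     (\<And>x z. norm (\<psi> (x + z) + \<psi> (x - z) - 2 *\<^sub>R \<psi> x) \<le> \<rho> * r * (norm z)\<^sup>2) \<Longrightarrow>
     L2_le (II' \<epsilon> g \<psi>) (C2 * \<rho> * b)"
    using L2_le_II'[OF h integral_ift_lp_fat[OF chi]] by blast
  define K where "K = 8 * C1 * (1 + C2)"
  have K: "1 \<le> K" "8 * C1 \<le> K" "C2 * (8 * C1) \<le> K"
    using C1(1) C2(1) mult_mono[of 1 C1 1 "1 + C2"] by (auto simp: K_def algebra_simps)
  have "L2_norm (II' \<epsilon> (lp_block chi j f) (\<psi> t)) \<le> ennreal (K * V) * L2_norm (lp_block chi j (nonlocal_dist \<epsilon> f))"
    if e: "0 < \<epsilon>" and f: "f \<in> besov_eps chi \<epsilon> \<sigma>" and I: "time_interval I"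
      and v: "AE \<tau> in lebesgue_on I. \<forall>k. tempered (v \<tau> $ k)"
      and flow: "is_flow I (\<lambda>\<tau>. vlow chi (j - 1) (v \<tau>)) \<psi>" and t: "t \<in> I"
      and V: "V_int v t = ennreal V" "0 \<le> V" "K * V \<le> 1 / 2"
    for \<epsilon> \<sigma> f I v \<psi> t j V
  proof -
    have u: "tempered f" using f by (simp add: besov_eps_def Sh'_def)
    let ?r = "2 powi j :: real" and ?R = "2 powi (j - 1) :: real"
    have R: "0 < ?R" "?R \<le> ?r" by (simp_all add: power_int_diff)
    define \<rho> where "\<rho> = 8 * C1 * V"
    have \<rho>: "0 \<le> \<rho>" "\<rho> \<le> 1/2"
      using C1(1) V(2,3) mult_right_mono[OF K(2) V(2)] by (auto simp: \<rho>_def)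
    have ae: "AE \<tau> in lebesgue. \<tau> \<in> {0..t} \<longrightarrow> (\<forall>r\<ge>0. grad_Linf_norm (v \<tau>) < ennreal r \<longrightarrow>
       (\<forall>x y. norm (vlow chi (j - 1) (v \<tau>) x - vlow chi (j - 1) (v \<tau>) y) \<le> C1 * r * norm (x - y)) \<and>
       (\<forall>p b. norm (vlow chi (j - 1) (v \<tau>) (p + b) + vlow chi (j - 1) (v \<tau>) (p - b) - 2 *\<^sub>R vlow chi (j - 1) (v \<tau>) p) \<le> C1 * ?R * r * (norm b)\<^sup>2))"
    proof -
      have "AE \<tau> in lebesgue. \<tau> \<in> I \<longrightarrow> (\<forall>k. tempered (v \<tau> $ k))"
        using v time_interval_sets[OF I] by (simp add: AE_restrict_space_iff)
      then show ?thesis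
      proof (rule AE_mp, intro AE_I2 impI allI conjI)
        fix \<tau> r x y
        assume "\<tau> \<in> I \<longrightarrow> (\<forall>k. tempered (v \<tau> $ k))" "\<tau> \<in> {0..t}" "0 \<le> r" "grad_Linf_norm (v \<tau>) < ennreal r"
        with time_interval_le[OF I t] C1(2)[of "v \<tau>" r "j - 1"] show "norm (vlow chi (j - 1) (v \<tau>) x - vlow chi (j - 1) (v \<tau>) y) \<le> C1 * r * norm (x - y)"
          by auto
      next
        fix \<tau> r p b
        assume "\<tau> \<in> I \<longrightarrow> (\<forall>k. tempered (v \<tau> $ k))" "\<tau> \<in> {0..t}" "0 \<le> r" "grad_Linf_norm (v \<tau>) < ennreal r"
        with time_interval_le[OF I t] C1(3)[of "v \<tau>" r "j - 1"] show "norm (vlow chi (j - 1) (v \<tau>) (p + b) + vlow chi (j - 1) (v \<tau>) (p - b) - 2 *\<^sub>R vlow chi (j - 1) (v \<tau>) p) \<le> C1 * ?R * r * (norm b)\<^sup>2"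
          by auto
      qed
    qed
    have Vle: "(\<integral>\<^sup>+\<tau>\<in>{0..t}. grad_Linf_norm (v \<tau>) \<partial>lebesgue) \<le> ennreal V"
      using V(1) by (simp add: V_int_def)
    have C1V: "0 < C1" "C1 * V \<le> 1 / 2" using C1(1) \<rho> V(2) by (auto simp: \<rho>_def)
    note fd = flow_differences[OF flow I t Vle V(2) C1V R(1) ae]
    have \<psi>1: "norm (\<psi> t x - \<psi> t y - (x - y)) \<le> \<rho> * norm (x - y)" for x y
    proof -
      have "2 * C1 * V \<le> \<rho>" using C1(1) V(2) by (simp add: \<rho>_def)
      from order_trans[OF fd(1) mult_right_mono[OF this norm_ge_zero]] show ?thesis .
    qed
    have \<psi>2: "norm (\<psi> t (x + z) + \<psi> t (x - z) - 2 *\<^sub>R \<psi> t x) \<le> \<rho> * ?r * (norm z)\<^sup>2" for x z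
    proof -
      have "8 * C1 * V * ?R * (norm z)\<^sup>2 \<le> \<rho> * ?r * (norm z)\<^sup>2"
        unfolding \<rho>_def by (intro mult_right_mono mult_left_mono R) (use C1(1) V(2) in auto)
      with fd(2)[of x z] show ?thesis by linarith
    qed
    let ?g = "lp_block chi j f"
    obtain a where a: "L2_le ?g a" using lp_block_L2[OF f chi e] by blast
    have r: "0 < ?r" by simp
    note hg = lp_block_reproducing[OF chi u, of j]
    have g: "bdd_meas ?g"
      by (rule bdd_meas_reproducing[OF schwartz_rapid[OF schwartz_dil_lp_fat[OF chi r]] a hg])
    have "L2_le (\<lambda>x. complex_of_real (1 / \<epsilon>\<^sup>2) * (conv (heat \<epsilon>) ?g x - ?g x)) (norm (complex_of_real (1 / \<epsilon>\<^sup>2)) * (a + a))"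
      by (intro L2_le_cmult L2_le_diff L2_le_conv_heat e a)
    then have "L2_le (nonlocal_fun \<epsilon> ?g) (norm (complex_of_real (1 / \<epsilon>\<^sup>2)) * (a + a))"
      by (simp add: nonlocal_fun_conv[abs_def])
    then obtain b where b: "0 \<le> b" "L2_norm (nonlocal_fun \<epsilon> ?g) = ennreal b" "L2_le (nonlocal_fun \<epsilon> ?g) b"
      using L2_le_norm by metis
    have eq: "lp_block chi j (nonlocal_dist \<epsilon> f) = nonlocal_fun \<epsilon> ?g"
      by (rule ext) (rule lp_block_nonlocal[OF chi u e])
    have "L2_norm (II' \<epsilon> ?g (\<psi> t)) \<le> ennreal (C2 * \<rho> * b)"
      by (rule L2_norm_le[OF C2(2)[OF r e g hg a b(3) \<rho> \<psi>1 \<psi>2]])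
    also have "\<dots> \<le> ennreal (K * V * b)"
    proof (rule ennreal_leI)
      have "C2 * \<rho> * b = C2 * (8 * C1) * (V * b)" by (simp add: \<rho>_def)
      also have "\<dots> \<le> K * (V * b)" by (rule mult_right_mono[OF K(3)]) (use V(2) b(1) in simp)
      finally show "C2 * \<rho> * b \<le> K * V * b" by (simp add: mult.assoc)
    qed
    also have "\<dots> = ennreal (K * V) * L2_norm (lp_block chi j (nonlocal_dist \<epsilon> f))"
      unfolding eq b(2) using K(1) V(2) b(1) by (simp add: ennreal_mult)
    finally show ?thesis .
  qed
  with K(1) that show ?thesis by blast
qed

theorem theorem5:
  fixes chi :: "real^'n::finite \<Rightarrow> real" and \<sigma> :: real
  assumes "lp_cutoff chi"
  shows "\<exists>C::real. C > 0 \<and>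
    (\<forall>\<epsilon>::real. \<epsilon> > 0 \<longrightarrow> (\<forall>f \<in> besov_eps chi \<epsilon> \<sigma>.
      \<exists>c :: int \<Rightarrow> real. (\<forall>j. c j > 0) \<and> (c has_sum 1) UNIV \<and>
        (\<forall>I v \<psi>.
           time_interval I \<longrightarrow>
           v \<in> Lp_besov chi 1 I (real CARD('n) / 2 + 1) \<inter> Lp_besov chi 2 I (real CARD('n) / 2) \<longrightarrow>
           (\<forall>j::int. is_flow I (\<lambda>\<tau>. vlow chi (j - 1) (v \<tau>)) (\<psi> j)) \<longrightarrow>
           (\<forall>t\<in>I. eexp (2 * ennreal C * V_int v t) - 1 \<le> 1 / 2 \<longrightarrow>
             (\<forall>j::int.
                L2_norm (II' \<epsilon> (lp_block chi j f) (\<psi> j t))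
                \<le> ennreal C * eexp (ennreal C * V_int v t)
                   * (V_int v t + (eexp (2 * ennreal C * V_int v t) - 1))
                   * ennreal (c j) * ennreal (2 powr (- real_of_int j * \<sigma>))
                   * besov_norm chi \<sigma> (nonlocal_dist \<epsilon> f))))))"
proof -
  obtain K where K: "1 \<le> K" "\<And>\<epsilon> \<sigma> f I v \<psi> t j V. 0 < \<epsilon> \<Longrightarrow> f \<in> besov_eps chi \<epsilon> \<sigma> \<Longrightarrow> time_interval I \<Longrightarrow>
    AE \<tau> in lebesgue_on I. \<forall>k. tempered (v \<tau> $ k) \<Longrightarrow>
    is_flow I (\<lambda>\<tau>. vlow chi (j - 1) (v \<tau>)) \<psi> \<Longrightarrow> t \<in> I \<Longrightarrow> V_int v t = ennreal V \<Longrightarrow> 0 \<le> V \<Longrightarrow> K * V \<le> 1 / 2 \<Longrightarrow>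
    L2_norm (II' \<epsilon> (lp_block chi j f) (\<psi> t)) \<le> ennreal (K * V) * L2_norm (lp_block chi j (nonlocal_dist \<epsilon> f))"
    using lp_block_commutator_bound[OF assms] by blast
  define C where "C = 2 * K"
  have C: "0 < C" using K(1) by (simp add: C_def)
  show ?thesis
  proof (intro exI[of _ C] conjI allI impI ballI C)
    fix \<epsilon> :: real and f
    assume e: "\<epsilon> > 0" and f: "f \<in> besov_eps chi \<epsilon> \<sigma>"
    let ?n = "\<lambda>l. L2_norm (lp_block chi l (nonlocal_dist \<epsilon> f))"
    have u: "tempered f" using f by (simp add: besov_eps_def Sh'_def)
    have "\<exists>b. 0 \<le> b \<and> ?n l = ennreal b" for l
    proof -
      obtain a where a: "L2_le (lp_block chi l f) a" using lp_block_L2[OF f assms e] by blast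
      have "L2_le (\<lambda>x. complex_of_real (1 / \<epsilon>\<^sup>2) * (conv (heat \<epsilon>) (lp_block chi l f) x - lp_block chi l f x))
          (norm (complex_of_real (1 / \<epsilon>\<^sup>2)) * (a + a))"
        by (intro L2_le_cmult L2_le_diff L2_le_conv_heat e a)
      also have "(\<lambda>x. complex_of_real (1 / \<epsilon>\<^sup>2) * (conv (heat \<epsilon>) (lp_block chi l f) x - lp_block chi l f x)) =
          lp_block chi l (nonlocal_dist \<epsilon> f)"
        by (simp add: fun_eq_iff lp_block_nonlocal[OF assms u e] nonlocal_fun_conv)
      finally show ?thesis using L2_le_norm by metis
    qed
    then obtain b where b: "\<And>l. 0 \<le> b l" "\<And>l. ?n l = ennreal (b l)" by metis
    define a where "a = (\<lambda>l :: int. 2 powr (real_of_int l * \<sigma>) * b l)"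
    have a0: "0 \<le> a l" for l using b(1)[of l] by (simp add: a_def)
    obtain c :: "int \<Rightarrow> real" where c: "\<And>j. 0 < c j" "(c has_sum 1) UNIV"
      "\<And>j. ennreal (a j) \<le> 2 * ennreal (c j) * (\<Sum>\<^sub>\<infinity>l\<in>UNIV. ennreal (a l))"
      using besov_weights[of a] a0 by blast
    have B: "besov_norm chi \<sigma> (nonlocal_dist \<epsilon> f) = (\<Sum>\<^sub>\<infinity>l\<in>UNIV. ennreal (a l))"
      unfolding besov_norm_def b(2) a_def using b(1) by (simp add: ennreal_mult)
    show "\<exists>c :: int \<Rightarrow> real. (\<forall>j. c j > 0) \<and> (c has_sum 1) UNIV \<and>
        (\<forall>I v \<psi>.
           time_interval I \<longrightarrow>
           v \<in> Lp_besov chi 1 I (real CARD('n) / 2 + 1) \<inter> Lp_besov chi 2 I (real CARD('n) / 2) \<longrightarrow>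
           (\<forall>j::int. is_flow I (\<lambda>\<tau>. vlow chi (j - 1) (v \<tau>)) (\<psi> j)) \<longrightarrow>
           (\<forall>t\<in>I. eexp (2 * ennreal C * V_int v t) - 1 \<le> 1 / 2 \<longrightarrow>
             (\<forall>j::int.
                L2_norm (II' \<epsilon> (lp_block chi j f) (\<psi> j t))
                \<le> ennreal C * eexp (ennreal C * V_int v t)
                   * (V_int v t + (eexp (2 * ennreal C * V_int v t) - 1))
                   * ennreal (c j) * ennreal (2 powr (- real_of_int j * \<sigma>))
                   * besov_norm chi \<sigma> (nonlocal_dist \<epsilon> f))))"
    proof (intro exI[of _ c] conjI allI impI ballI c(1,2))
      fix I v \<psi> t and j :: int
      assume I: "time_interval I"
        and v: "v \<in> Lp_besov chi 1 I (real CARD('n) / 2 + 1) \<inter> Lp_besov chi 2 I (real CARD('n) / 2)"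
        and flow: "\<forall>j::int. is_flow I (\<lambda>\<tau>. vlow chi (j - 1) (v \<tau>)) (\<psi> j)"
        and t: "t \<in> I" and small: "eexp (2 * ennreal C * V_int v t) - 1 \<le> 1 / 2"
      have fin: "V_int v t \<noteq> \<infinity>"
      proof
        assume "V_int v t = \<infinity>"
        then have "2 * ennreal C * V_int v t = \<infinity>" using C by (simp add: ennreal_mult_eq_top_iff)
        then have "eexp (2 * ennreal C * V_int v t) - 1 = \<infinity>" by (simp add: eexp_def)
        with small have "(\<infinity> :: ennreal) \<le> 1 / 2" by simp
        then show False by (simp add: divide_ennreal_def top_unique ennreal_mult_eq_top_iff)
      qed
      define V where "V = enn2real (V_int v t)"
      have V: "V_int v t = ennreal V" "0 \<le> V" using fin by (auto simp: V_def less_top)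
      have ee: "eexp (ennreal x) = ennreal (exp x)" if "0 \<le> x" for x using that by (simp add: eexp_def)
      have e1: "ennreal C * V_int v t = ennreal (C * V)" "2 * ennreal C * V_int v t = ennreal (2 * C * V)"
        using C V(2) unfolding V(1) by (simp_all add: ennreal_mult[symmetric] flip: ennreal_numeral)
      have "ennreal (exp (2 * C * V)) - 1 \<le> 1 / 2"
        using small C V(2) unfolding e1(2) by (subst (asm) ee) auto
      moreover have "ennreal (exp (2 * C * V)) - 1 = ennreal (exp (2 * C * V) - 1)"
        using ennreal_minus[of 1 "exp (2 * C * V)"] by simp
      moreover have "(1 / 2 :: ennreal) = ennreal (1 / 2)"
        using divide_ennreal[of 1 2] by simp
      ultimately have "ennreal (exp (2 * C * V) - 1) \<le> ennreal (1 / 2)" by (simp only:)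
      then have "exp (2 * C * V) - 1 \<le> 1 / 2" by (rule iffD1[OF ennreal_le_iff, rotated]) simp
      moreover have "2 * C * V \<le> exp (2 * C * V) - 1" using exp_ge_add_one_self[of "2 * C * V"] by linarith
      ultimately have "2 * (C * V) \<le> 1 / 2" by simp
      then have KV: "K * V \<le> 1 / 2" using K(1) V(2) by (simp add: C_def)
      have te: "AE \<tau> in lebesgue_on I. \<forall>k. tempered (v \<tau> $ k)"
      proof -
        have "AE \<tau> in lebesgue_on I. v \<tau> \<in> vbesov chi (real CARD('n) / 2 + 1)"
          using v by (simp add: Lp_besov_def)
        then show ?thesis by (rule AE_mp) (auto intro!: AE_I2 simp: vbesov_def Sh'_def)
      qed
      have "L2_norm (II' \<epsilon> (lp_block chi j f) (\<psi> j t)) \<le> ennreal (K * V) * ?n j"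
        by (rule K(2)[OF e f I te spec[OF flow] t V KV])
      also have "?n j = ennreal (2 powr (- real_of_int j * \<sigma>)) * ennreal (a j)"
        using b(1)[of j] unfolding b(2) a_def
        by (simp add: ennreal_mult[symmetric] powr_minus field_simps)
      also have "ennreal (K * V) * (ennreal (2 powr (- real_of_int j * \<sigma>)) * ennreal (a j)) \<le>
          ennreal (K * V) * (ennreal (2 powr (- real_of_int j * \<sigma>)) * (2 * ennreal (c j) * besov_norm chi \<sigma> (nonlocal_dist \<epsilon> f)))"
        unfolding B by (intro mult_left_mono c(3)) auto
      also have "\<dots> = (ennreal C * 1 * V_int v t) * ennreal (c j) * ennreal (2 powr (- real_of_int j * \<sigma>)) * besov_norm chi \<sigma> (nonlocal_dist \<epsilon> f)"
      proof -
        have re: "x * (p * (2 * q * w)) = (x * 2) * q * p * w" for x p q w :: ennreal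
          by (simp add: mult_ac)
        have eq: "ennreal (K * V) * 2 = ennreal C * 1 * V_int v t"
          unfolding V(1) C_def using K(1) V(2) by (simp add: ennreal_mult mult_ac)
        show ?thesis by (simp only: re eq)
      qed
      also have "\<dots> \<le> ennreal C * eexp (ennreal C * V_int v t)
                   * (V_int v t + (eexp (2 * ennreal C * V_int v t) - 1))
                   * ennreal (c j) * ennreal (2 powr (- real_of_int j * \<sigma>))
                   * besov_norm chi \<sigma> (nonlocal_dist \<epsilon> f)"
      proof (intro mult_right_mono mult_mono)
        show "1 \<le> eexp (ennreal C * V_int v t)"
          unfolding e1(1) using C V(2) by (subst ee) (auto simp: ennreal_ge_1)
        show "V_int v t \<le> V_int v t + (eexp (2 * ennreal C * V_int v t) - 1)" by simp
      qed auto
      finally show "L2_norm (II' \<epsilon> (lp_block chi j f) (\<psi> j t))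
                \<le> ennreal C * eexp (ennreal C * V_int v t)
                   * (V_int v t + (eexp (2 * ennreal C * V_int v t) - 1))
                   * ennreal (c j) * ennreal (2 powr (- real_of_int j * \<sigma>))
                   * besov_norm chi \<sigma> (nonlocal_dist \<epsilon> f)" .
    qed
  qed
qed

end
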